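(* Let $(M,\nabla,\langle\cdot,\cdot\rangle)$ be an affine-Riemann manifold. If $\mathrm{tr}_{\langle,\rangle}(\gamma)=0$ then, for every vector field $X$ on $M$, $\mathrm{tr}_{\langle,\rangle}(D_X(\gamma))=0$. In particular, if $\mathrm{tr}_{\langle,\rangle}(\gamma)=0$ then the canonical Hermitian structure $(TM,J_1,g_1)$ is Calabi-Yau with torsion, i.e., $\rho^B=0$.
   Context: An affine-Riemann manifold $(M,\nabla,\langle\cdot,\cdot\rangle)$ is a manifold with a flat torsionless connection $\nabla$ and a Riemannian metric. $D$ is the Levi-Civita connection of the metric; the difference tensor is $\gamma_XY=D_XY-\nabla_XY$; $D_X(\gamma)(Y,Z)=D_X(\gamma_YZ)-\gamma_{D_XY}Z-\gamma_YD_XZ$. For a local orthonormal frame $(E_i)$, $\mathrm{tr}_{\langle,\rangle}(\gamma)=\sum_i\gamma_{E_i}E_i$ and $\mathrm{tr}_{\langle,\rangle}(D_X(\gamma))=\sum_iD_X(\gamma)(E_i,E_i)$. Canonical Hermitian structure: $\pi_1:TM\to M$ is the projection; for a vector field $X$ on $M$, $X^h$ is the horizontal lift with respect to $\nabla$ and $X^v$ the vertical lift; $J_1X^h=X^v$, $J_1X^v=-X^h$; $g_1(X^h,Y^h)=g_1(X^v,Y^v)=\langle X,Y\rangle\circ\pi_1$, $g_1(X^h,Y^v)=0$. For a Hermitian manifold $(N,J,g)$ of real dimension $2n$ with $\omega=g(J\cdot,\cdot)$ and Levi-Civita connection $\nabla^{LC}$, the Bismut connection is $g(\nabla^B_XY,Z)=g(\nabla^{LC}_XY,Z)+\frac12d\omega(JX,JY,JZ)$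 (the unique connection preserving $J$ and $g$ with totally skew-symmetric torsion). With $R^B(X,Y)=\nabla^B_{[X,Y]}-\nabla^B_X\nabla^B_Y+\nabla^B_Y\nabla^B_X$, its Ricci form is $\rho^B(X,Y)=\frac12\sum_{i=1}^{2n}g(R^B(X,Y)E_i,JE_i)$ for a local $g$-orthonormal frame. $(N,J,g)$ is Calabi-Yau with torsion if $\rho^B=0$. *)

theory Defs
  imports "HOL-Analysis.Analysis" "HOL-Library.Function_Algebras"
begin

section \<open>Smooth manifolds\<close>

text \<open>For open \<open>S\<close> this is the usual class \<open>C\<^sup>k\<close>: all directional derivatives up to order \<open>k\<close>
  exist and are continuous.\<close>

primrec Ck_on :: "nat \<Rightarrow> 'e::euclidean_space set \<Rightarrow> ('e \<Rightarrow> 'f::real_normed_vector) \<Rightarrow> bool" where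
  "Ck_on 0 S f \<longleftrightarrow> continuous_on S f"
| "Ck_on (Suc k) S f \<longleftrightarrow>
     (\<forall>x\<in>S. f differentiable (at x)) \<and> (\<forall>v. Ck_on k S (\<lambda>x. frechet_derivative f (at x) v))"

definition smooth_on :: "'e::euclidean_space set \<Rightarrow> ('e \<Rightarrow> 'f::real_normed_vector) \<Rightarrow> bool" where
  "smooth_on S f \<longleftrightarrow> (\<forall>k. Ck_on k S f)"

text \<open>A chart is a pair \<open>(U, \<phi>)\<close>; only the values of \<open>\<phi>\<close> on \<open>U\<close> matter.\<close>

record ('a, 'e) manifold =
  mtop :: "'a topology"
  atlas :: "('a set \<times> ('a \<Rightarrow> 'e)) set"

definition smooth_manifold :: "('a, 'e::euclidean_space) manifold \<Rightarrow> bool" where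
  "smooth_manifold M \<longleftrightarrow>
     Hausdorff_space (mtop M) \<and> second_countable (mtop M) \<and>
     (\<Union>(U, \<phi>)\<in>atlas M. U) = topspace (mtop M) \<and>
     (\<forall>(U, \<phi>)\<in>atlas M. openin (mtop M) U \<and> open (\<phi> ` U) \<and>
        homeomorphic_map (subtopology (mtop M) U) (top_of_set (\<phi> ` U)) \<phi>) \<and>
     (\<forall>(U, \<phi>)\<in>atlas M. \<forall>(V, \<psi>)\<in>atlas M. smooth_on (\<phi> ` (U \<inter> V)) (\<psi> \<circ> inv_into U \<phi>))"

definition smooth_fun :: "('a, 'e::euclidean_space) manifold \<Rightarrow> 'a set \<Rightarrow> ('a \<Rightarrow> real) \<Rightarrow> bool" where
  "smooth_fun M U f \<longleftrightarrow> (\<forall>(V, \<phi>)\<in>atlas M. smooth_on (\<phi> ` (U \<inter> V)) (f \<circ> inv_into V \<phi>))"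

definition smooth_near :: "('a, 'e::euclidean_space) manifold \<Rightarrow> 'a \<Rightarrow> ('a \<Rightarrow> real) \<Rightarrow> bool" where
  "smooth_near M p f \<longleftrightarrow> (\<exists>U. openin (mtop M) U \<and> p \<in> U \<and> smooth_fun M U f)"

section \<open>Tangent vectors and vector fields\<close>

text \<open>A tangent vector at \<open>p\<close> is a directional derivative at \<open>p\<close>, acting on the functions that are
  smooth near \<open>p\<close>.  It is set to \<open>0\<close> on all other functions, so that equality of tangent vectors is
  equality in HOL.  The vector space operations are the pointwise ones.\<close>

type_synonym 'a tvec = "('a \<Rightarrow> real) \<Rightarrow> real"
type_synonym 'a vfield = "'a \<Rightarrow> 'a tvec"

definition tangent_space :: "('a, 'e::euclidean_space) manifold \<Rightarrow> 'a \<Rightarrow> 'a tvec set" where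
  "tangent_space M p =
     {(\<lambda>f. if smooth_near M p f
            then frechet_derivative (f \<circ> inv_into U \<phi>) (at (\<phi> p)) w else 0) | U \<phi> w.
      (U, \<phi>) \<in> atlas M \<and> p \<in> U}"

definition tscale :: "real \<Rightarrow> 'a tvec \<Rightarrow> 'a tvec" where
  "tscale c v = (\<lambda>h. c * v h)"

definition fscale :: "('a \<Rightarrow> real) \<Rightarrow> 'a vfield \<Rightarrow> 'a vfield" where
  "fscale f X = (\<lambda>p. tscale (f p) (X p))"

text \<open>Smooth vector fields on the open set \<open>U\<close>.  Values outside \<open>U\<close> are irrelevant; two fields on
  \<open>U\<close> are the same if they agree on \<open>U\<close>.\<close>

definition vfields :: "('a, 'e::euclidean_space) manifold \<Rightarrow> 'a set \<Rightarrow> 'a vfield set" where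
  "vfields M U = {X. (\<forall>p\<in>U. X p \<in> tangent_space M p) \<and>
     (\<forall>V f. openin (mtop M) V \<and> V \<subseteq> U \<and> smooth_fun M V f \<longrightarrow> smooth_fun M V (\<lambda>p. X p f))}"

definition lie_bracket ::
    "('a, 'e::euclidean_space) manifold \<Rightarrow> 'a vfield \<Rightarrow> 'a vfield \<Rightarrow> 'a vfield" where
  "lie_bracket M X Y = (\<lambda>p f. if smooth_near M p f
     then X p (\<lambda>q. Y q f) - Y p (\<lambda>q. X q f) else 0)"

definition differential :: "('a, 'e::euclidean_space) manifold \<Rightarrow> ('b, 'f::euclidean_space) manifold
    \<Rightarrow> ('a \<Rightarrow> 'b) \<Rightarrow> 'a \<Rightarrow> 'a tvec \<Rightarrow> 'b tvec" where
  "differential M N \<Phi> p v = (\<lambda>F. if smooth_near N (\<Phi> p) F then v (F \<circ> \<Phi>) else 0)"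

section \<open>Connections and metrics\<close>

text \<open>A connection acts on vector fields defined on arbitrary open sets, compatibly with restriction:
  since a field on \<open>U\<close> is also a field on every smaller open set, the second clause says that
  \<open>\<nabla>\<^sub>X Y\<close> on an open set depends only on \<open>X\<close> and \<open>Y\<close> there.\<close>

definition connection ::
    "('a, 'e::euclidean_space) manifold \<Rightarrow> ('a vfield \<Rightarrow> 'a vfield \<Rightarrow> 'a vfield) \<Rightarrow> bool" where
  "connection M nab \<longleftrightarrow> (\<forall>U. openin (mtop M) U \<longrightarrow>
     (\<forall>X\<in>vfields M U. \<forall>Y\<in>vfields M U. nab X Y \<in> vfields M U) \<and>
     (\<forall>X\<in>vfields M U. \<forall>X'\<in>vfields M U. \<forall>Y\<in>vfields M U. \<forall>Y'\<in>vfields M U.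
        (\<forall>p\<in>U. X p = X' p \<and> Y p = Y' p) \<longrightarrow> (\<forall>p\<in>U. nab X Y p = nab X' Y' p)) \<and>
     (\<forall>X\<in>vfields M U. \<forall>X'\<in>vfields M U. \<forall>Y\<in>vfields M U. \<forall>p\<in>U.
        nab (X + X') Y p = nab X Y p + nab X' Y p) \<and>
     (\<forall>f. \<forall>X\<in>vfields M U. \<forall>Y\<in>vfields M U. smooth_fun M U f \<longrightarrow> (\<forall>p\<in>U.
        nab (fscale f X) Y p = tscale (f p) (nab X Y p))) \<and>
     (\<forall>X\<in>vfields M U. \<forall>Y\<in>vfields M U. \<forall>Y'\<in>vfields M U. \<forall>p\<in>U.
        nab X (Y + Y') p = nab X Y p + nab X Y' p) \<and>
     (\<forall>f. \<forall>X\<in>vfields M U. \<forall>Y\<in>vfields M U. smooth_fun M U f \<longrightarrow> (\<forall>p\<in>U.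
        nab X (fscale f Y) p = tscale (X p f) (Y p) + tscale (f p) (nab X Y p))))"

definition torsion_free ::
    "('a, 'e::euclidean_space) manifold \<Rightarrow> ('a vfield \<Rightarrow> 'a vfield \<Rightarrow> 'a vfield) \<Rightarrow> bool" where
  "torsion_free M nab \<longleftrightarrow> (\<forall>U. openin (mtop M) U \<longrightarrow>
     (\<forall>X\<in>vfields M U. \<forall>Y\<in>vfields M U. \<forall>p\<in>U. nab X Y p - nab Y X p = lie_bracket M X Y p))"

definition curvature :: "('a, 'e::euclidean_space) manifold
    \<Rightarrow> ('a vfield \<Rightarrow> 'a vfield \<Rightarrow> 'a vfield) \<Rightarrow> 'a vfield \<Rightarrow> 'a vfield \<Rightarrow> 'a vfield \<Rightarrow> 'a vfield" where
  "curvature M nab X Y Z = nab (lie_bracket M X Y) Z - nab X (nab Y Z) + nab Y (nab X Z)"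

definition flat ::
    "('a, 'e::euclidean_space) manifold \<Rightarrow> ('a vfield \<Rightarrow> 'a vfield \<Rightarrow> 'a vfield) \<Rightarrow> bool" where
  "flat M nab \<longleftrightarrow> (\<forall>U. openin (mtop M) U \<longrightarrow>
     (\<forall>X\<in>vfields M U. \<forall>Y\<in>vfields M U. \<forall>Z\<in>vfields M U. \<forall>p\<in>U. curvature M nab X Y Z p = 0))"

type_synonym 'a metric_field = "'a \<Rightarrow> 'a tvec \<Rightarrow> 'a tvec \<Rightarrow> real"

definition riemannian_metric ::
    "('a, 'e::euclidean_space) manifold \<Rightarrow> 'a metric_field \<Rightarrow> bool" where
  "riemannian_metric M g \<longleftrightarrow>
     (\<forall>p\<in>topspace (mtop M). \<forall>u\<in>tangent_space M p. \<forall>v\<in>tangent_space M p. \<forall>w\<in>tangent_space M p. \<forall>c.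
        g p u v = g p v u \<and>
        g p (u + v) w = g p u w + g p v w \<and>
        g p (tscale c u) v = c * g p u v \<and>
        (u \<noteq> 0 \<longrightarrow> g p u u > 0)) \<and>
     (\<forall>U. openin (mtop M) U \<longrightarrow>
        (\<forall>X\<in>vfields M U. \<forall>Y\<in>vfields M U. smooth_fun M U (\<lambda>p. g p (X p) (Y p))))"

definition levi_civita :: "('a, 'e::euclidean_space) manifold \<Rightarrow> 'a metric_field
    \<Rightarrow> ('a vfield \<Rightarrow> 'a vfield \<Rightarrow> 'a vfield) \<Rightarrow> bool" where
  "levi_civita M g D \<longleftrightarrow> connection M D \<and> torsion_free M D \<and>
     (\<forall>U. openin (mtop M) U \<longrightarrow>
        (\<forall>X\<in>vfields M U. \<forall>Y\<in>vfields M U. \<forall>Z\<in>vfields M U. \<forall>p\<in>U.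
           X p (\<lambda>q. g q (Y q) (Z q)) = g p (D X Y p) (Z p) + g p (Y p) (D X Z p)))"

definition affine_riemann :: "('a, 'e::euclidean_space) manifold
    \<Rightarrow> ('a vfield \<Rightarrow> 'a vfield \<Rightarrow> 'a vfield) \<Rightarrow> 'a metric_field \<Rightarrow> bool" where
  "affine_riemann M nab g \<longleftrightarrow> smooth_manifold M \<and>
     connection M nab \<and> torsion_free M nab \<and> flat M nab \<and> riemannian_metric M g"

text \<open>\<open>DIM('e)\<close> orthonormal fields on an open set; they automatically form a basis at each point.\<close>

definition orthonormal_frame :: "('a, 'e::euclidean_space) manifold \<Rightarrow> 'a metric_field
    \<Rightarrow> 'a set \<Rightarrow> (nat \<Rightarrow> 'a vfield) \<Rightarrow> bool" where
  "orthonormal_frame M g U E \<longleftrightarrow> openin (mtop M) U \<and>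
     (\<forall>i<DIM('e). E i \<in> vfields M U) \<and>
     (\<forall>i<DIM('e). \<forall>j<DIM('e). \<forall>p\<in>U. g p (E i p) (E j p) = (if i = j then 1 else 0))"

text \<open>The trace of a (tensorial) bilinear map on vector fields; \<open>THE\<close> picks the value common to all
  local orthonormal frames.\<close>

definition metric_trace :: "('a, 'e::euclidean_space) manifold \<Rightarrow> 'a metric_field
    \<Rightarrow> ('a vfield \<Rightarrow> 'a vfield \<Rightarrow> 'a vfield) \<Rightarrow> 'a vfield" where
  "metric_trace M g T p = (THE v. \<exists>U E. orthonormal_frame M g U E \<and> p \<in> U \<and>
     v = (\<Sum>i<DIM('e). T (E i) (E i) p))"

definition difference_tensor :: "('a vfield \<Rightarrow> 'a vfield \<Rightarrow> 'a vfield)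
    \<Rightarrow> ('a vfield \<Rightarrow> 'a vfield \<Rightarrow> 'a vfield) \<Rightarrow> 'a vfield \<Rightarrow> 'a vfield \<Rightarrow> 'a vfield" where
  "difference_tensor D nab X Y = D X Y - nab X Y"

definition tensor_deriv :: "('a vfield \<Rightarrow> 'a vfield \<Rightarrow> 'a vfield)
    \<Rightarrow> ('a vfield \<Rightarrow> 'a vfield \<Rightarrow> 'a vfield) \<Rightarrow> 'a vfield \<Rightarrow> 'a vfield \<Rightarrow> 'a vfield \<Rightarrow> 'a vfield" where
  "tensor_deriv D \<gamma> X Y Z = D X (\<gamma> Y Z) - \<gamma> (D X Y) Z - \<gamma> Y (D X Z)"

section \<open>The tangent bundle and its canonical Hermitian structure\<close>

definition bundle_over :: "('a, 'e::euclidean_space) manifold \<Rightarrow> 'a set \<Rightarrow> ('a \<times> 'a tvec) set" where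
  "bundle_over M U = {(p, v). p \<in> U \<and> v \<in> tangent_space M p}"

definition bundle_chart :: "('a \<Rightarrow> 'e::euclidean_space) \<Rightarrow> 'a \<times> 'a tvec \<Rightarrow> 'e \<times> 'e" where
  "bundle_chart \<phi> = (\<lambda>(p, v). (\<phi> p, \<Sum>b\<in>Basis. v (\<lambda>q. \<phi> q \<bullet> b) *\<^sub>R b))"

definition tangent_bundle ::
    "('a, 'e::euclidean_space) manifold \<Rightarrow> ('a \<times> 'a tvec, 'e \<times> 'e) manifold" where
  "tangent_bundle M =
     \<lparr> mtop = topology_generated_by
         {bundle_over M U \<inter> bundle_chart \<phi> -` W | U \<phi> W. (U, \<phi>) \<in> atlas M \<and> open W},
       atlas = {(bundle_over M U, bundle_chart \<phi>) | U \<phi>. (U, \<phi>) \<in> atlas M} \<rparr>"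

text \<open>The vertical lift of \<open>x\<close> to \<open>(p, u)\<close> is the velocity at \<open>t = 0\<close> of \<open>t \<mapsto> (p, u + t x)\<close>.\<close>

definition vlift_at :: "('a, 'e::euclidean_space) manifold
    \<Rightarrow> 'a \<times> 'a tvec \<Rightarrow> 'a tvec \<Rightarrow> ('a \<times> 'a tvec) tvec" where
  "vlift_at M w x = (\<lambda>F. if smooth_near (tangent_bundle M) w F
     then deriv (\<lambda>t. F (fst w, snd w + tscale t x)) 0 else 0)"

text \<open>The horizontal space at \<open>(p, u)\<close> consists of the vectors \<open>(dY)\<^sub>p(x)\<close>, where \<open>Y\<close> is a local
  section of the tangent bundle with \<open>Y\<^sub>p = u\<close> whose covariant derivative vanishes at \<open>p\<close>.\<close>

definition horizontal_space :: "('a, 'e::euclidean_space) manifold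
    \<Rightarrow> ('a vfield \<Rightarrow> 'a vfield \<Rightarrow> 'a vfield) \<Rightarrow> 'a \<times> 'a tvec \<Rightarrow> ('a \<times> 'a tvec) tvec set" where
  "horizontal_space M nab w =
     {differential M (tangent_bundle M) (\<lambda>q. (q, Y q)) (fst w) x | x Y U.
        x \<in> tangent_space M (fst w) \<and> openin (mtop M) U \<and> fst w \<in> U \<and> Y \<in> vfields M U \<and>
        Y (fst w) = snd w \<and> (\<forall>Z\<in>vfields M U. nab Z Y (fst w) = 0)}"

definition hlift_at :: "('a, 'e::euclidean_space) manifold
    \<Rightarrow> ('a vfield \<Rightarrow> 'a vfield \<Rightarrow> 'a vfield)
    \<Rightarrow> 'a \<times> 'a tvec \<Rightarrow> 'a tvec \<Rightarrow> ('a \<times> 'a tvec) tvec" where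
  "hlift_at M nab w x =
     (THE \<xi>. \<xi> \<in> horizontal_space M nab w \<and> differential (tangent_bundle M) M fst w \<xi> = x)"

text \<open>Every tangent vector of the tangent bundle is uniquely a sum of a horizontal and a vertical
  lift; \<open>J1\<close> and \<open>g1\<close> are the linear and bilinear extensions of their values on lifts.\<close>

definition J1 :: "('a, 'e::euclidean_space) manifold
    \<Rightarrow> ('a vfield \<Rightarrow> 'a vfield \<Rightarrow> 'a vfield)
    \<Rightarrow> 'a \<times> 'a tvec \<Rightarrow> ('a \<times> 'a tvec) tvec \<Rightarrow> ('a \<times> 'a tvec) tvec" where
  "J1 M nab w \<xi> = (THE \<eta>. \<exists>x\<in>tangent_space M (fst w). \<exists>y\<in>tangent_space M (fst w).
     \<xi> = hlift_at M nab w x + vlift_at M w y \<and> \<eta> = vlift_at M w x - hlift_at M nab w y)"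

definition g1 :: "('a, 'e::euclidean_space) manifold
    \<Rightarrow> ('a vfield \<Rightarrow> 'a vfield \<Rightarrow> 'a vfield) \<Rightarrow> 'a metric_field
    \<Rightarrow> ('a \<times> 'a tvec) metric_field" where
  "g1 M nab g w \<xi> \<eta> = (THE r. \<exists>x\<in>tangent_space M (fst w). \<exists>y\<in>tangent_space M (fst w).
     \<exists>x'\<in>tangent_space M (fst w). \<exists>y'\<in>tangent_space M (fst w).
     \<xi> = hlift_at M nab w x + vlift_at M w y \<and> \<eta> = hlift_at M nab w x' + vlift_at M w y' \<and>
     r = g (fst w) x x' + g (fst w) y y')"

section \<open>Hermitian manifolds and the Bismut connection\<close>

definition field_map :: "('a \<Rightarrow> 'a tvec \<Rightarrow> 'a tvec) \<Rightarrow> 'a vfield \<Rightarrow> 'a vfield" where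
  "field_map J X = (\<lambda>p. J p (X p))"

definition hermitian_manifold :: "('a, 'e::euclidean_space) manifold
    \<Rightarrow> ('a \<Rightarrow> 'a tvec \<Rightarrow> 'a tvec) \<Rightarrow> 'a metric_field \<Rightarrow> bool" where
  "hermitian_manifold N J g \<longleftrightarrow> smooth_manifold N \<and> riemannian_metric N g \<and>
     (\<forall>p\<in>topspace (mtop N). \<forall>u\<in>tangent_space N p. \<forall>v\<in>tangent_space N p. \<forall>c.
        J p u \<in> tangent_space N p \<and>
        J p (u + v) = J p u + J p v \<and> J p (tscale c u) = tscale c (J p u) \<and>
        J p (J p u) = - u \<and>
        g p (J p u) (J p v) = g p u v) \<and>
     (\<forall>U. openin (mtop N) U \<longrightarrow>
        (\<forall>X\<in>vfields N U. field_map J X \<in> vfields N U) \<and>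
        (\<forall>X\<in>vfields N U. \<forall>Y\<in>vfields N U. \<forall>p\<in>U.
           lie_bracket N (field_map J X) (field_map J Y) p
           - J p (lie_bracket N (field_map J X) Y p)
           - J p (lie_bracket N X (field_map J Y) p)
           - lie_bracket N X Y p = 0))"

definition fundamental_form ::
    "('a \<Rightarrow> 'a tvec \<Rightarrow> 'a tvec) \<Rightarrow> 'a metric_field \<Rightarrow> 'a vfield \<Rightarrow> 'a vfield \<Rightarrow> 'a \<Rightarrow> real" where
  "fundamental_form J g X Y = (\<lambda>p. g p (J p (X p)) (Y p))"

text \<open>Exterior derivative of a 2-form, normalised without the factor \<open>1/3\<close>.  This is the
  normalisation for which the Bismut connection below preserves \<open>J\<close>.\<close>

definition ext_deriv2 :: "('a, 'e::euclidean_space) manifold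
    \<Rightarrow> ('a vfield \<Rightarrow> 'a vfield \<Rightarrow> 'a \<Rightarrow> real)
    \<Rightarrow> 'a vfield \<Rightarrow> 'a vfield \<Rightarrow> 'a vfield \<Rightarrow> 'a \<Rightarrow> real" where
  "ext_deriv2 N \<omega> X Y Z p =
     X p (\<omega> Y Z) - Y p (\<omega> X Z) + Z p (\<omega> X Y)
     - \<omega> (lie_bracket N X Y) Z p + \<omega> (lie_bracket N X Z) Y p - \<omega> (lie_bracket N Y Z) X p"

definition bismut_connection :: "('a, 'e::euclidean_space) manifold
    \<Rightarrow> ('a \<Rightarrow> 'a tvec \<Rightarrow> 'a tvec) \<Rightarrow> 'a metric_field
    \<Rightarrow> ('a vfield \<Rightarrow> 'a vfield \<Rightarrow> 'a vfield) \<Rightarrow> bool" where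
  "bismut_connection N J g B \<longleftrightarrow> connection N B \<and>
     (\<exists>L. levi_civita N g L \<and>
        (\<forall>U. openin (mtop N) U \<longrightarrow>
           (\<forall>X\<in>vfields N U. \<forall>Y\<in>vfields N U. \<forall>Z\<in>vfields N U. \<forall>p\<in>U.
              g p (B X Y p) (Z p) = g p (L X Y p) (Z p)
                + 1/2 * ext_deriv2 N (fundamental_form J g)
                          (field_map J X) (field_map J Y) (field_map J Z) p)))"

text \<open>As for the metric trace, the value does not depend on the orthonormal frame.\<close>

definition ricci_form :: "('a, 'e::euclidean_space) manifold
    \<Rightarrow> ('a \<Rightarrow> 'a tvec \<Rightarrow> 'a tvec) \<Rightarrow> 'a metric_field
    \<Rightarrow> ('a vfield \<Rightarrow> 'a vfield \<Rightarrow> 'a vfield) \<Rightarrow> 'a vfield \<Rightarrow> 'a vfield \<Rightarrow> 'a \<Rightarrow> real" where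
  "ricci_form N J g B X Y p = (THE r. \<exists>U E. orthonormal_frame N g U E \<and> p \<in> U \<and>
     r = 1/2 * (\<Sum>i<DIM('e). g p (curvature N B X Y (E i) p) (J p (E i p))))"

text \<open>On a Hermitian manifold the Bismut connection exists and is unique (as an operator on local
  fields), so the quantifier over \<open>B\<close> ranges over exactly one connection.\<close>

definition calabi_yau_with_torsion :: "('a, 'e::euclidean_space) manifold
    \<Rightarrow> ('a \<Rightarrow> 'a tvec \<Rightarrow> 'a tvec) \<Rightarrow> 'a metric_field \<Rightarrow> bool" where
  "calabi_yau_with_torsion N J g \<longleftrightarrow> hermitian_manifold N J g \<and>
     (\<forall>B. bismut_connection N J g B \<longrightarrow>
        (\<forall>U. openin (mtop N) U \<longrightarrow>
           (\<forall>X\<in>vfields N U. \<forall>Y\<in>vfields N U. \<forall>p\<in>U. ricci_form N J g B X Y p = 0)))"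

end

theory Submission
  imports Defs "HOL-Real_Asymp.Real_Asymp"
begin

text \<open>Write \<open>h\<^sub>i\<close>, \<open>v\<^sub>i\<close> for the horizontal and vertical lifts of a local orthonormal frame \<open>e\<^sub>i\<close> of \<open>M\<close>.
  Since \<open>\<nabla>\<close> is flat and torsion free, \<open>[X\<^sup>h, Y\<^sup>h] = [X, Y]\<^sup>h\<close>, \<open>[X\<^sup>h, Y\<^sup>v] = (\<nabla>\<^sub>X Y)\<^sup>v\<close> and \<open>[X\<^sup>v, Y\<^sup>v] = 0\<close>.
  These brackets make \<open>J\<^sub>1\<close> integrable, and through the Koszul formula they express the Bismut connection in the frame
  \<open>(h\<^sub>i, v\<^sub>i)\<close> by the coefficients \<open>\<langle>\<nabla>\<^sub>e\<^sub>i e\<^sub>k, e\<^sub>l\<rangle>\<close>.  The connection form commutes with \<open>J\<^sub>1\<close>,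
  so the Ricci form is, up to sign, the exterior derivative of \<open>\<alpha>(X) = \<Sum>\<^sub>i g\<^sub>1(\<nabla>\<^sup>B\<^sub>X h\<^sub>i, v\<^sub>i)\<close>;
  one finds \<open>\<alpha>(A\<^sup>h) = 0\<close> and \<open>\<alpha>(A\<^sup>v) = \<langle>A, tr \<gamma>\<rangle>\<close>, which vanishes when \<open>tr \<gamma> = 0\<close>.
  The first claim holds because the covariant derivatives of an orthonormal frame have skew coefficients while
  \<open>\<gamma>\<close> is symmetric.\<close>

section \<open>Calculus of \<open>C\<^sup>k\<close> functions\<close>

text \<open>The horizontal lift, \<open>J1\<close>, \<open>g1\<close>, the metric trace and the
  Ricci form are definite descriptions, so each needs a unique value before it can be computed with.
  For the horizontal lift, uniqueness rests on vanishing torsion: if \<open>Y\<close> is parallel at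
  \<open>p\<close>, then at \<open>p\<close> the derivative \<open>X(Y f)\<close> equals
  \<open>Z(X f) - (\<nabla>_Z X) f\<close> for every field \<open>Z\<close> with
  \<open>Z p = Y p\<close>, an expression that sees \<open>Y\<close> only through
  \<open>Y p\<close>. Equality of vectors on the bundle is tested on two kinds of functions,
  \<open>f (fst w)\<close> and \<open>snd w f\<close>, since these contain the bundle coordinates.
  In the adapted frame the metric and the fundamental form both have constant coefficients, so the
  Koszul formula and the exterior derivative reduce to brackets paired with frame fields; that the
  Bismut connection commutes with \<open>J1\<close> is read off from these values. As \<nabla> need
  not preserve the metric, its coefficients carry no skew symmetry, and tr \<gamma> appears as the
  difference of the sums of \<open><D_{e_i} e_i, e_l>\<close> and
  \<open><\<nabla>_{e_i} e_i, e_l>\<close>. It vanishes on all of \<open>M\<close>, so \<alpha> is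
  identically zero and so is its differential.\<close>

lemma frechet_derivative_cong_open:
  assumes "open S" "x \<in> S" "\<And>y. y \<in> S \<Longrightarrow> f y = g y"
  shows "frechet_derivative f (at x) = frechet_derivative g (at x)"
proof -
  have "(f has_derivative f') (at x) \<longleftrightarrow> (g has_derivative f') (at x)" for f'
    using assms has_derivative_transform_within_open by (metis (no_types, lifting))
  then show ?thesis
    by (simp add: frechet_derivative_def)
qed

lemma Ck_on_subset: "Ck_on k S f \<Longrightarrow> T \<subseteq> S \<Longrightarrow> Ck_on k T f"
  by (induction k arbitrary: f) (auto intro: continuous_on_subset)

lemma Ck_on_cong:
  assumes "open S" "Ck_on k S f" "\<And>y. y \<in> S \<Longrightarrow> f y = g y"
  shows "Ck_on k S g"
  using assms(2,3)
proof (induction k arbitrary: f g)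
  case 0
  then show ?case by (simp cong: continuous_on_cong)
next
  case (Suc k)
  have "g differentiable at x" if "x \<in> S" for x
    using Suc.prems that \<open>open S\<close> has_derivative_transform_within_open
    unfolding differentiable_def Ck_on.simps by metis
  moreover have "Ck_on k S (\<lambda>x. frechet_derivative g (at x) v)" for v
  proof (rule Suc.IH)
    show "Ck_on k S (\<lambda>x. frechet_derivative f (at x) v)"
      using Suc.prems by simp
    show "frechet_derivative f (at y) v = frechet_derivative g (at y) v" if "y \<in> S" for y
      using frechet_derivative_cong_open[OF \<open>open S\<close> that] Suc.prems(2) by metis
  qed
  ultimately show ?case by simp
qed

lemma Ck_on_SucD: "Ck_on (Suc k) S f \<Longrightarrow> Ck_on k S f"
proof (induction k arbitrary: f)
  case 0
  then show ?case
    by (auto intro!: continuous_at_imp_continuous_on differentiable_imp_continuous_within)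
next
  case (Suc k)
  then show ?case by (metis Ck_on.simps(2))
qed

lemma Ck_on_has_derivative:
  "Ck_on (Suc k) S f \<Longrightarrow> x \<in> S \<Longrightarrow> (f has_derivative frechet_derivative f (at x)) (at x)"
  using frechet_derivative_works by auto

text \<open>Uniqueness of the derivative lets any explicit formula \<open>f'\<close> stand in for
  \<open>frechet_derivative\<close>; openness makes the two agree near each point, as
  \<open>Ck_on_cong\<close> requires.\<close>

lemma Ck_on_SucI:
  assumes "open S" "\<And>x. x \<in> S \<Longrightarrow> (f has_derivative f' x) (at x)"
    and "\<And>v. Ck_on k S (\<lambda>x. f' x v)"
  shows "Ck_on (Suc k) S f"
proof -
  have "Ck_on k S (\<lambda>x. frechet_derivative f (at x) v)" for v
  proof (rule Ck_on_cong[OF assms(1) assms(3)[of v]])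
    show "f' y v = frechet_derivative f (at y) v" if "y \<in> S" for y
      using frechet_derivative_at[OF assms(2)[OF that]] by simp
  qed
  moreover have "\<forall>x\<in>S. f differentiable (at x)"
    using assms(2) differentiable_def by blast
  ultimately show ?thesis by simp
qed

lemma Ck_on_const: "open S \<Longrightarrow> Ck_on k S (\<lambda>x. c)"
  by (induction k arbitrary: c) auto

lemma Ck_on_bounded_linear:
  assumes "bounded_linear h" "open S"
  shows "Ck_on k S f \<Longrightarrow> Ck_on k S (\<lambda>x. h (f x))"
proof (induction k arbitrary: f)
  case 0
  then show ?case
    using assms by (simp add: bounded_linear.continuous_on)
next
  case (Suc k)
  show ?case
  proof (rule Ck_on_SucI[OF assms(2)])
    show "((\<lambda>x. h (f x)) has_derivative (\<lambda>v. h (frechet_derivative f (at x) v))) (at x)"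
      if "x \<in> S" for x
      using bounded_linear.has_derivative[OF assms(1)] Ck_on_has_derivative[OF Suc.prems that] .
    show "Ck_on k S (\<lambda>x. h (frechet_derivative f (at x) v))" for v
      using Suc by simp
  qed
qed

lemma Ck_on_add:
  assumes "open S"
  shows "Ck_on k S f \<Longrightarrow> Ck_on k S g \<Longrightarrow> Ck_on k S (\<lambda>x. f x + g x)"
proof (induction k arbitrary: f g)
  case 0
  then show ?case by (simp add: continuous_on_add)
next
  case (Suc k)
  show ?case
  proof (rule Ck_on_SucI[OF assms])
    show "((\<lambda>x. f x + g x) has_derivative
        (\<lambda>v. frechet_derivative f (at x) v + frechet_derivative g (at x) v)) (at x)" if "x \<in> S" for x
      using Suc.prems that by (intro has_derivative_add Ck_on_has_derivative)
    show "Ck_on k S (\<lambda>x. frechet_derivative f (at x) v + frechet_derivative g (at x) v)" for v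
      using Suc by simp
  qed
qed

text \<open>The product rule mixes the factors with their derivatives, so the induction step also
  needs \<open>f\<close> and \<open>g\<close> at order \<open>k\<close>, which
  \<open>Ck_on_SucD\<close> supplies.\<close>

lemma Ck_on_bilinear:
  assumes "bounded_bilinear pr" "open S"
  shows "Ck_on k S f \<Longrightarrow> Ck_on k S g \<Longrightarrow> Ck_on k S (\<lambda>x. pr (f x) (g x))"
proof (induction k arbitrary: f g)
  case 0
  then show ?case using assms by (simp add: bounded_bilinear.continuous_on)
next
  case (Suc k)
  let ?f' = "\<lambda>x. frechet_derivative f (at x)" and ?g' = "\<lambda>x. frechet_derivative g (at x)"
  show ?case
  proof (rule Ck_on_SucI[OF assms(2)])
    show "((\<lambda>x. pr (f x) (g x)) has_derivative (\<lambda>v. pr (f x) (?g' x v) + pr (?f' x v) (g x))) (at x)"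
      if "x \<in> S" for x
      by (rule bounded_bilinear.FDERIV[OF assms(1)])
        (use Suc that in \<open>auto intro: Ck_on_has_derivative[where k=k]\<close>)
    show "Ck_on k S (\<lambda>x. pr (f x) (?g' x v) + pr (?f' x v) (g x))" for v
      using Suc.prems Suc.prems[THEN Ck_on_SucD] by (intro Ck_on_add assms Suc.IH) auto
  qed
qed

lemma Ck_on_sum:
  assumes "open S" "\<And>i. i \<in> I \<Longrightarrow> Ck_on k S (f i)"
  shows "Ck_on k S (\<lambda>x. \<Sum>i\<in>I. f i x)"
proof (cases "finite I")
  case True
  then show ?thesis using assms(2)
    by (induction I rule: finite_induct) (auto intro: Ck_on_add Ck_on_const assms(1))
next
  case False
  then show ?thesis using Ck_on_const[OF assms(1)] by simp
qed

lemma linear_expand: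
  fixes v :: "'e::euclidean_space"
  assumes "linear h" shows "h v = (\<Sum>b\<in>Basis. (v \<bullet> b) *\<^sub>R h b)"
proof -
  have "h v = h (\<Sum>b\<in>Basis. (v \<bullet> b) *\<^sub>R b)" by (simp add: euclidean_representation)
  also have "\<dots> = (\<Sum>b\<in>Basis. (v \<bullet> b) *\<^sub>R h b)"
    using assms by (simp add: linear_sum linear_cmul)
  finally show ?thesis .
qed

text \<open>\<open>Ck_on\<close> speaks of derivatives in a fixed direction, whereas the chain rule
  differentiates \<open>f\<close> in the moving direction \<open>g'(x) v\<close>. Expanding that
  direction in the basis leaves products of components of \<open>g'\<close> with
  \<open>x \<mapsto> f'(g x) b\<close> for fixed \<open>b\<close>, to which the induction hypothesis
  applies.\<close>

lemma Ck_on_compose: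
  fixes f :: "'b::euclidean_space \<Rightarrow> 'c::real_normed_vector" and g :: "'a::euclidean_space \<Rightarrow> 'b"
  assumes "open S" "open T" "g ` S \<subseteq> T"
  shows "Ck_on k T f \<Longrightarrow> Ck_on k S g \<Longrightarrow> Ck_on k S (\<lambda>x. f (g x))"
proof (induction k arbitrary: f)
  case 0
  then show ?case
    using assms(3) by (auto intro: continuous_on_compose2)
next
  case (Suc k)
  let ?f' = "\<lambda>x. frechet_derivative f (at x)" and ?g' = "\<lambda>x. frechet_derivative g (at x)"
  show ?case
  proof (rule Ck_on_SucI[OF assms(1)])
    fix x assume x: "x \<in> S"
    then have gx: "g x \<in> T" using assms(3) by auto
    have f': "(f has_derivative ?f' (g x)) (at (g x))"
      using Ck_on_has_derivative[OF Suc.prems(1) gx] .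
    have "((\<lambda>x. f (g x)) has_derivative (\<lambda>v. ?f' (g x) (?g' x v))) (at x)"
      using diff_chain_at[OF Ck_on_has_derivative[OF Suc.prems(2) x] f'] by (simp add: o_def)
    moreover have "?f' (g x) (?g' x v) = (\<Sum>b\<in>Basis. (?g' x v \<bullet> b) *\<^sub>R ?f' (g x) b)" for v
      using linear_expand[OF has_derivative_linear[OF f']] .
    ultimately show "((\<lambda>x. f (g x)) has_derivative (\<lambda>v. \<Sum>b\<in>Basis. (?g' x v \<bullet> b) *\<^sub>R ?f' (g x) b)) (at x)"
      by simp
  next
    show "Ck_on k S (\<lambda>x. \<Sum>b\<in>Basis. (?g' x v \<bullet> b) *\<^sub>R ?f' (g x) b)" for v
    proof (intro Ck_on_sum[OF assms(1)] Ck_on_bilinear[OF bounded_bilinear_scaleR assms(1)])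
      fix b :: 'b
      show "Ck_on k S (\<lambda>x. ?g' x v \<bullet> b)"
        by (rule Ck_on_bounded_linear[OF bounded_linear_inner_left assms(1)]) (use Suc.prems in simp)
      show "Ck_on k S (\<lambda>x. ?f' (g x) b)"
        using Suc.IH[of "\<lambda>y. ?f' y b"] Suc.prems(1) Ck_on_SucD[OF Suc.prems(2)] by simp
    qed
  qed
qed

lemma Ck_on_local:
  assumes "\<And>x. x \<in> S \<Longrightarrow> \<exists>T. open T \<and> x \<in> T \<and> Ck_on k T f"
  shows "Ck_on k S f"
  using assms
proof (induction k arbitrary: f)
  case 0
  then show ?case
    by (metis Ck_on.simps(1) continuous_at_imp_continuous_on continuous_on_eq_continuous_at)
next
  case (Suc k)
  then show ?case
    by (metis Ck_on.simps(2))
qed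

section \<open>Closure properties of smooth functions\<close>

lemma smooth_on_subset: "smooth_on S f \<Longrightarrow> T \<subseteq> S \<Longrightarrow> smooth_on T f"
  using Ck_on_subset smooth_on_def by metis

lemma smooth_on_cong:
  "open S \<Longrightarrow> smooth_on S f \<Longrightarrow> (\<And>y. y \<in> S \<Longrightarrow> f y = g y) \<Longrightarrow> smooth_on S g"
  using Ck_on_cong smooth_on_def by metis

lemma smooth_on_local:
  "(\<And>x. x \<in> S \<Longrightarrow> \<exists>T. open T \<and> x \<in> T \<and> smooth_on T f) \<Longrightarrow> smooth_on S f"
  unfolding smooth_on_def using Ck_on_local by metis

lemma smooth_on_const: "open S \<Longrightarrow> smooth_on S (\<lambda>x. c)"
  by (simp add: smooth_on_def Ck_on_const)

lemma smooth_on_bounded_linear: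
  "bounded_linear h \<Longrightarrow> open S \<Longrightarrow> smooth_on S f \<Longrightarrow> smooth_on S (\<lambda>x. h (f x))"
  by (simp add: smooth_on_def Ck_on_bounded_linear)

lemma smooth_on_add:
  "open S \<Longrightarrow> smooth_on S f \<Longrightarrow> smooth_on S g \<Longrightarrow> smooth_on S (\<lambda>x. f x + g x)"
  by (simp add: smooth_on_def Ck_on_add)

lemma smooth_on_scaleR:
  "open S \<Longrightarrow> smooth_on S f \<Longrightarrow> smooth_on S g \<Longrightarrow> smooth_on S (\<lambda>x. f x *\<^sub>R g x)"
  by (simp add: smooth_on_def Ck_on_bilinear[OF bounded_bilinear_scaleR])

lemma smooth_on_mult:
  fixes f g :: "'e::euclidean_space \<Rightarrow> real"
  shows "open S \<Longrightarrow> smooth_on S f \<Longrightarrow> smooth_on S g \<Longrightarrow> smooth_on S (\<lambda>x. f x * g x)"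
  by (simp add: smooth_on_def Ck_on_bilinear[OF bounded_bilinear_mult])

lemma smooth_on_inner:
  fixes f g :: "'e::euclidean_space \<Rightarrow> 'f::euclidean_space"
  shows "open S \<Longrightarrow> smooth_on S f \<Longrightarrow> smooth_on S g \<Longrightarrow> smooth_on S (\<lambda>x. f x \<bullet> g x)"
  by (simp add: smooth_on_def Ck_on_bilinear[OF bounded_bilinear_inner])

lemma smooth_on_sum:
  "open S \<Longrightarrow> (\<And>i. i \<in> I \<Longrightarrow> smooth_on S (f i)) \<Longrightarrow> smooth_on S (\<lambda>x. \<Sum>i\<in>I. f i x)"
  by (simp add: smooth_on_def Ck_on_sum)

lemma smooth_on_compose:
  fixes f :: "'b::euclidean_space \<Rightarrow> 'c::real_normed_vector" and g :: "'a::euclidean_space \<Rightarrow> 'b"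
  shows "open S \<Longrightarrow> open T \<Longrightarrow> g ` S \<subseteq> T \<Longrightarrow> smooth_on T f \<Longrightarrow> smooth_on S g
    \<Longrightarrow> smooth_on S (\<lambda>x. f (g x))"
  unfolding smooth_on_def by (metis Ck_on_compose)

lemma smooth_on_ident: "open S \<Longrightarrow> smooth_on S (\<lambda>x. x)"
proof (unfold smooth_on_def, rule allI)
  fix k assume "open S"
  then show "Ck_on k S (\<lambda>x. x)"
    by (cases k) (auto intro: Ck_on_const)
qed

lemma smooth_on_linear: "bounded_linear h \<Longrightarrow> open S \<Longrightarrow> smooth_on S h"
  using smooth_on_bounded_linear smooth_on_ident by blast

lemma smooth_on_frechet:
  "smooth_on S f \<Longrightarrow> smooth_on S (\<lambda>x. frechet_derivative f (at x) v)"
  unfolding smooth_on_def by (metis Ck_on.simps(2))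

lemma smooth_on_has_derivative:
  "smooth_on S f \<Longrightarrow> x \<in> S \<Longrightarrow> (f has_derivative frechet_derivative f (at x)) (at x)"
  unfolding smooth_on_def by (metis Ck_on_has_derivative)

lemma smooth_on_continuous: "smooth_on S f \<Longrightarrow> continuous_on S f"
  unfolding smooth_on_def by (metis Ck_on.simps(1))

lemma smooth_on_components:
  fixes f :: "'e::euclidean_space \<Rightarrow> 'f::euclidean_space"
  assumes "open S" "\<And>b. b \<in> Basis \<Longrightarrow> smooth_on S (\<lambda>x. f x \<bullet> b)"
  shows "smooth_on S f"
proof -
  have "smooth_on S (\<lambda>x. \<Sum>b\<in>Basis. (f x \<bullet> b) *\<^sub>R b)"
    by (intro smooth_on_sum smooth_on_scaleR smooth_on_const assms)
  then show ?thesis by (simp add: euclidean_representation)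
qed

text \<open>A family closed under differentiation up to linear combinations is smooth: the induction
  on the order treats all members at once.\<close>

lemma smooth_on_real:
  fixes S :: "real set"
  assumes "open S" "\<And>k x. x \<in> S \<Longrightarrow> (F k has_real_derivative (\<Sum>j\<in>I k. c k j * F j x)) (at x)"
  shows "smooth_on S (F k)"
proof -
  have "Ck_on m S (F k)" for m
  proof (induction m arbitrary: k)
    case 0
    then show ?case
      by (simp, intro continuous_at_imp_continuous_on ballI) (use assms(2) DERIV_isCont in blast)
  next
    case (Suc m)
    show ?case
    proof (rule Ck_on_SucI[OF assms(1)])
      show "(F k has_derivative (\<lambda>v. (\<Sum>j\<in>I k. c k j * F j x) * v)) (at x)" if "x \<in> S" for x
        using assms(2)[OF that, of k] by (simp add: has_field_derivative_def)
      show "Ck_on m S (\<lambda>x. (\<Sum>j\<in>I k. c k j * F j x) * v)" for v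
        by (intro Ck_on_bilinear[OF bounded_bilinear_mult] Ck_on_sum Ck_on_const assms(1) Suc.IH)
    qed
  qed
  then show ?thesis by (simp add: smooth_on_def)
qed

text \<open>Used to normalise fields in the Gram-Schmidt process. The closed family consists of the
  powers \<open>t powr (-1/2 - k)\<close>.\<close>

lemma smooth_on_inverse_sqrt: "smooth_on {0<..} (\<lambda>t::real. inverse (sqrt t))"
proof -
  define F where "F k t = t powr (- 1/2 - real k)" for k :: nat and t :: real
  have F: "(F k has_real_derivative (\<Sum>j\<in>{Suc k}. (- 1/2 - real k) * F j x)) (at x)"
    if "x \<in> {0<..}" for k x
  proof -
    have eq: "- 1/2 - real k - 1 = - 1/2 - real (Suc k)" by simp
    have "((\<lambda>t. t powr (- 1/2 - real k)) has_real_derivative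
      (- 1/2 - real k) * x powr (- 1/2 - real k - 1)) (at x)"
      using that by (intro has_real_derivative_powr) simp
    then show ?thesis unfolding F_def[abs_def] eq by simp
  qed
  have "smooth_on {0<..} (F 0)"
    by (rule smooth_on_real[where I="\<lambda>k. {Suc k}" and c="\<lambda>k j. - 1/2 - real k"]) (use F in auto)
  then show ?thesis
    by (rule smooth_on_cong[rotated])
      (auto simp: F_def powr_minus powr_half_sqrt simp flip: powr_minus_divide)
qed

text \<open>The standard flat function behind bump functions. The family
  \<open>exp(-1/t) / t^k\<close>, extended by 0, is closed under differentiation: the derivative of
  member \<open>k\<close> is \<open>-k\<close> times member \<open>k+1\<close> plus member
  \<open>k+2\<close>.\<close>

lemma smooth_on_flat_exp: "smooth_on UNIV (\<lambda>t::real. if t > 0 then exp (- (1/t)) else 0)"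
proof -
  define F where "F k t = (if t > 0 then exp (- (1/t)) / t ^ k else 0)" for k :: nat and t :: real
  have F: "(F k has_real_derivative (- real k * F (k+1) x + F (k+2) x)) (at x)" for k x
  proof -
    consider "x > 0" | "x < 0" | "x = 0" by linarith
    then show ?thesis
    proof cases
      case 1
      have "((\<lambda>t. exp (- (1/t)) / t ^ k) has_real_derivative
         (- real k * F (k+1) x + F (k+2) x)) (at x)"
        using 1 by (auto intro!: derivative_eq_intros simp: F_def field_simps power2_eq_square
            power_eq_if[of x k])
      then show ?thesis
        by (rule has_field_derivative_transform_within_open[of _ _ _ "{0<..}"])
          (use 1 in \<open>auto simp: F_def\<close>)
    next
      case 2
      have "((\<lambda>t. 0) has_real_derivative (- real k * F (k+1) x + F (k+2) x)) (at x)"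
        using 2 by (simp add: F_def)
      then show ?thesis
        by (rule has_field_derivative_transform_within_open[of _ _ _ "{..<0}"])
          (use 2 in \<open>auto simp: F_def\<close>)
    next
      case 3
      \<comment> \<open>At 0 the difference quotient is examined from each side; on the right the
        exponential beats every power of \<open>t\<close>, so the derivative there is 0, as the
        recursion predicts.\<close>
      have right: "((\<lambda>t. exp (- (1/t)) / t ^ k / t) \<longlongrightarrow> 0) (at_right (0::real))"
        by real_asymp
      have "((\<lambda>t. F k t / t) \<longlongrightarrow> 0) (at_right 0)"
        by (rule Lim_transform_eventually[OF right])
          (auto simp: eventually_at_filter F_def)
      moreover have "((\<lambda>t. F k t / t) \<longlongrightarrow> 0) (at_left 0)"
        by (rule Lim_transform_eventually[of "\<lambda>_. 0"])
          (auto simp: eventually_at_filter F_def)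
      ultimately have "((\<lambda>t. F k t / t) \<longlongrightarrow> 0) (at 0)"
        by (simp add: filterlim_split_at)
      then show ?thesis using 3 by (simp add: has_field_derivative_iff F_def)
    qed
  qed
  have "smooth_on UNIV (F 0)"
    by (rule smooth_on_real[where I="\<lambda>k. {k+1, k+2}" and
          c="\<lambda>k j. if j = k+1 then - real k else 1"]) (use F in auto)
  then show ?thesis by (rule smooth_on_cong[rotated]) (auto simp: F_def)
qed

section \<open>Symmetry of second derivatives\<close>

lemma has_real_derivative_along_line:
  fixes a v :: "'e::euclidean_space" and f :: "'e \<Rightarrow> real"
  assumes "(f has_derivative f') (at (a + s *\<^sub>R v))"
  shows "((\<lambda>s. f (a + s *\<^sub>R v)) has_real_derivative f' v) (at s)"
proof -
  have "((\<lambda>s. a + s *\<^sub>R v) has_derivative (\<lambda>s. s *\<^sub>R v)) (at s)"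
    by (auto intro!: derivative_eq_intros)
  from diff_chain_at[OF this assms]
  have "((\<lambda>s. f (a + s *\<^sub>R v)) has_derivative (\<lambda>s. f' (s *\<^sub>R v))) (at s)"
    by (simp add: o_def)
  moreover have "f' (s *\<^sub>R v) = f' v * s" for s
    using linear_cmul[OF has_derivative_linear[OF assms]] by simp
  ultimately show ?thesis by (simp add: has_field_derivative_def)
qed

text \<open>The second difference is the increment in the direction \<open>v\<close> of an increment
  in the direction \<open>w\<close>. The mean value theorem in \<open>s\<close> replaces the former
  by a derivative along \<open>v\<close>, and a second application in \<open>r\<close> replaces the
  latter by a derivative along \<open>w\<close>.\<close>

lemma second_difference_mvt:
  fixes f :: "'e::euclidean_space \<Rightarrow> real"
  assumes f: "smooth_on S f" and t: "0 < t"
    and S: "\<And>s r. 0 \<le> s \<Longrightarrow> s \<le> t \<Longrightarrow> 0 \<le> r \<Longrightarrow> r \<le> t \<Longrightarrow> x + s *\<^sub>R v + r *\<^sub>R w \<in> S"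
  obtains s r where "0 \<le> s" "s \<le> t" "0 \<le> r" "r \<le> t"
    "f (x + t *\<^sub>R v + t *\<^sub>R w) - f (x + t *\<^sub>R v) - f (x + t *\<^sub>R w) + f x
      = t * t * frechet_derivative (\<lambda>y. frechet_derivative f (at y) v) (at (x + s *\<^sub>R v + r *\<^sub>R w)) w"
proof -
  let ?f' = "\<lambda>y. frechet_derivative f (at y)"
  define h where "h s = f ((x + t *\<^sub>R w) + s *\<^sub>R v) - f (x + s *\<^sub>R v)" for s
  have S2: "x + t *\<^sub>R w + s *\<^sub>R v \<in> S" "x + s *\<^sub>R v \<in> S" if "0 \<le> s" "s \<le> t" for s
    using S[of s t] S[of s 0] that t by (auto simp: algebra_simps)
  have "(h has_real_derivative (?f' ((x + t *\<^sub>R w) + s *\<^sub>R v) v - ?f' (x + s *\<^sub>R v) v)) (at s)"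
    if "0 \<le> s" "s \<le> t" for s
    unfolding h_def
    by (intro DERIV_diff has_real_derivative_along_line smooth_on_has_derivative[OF f] S2 that)
  from MVT2[OF t this] obtain s where s: "0 < s" "s < t"
    "h t - h 0 = (t - 0) * (?f' ((x + t *\<^sub>R w) + s *\<^sub>R v) v - ?f' (x + s *\<^sub>R v) v)" by blast
  define k where "k r = ?f' ((x + s *\<^sub>R v) + r *\<^sub>R w) v" for r
  have "(k has_real_derivative frechet_derivative (\<lambda>y. ?f' y v) (at (x + s *\<^sub>R v + r *\<^sub>R w)) w) (at r)"
    if "0 \<le> r" "r \<le> t" for r
    unfolding k_def
    by (intro has_real_derivative_along_line smooth_on_has_derivative[of S] smooth_on_frechet f S)
      (use that s in auto)
  from MVT2[OF t this] obtain r where r: "0 < r" "r < t"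
    "k t - k 0 = (t - 0) * frechet_derivative (\<lambda>y. ?f' y v) (at (x + s *\<^sub>R v + r *\<^sub>R w)) w" by blast
  have "?f' ((x + t *\<^sub>R w) + s *\<^sub>R v) v = k t" "?f' (x + s *\<^sub>R v) v = k 0"
    by (simp_all add: k_def add.commute add.left_commute)
  then have "h t - h 0 = t * t * frechet_derivative (\<lambda>y. ?f' y v) (at (x + s *\<^sub>R v + r *\<^sub>R w)) w"
    using s(3) r(3) by simp
  moreover have "h t - h 0 = f (x + t *\<^sub>R v + t *\<^sub>R w) - f (x + t *\<^sub>R v) - f (x + t *\<^sub>R w) + f x"
    by (simp add: h_def algebra_simps)
  ultimately show ?thesis using that[of s r] s r by auto
qed

text \<open>The second difference is symmetric in \<open>v\<close> and \<open>w\<close>, so both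
  mixed derivatives attain the same value at points of a small parallelogram. If they differed at
  \<open>x\<close>, continuity would separate these values.\<close>

lemma frechet_derivative_commute:
  fixes f :: "'e::euclidean_space \<Rightarrow> real"
  assumes S: "open S" and f: "smooth_on S f" and x: "x \<in> S"
  shows "frechet_derivative (\<lambda>y. frechet_derivative f (at y) v) (at x) w =
         frechet_derivative (\<lambda>y. frechet_derivative f (at y) w) (at x) v"
proof (rule ccontr)
  define A where "A y = frechet_derivative (\<lambda>y. frechet_derivative f (at y) v) (at y) w" for y
  define B where "B y = frechet_derivative (\<lambda>y. frechet_derivative f (at y) w) (at y) v" for y
  assume "\<not> ?thesis"
  then have ne: "A x \<noteq> B x" by (simp add: A_def B_def)
  have cont: "continuous_on S A" "continuous_on S B"
    unfolding A_def B_def by (intro smooth_on_continuous smooth_on_frechet f)+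
  define e where "e = \<bar>A x - B x\<bar> / 2"
  have e: "e > 0" using ne by (simp add: e_def)
  obtain d1 where d1: "d1 > 0" "\<And>y. y \<in> S \<Longrightarrow> dist y x < d1 \<Longrightarrow> \<bar>A y - A x\<bar> < e"
    using cont(1) x e unfolding continuous_on_iff dist_real_def by metis
  obtain d2 where d2: "d2 > 0" "\<And>y. y \<in> S \<Longrightarrow> dist y x < d2 \<Longrightarrow> \<bar>B y - B x\<bar> < e"
    using cont(2) x e unfolding continuous_on_iff dist_real_def by metis
  obtain d3 where d3: "d3 > 0" "ball x d3 \<subseteq> S"
    using S x open_contains_ball by metis
  define d where "d = min d1 (min d2 d3)"
  \<comment> \<open>The parallelogram has diameter at most \<open>t (|v| + |w|)\<close>, which this
    choice keeps strictly below \<open>d\<close>; the summand 1 covers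
    \<open>v = w = 0\<close>.\<close>
  define t where "t = d / (2 * (norm v + norm w + 1))"
  have t0: "t > 0" using d1 d2 d3 by (simp add: t_def d_def add_nonneg_pos)
  have near: "dist (x + s *\<^sub>R v + r *\<^sub>R w) x < d" if "0 \<le> s" "s \<le> t" "0 \<le> r" "r \<le> t" for s r
  proof -
    have "dist (x + s *\<^sub>R v + r *\<^sub>R w) x = norm (s *\<^sub>R v + r *\<^sub>R w)"
      by (simp add: dist_norm algebra_simps)
    also have "\<dots> \<le> s * norm v + r * norm w"
      using norm_triangle_ineq[of "s *\<^sub>R v" "r *\<^sub>R w"] that by simp
    also have "\<dots> \<le> t * norm v + t * norm w"
      using that by (intro add_mono mult_right_mono) auto
    also have "\<dots> < t * (2 * (norm v + norm w + 1))"
    proof -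
      have "0 \<le> t * norm v" "0 \<le> t * norm w" using t0 by auto
      moreover have "t * (2 * (norm v + norm w + 1)) = 2 * (t * norm v) + 2 * (t * norm w) + 2 * t"
        by (simp add: algebra_simps)
      ultimately show ?thesis using t0 by linarith
    qed
    also have "\<dots> = d"
    proof -
      have "norm v + norm w + 1 > 0" by (simp add: add_nonneg_pos)
      then show ?thesis by (simp add: t_def)
    qed
    finally show ?thesis .
  qed
  have inS: "x + s *\<^sub>R v + r *\<^sub>R w \<in> S" "x + r *\<^sub>R w + s *\<^sub>R v \<in> S"
    if "0 \<le> s" "s \<le> t" "0 \<le> r" "r \<le> t" for s r
    using near[OF that] d3(2) by (auto simp: d_def dist_commute subset_iff add.commute add.left_commute)
  obtain s r where 1: "0 \<le> s" "s \<le> t" "0 \<le> r" "r \<le> t"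
    "f (x + t *\<^sub>R v + t *\<^sub>R w) - f (x + t *\<^sub>R v) - f (x + t *\<^sub>R w) + f x
      = t * t * A (x + s *\<^sub>R v + r *\<^sub>R w)"
    unfolding A_def by (rule second_difference_mvt[OF f t0 inS(1)])
  obtain s' r' where 2: "0 \<le> s'" "s' \<le> t" "0 \<le> r'" "r' \<le> t"
    "f (x + t *\<^sub>R w + t *\<^sub>R v) - f (x + t *\<^sub>R w) - f (x + t *\<^sub>R v) + f x
      = t * t * B (x + s' *\<^sub>R w + r' *\<^sub>R v)"
    unfolding B_def by (rule second_difference_mvt[OF f t0 inS(2)])
  have "t * t * A (x + s *\<^sub>R v + r *\<^sub>R w) = t * t * B (x + s' *\<^sub>R w + r' *\<^sub>R v)"
  proof -
    have "x + t *\<^sub>R w + t *\<^sub>R v = x + t *\<^sub>R v + t *\<^sub>R w" by simp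
    then show ?thesis using 1(5) 2(5) by (smt (verit))
  qed
  then have "A (x + s *\<^sub>R v + r *\<^sub>R w) = B (x + s' *\<^sub>R w + r' *\<^sub>R v)" using t0 by simp
  moreover have "\<bar>A (x + s *\<^sub>R v + r *\<^sub>R w) - A x\<bar> < e"
    using d1(2) inS(1) near 1 by (simp add: d_def)
  moreover have "\<bar>B (x + s' *\<^sub>R w + r' *\<^sub>R v) - B x\<bar> < e"
    using d2(2) inS(2) near[of r' s'] 2 by (simp add: d_def add.commute add.left_commute)
  ultimately have "\<bar>A x - B x\<bar> < e + e" by linarith
  then show False unfolding e_def by simp
qed

section \<open>Smooth functions and tangent vectors\<close>

lemma sum_fun_apply: "(\<Sum>i\<in>I. F i) x = (\<Sum>i\<in>I. F i x)"
  by (induction I rule: infinite_finite_induct) auto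

lemma tscale_apply [simp]: "tscale c v f = c * v f"
  by (simp add: tscale_def)

lemma fscale_apply [simp]: "fscale f X p = tscale (f p) (X p)"
  by (simp add: fscale_def)

section \<open>Charts and smooth germs on a fixed manifold\<close>

locale smooth_mfd =
  fixes M :: "('a, 'e::euclidean_space) manifold"
  assumes smooth_manifold: "smooth_manifold M"
begin

abbreviation opn :: "'a set \<Rightarrow> bool" where "opn \<equiv> openin (mtop M)"
abbreviation T :: "'a \<Rightarrow> 'a tvec set" where "T \<equiv> tangent_space M"
abbreviation snear :: "'a \<Rightarrow> ('a \<Rightarrow> real) \<Rightarrow> bool" where "snear \<equiv> smooth_near M"

lemma opn_Int: "opn U \<Longrightarrow> opn V \<Longrightarrow> opn (U \<inter> V)"
  by (rule openin_Int)

lemma atlas_cover: "(\<Union>(U, \<phi>)\<in>atlas M. U) = topspace (mtop M)"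
  using smooth_manifold unfolding smooth_manifold_def by (elim conjE)

lemma chart_opn: "(U, \<phi>) \<in> atlas M \<Longrightarrow> opn U"
  and chart_open: "(U, \<phi>) \<in> atlas M \<Longrightarrow> open (\<phi> ` U)"
  and chart_homeo: "(U, \<phi>) \<in> atlas M \<Longrightarrow>
    homeomorphic_map (subtopology (mtop M) U) (top_of_set (\<phi> ` U)) \<phi>"
proof -
  have "\<forall>(U, \<phi>)\<in>atlas M. opn U \<and> open (\<phi> ` U) \<and>
        homeomorphic_map (subtopology (mtop M) U) (top_of_set (\<phi> ` U)) \<phi>"
    using smooth_manifold unfolding smooth_manifold_def by (elim conjE)
  then show "(U, \<phi>) \<in> atlas M \<Longrightarrow> opn U" "(U, \<phi>) \<in> atlas M \<Longrightarrow> open (\<phi> ` U)"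
    "(U, \<phi>) \<in> atlas M \<Longrightarrow> homeomorphic_map (subtopology (mtop M) U) (top_of_set (\<phi> ` U)) \<phi>"
    by blast+
qed

lemma chart_transition:
  assumes "(U, \<phi>) \<in> atlas M" "(V, \<psi>) \<in> atlas M"
  shows "smooth_on (\<phi> ` (U \<inter> V)) (\<psi> \<circ> inv_into U \<phi>)"
proof -
  have "\<forall>(U, \<phi>)\<in>atlas M. \<forall>(V, \<psi>)\<in>atlas M. smooth_on (\<phi> ` (U \<inter> V)) (\<psi> \<circ> inv_into U \<phi>)"
    using smooth_manifold unfolding smooth_manifold_def by (elim conjE)
  then show ?thesis using assms by blast
qed

lemma chart_inj: "(U, \<phi>) \<in> atlas M \<Longrightarrow> inj_on \<phi> U"
  using homeomorphic_imp_injective_map[OF chart_homeo, of U \<phi>] openin_subset[OF chart_opn, of U \<phi>]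
  by (simp add: Int_absorb1)

lemma inv_chart: "(U, \<phi>) \<in> atlas M \<Longrightarrow> q \<in> U \<Longrightarrow> inv_into U \<phi> (\<phi> q) = q"
  using chart_inj by (simp add: inv_into_f_f)

lemma chart_open_image:
  assumes c: "(U, \<phi>) \<in> atlas M" and V: "opn V"
  shows "open (\<phi> ` (V \<inter> U))"
proof -
  have "openin (subtopology (mtop M) U) (V \<inter> U)"
    using V by (auto simp: openin_subtopology)
  then have "openin (top_of_set (\<phi> ` U)) (\<phi> ` (V \<inter> U))"
    using homeomorphic_imp_open_map[OF chart_homeo[OF c]] by (simp add: open_map_def)
  then show ?thesis
    using chart_open[OF c] openin_open_eq by blast
qed

lemma chart_open_image_subset:
  "(U, \<phi>) \<in> atlas M \<Longrightarrow> opn V \<Longrightarrow> V \<subseteq> U \<Longrightarrow> open (\<phi> ` V)"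
  using chart_open_image by (metis Int_absorb2)

lemma chart_open_vimage:
  assumes c: "(U, \<phi>) \<in> atlas M" and W: "open W"
  shows "opn {q \<in> U. \<phi> q \<in> W}"
proof -
  have "continuous_map (subtopology (mtop M) U) (top_of_set (\<phi> ` U)) \<phi>"
    using homeomorphic_imp_continuous_map[OF chart_homeo[OF c]] .
  then have "openin (subtopology (mtop M) U) {q \<in> topspace (subtopology (mtop M) U). \<phi> q \<in> \<phi> ` U \<inter> W}"
    by (rule openin_continuous_map_preimage) (use W openin_open_Int in blast)
  moreover have "{q \<in> topspace (subtopology (mtop M) U). \<phi> q \<in> \<phi> ` U \<inter> W} = {q \<in> U. \<phi> q \<in> W}"
    using openin_subset[OF chart_opn[OF c]] by auto
  ultimately show ?thesis
    using openin_trans_full chart_opn[OF c] by metis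
qed

lemma chart_at:
  assumes "p \<in> topspace (mtop M)"
  obtains U \<phi> where "(U, \<phi>) \<in> atlas M" "p \<in> U"
  using assms unfolding atlas_cover[symmetric] by blast

lemma opn_topspace: "opn U \<Longrightarrow> p \<in> U \<Longrightarrow> p \<in> topspace (mtop M)"
  using openin_subset by blast

text \<open>\<open>smooth_fun\<close> quantifies over the whole atlas; a single chart containing
  \<open>W\<close> suffices because every other representative is obtained by composing with a
  smooth transition map.\<close>

lemma smooth_fun_chartI:
  assumes c: "(U, \<phi>) \<in> atlas M" and W: "opn W" "W \<subseteq> U"
    and f: "smooth_on (\<phi> ` W) (f \<circ> inv_into U \<phi>)"
  shows "smooth_fun M W f"
  unfolding smooth_fun_def
proof (clarify)
  fix V \<psi> assume d: "(V, \<psi>) \<in> atlas M"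
  have o: "open (\<psi> ` (W \<inter> V))" using chart_open_image[OF d W(1)] .
  have "smooth_on (\<psi> ` (W \<inter> V)) (\<lambda>x. (f \<circ> inv_into U \<phi>) ((\<phi> \<circ> inv_into V \<psi>) x))"
  proof (rule smooth_on_compose[OF o _ _ f])
    show "open (\<phi> ` W)" using chart_open_image[OF c W(1)] W(2) by (simp add: Int_absorb2)
    show "(\<phi> \<circ> inv_into V \<psi>) ` \<psi> ` (W \<inter> V) \<subseteq> \<phi> ` W"
      using inv_chart[OF d] by auto
    show "smooth_on (\<psi> ` (W \<inter> V)) (\<phi> \<circ> inv_into V \<psi>)"
      by (rule smooth_on_subset[OF chart_transition[OF d c]]) (use W in auto)
  qed
  then show "smooth_on (\<psi> ` (W \<inter> V)) (f \<circ> inv_into V \<psi>)"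
    by (rule smooth_on_cong[OF o]) (use W inv_chart[OF c] inv_chart[OF d] in auto)
qed

lemma smooth_near_chartI:
  assumes "(U, \<phi>) \<in> atlas M" "opn W" "W \<subseteq> U" "p \<in> W" "smooth_on (\<phi> ` W) (f \<circ> inv_into U \<phi>)"
  shows "snear p f"
  using smooth_fun_chartI[OF assms(1-3,5)] assms(2,4) unfolding smooth_near_def by blast

lemma smooth_near_chartE:
  assumes f: "snear p f" and c: "(U, \<phi>) \<in> atlas M" "p \<in> U"
  obtains W where "opn W" "W \<subseteq> U" "p \<in> W" "open (\<phi> ` W)" "smooth_on (\<phi> ` W) (f \<circ> inv_into U \<phi>)"
proof -
  obtain V where V: "opn V" "p \<in> V" "smooth_fun M V f"
    using f unfolding smooth_near_def by blast
  show ?thesis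
  proof (rule that[of "V \<inter> U"])
    show "opn (V \<inter> U)" using opn_Int[OF V(1) chart_opn[OF c(1)]] .
    show "open (\<phi> ` (V \<inter> U))" using chart_open_image[OF c(1) V(1)] .
    show "smooth_on (\<phi> ` (V \<inter> U)) (f \<circ> inv_into U \<phi>)"
      using V(3) c(1) unfolding smooth_fun_def by blast
  qed (use V c in auto)
qed

lemma snear_topspace: "snear p f \<Longrightarrow> p \<in> topspace (mtop M)"
  unfolding smooth_near_def using openin_subset by blast

text \<open>Smoothness on an open set is a condition on germs. Everything below is phrased with
  \<open>smooth_near\<close>, which spares the bookkeeping of domains.\<close>

lemma smooth_fun_iff:
  assumes "opn V"
  shows "smooth_fun M V f \<longleftrightarrow> (\<forall>p\<in>V. snear p f)"
proof
  assume "smooth_fun M V f"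
  then show "\<forall>p\<in>V. snear p f" using assms unfolding smooth_near_def by blast
next
  assume r: "\<forall>p\<in>V. snear p f"
  show "smooth_fun M V f"
    unfolding smooth_fun_def
  proof (clarify, rule smooth_on_local)
    fix U \<phi> x assume c: "(U, \<phi>) \<in> atlas M" and "x \<in> \<phi> ` (V \<inter> U)"
    then obtain q where q: "x = \<phi> q" "q \<in> V" "q \<in> U" by blast
    obtain W where "q \<in> W" "open (\<phi> ` W)" "smooth_on (\<phi> ` W) (f \<circ> inv_into U \<phi>)"
      using smooth_near_chartE[OF _ c q(3)] r q(2) by metis
    then show "\<exists>T. open T \<and> x \<in> T \<and> smooth_on T (f \<circ> inv_into U \<phi>)" using q(1) by blast
  qed
qed

lemma snear_cong:
  assumes f: "snear p f" and W: "opn W" "p \<in> W" "\<And>q. q \<in> W \<Longrightarrow> f q = g q"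
  shows "snear p g"
proof -
  obtain U \<phi> where c: "(U, \<phi>) \<in> atlas M" "p \<in> U" using chart_at snear_topspace[OF f] by metis
  obtain V where V: "opn V" "V \<subseteq> U" "p \<in> V" "open (\<phi> ` V)" "smooth_on (\<phi> ` V) (f \<circ> inv_into U \<phi>)"
    using smooth_near_chartE[OF f c] .
  have o: "open (\<phi> ` (W \<inter> V))"
    by (rule chart_open_image_subset[OF c(1) opn_Int[OF W(1) V(1)]]) (use V(2) in auto)
  show ?thesis
  proof (rule smooth_near_chartI[OF c(1), of "W \<inter> V"])
    show "opn (W \<inter> V)" using opn_Int[OF W(1) V(1)] .
    show "smooth_on (\<phi> ` (W \<inter> V)) (g \<circ> inv_into U \<phi>)"
    proof (rule smooth_on_cong[OF o])
      show "smooth_on (\<phi> ` (W \<inter> V)) (f \<circ> inv_into U \<phi>)"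
        by (rule smooth_on_subset[OF V(5)]) auto
      show "(f \<circ> inv_into U \<phi>) y = (g \<circ> inv_into U \<phi>) y" if "y \<in> \<phi> ` (W \<inter> V)" for y
        using that V(2) W(3) inv_chart[OF c(1)] by auto
    qed
  qed (use W V in auto)
qed

lemma snear_op2:
  assumes f: "snear p f" and g: "snear p g"
    and op: "\<And>(S :: 'e set) F G. open S \<Longrightarrow> smooth_on S F \<Longrightarrow> smooth_on S G \<Longrightarrow> smooth_on S (\<lambda>x. h (F x) (G x))"
  shows "snear p (\<lambda>q. h (f q) (g q))"
proof -
  obtain U \<phi> where c: "(U, \<phi>) \<in> atlas M" "p \<in> U" using chart_at snear_topspace[OF f] by metis
  obtain V where V: "opn V" "V \<subseteq> U" "p \<in> V" "open (\<phi> ` V)" "smooth_on (\<phi> ` V) (f \<circ> inv_into U \<phi>)"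
    using smooth_near_chartE[OF f c] .
  obtain W where W: "opn W" "W \<subseteq> U" "p \<in> W" "open (\<phi> ` W)" "smooth_on (\<phi> ` W) (g \<circ> inv_into U \<phi>)"
    using smooth_near_chartE[OF g c] .
  have o: "open (\<phi> ` (W \<inter> V))"
    by (rule chart_open_image_subset[OF c(1) opn_Int[OF W(1) V(1)]]) (use V(2) in auto)
  show ?thesis
  proof (rule smooth_near_chartI[OF c(1), of "W \<inter> V"])
    show "opn (W \<inter> V)" using opn_Int[OF W(1) V(1)] .
    have "smooth_on (\<phi> ` (W \<inter> V)) (\<lambda>x. h ((f \<circ> inv_into U \<phi>) x) ((g \<circ> inv_into U \<phi>) x))"
      by (rule op[OF o]; rule smooth_on_subset[OF V(5)] smooth_on_subset[OF W(5)]) auto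
    then show "smooth_on (\<phi> ` (W \<inter> V)) ((\<lambda>q. h (f q) (g q)) \<circ> inv_into U \<phi>)"
      by (simp add: o_def)
  qed (use W V in auto)
qed

lemma snear_const: 
  assumes "p \<in> topspace (mtop M)" shows "snear p (\<lambda>q. c)"
proof -
  obtain U \<phi> where c: "(U, \<phi>) \<in> atlas M" "p \<in> U" using chart_at assms by metis
  show ?thesis
    by (rule smooth_near_chartI[OF c(1) chart_opn[OF c(1)] _ c(2)])
      (use chart_open[OF c(1)] in \<open>auto simp: o_def smooth_on_const\<close>)
qed

lemma snear_add: "snear p f \<Longrightarrow> snear p g \<Longrightarrow> snear p (\<lambda>q. f q + g q)"
  by (rule snear_op2[where h="(+)"]) (auto intro: smooth_on_add)

lemma snear_mult: "snear p f \<Longrightarrow> snear p g \<Longrightarrow> snear p (\<lambda>q. f q * g q)"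
  by (rule snear_op2[where h="(*)"]) (auto intro: smooth_on_mult)

lemma snear_uminus: "snear p f \<Longrightarrow> snear p (\<lambda>q. - f q)"
  using snear_mult[OF snear_const[of p "-1"], of f] snear_topspace[of p f] by simp

lemma snear_diff: "snear p f \<Longrightarrow> snear p g \<Longrightarrow> snear p (\<lambda>q. f q - g q)"
  using snear_add[of p f "\<lambda>q. - g q"] snear_uminus[of p g] by simp

lemma snear_sum:
  assumes "p \<in> topspace (mtop M)" "\<And>i. i \<in> I \<Longrightarrow> snear p (f i)"
  shows "snear p (\<lambda>q. \<Sum>i\<in>I. f i q)"
  using assms(2)
  by (induction I rule: infinite_finite_induct) (auto intro: snear_add snear_const assms(1))

lemma snear_compose:
  fixes h :: "real \<Rightarrow> real"
  assumes f: "snear p f" and h: "open S" "smooth_on S h" and W: "opn W" "p \<in> W" "\<And>q. q \<in> W \<Longrightarrow> f q \<in> S"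
  shows "snear p (\<lambda>q. h (f q))"
proof -
  obtain U \<phi> where c: "(U, \<phi>) \<in> atlas M" "p \<in> U" using chart_at snear_topspace[OF f] by metis
  obtain V where V: "opn V" "V \<subseteq> U" "p \<in> V" "open (\<phi> ` V)" "smooth_on (\<phi> ` V) (f \<circ> inv_into U \<phi>)"
    using smooth_near_chartE[OF f c] .
  have o: "open (\<phi> ` (W \<inter> V))"
    by (rule chart_open_image_subset[OF c(1) opn_Int[OF W(1) V(1)]]) (use V(2) in auto)
  show ?thesis
  proof (rule smooth_near_chartI[OF c(1), of "W \<inter> V"])
    show "opn (W \<inter> V)" using opn_Int[OF W(1) V(1)] .
    have "smooth_on (\<phi> ` (W \<inter> V)) (\<lambda>x. h ((f \<circ> inv_into U \<phi>) x))"
    proof (rule smooth_on_compose[OF o h(1) _ h(2)])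
      show "(f \<circ> inv_into U \<phi>) ` \<phi> ` (W \<inter> V) \<subseteq> S"
        using V(2) W(3) inv_chart[OF c(1)] by auto
      show "smooth_on (\<phi> ` (W \<inter> V)) (f \<circ> inv_into U \<phi>)"
        by (rule smooth_on_subset[OF V(5)]) auto
    qed
    then show "smooth_on (\<phi> ` (W \<inter> V)) ((\<lambda>q. h (f q)) \<circ> inv_into U \<phi>)"
      by (simp add: o_def)
  qed (use W V in auto)
qed

section \<open>Coordinate functions, coordinate fields and tangent spaces\<close>

lemma snear_chart_comp:
  assumes c: "(U, \<phi>) \<in> atlas M" "p \<in> U" and h: "smooth_on S h" "\<phi> ` U \<subseteq> S"
  shows "snear p (\<lambda>q. h (\<phi> q))"
proof (rule smooth_near_chartI[OF c(1) chart_opn[OF c(1)] _ c(2)])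
  show "smooth_on (\<phi> ` U) ((\<lambda>q. h (\<phi> q)) \<circ> inv_into U \<phi>)"
    by (rule smooth_on_cong[OF chart_open[OF c(1)] smooth_on_subset[OF h]])
      (use inv_chart[OF c(1)] in auto)
qed auto

lemma snear_coord:
  assumes "(U, \<phi>) \<in> atlas M" "p \<in> U" shows "snear p (\<lambda>q. \<phi> q \<bullet> b)"
  using snear_chart_comp[OF assms, of UNIV "\<lambda>x. x \<bullet> b"]
  by (simp add: smooth_on_linear bounded_linear_inner_left)

text \<open>The coordinate field with constant components \<open>w\<close>. Its default 0 is that of
  \<open>tangent_space\<close>, so its values are literally the elements listed there.\<close>

definition cvec :: "'a set \<Rightarrow> ('a \<Rightarrow> 'e) \<Rightarrow> 'e \<Rightarrow> 'a vfield" where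
  "cvec U \<phi> w p = (\<lambda>f. if snear p f then frechet_derivative (f \<circ> inv_into U \<phi>) (at (\<phi> p)) w else 0)"

lemma snear_has_derivative:
  assumes "snear p f" "(U, \<phi>) \<in> atlas M" "p \<in> U"
  shows "((f \<circ> inv_into U \<phi>) has_derivative frechet_derivative (f \<circ> inv_into U \<phi>) (at (\<phi> p))) (at (\<phi> p))"
  using smooth_near_chartE[OF assms] smooth_on_has_derivative by (metis imageI)

lemma cvec_smooth:
  assumes f: "snear p f" and c: "(U, \<phi>) \<in> atlas M" "p \<in> U"
  shows "snear p (\<lambda>q. cvec U \<phi> w q f)"
proof -
  obtain V where V: "opn V" "V \<subseteq> U" "p \<in> V" "open (\<phi> ` V)" "smooth_on (\<phi> ` V) (f \<circ> inv_into U \<phi>)"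
    using smooth_near_chartE[OF f c] .
  show ?thesis
  proof (rule smooth_near_chartI[OF c(1) V(1,2,3)])
    show "smooth_on (\<phi> ` V) ((\<lambda>q. cvec U \<phi> w q f) \<circ> inv_into U \<phi>)"
    proof (rule smooth_on_cong[OF V(4) smooth_on_frechet[OF V(5)]])
      fix y assume "y \<in> \<phi> ` V"
      then obtain q where q: "y = \<phi> q" "q \<in> V" by blast
      have "snear q f" using smooth_near_chartI[OF c(1) V(1,2) q(2) V(5)] .
      then show "frechet_derivative (f \<circ> inv_into U \<phi>) (at y) w = ((\<lambda>q. cvec U \<phi> w q f) \<circ> inv_into U \<phi>) y"
        using q V(2) inv_chart[OF c(1)] by (auto simp: cvec_def)
    qed
  qed
qed

text \<open>Symmetry of second derivatives, transported to the manifold: coordinate fields of one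
  chart have vanishing bracket.\<close>

lemma cvec_commute:
  assumes f: "snear p f" and c: "(U, \<phi>) \<in> atlas M" "p \<in> U"
  shows "cvec U \<phi> w p (\<lambda>q. cvec U \<phi> v q f) = cvec U \<phi> v p (\<lambda>q. cvec U \<phi> w q f)"
proof -
  obtain V where V: "opn V" "V \<subseteq> U" "p \<in> V" "open (\<phi> ` V)" "smooth_on (\<phi> ` V) (f \<circ> inv_into U \<phi>)"
    using smooth_near_chartE[OF f c] .
  let ?F = "f \<circ> inv_into U \<phi>"
  have eq: "cvec U \<phi> w p (\<lambda>q. cvec U \<phi> v q f) =
    frechet_derivative (\<lambda>x. frechet_derivative ?F (at x) v) (at (\<phi> p)) w" for v w
  proof -
    have "((\<lambda>q. cvec U \<phi> v q f) \<circ> inv_into U \<phi>) y = frechet_derivative ?F (at y) v" if y: "y \<in> \<phi> ` V" for y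
    proof -
      obtain q where q: "y = \<phi> q" "q \<in> V" using y by blast
      have "snear q f" using smooth_near_chartI[OF c(1) V(1,2) q(2) V(5)] .
      then show ?thesis using q V(2) inv_chart[OF c(1)] by (auto simp: cvec_def)
    qed
    then have "frechet_derivative ((\<lambda>q. cvec U \<phi> v q f) \<circ> inv_into U \<phi>) (at (\<phi> p))
      = frechet_derivative (\<lambda>x. frechet_derivative ?F (at x) v) (at (\<phi> p))"
      by (intro frechet_derivative_cong_open[OF V(4)]) (use V(3) in auto)
    then show ?thesis
      using cvec_smooth[OF f c, of v] by (subst cvec_def) simp
  qed
  show ?thesis
    unfolding eq using frechet_derivative_commute[OF V(4,5)] V(3) by blast
qed

lemma cvec_coord:
  assumes c: "(U, \<phi>) \<in> atlas M" "p \<in> U"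
  shows "cvec U \<phi> w p (\<lambda>q. \<phi> q \<bullet> b) = w \<bullet> b"
proof -
  have "frechet_derivative ((\<lambda>q. \<phi> q \<bullet> b) \<circ> inv_into U \<phi>) (at (\<phi> p))
      = frechet_derivative (\<lambda>x. x \<bullet> b) (at (\<phi> p))"
    by (rule frechet_derivative_cong_open[OF chart_open[OF c(1)]])
      (use c inv_chart[OF c(1)] in auto)
  also have "\<dots> = (\<lambda>x. x \<bullet> b)"
    by (rule frechet_derivative_at[symmetric])
      (simp add: bounded_linear_imp_has_derivative bounded_linear_inner_left)
  finally show ?thesis using snear_coord[OF c] by (simp add: cvec_def)
qed

lemma cvec_add:
  assumes c: "(U, \<phi>) \<in> atlas M" "p \<in> U"
  shows "cvec U \<phi> (v + w) p = cvec U \<phi> v p + cvec U \<phi> w p"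
  using linear_add[OF has_derivative_linear[OF snear_has_derivative[OF _ c]]]
  by (auto simp: cvec_def fun_eq_iff)

lemma cvec_scale:
  assumes c: "(U, \<phi>) \<in> atlas M" "p \<in> U"
  shows "cvec U \<phi> (k *\<^sub>R w) p = tscale k (cvec U \<phi> w p)"
  using linear_cmul[OF has_derivative_linear[OF snear_has_derivative[OF _ c]]]
  by (auto simp: cvec_def fun_eq_iff)

lemma cvec_zero:
  assumes c: "(U, \<phi>) \<in> atlas M" "p \<in> U"
  shows "cvec U \<phi> 0 p = 0"
  using cvec_scale[OF c, of 0 0] by (auto simp: fun_eq_iff)

lemma cvec_sum:
  assumes c: "(U, \<phi>) \<in> atlas M" "p \<in> U"
  shows "cvec U \<phi> (\<Sum>i\<in>I. w i) p = (\<Sum>i\<in>I. cvec U \<phi> (w i) p)"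
  by (induction I rule: infinite_finite_induct) (simp_all add: cvec_zero[OF c] cvec_add[OF c])

lemma cvec_expand:
  assumes c: "(U, \<phi>) \<in> atlas M" "p \<in> U"
  shows "cvec U \<phi> w p = (\<Sum>b\<in>Basis. tscale (w \<bullet> b) (cvec U \<phi> b p))"
proof -
  have "cvec U \<phi> w p = cvec U \<phi> (\<Sum>b\<in>Basis. (w \<bullet> b) *\<^sub>R b) p" by (simp add: euclidean_representation)
  also have "\<dots> = (\<Sum>b\<in>Basis. tscale (w \<bullet> b) (cvec U \<phi> b p))"
    unfolding cvec_sum[OF c] cvec_scale[OF c] ..
  finally show ?thesis .
qed

text \<open>The chain rule for the transition map: the components of a vector change by the
  derivative of the coordinate change.\<close>

lemma cvec_change:
  assumes c: "(U, \<phi>) \<in> atlas M" "p \<in> U" and d: "(V, \<psi>) \<in> atlas M" "p \<in> V"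
  shows "cvec V \<psi> w p = cvec U \<phi> (frechet_derivative (\<phi> \<circ> inv_into V \<psi>) (at (\<psi> p)) w) p"
proof
  fix f
  let ?t = "\<phi> \<circ> inv_into V \<psi>"
  show "cvec V \<psi> w p f = cvec U \<phi> (frechet_derivative ?t (at (\<psi> p)) w) p f"
  proof (cases "snear p f")
    case True
    have o: "open (\<psi> ` (V \<inter> U))"
      using chart_open_image[OF d(1) chart_opn[OF c(1)]] by (simp add: Int_commute)
    have t: "(?t has_derivative frechet_derivative ?t (at (\<psi> p))) (at (\<psi> p))"
      using smooth_on_has_derivative[OF chart_transition[OF d(1) c(1)]] c(2) d(2) by blast
    have tp: "?t (\<psi> p) = \<phi> p" using inv_chart[OF d] by simp
    have "((f \<circ> inv_into U \<phi>) \<circ> ?t has_derivative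
      frechet_derivative (f \<circ> inv_into U \<phi>) (at (\<phi> p)) \<circ> frechet_derivative ?t (at (\<psi> p))) (at (\<psi> p))"
      using diff_chain_at[OF t] snear_has_derivative[OF True c] tp by simp
    moreover have "frechet_derivative ((f \<circ> inv_into U \<phi>) \<circ> ?t) (at (\<psi> p)) =
        frechet_derivative (f \<circ> inv_into V \<psi>) (at (\<psi> p))"
      by (rule frechet_derivative_cong_open[OF o])
        (use c d inv_chart[OF c(1)] inv_chart[OF d(1)] in auto)
    ultimately have "frechet_derivative (f \<circ> inv_into V \<psi>) (at (\<psi> p)) =
      frechet_derivative (f \<circ> inv_into U \<phi>) (at (\<phi> p)) \<circ> frechet_derivative ?t (at (\<psi> p))"
      using frechet_derivative_at by metis
    then show ?thesis using True by (simp add: cvec_def)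
  qed (simp add: cvec_def)
qed

text \<open>The existential over charts in \<open>tangent_space\<close> collapses to any one chart
  at \<open>p\<close>. This is what makes the set closed under addition, since two vectors can now
  be written in the same chart.\<close>

lemma T_chart:
  assumes c: "(U, \<phi>) \<in> atlas M" "p \<in> U"
  shows "T p = range (\<lambda>w. cvec U \<phi> w p)"
proof -
  have "T p = {cvec V \<psi> w p | V \<psi> w. (V, \<psi>) \<in> atlas M \<and> p \<in> V}"
    unfolding tangent_space_def cvec_def by simp
  also have "\<dots> = range (\<lambda>w. cvec U \<phi> w p)"
  proof (intro equalityI subsetI)
    fix v assume "v \<in> {cvec V \<psi> w p | V \<psi> w. (V, \<psi>) \<in> atlas M \<and> p \<in> V}"
    then obtain V \<psi> w where "v = cvec V \<psi> w p" "(V, \<psi>) \<in> atlas M" "p \<in> V" by blast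
    then show "v \<in> range (\<lambda>w. cvec U \<phi> w p)" using cvec_change[OF c, of V \<psi> w] by simp
  qed (use c in blast)
  finally show ?thesis .
qed

lemma T_cvecE:
  assumes v: "v \<in> T p" and c: "(U, \<phi>) \<in> atlas M" "p \<in> U"
  obtains w where "v = cvec U \<phi> w p"
  using v unfolding T_chart[OF c] by (rule rangeE)

lemma T_topspace: "v \<in> T p \<Longrightarrow> p \<in> topspace (mtop M)"
  unfolding tangent_space_def using atlas_cover by auto

lemma cvec_in_T: "(U, \<phi>) \<in> atlas M \<Longrightarrow> p \<in> U \<Longrightarrow> cvec U \<phi> w p \<in> T p"
  using T_chart by simp

lemma T_expand:
  assumes v: "v \<in> T p" and c: "(U, \<phi>) \<in> atlas M" "p \<in> U"
  shows "v = (\<Sum>b\<in>Basis. tscale (v (\<lambda>q. \<phi> q \<bullet> b)) (cvec U \<phi> b p))"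
proof -
  obtain w where w: "v = cvec U \<phi> w p" by (rule T_cvecE[OF v c])
  show ?thesis unfolding w cvec_coord[OF c] by (rule cvec_expand[OF c])
qed

lemma T_eqI:
  assumes v: "v \<in> T p" and w: "w \<in> T p" and c: "(U, \<phi>) \<in> atlas M" "p \<in> U"
    and eq: "\<And>b. b \<in> Basis \<Longrightarrow> v (\<lambda>q. \<phi> q \<bullet> b) = w (\<lambda>q. \<phi> q \<bullet> b)"
  shows "v = w"
proof -
  have "v = (\<Sum>b\<in>Basis. tscale (v (\<lambda>q. \<phi> q \<bullet> b)) (cvec U \<phi> b p))"
    by (rule T_expand[OF v c])
  also have "\<dots> = (\<Sum>b\<in>Basis. tscale (w (\<lambda>q. \<phi> q \<bullet> b)) (cvec U \<phi> b p))"
    using eq by simp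
  also have "\<dots> = w" by (rule T_expand[OF w c, symmetric])
  finally show ?thesis .
qed

lemma T_add:
  assumes v: "v \<in> T p" and w: "w \<in> T p"
  shows "v + w \<in> T p"
proof -
  obtain U \<phi> where c: "(U, \<phi>) \<in> atlas M" "p \<in> U" using chart_at T_topspace[OF v] by metis
  obtain x where x: "v = cvec U \<phi> x p" by (rule T_cvecE[OF v c])
  obtain y where y: "w = cvec U \<phi> y p" by (rule T_cvecE[OF w c])
  show ?thesis unfolding x y using cvec_in_T[OF c, of "x + y"] unfolding cvec_add[OF c] .
qed

lemma T_scale:
  assumes v: "v \<in> T p"
  shows "tscale k v \<in> T p"
proof -
  obtain U \<phi> where c: "(U, \<phi>) \<in> atlas M" "p \<in> U" using chart_at T_topspace[OF v] by metis
  obtain x where x: "v = cvec U \<phi> x p" by (rule T_cvecE[OF v c])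
  show ?thesis unfolding x using cvec_in_T[OF c, of "k *\<^sub>R x"] unfolding cvec_scale[OF c] .
qed

lemma T_uminus: "v \<in> T p \<Longrightarrow> - v \<in> T p"
proof -
  assume "v \<in> T p"
  moreover have "- v = tscale (-1) v" by (simp add: fun_eq_iff)
  ultimately show ?thesis using T_scale by metis
qed

lemma T_diff: "v \<in> T p \<Longrightarrow> w \<in> T p \<Longrightarrow> v - w \<in> T p"
  using T_add[of v p "- w"] T_uminus[of w p] by simp

lemma T_zero: "p \<in> topspace (mtop M) \<Longrightarrow> 0 \<in> T p"
  using chart_at cvec_zero cvec_in_T by metis

lemma T_sum: "p \<in> topspace (mtop M) \<Longrightarrow> (\<And>i. i \<in> I \<Longrightarrow> v i \<in> T p) \<Longrightarrow> (\<Sum>i\<in>I. v i) \<in> T p"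
  by (induction I rule: infinite_finite_induct) (auto intro: T_add T_zero)

lemma T_not_smooth: "v \<in> T p \<Longrightarrow> \<not> snear p f \<Longrightarrow> v f = 0"
  unfolding tangent_space_def by auto

text \<open>Tangent vectors see only germs. This includes functions that are not smooth near
  \<open>p\<close>: being smooth is itself local, and otherwise both values are the default
  0.\<close>

lemma T_cong:
  assumes v: "v \<in> T p" and W: "opn W" "p \<in> W" "\<And>q. q \<in> W \<Longrightarrow> f q = g q"
  shows "v f = v g"
proof -
  obtain U \<phi> where c: "(U, \<phi>) \<in> atlas M" "p \<in> U" using chart_at T_topspace[OF v] by metis
  obtain w where w: "v = cvec U \<phi> w p" by (rule T_cvecE[OF v c])
  have "frechet_derivative (f \<circ> inv_into U \<phi>) (at (\<phi> p)) = frechet_derivative (g \<circ> inv_into U \<phi>) (at (\<phi> p))"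
    by (rule frechet_derivative_cong_open[OF chart_open_image[OF c(1) W(1)]])
      (use c W inv_chart[OF c(1)] in auto)
  moreover have "snear p f \<longleftrightarrow> snear p g"
    using snear_cong[of p f W g] snear_cong[of p g W f] W by metis
  ultimately show ?thesis by (simp add: w cvec_def)
qed

section \<open>Tangent vectors as derivations\<close>

lemma T_deriv_add:
  assumes v: "v \<in> T p" and f: "snear p f" and g: "snear p g"
  shows "v (\<lambda>q. f q + g q) = v f + v g"
proof -
  obtain U \<phi> where c: "(U, \<phi>) \<in> atlas M" "p \<in> U" using chart_at T_topspace[OF v] by metis
  obtain w where w: "v = cvec U \<phi> w p" by (rule T_cvecE[OF v c])
  have "((\<lambda>q. f q + g q) \<circ> inv_into U \<phi> has_derivative
     (\<lambda>w. frechet_derivative (f \<circ> inv_into U \<phi>) (at (\<phi> p)) w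
        + frechet_derivative (g \<circ> inv_into U \<phi>) (at (\<phi> p)) w)) (at (\<phi> p))"
    using has_derivative_add[OF snear_has_derivative[OF f c] snear_has_derivative[OF g c]]
    by (simp add: o_def)
  from frechet_derivative_at[OF this, symmetric] show ?thesis
    using f g snear_add[OF f g] by (simp add: w cvec_def)
qed

lemma T_deriv_mult:
  assumes v: "v \<in> T p" and f: "snear p f" and g: "snear p g"
  shows "v (\<lambda>q. f q * g q) = f p * v g + v f * g p"
proof -
  obtain U \<phi> where c: "(U, \<phi>) \<in> atlas M" "p \<in> U" using chart_at T_topspace[OF v] by metis
  obtain w where w: "v = cvec U \<phi> w p" by (rule T_cvecE[OF v c])
  have "((\<lambda>q. f q * g q) \<circ> inv_into U \<phi> has_derivative
     (\<lambda>w. f p * frechet_derivative (g \<circ> inv_into U \<phi>) (at (\<phi> p)) w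
        + frechet_derivative (f \<circ> inv_into U \<phi>) (at (\<phi> p)) w * g p)) (at (\<phi> p))"
    using has_derivative_mult[OF snear_has_derivative[OF f c] snear_has_derivative[OF g c]] inv_chart[OF c]
    by (simp add: o_def)
  from frechet_derivative_at[OF this, symmetric] show ?thesis
    using f g snear_mult[OF f g] by (simp add: w cvec_def)
qed

lemma T_deriv_const: "v \<in> T p \<Longrightarrow> v (\<lambda>q. k) = 0"
proof -
  assume v: "v \<in> T p"
  obtain U \<phi> where c: "(U, \<phi>) \<in> atlas M" "p \<in> U" using chart_at T_topspace[OF v] by metis
  obtain w where w: "v = cvec U \<phi> w p" by (rule T_cvecE[OF v c])
  show ?thesis unfolding w cvec_def by (simp add: o_def)
qed

lemma T_deriv_cmult: "v \<in> T p \<Longrightarrow> snear p f \<Longrightarrow> v (\<lambda>q. k * f q) = k * v f"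
  using T_deriv_mult[of v p "\<lambda>q. k" f] T_deriv_const[of v p k] snear_const[of p k] T_topspace by simp

lemma T_deriv_uminus: "v \<in> T p \<Longrightarrow> snear p f \<Longrightarrow> v (\<lambda>q. - f q) = - v f"
  using T_deriv_cmult[of v p f "-1"] by simp

lemma T_deriv_diff: "v \<in> T p \<Longrightarrow> snear p f \<Longrightarrow> snear p g \<Longrightarrow> v (\<lambda>q. f q - g q) = v f - v g"
  using T_deriv_add[of v p f "\<lambda>q. - g q"] T_deriv_uminus[of v p g] snear_uminus[of p g] by simp

lemma T_deriv_sum:
  assumes v: "v \<in> T p"
  shows "(\<And>i. i \<in> I \<Longrightarrow> snear p (f i)) \<Longrightarrow> v (\<lambda>q. \<Sum>i\<in>I. f i q) = (\<Sum>i\<in>I. v (f i))"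
proof (induction I rule: infinite_finite_induct)
  case (insert i I)
  then show ?case
    using T_deriv_add[OF v, of "f i" "\<lambda>q. \<Sum>i\<in>I. f i q"] snear_sum[OF T_topspace[OF v], of I f] by simp
qed (simp_all add: T_deriv_const[OF v])

end

section \<open>Vector fields and connections\<close>

context smooth_mfd
begin

lemma vfields_T: "X \<in> vfields M U \<Longrightarrow> p \<in> U \<Longrightarrow> X p \<in> T p"
  by (simp add: vfields_def)

lemma vfields_snear:
  assumes U: "opn U" and X: "X \<in> vfields M U" and p: "p \<in> U" and f: "snear p f"
  shows "snear p (\<lambda>q. X q f)"
proof -
  obtain V where V: "opn V" "p \<in> V" "smooth_fun M V f"
    using f unfolding smooth_near_def by blast
  have o: "opn (V \<inter> U)" using opn_Int[OF V(1) U] .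
  have "smooth_fun M (V \<inter> U) f"
    using V smooth_fun_iff[OF V(1)] smooth_fun_iff[OF o] by auto
  moreover have "\<forall>V f. opn V \<and> V \<subseteq> U \<and> smooth_fun M V f \<longrightarrow> smooth_fun M V (\<lambda>p. X p f)"
    using X by (simp add: vfields_def)
  ultimately have "smooth_fun M (V \<inter> U) (\<lambda>q. X q f)" using o by (meson Int_lower2)
  then show ?thesis using smooth_fun_iff[OF o] V p by auto
qed

lemma vfieldsI:
  assumes "opn U" "\<And>p. p \<in> U \<Longrightarrow> X p \<in> T p"
    "\<And>p f. p \<in> U \<Longrightarrow> snear p f \<Longrightarrow> snear p (\<lambda>q. X q f)"
  shows "X \<in> vfields M U"
  unfolding vfields_def
proof (intro CollectI conjI ballI allI impI)
  fix V f assume V: "opn V \<and> V \<subseteq> U \<and> smooth_fun M V f"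
  then show "smooth_fun M V (\<lambda>p. X p f)"
    using smooth_fun_iff[of V] assms(3) by blast
qed (use assms in auto)

lemma vfields_restrict: "X \<in> vfields M U \<Longrightarrow> V \<subseteq> U \<Longrightarrow> X \<in> vfields M V"
  unfolding vfields_def by blast

lemma vfields_local:
  assumes "opn U" "\<And>p. p \<in> U \<Longrightarrow> \<exists>W. opn W \<and> p \<in> W \<and> X \<in> vfields M W"
  shows "X \<in> vfields M U"
  by (rule vfieldsI[OF assms(1)]) (use assms(2) vfields_T vfields_snear in metis)+

lemma vfields_cong:
  assumes "opn U" "X \<in> vfields M U" "\<And>q. q \<in> U \<Longrightarrow> X q = Y q"
  shows "Y \<in> vfields M U"
proof (rule vfieldsI[OF assms(1)])
  show "Y p \<in> T p" if "p \<in> U" for p using assms that vfields_T by metis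
  show "snear p (\<lambda>q. Y q f)" if "p \<in> U" "snear p f" for p f
    by (rule snear_cong[OF vfields_snear[OF assms(1,2) that] assms(1) that(1)]) (simp add: assms(3))
qed

text \<open>A field is smooth as soon as its components are, since \<open>X f\<close> is the sum of
  components times coordinate derivatives of \<open>f\<close>.\<close>

lemma vfields_chartI:
  assumes "opn U" "\<And>p. p \<in> U \<Longrightarrow> X p \<in> T p"
    "\<And>p. p \<in> U \<Longrightarrow> \<exists>V \<phi>. (V, \<phi>) \<in> atlas M \<and> p \<in> V \<and> (\<forall>b\<in>Basis. snear p (\<lambda>q. X q (\<lambda>r. \<phi> r \<bullet> b)))"
  shows "X \<in> vfields M U"
proof (rule vfieldsI[OF assms(1,2)])
  fix p f assume p: "p \<in> U" and f: "snear p f"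
  obtain V \<phi> where c: "(V, \<phi>) \<in> atlas M" "p \<in> V" "\<forall>b\<in>Basis. snear p (\<lambda>q. X q (\<lambda>r. \<phi> r \<bullet> b))"
    using assms(3)[OF p] by blast
  have "snear p (\<lambda>q. \<Sum>b\<in>Basis. X q (\<lambda>r. \<phi> r \<bullet> b) * cvec V \<phi> b q f)"
    using c by (intro snear_sum snear_mult cvec_smooth[OF f c(1,2)] snear_topspace[OF f]) auto
  then show "snear p (\<lambda>q. X q f)"
  proof (rule snear_cong[OF _ opn_Int[OF assms(1) chart_opn[OF c(1)]]])
    fix q assume "q \<in> U \<inter> V"
    then have "X q f = (\<Sum>b\<in>Basis. tscale (X q (\<lambda>q. \<phi> q \<bullet> b)) (cvec V \<phi> b q)) f"
      using T_expand[OF assms(2) c(1), of q] by simp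
    then show "(\<Sum>b\<in>Basis. X q (\<lambda>r. \<phi> r \<bullet> b) * cvec V \<phi> b q f) = X q f"
      by (simp add: sum_fun_apply)
  qed (use p c in auto)
qed

lemma vfields_cvec: "(U, \<phi>) \<in> atlas M \<Longrightarrow> cvec U \<phi> w \<in> vfields M U"
  by (rule vfieldsI) (auto simp: chart_opn cvec_in_T cvec_smooth)

lemma vfields_add:
  assumes "opn U" "X \<in> vfields M U" "Y \<in> vfields M U" shows "X + Y \<in> vfields M U"
  by (rule vfieldsI[OF assms(1)])
    (use assms vfields_T vfields_snear in \<open>auto intro!: T_add snear_add\<close>)

lemma vfields_fscale:
  assumes "opn U" "X \<in> vfields M U" "\<And>p. p \<in> U \<Longrightarrow> snear p f" shows "fscale f X \<in> vfields M U"
  by (rule vfieldsI[OF assms(1)])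
    (use assms vfields_T vfields_snear in \<open>auto intro!: T_scale snear_mult\<close>)

lemma vfields_uminus:
  assumes "opn U" "X \<in> vfields M U" shows "- X \<in> vfields M U"
  by (rule vfieldsI[OF assms(1)])
    (use assms vfields_T vfields_snear in \<open>auto intro!: T_uminus snear_uminus\<close>)

lemma vfields_diff:
  assumes "opn U" "X \<in> vfields M U" "Y \<in> vfields M U" shows "X - Y \<in> vfields M U"
  using vfields_add[OF assms(1,2) vfields_uminus[OF assms(1,3)]] by simp

lemma vfields_zero: "opn U \<Longrightarrow> 0 \<in> vfields M U"
  by (rule vfieldsI) (auto intro: T_zero snear_const opn_topspace)

lemma vfields_sum:
  "opn U \<Longrightarrow> (\<And>i. i \<in> I \<Longrightarrow> X i \<in> vfields M U) \<Longrightarrow> (\<Sum>i\<in>I. X i) \<in> vfields M U"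
  by (induction I rule: infinite_finite_induct) (auto intro: vfields_add vfields_zero)

section \<open>Lie brackets\<close>

lemma lie_bracket_apply:
  "snear p f \<Longrightarrow> lie_bracket M X Y p f = X p (\<lambda>q. Y q f) - Y p (\<lambda>q. X q f)"
  by (simp add: lie_bracket_def)

lemma lie_bracket_swap: "lie_bracket M X Y p = - lie_bracket M Y X p"
  by (auto simp: lie_bracket_def fun_eq_iff)

lemma lie_bracket_cong:
  assumes W: "opn W" "p \<in> W" and eq: "\<And>q. q \<in> W \<Longrightarrow> X q = X' q" "\<And>q. q \<in> W \<Longrightarrow> Y q = Y' q"
    and T: "X p \<in> T p" "Y p \<in> T p"
  shows "lie_bracket M X Y p = lie_bracket M X' Y' p"
proof
  fix f
  have "X p (\<lambda>q. Y q f) = X' p (\<lambda>q. Y' q f)" "Y p (\<lambda>q. X q f) = Y' p (\<lambda>q. X' q f)"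
    using T_cong[OF T(1) W, of "\<lambda>q. Y q f" "\<lambda>q. Y' q f"]
      T_cong[OF T(2) W, of "\<lambda>q. X q f" "\<lambda>q. X' q f"] eq W by auto
  then show "lie_bracket M X Y p f = lie_bracket M X' Y' p f" by (simp add: lie_bracket_def)
qed

text \<open>Expanding both fields in coordinate fields, \<open>X (Y f)\<close> splits into
  first-order terms and a second-order sum. The latter is symmetric in \<open>X\<close> and
  \<open>Y\<close>, so the bracket is the coordinate combination with components
  \<open>X(y_b) - Y(x_b)\<close>.\<close>

lemma lie_bracket_T:
  assumes U: "opn U" and X: "X \<in> vfields M U" and Y: "Y \<in> vfields M U" and p: "p \<in> U"
  shows "lie_bracket M X Y p \<in> T p"
proof -
  obtain V \<phi> where c: "(V, \<phi>) \<in> atlas M" "p \<in> V" using chart_at opn_topspace[OF U p] by metis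
  define x where "x X b = (\<lambda>q. X q (\<lambda>r. \<phi> r \<bullet> b))" for X :: "'a vfield" and b
  have xs: "snear p (x X b)" if "X \<in> vfields M U" for X b
    unfolding x_def by (rule vfields_snear[OF U that p snear_coord[OF c]])
  have ex: "X q f = (\<Sum>b\<in>Basis. x X b q * cvec V \<phi> b q f)" if "X \<in> vfields M U" "q \<in> U \<inter> V" for X q f
  proof -
    have "X q f = (\<Sum>b\<in>Basis. tscale (X q (\<lambda>q. \<phi> q \<bullet> b)) (cvec V \<phi> b q)) f"
      using T_expand[OF vfields_T[OF that(1)] c(1), of q] that(2) by simp
    then show ?thesis by (simp add: sum_fun_apply x_def)
  qed
  have XY: "X p (\<lambda>q. Y q f) = (\<Sum>b\<in>Basis. X p (x Y b) * cvec V \<phi> b p f) +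
      (\<Sum>b\<in>Basis. \<Sum>d\<in>Basis. x Y b p * x X d p * cvec V \<phi> d p (\<lambda>q. cvec V \<phi> b q f))"
    if X: "X \<in> vfields M U" and Y: "Y \<in> vfields M U" and f: "snear p f" for X Y f
  proof -
    have "X p (\<lambda>q. Y q f) = X p (\<lambda>q. \<Sum>b\<in>Basis. x Y b q * cvec V \<phi> b q f)"
      by (rule T_cong[OF vfields_T[OF X p] opn_Int[OF U chart_opn[OF c(1)]]]) (use p c ex[OF Y] in auto)
    also have "\<dots> = (\<Sum>b\<in>Basis. X p (\<lambda>q. x Y b q * cvec V \<phi> b q f))"
      by (rule T_deriv_sum[OF vfields_T[OF X p]]) (intro snear_mult xs[OF Y] cvec_smooth[OF f c])
    also have "\<dots> = (\<Sum>b\<in>Basis. x Y b p * X p (\<lambda>q. cvec V \<phi> b q f) + X p (x Y b) * cvec V \<phi> b p f)"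
      by (intro sum.cong refl T_deriv_mult[OF vfields_T[OF X p]] xs[OF Y] cvec_smooth[OF f c])
    also have "\<dots> = (\<Sum>b\<in>Basis. x Y b p * (\<Sum>d\<in>Basis. x X d p * cvec V \<phi> d p (\<lambda>q. cvec V \<phi> b q f))
       + X p (x Y b) * cvec V \<phi> b p f)"
      using ex[OF X, of p] p c by simp
    finally show ?thesis
      by (simp add: sum.distrib sum_distrib_left mult.assoc add.commute)
  qed
  have "lie_bracket M X Y p = (\<Sum>b\<in>Basis. tscale (X p (x Y b) - Y p (x X b)) (cvec V \<phi> b p))"
  proof
    fix f
    show "lie_bracket M X Y p f = (\<Sum>b\<in>Basis. tscale (X p (x Y b) - Y p (x X b)) (cvec V \<phi> b p)) f"
    proof (cases "snear p f")
      case True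
      \<comment> \<open>The symmetry of the second-order part: rename the indices and commute the
        coordinate fields.\<close>
      have "(\<Sum>b\<in>Basis. \<Sum>d\<in>Basis. x X b p * x Y d p * cvec V \<phi> d p (\<lambda>q. cvec V \<phi> b q f)) =
        (\<Sum>d\<in>Basis. \<Sum>b\<in>Basis. x X b p * x Y d p * cvec V \<phi> d p (\<lambda>q. cvec V \<phi> b q f))"
        by (rule sum.swap)
      also have "\<dots> = (\<Sum>d\<in>Basis. \<Sum>b\<in>Basis. x Y d p * x X b p * cvec V \<phi> b p (\<lambda>q. cvec V \<phi> d q f))"
        by (intro sum.cong refl) (simp add: cvec_commute[OF True c, of _ _] mult.commute)
      finally show ?thesis
        unfolding lie_bracket_apply[OF True] XY[OF X Y True] XY[OF Y X True]
        by (simp add: sum_fun_apply sum_subtractf left_diff_distrib)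
    next
      case False
      then show ?thesis by (simp add: lie_bracket_def cvec_def sum_fun_apply)
    qed
  qed
  also have "\<dots> \<in> T p"
    by (intro T_sum T_scale cvec_in_T[OF c] opn_topspace[OF U p])
  finally show ?thesis .
qed

lemma vfields_lie_bracket:
  assumes U: "opn U" and X: "X \<in> vfields M U" and Y: "Y \<in> vfields M U"
  shows "lie_bracket M X Y \<in> vfields M U"
proof (rule vfieldsI[OF U lie_bracket_T[OF assms]])
  fix p f assume p: "p \<in> U" and f: "snear p f"
  obtain V where V: "opn V" "p \<in> V" "smooth_fun M V f"
    using f unfolding smooth_near_def by blast
  have "snear p (\<lambda>q. X q (\<lambda>r. Y r f) - Y q (\<lambda>r. X r f))"
    by (rule snear_diff[OF vfields_snear[OF U X p vfields_snear[OF U Y p f]]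
          vfields_snear[OF U Y p vfields_snear[OF U X p f]]])
  then show "snear p (\<lambda>q. lie_bracket M X Y q f)"
    by (rule snear_cong[OF _ V(1,2)]) (use V smooth_fun_iff[OF V(1)] in \<open>simp add: lie_bracket_def\<close>)
qed

lemma lie_bracket_fscale_left:
  assumes U: "opn U" and X: "X \<in> vfields M U" and Y: "Y \<in> vfields M U" and p: "p \<in> U" and f: "snear p f"
  shows "lie_bracket M (fscale f X) Y p = tscale (f p) (lie_bracket M X Y p) - tscale (Y p f) (X p)"
proof
  fix h
  show "lie_bracket M (fscale f X) Y p h = (tscale (f p) (lie_bracket M X Y p) - tscale (Y p f) (X p)) h"
  proof (cases "snear p h")
    case True
    then show ?thesis
      using T_deriv_mult[OF vfields_T[OF Y p] f vfields_snear[OF U X p True]]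
      by (simp add: lie_bracket_apply algebra_simps)
  next
    case False
    then show ?thesis using T_not_smooth[OF vfields_T[OF X p]] by (simp add: lie_bracket_def)
  qed
qed

lemma lie_bracket_add_left:
  assumes U: "opn U" and X: "X \<in> vfields M U" "X' \<in> vfields M U" and Y: "Y \<in> vfields M U" and p: "p \<in> U"
  shows "lie_bracket M (X + X') Y p = lie_bracket M X Y p + lie_bracket M X' Y p"
proof
  fix h
  show "lie_bracket M (X + X') Y p h = (lie_bracket M X Y p + lie_bracket M X' Y p) h"
  proof (cases "snear p h")
    case True
    then show ?thesis
      using T_deriv_add[OF vfields_T[OF Y p] vfields_snear[OF U X(1) p True] vfields_snear[OF U X(2) p True]]
      by (simp add: lie_bracket_apply)
  qed (simp add: lie_bracket_def)
qed

lemma lie_bracket_uminus_left: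
  assumes U: "opn U" and X: "X \<in> vfields M U" and Y: "Y \<in> vfields M U" and p: "p \<in> U"
  shows "lie_bracket M (- X) Y p = - lie_bracket M X Y p"
proof
  fix h
  show "lie_bracket M (- X) Y p h = (- lie_bracket M X Y p) h"
  proof (cases "snear p h")
    case True
    then show ?thesis
      using T_deriv_uminus[OF vfields_T[OF Y p] vfields_snear[OF U X(1) p True]]
      by (simp add: lie_bracket_apply)
  qed (simp add: lie_bracket_def)
qed

end

section \<open>Connections and their curvature\<close>

locale conn_mfd = smooth_mfd +
  fixes nab :: "'a vfield \<Rightarrow> 'a vfield \<Rightarrow> 'a vfield"
  assumes connection: "connection M nab"
begin

context
  fixes U assumes U: "opn U"
begin

lemma nab_vfields: "X \<in> vfields M U \<Longrightarrow> Y \<in> vfields M U \<Longrightarrow> nab X Y \<in> vfields M U"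
  and nab_cong: "X \<in> vfields M U \<Longrightarrow> X' \<in> vfields M U \<Longrightarrow> Y \<in> vfields M U \<Longrightarrow> Y' \<in> vfields M U \<Longrightarrow>
    (\<And>q. q \<in> U \<Longrightarrow> X q = X' q) \<Longrightarrow> (\<And>q. q \<in> U \<Longrightarrow> Y q = Y' q) \<Longrightarrow> p \<in> U \<Longrightarrow> nab X Y p = nab X' Y' p"
  and nab_add_left: "X \<in> vfields M U \<Longrightarrow> X' \<in> vfields M U \<Longrightarrow> Y \<in> vfields M U \<Longrightarrow> p \<in> U \<Longrightarrow>
    nab (X + X') Y p = nab X Y p + nab X' Y p"
  and nab_add_right: "X \<in> vfields M U \<Longrightarrow> Y \<in> vfields M U \<Longrightarrow> Y' \<in> vfields M U \<Longrightarrow> p \<in> U \<Longrightarrow>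
    nab X (Y + Y') p = nab X Y p + nab X Y' p"
proof -
  note * = mp[OF spec[OF connection[unfolded connection_def], of U] U]
  show "X \<in> vfields M U \<Longrightarrow> Y \<in> vfields M U \<Longrightarrow> nab X Y \<in> vfields M U"
    using *[THEN conjunct1] by blast
  show "X \<in> vfields M U \<Longrightarrow> X' \<in> vfields M U \<Longrightarrow> Y \<in> vfields M U \<Longrightarrow> Y' \<in> vfields M U \<Longrightarrow>
    (\<And>q. q \<in> U \<Longrightarrow> X q = X' q) \<Longrightarrow> (\<And>q. q \<in> U \<Longrightarrow> Y q = Y' q) \<Longrightarrow> p \<in> U \<Longrightarrow> nab X Y p = nab X' Y' p"
    using *[THEN conjunct2, THEN conjunct1] by blast
  show "X \<in> vfields M U \<Longrightarrow> X' \<in> vfields M U \<Longrightarrow> Y \<in> vfields M U \<Longrightarrow> p \<in> U \<Longrightarrow>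
    nab (X + X') Y p = nab X Y p + nab X' Y p"
    using *[THEN conjunct2, THEN conjunct2, THEN conjunct1] by blast
  show "X \<in> vfields M U \<Longrightarrow> Y \<in> vfields M U \<Longrightarrow> Y' \<in> vfields M U \<Longrightarrow> p \<in> U \<Longrightarrow>
    nab X (Y + Y') p = nab X Y p + nab X Y' p"
    using *[THEN conjunct2, THEN conjunct2, THEN conjunct2, THEN conjunct2, THEN conjunct1] by blast
qed

lemma nab_fscale_left:
  assumes "X \<in> vfields M U" "Y \<in> vfields M U" "\<And>q. q \<in> U \<Longrightarrow> snear q f" "p \<in> U"
  shows "nab (fscale f X) Y p = tscale (f p) (nab X Y p)"
proof -
  have "smooth_fun M U f" using smooth_fun_iff[OF U] assms(3) by blast
  then show ?thesis
    using mp[OF spec[OF connection[unfolded connection_def], of U] U,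
        THEN conjunct2, THEN conjunct2, THEN conjunct2, THEN conjunct1] assms(1,2,4) by blast
qed

lemma nab_fscale_right:
  assumes "X \<in> vfields M U" "Y \<in> vfields M U" "\<And>q. q \<in> U \<Longrightarrow> snear q f" "p \<in> U"
  shows "nab X (fscale f Y) p = tscale (X p f) (Y p) + tscale (f p) (nab X Y p)"
proof -
  have "smooth_fun M U f" using smooth_fun_iff[OF U] assms(3) by blast
  then show ?thesis
    using mp[OF spec[OF connection[unfolded connection_def], of U] U,
        THEN conjunct2, THEN conjunct2, THEN conjunct2, THEN conjunct2, THEN conjunct2] assms(1,2,4) by blast
qed

lemma nab_T: "X \<in> vfields M U \<Longrightarrow> Y \<in> vfields M U \<Longrightarrow> p \<in> U \<Longrightarrow> nab X Y p \<in> T p"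
  using nab_vfields vfields_T by blast

lemma nab_zero_left:
  assumes "Y \<in> vfields M U" "p \<in> U" shows "nab 0 Y p = 0"
  using nab_add_left[OF vfields_zero[OF U] vfields_zero[OF U] assms] by simp

lemma nab_zero_right:
  assumes "Y \<in> vfields M U" "p \<in> U" shows "nab Y 0 p = 0"
  using nab_add_right[OF assms(1) vfields_zero[OF U] vfields_zero[OF U] assms(2)] by simp

text \<open>The expansion \<open>eq\<close> holds on \<open>U\<close> only, not as an equality of
  functions. The locality clause \<open>nab_cong\<close> replaces \<open>X\<close> by the literal
  sum of rescaled fields, on which linearity acts.\<close>

lemma nab_lincomb_left:
  assumes "\<And>i. i \<in> I \<Longrightarrow> E i \<in> vfields M U" "\<And>i q. i \<in> I \<Longrightarrow> q \<in> U \<Longrightarrow> snear q (f i)"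
    and Y: "Y \<in> vfields M U" and X: "X \<in> vfields M U" and p: "p \<in> U"
    and eq: "\<And>q. q \<in> U \<Longrightarrow> X q = (\<Sum>i\<in>I. tscale (f i q) (E i q))"
  shows "nab X Y p = (\<Sum>i\<in>I. tscale (f i p) (nab (E i) Y p))"
proof -
  have "(\<Sum>i\<in>I. fscale (f i) (E i)) \<in> vfields M U"
    using assms(1,2) by (intro vfields_sum[OF U] vfields_fscale[OF U]) auto
  then have "nab X Y p = nab (\<Sum>i\<in>I. fscale (f i) (E i)) Y p"
    by (intro nab_cong X Y p) (simp_all add: eq sum_fun_apply[where x="_ :: 'a"])
  also have "\<dots> = (\<Sum>i\<in>I. tscale (f i p) (nab (E i) Y p))"
    using assms(1,2)
  proof (induction I rule: infinite_finite_induct)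
    case (insert i I)
    have "nab (\<Sum>i\<in>insert i I. fscale (f i) (E i)) Y p = nab (fscale (f i) (E i) + (\<Sum>i\<in>I. fscale (f i) (E i))) Y p"
      by (simp only: sum.insert[OF insert.hyps])
    also have "\<dots> = nab (fscale (f i) (E i)) Y p + nab (\<Sum>i\<in>I. fscale (f i) (E i)) Y p"
      using insert.prems by (intro nab_add_left Y p vfields_sum[OF U] vfields_fscale[OF U]) auto
    also have "\<dots> = tscale (f i p) (nab (E i) Y p) + (\<Sum>i\<in>I. tscale (f i p) (nab (E i) Y p))"
      using insert.prems by (subst nab_fscale_left[OF _ Y _ p]) (auto intro!: insert.IH)
    finally show ?case by (simp only: sum.insert[OF insert.hyps])
  qed (use nab_zero_left[OF Y p] in simp_all)
  finally show ?thesis .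
qed

lemma nab_lincomb_right:
  assumes "\<And>i. i \<in> I \<Longrightarrow> E i \<in> vfields M U" "\<And>i q. i \<in> I \<Longrightarrow> q \<in> U \<Longrightarrow> snear q (f i)"
    and Y: "Y \<in> vfields M U" and X: "X \<in> vfields M U" and p: "p \<in> U"
    and eq: "\<And>q. q \<in> U \<Longrightarrow> Y q = (\<Sum>i\<in>I. tscale (f i q) (E i q))"
  shows "nab X Y p = (\<Sum>i\<in>I. tscale (X p (f i)) (E i p) + tscale (f i p) (nab X (E i) p))"
proof -
  have "(\<Sum>i\<in>I. fscale (f i) (E i)) \<in> vfields M U"
    using assms(1,2) by (intro vfields_sum[OF U] vfields_fscale[OF U]) auto
  then have "nab X Y p = nab X (\<Sum>i\<in>I. fscale (f i) (E i)) p"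
    by (intro nab_cong X Y p) (simp_all add: eq sum_fun_apply[where x="_ :: 'a"])
  also have "\<dots> = (\<Sum>i\<in>I. tscale (X p (f i)) (E i p) + tscale (f i p) (nab X (E i) p))"
    using assms(1,2)
  proof (induction I rule: infinite_finite_induct)
    case (insert i I)
    have "nab X (\<Sum>i\<in>insert i I. fscale (f i) (E i)) p = nab X (fscale (f i) (E i) + (\<Sum>i\<in>I. fscale (f i) (E i))) p"
      by (simp only: sum.insert[OF insert.hyps])
    also have "\<dots> = nab X (fscale (f i) (E i)) p + nab X (\<Sum>i\<in>I. fscale (f i) (E i)) p"
      using insert.prems by (intro nab_add_right X p vfields_sum[OF U] vfields_fscale[OF U]) auto
    also have "\<dots> = (tscale (X p (f i)) (E i p) + tscale (f i p) (nab X (E i) p)) +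
       (\<Sum>i\<in>I. tscale (X p (f i)) (E i p) + tscale (f i p) (nab X (E i) p))"
      using insert.prems by (subst nab_fscale_right[OF X _ _ p]) (auto intro!: insert.IH)
    finally show ?case by (simp only: sum.insert[OF insert.hyps])
  qed (use nab_zero_right[OF X p] in simp_all)
  finally show ?thesis .
qed

lemma nab_uminus_right:
  assumes X: "X \<in> vfields M U" and Y: "Y \<in> vfields M U" and p: "p \<in> U"
  shows "nab X (- Y) p = - nab X Y p"
proof -
  have "nab X (- Y) p + nab X Y p = nab X (- Y + Y) p"
    by (rule nab_add_right[symmetric]) (auto intro: vfields_uminus[OF U] assms)
  also have "\<dots> = 0" using nab_zero_right[OF X p] by simp
  finally show ?thesis by (simp add: eq_neg_iff_add_eq_0)
qed

lemma nab_diff_right: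
  assumes X: "X \<in> vfields M U" and Y: "Y \<in> vfields M U" and Y': "Y' \<in> vfields M U" and p: "p \<in> U"
  shows "nab X (Y - Y') p = nab X Y p - nab X Y' p"
  using nab_add_right[OF X Y vfields_uminus[OF U Y'] p] nab_uminus_right[OF X Y' p] by simp

end

text \<open>On a chart both fields are combinations of the same coordinate fields, and at
  \<open>p\<close> the coefficients depend only on the common value there.\<close>

lemma nab_tensor_left:
  assumes U: "opn U" and X: "X \<in> vfields M U" and X': "X' \<in> vfields M U"
    and Y: "Y \<in> vfields M U" and p: "p \<in> U" and eq: "X p = X' p"
  shows "nab X Y p = nab X' Y p"
proof -
  obtain V \<phi> where c: "(V, \<phi>) \<in> atlas M" "p \<in> V" using chart_at opn_topspace[OF U p] by metis
  have o: "opn (U \<inter> V)" using opn_Int[OF U chart_opn[OF c(1)]] .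
  have ex: "nab X Y p = (\<Sum>b\<in>Basis. tscale (X p (\<lambda>q. \<phi> q \<bullet> b)) (nab (cvec V \<phi> b) Y p))"
    if X: "X \<in> vfields M U" for X
  proof (rule nab_lincomb_left[OF o])
    show "cvec V \<phi> b \<in> vfields M (U \<inter> V)" for b
      by (rule vfields_restrict[OF vfields_cvec[OF c(1)]]) auto
    show "snear q (\<lambda>q. X q (\<lambda>r. \<phi> r \<bullet> b))" if "q \<in> U \<inter> V" for q b
      using vfields_snear[OF U X _ snear_coord[OF c(1)]] that by auto
    show "X q = (\<Sum>b\<in>Basis. tscale (X q (\<lambda>r. \<phi> r \<bullet> b)) (cvec V \<phi> b q))" if "q \<in> U \<inter> V" for q
      using T_expand[OF vfields_T[OF X] c(1)] that by simp
  qed (use p c X Y vfields_restrict[of _ U "U \<inter> V"] in auto)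
  show ?thesis unfolding ex[OF X] ex[OF X'] eq ..
qed

lemma curvature_add:
  assumes U: "opn U" and X: "X \<in> vfields M U" and Y: "Y \<in> vfields M U" and p: "p \<in> U"
    and Z: "Z \<in> vfields M U" and Z': "Z' \<in> vfields M U"
  shows "curvature M nab X Y (Z + Z') p = curvature M nab X Y Z p + curvature M nab X Y Z' p"
proof -
  have vf: "nab X Z \<in> vfields M U" "nab X Z' \<in> vfields M U" "nab Y Z \<in> vfields M U" "nab Y Z' \<in> vfields M U"
    using nab_vfields[OF U] X Y Z Z' by auto
  have 1: "nab X (nab Y (Z + Z')) p = nab X (nab Y Z + nab Y Z') p"
    if X: "X \<in> vfields M U" and Y: "Y \<in> vfields M U" for X Y
    by (rule nab_cong[OF U])
      (use X Y Z Z' p nab_add_right[OF U] nab_vfields[OF U] vfields_add[OF U] in auto)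
  have 2: "nab (lie_bracket M X Y) (Z + Z') p = nab (lie_bracket M X Y) Z p + nab (lie_bracket M X Y) Z' p"
    by (rule nab_add_right[OF U vfields_lie_bracket[OF U X Y] Z Z' p])
  show ?thesis
    unfolding curvature_def
    using 2 1[OF X Y] 1[OF Y X] nab_add_right[OF U X vf(3,4) p] nab_add_right[OF U Y vf(1,2) p] by simp
qed

text \<open>In \<open>\<nabla>_X \<nabla>_Y (f Z)\<close> the terms with one derivative of
  \<open>f\<close> are symmetric in \<open>X\<close> and \<open>Y\<close> and cancel. The terms
  \<open>X(Y f) - Y(X f)\<close> cancel against the Leibniz term of
  \<open>\<nabla>_{[X,Y]} (f Z)\<close>.\<close>

lemma curvature_fscale:
  assumes U: "opn U" and X: "X \<in> vfields M U" and Y: "Y \<in> vfields M U" and p: "p \<in> U"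
    and Z: "Z \<in> vfields M U" and f: "\<And>q. q \<in> U \<Longrightarrow> snear q f"
  shows "curvature M nab X Y (fscale f Z) p = tscale (f p) (curvature M nab X Y Z p)"
proof -
  have 1: "nab X (nab Y (fscale f Z)) p = tscale (X p (\<lambda>q. Y q f)) (Z p) + tscale (Y p f) (nab X Z p)
      + (tscale (X p f) (nab Y Z p) + tscale (f p) (nab X (nab Y Z) p))"
    if X: "X \<in> vfields M U" and Y: "Y \<in> vfields M U" for X Y
  proof -
    have Yf: "\<And>q. q \<in> U \<Longrightarrow> snear q (\<lambda>q. Y q f)" using vfields_snear[OF U Y _ f] by auto
    have "nab X (nab Y (fscale f Z)) p = nab X (fscale (\<lambda>q. Y q f) Z + fscale f (nab Y Z)) p"
    proof (rule nab_cong[OF U X X _ _ refl _ p])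
      show "nab Y (fscale f Z) \<in> vfields M U"
        using nab_vfields[OF U Y] vfields_fscale[OF U Z] f by blast
      show "fscale (\<lambda>q. Y q f) Z + fscale f (nab Y Z) \<in> vfields M U"
        using vfields_add[OF U] vfields_fscale[OF U] Yf f Z nab_vfields[OF U Y Z] by blast
      show "nab Y (fscale f Z) q = (fscale (\<lambda>q. Y q f) Z + fscale f (nab Y Z)) q" if "q \<in> U" for q
        using nab_fscale_right[OF U Y Z f that] by simp
    qed
    also have "\<dots> = nab X (fscale (\<lambda>q. Y q f) Z) p + nab X (fscale f (nab Y Z)) p"
      by (rule nab_add_right[OF U X _ _ p])
        (use vfields_fscale[OF U] Yf f Z nab_vfields[OF U Y Z] in blast)+
    also have "nab X (fscale (\<lambda>q. Y q f) Z) p = tscale (X p (\<lambda>q. Y q f)) (Z p) + tscale (Y p f) (nab X Z p)"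
      by (rule nab_fscale_right[OF U X Z Yf p])
    also have "nab X (fscale f (nab Y Z)) p = tscale (X p f) (nab Y Z p) + tscale (f p) (nab X (nab Y Z) p)"
      by (rule nab_fscale_right[OF U X nab_vfields[OF U Y Z] f p])
    finally show ?thesis .
  qed
  have 2: "nab (lie_bracket M X Y) (fscale f Z) p = tscale (lie_bracket M X Y p f) (Z p)
      + tscale (f p) (nab (lie_bracket M X Y) Z p)"
    by (rule nab_fscale_right[OF U vfields_lie_bracket[OF U X Y] Z f p])
  show ?thesis
    by (rule ext) (simp add: curvature_def 1[OF X Y] 1[OF Y X] 2 lie_bracket_apply[OF f[OF p]] algebra_simps)
qed

lemma curvature_lincomb:
  assumes U: "opn U" and X: "X \<in> vfields M U" and Y: "Y \<in> vfields M U" and p: "p \<in> U"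
    and E: "\<And>i. i \<in> I \<Longrightarrow> E i \<in> vfields M U" and f: "\<And>i q. i \<in> I \<Longrightarrow> q \<in> U \<Longrightarrow> snear q (f i)"
    and Z: "Z \<in> vfields M U" and eq: "\<And>q. q \<in> U \<Longrightarrow> Z q = (\<Sum>i\<in>I. tscale (f i q) (E i q))"
  shows "curvature M nab X Y Z p = (\<Sum>i\<in>I. tscale (f i p) (curvature M nab X Y (E i) p))"
proof -
  have cong: "curvature M nab X Y Z p = curvature M nab X Y Z' p"
    if Z: "Z \<in> vfields M U" and Z': "Z' \<in> vfields M U" and eq: "\<And>q. q \<in> U \<Longrightarrow> Z q = Z' q" for Z Z'
  proof -
    have n: "nab A Z q = nab A Z' q" if "A \<in> vfields M U" "q \<in> U" for A q
      by (rule nab_cong[OF U]) (use that Z Z' eq in auto)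
    have "nab A (nab B Z) p = nab A (nab B Z') p" if "A \<in> vfields M U" "B \<in> vfields M U" for A B
      by (rule nab_cong[OF U]) (use that Z Z' n p nab_vfields[OF U] in auto)
    then show ?thesis
      unfolding curvature_def using X Y n[OF vfields_lie_bracket[OF U X Y] p] by simp
  qed
  have S: "(\<Sum>i\<in>I. fscale (f i) (E i)) \<in> vfields M U"
    using E f by (intro vfields_sum[OF U] vfields_fscale[OF U]) auto
  have zero: "curvature M nab X Y 0 p = 0"
    using curvature_add[OF U X Y p vfields_zero[OF U] vfields_zero[OF U]] by simp
  have "curvature M nab X Y Z p = curvature M nab X Y (\<Sum>i\<in>I. fscale (f i) (E i)) p"
    by (rule cong[OF Z S]) (simp add: eq sum_fun_apply[where x="_ :: 'a"])
  also have "\<dots> = (\<Sum>i\<in>I. tscale (f i p) (curvature M nab X Y (E i) p))"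
    using E f
  proof (induction I rule: infinite_finite_induct)
    case (insert i I)
    have "curvature M nab X Y (\<Sum>i\<in>insert i I. fscale (f i) (E i)) p =
        curvature M nab X Y (fscale (f i) (E i) + (\<Sum>i\<in>I. fscale (f i) (E i))) p"
      by (simp only: sum.insert[OF insert.hyps])
    also have "\<dots> = curvature M nab X Y (fscale (f i) (E i)) p + curvature M nab X Y (\<Sum>i\<in>I. fscale (f i) (E i)) p"
      using insert.prems by (intro curvature_add[OF U X Y p] vfields_sum[OF U] vfields_fscale[OF U]) auto
    also have "\<dots> = tscale (f i p) (curvature M nab X Y (E i) p) + (\<Sum>i\<in>I. tscale (f i p) (curvature M nab X Y (E i) p))"
      using insert.prems by (subst curvature_fscale[OF U X Y p]) (auto intro!: insert.IH)
    finally show ?case by (simp only: sum.insert[OF insert.hyps])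
  qed (use zero in simp_all)
  finally show ?thesis .
qed

end

section \<open>Riemannian metrics and orthonormal frames\<close>

context smooth_mfd
begin

text \<open>Needed because \<open>horizontal_space\<close> tests a section only against fields on
  the whole of its domain, whereas later fields live on smaller sets. A positive multiple of the
  value at \<open>p\<close> is enough, so the bump is not normalised.\<close>

lemma vfields_bump:
  assumes W: "opn W" and p: "p \<in> W" and Z: "Z \<in> vfields M W"
  obtains Z' k where "Z' \<in> vfields M (topspace (mtop M))" "k > 0" "Z' p = tscale k (Z p)"
proof -
  obtain U \<phi> where c: "(U, \<phi>) \<in> atlas M" "p \<in> U" using chart_at opn_topspace[OF W p] by metis
  obtain r where r: "r > 0" "cball (\<phi> p) r \<subseteq> \<phi> ` (W \<inter> U)"
    using open_contains_cball chart_open_image[OF c(1) W] p c(2) by (metis IntI imageI)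
  \<comment> \<open>The support of the bump. It is compact as the preimage of a closed ball under a
    chart and closed because the space is Hausdorff, so extension by 0 is smooth on its open
    complement.\<close>
  define K where "K = {q \<in> U. \<phi> q \<in> cball (\<phi> p) r}"
  have Usub: "U \<subseteq> topspace (mtop M)" using openin_subset[OF chart_opn[OF c(1)]] .
  have KW: "K \<subseteq> W"
  proof
    fix q assume q: "q \<in> K"
    then have "\<phi> q \<in> \<phi> ` (W \<inter> U)" using r(2) by (auto simp: K_def)
    then obtain q' where "q' \<in> W" "q' \<in> U" "\<phi> q = \<phi> q'" by blast
    then show "q \<in> W" using chart_inj[OF c(1)] q by (auto simp: K_def inj_on_def)
  qed
  have "\<phi> ` K = cball (\<phi> p) r" using r(2) by (auto simp: K_def)
  then have "compactin (top_of_set (\<phi> ` U)) (\<phi> ` K)"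
    using r(2) by (auto simp: compactin_subtopology)
  then have "compactin (subtopology (mtop M) U) K"
    using homeomorphic_map_compactness_eq[OF chart_homeo[OF c(1)]] Usub
    by (metis (no_types, lifting) K_def homeomorphic_map_compactness chart_homeo[OF c(1)] mem_Collect_eq
        subsetI topspace_subtopology_subset)
  then have "compactin (mtop M) K" by (simp add: compactin_subtopology)
  moreover have "Hausdorff_space (mtop M)"
    using smooth_manifold unfolding smooth_manifold_def by (elim conjE)
  ultimately have "closedin (mtop M) K" by (simp add: compactin_imp_closedin)
  then have Kc: "opn (topspace (mtop M) - K)" by blast
  define e where "e t = (if t > 0 then exp (- (1/t)) else 0)" for t :: real
  have e: "smooth_on UNIV e" unfolding e_def[abs_def] by (rule smooth_on_flat_exp)
  \<comment> \<open>The squared distance is polynomial in the coordinates, so composing with the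
    flat function is smooth; it is positive exactly inside the open ball of radius
    \<open>r\<close>.\<close>
  define h where "h q = (if q \<in> U then e (r\<^sup>2 - (\<phi> q - \<phi> p) \<bullet> (\<phi> q - \<phi> p)) else 0)" for q
  have h0: "h q = 0" if "q \<notin> K" for q
  proof (cases "q \<in> U")
    case True
    then have "r < norm (\<phi> q - \<phi> p)" using that by (simp add: K_def dist_norm norm_minus_commute)
    then have "r\<^sup>2 \<le> (\<phi> q - \<phi> p) \<bullet> (\<phi> q - \<phi> p)"
      using r(1) by (metis dot_square_norm less_eq_real_def power_mono)
    then show ?thesis by (simp add: h_def e_def)
  qed (simp add: h_def)
  have hU: "snear q h" if q: "q \<in> U" for q
  proof -
    have poly: "smooth_on UNIV (\<lambda>x. r\<^sup>2 + (- 1) * ((x + - \<phi> p) \<bullet> (x + - \<phi> p)))"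
      by (intro smooth_on_add smooth_on_mult smooth_on_inner smooth_on_ident smooth_on_const open_UNIV)
    have "smooth_on UNIV (\<lambda>x. e (r\<^sup>2 + (- 1) * ((x + - \<phi> p) \<bullet> (x + - \<phi> p))))"
      by (rule smooth_on_compose[OF open_UNIV open_UNIV _ e poly]) simp
    from snear_chart_comp[OF c(1) q this] show ?thesis
      by (rule snear_cong[OF _ chart_opn[OF c(1)] q]) (auto simp: h_def)
  qed
  have hs: "snear q h" if q: "q \<in> topspace (mtop M)" for q
  proof (cases "q \<in> U")
    case False
    then have "q \<in> topspace (mtop M) - K" using q by (auto simp: K_def)
    then show ?thesis
      using snear_cong[OF snear_const[OF q, of 0] Kc, of h] h0 by auto
  qed (rule hU)
  define Z' where "Z' q = (if q \<in> W then tscale (h q) (Z q) else 0)" for q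
  show ?thesis
  proof (rule that[of Z' "h p"])
    show "Z' \<in> vfields M (topspace (mtop M))"
    proof (rule vfields_local[OF openin_topspace])
      fix q assume q: "q \<in> topspace (mtop M)"
      show "\<exists>W'. opn W' \<and> q \<in> W' \<and> Z' \<in> vfields M W'"
      proof (cases "q \<in> W")
        case True
        have "fscale h Z \<in> vfields M W"
          by (rule vfields_fscale[OF W Z]) (use hs opn_topspace[OF W] in blast)
        then have "Z' \<in> vfields M W" by (rule vfields_cong[OF W]) (simp add: Z'_def)
        then show ?thesis using True W by blast
      next
        case False
        then have q': "q \<in> topspace (mtop M) - K" using q KW by auto
        have "Z' \<in> vfields M (topspace (mtop M) - K)"
          by (rule vfields_cong[OF Kc vfields_zero[OF Kc]]) (auto simp: Z'_def h0 fun_eq_iff)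
        then show ?thesis using Kc q' by blast
      qed
    qed
    show "h p > 0" using r(1) c(2) by (simp add: h_def e_def)
    show "Z' p = tscale (h p) (Z p)" using p by (simp add: Z'_def)
  qed
qed

end

section \<open>Metric algebra, orthonormal bases and frames\<close>

locale riem_mfd = smooth_mfd M for M :: "('a, 'e::euclidean_space) manifold" +
  fixes g :: "'a metric_field"
  assumes riemannian: "riemannian_metric M g"
begin

lemma g_props:
  assumes "u \<in> T p" "v \<in> T p" "w \<in> T p"
  shows "g p u v = g p v u \<and> g p (u + v) w = g p u w + g p v w \<and>
        g p (tscale c u) v = c * g p u v \<and> (u \<noteq> 0 \<longrightarrow> g p u u > 0)"
  using riemannian[unfolded riemannian_metric_def, THEN conjunct1] assms T_topspace[OF assms(1)] by blast

lemma g_sym: "u \<in> T p \<Longrightarrow> v \<in> T p \<Longrightarrow> g p u v = g p v u"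
  using g_props[of u p v v] by blast

lemma g_add_left: "u \<in> T p \<Longrightarrow> v \<in> T p \<Longrightarrow> w \<in> T p \<Longrightarrow> g p (u + v) w = g p u w + g p v w"
  using g_props[of u p v w] by blast

lemma g_scale_left: "u \<in> T p \<Longrightarrow> v \<in> T p \<Longrightarrow> g p (tscale c u) v = c * g p u v"
  using g_props[of u p v v] by blast

lemma g_pos: "u \<in> T p \<Longrightarrow> u \<noteq> 0 \<Longrightarrow> g p u u > 0"
  using g_props[of u p u u] by blast

lemma g_add_right: "u \<in> T p \<Longrightarrow> v \<in> T p \<Longrightarrow> w \<in> T p \<Longrightarrow> g p w (u + v) = g p w u + g p w v"
  using g_sym[of w p "u + v"] g_sym[of w p u] g_sym[of w p v] g_add_left[of u p v w] T_add[of u p v] by auto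

lemma g_scale_right: "u \<in> T p \<Longrightarrow> v \<in> T p \<Longrightarrow> g p u (tscale c v) = c * g p u v"
  using g_sym[of u p "tscale c v"] g_sym[of u p v] g_scale_left[of v p u] T_scale[of v p c] by auto

lemma g_zero_left: "v \<in> T p \<Longrightarrow> g p 0 v = 0"
  using g_add_left[of 0 p 0 v] T_zero[of p] T_topspace[of v p] by simp

lemma g_zero_right: "v \<in> T p \<Longrightarrow> g p v 0 = 0"
  using g_add_right[of 0 p 0 v] T_zero[of p] T_topspace[of v p] by simp

lemma g_uminus_left: "u \<in> T p \<Longrightarrow> v \<in> T p \<Longrightarrow> g p (- u) v = - g p u v"
  using g_add_left[of "- u" p u v] g_zero_left[of v p] T_uminus[of u p] by simp

lemma g_uminus_right: "u \<in> T p \<Longrightarrow> v \<in> T p \<Longrightarrow> g p u (- v) = - g p u v"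
  using g_add_right[of "- v" p v u] g_zero_right[of u p] T_uminus[of v p] by simp

lemma g_diff_left: "u \<in> T p \<Longrightarrow> v \<in> T p \<Longrightarrow> w \<in> T p \<Longrightarrow> g p (u - v) w = g p u w - g p v w"
  using g_add_left[of u p "- v" w] g_uminus_left[of v p w] T_uminus[of v p] by simp

lemma g_sum_left:
  assumes "v \<in> T p"
  shows "(\<And>i. i \<in> I \<Longrightarrow> u i \<in> T p) \<Longrightarrow> g p (\<Sum>i\<in>I. u i) v = (\<Sum>i\<in>I. g p (u i) v)"
proof (induction I rule: infinite_finite_induct)
  case (insert i I)
  have "g p (u i + (\<Sum>i\<in>I. u i)) v = g p (u i) v + g p (\<Sum>i\<in>I. u i) v"
    using insert.prems by (intro g_add_left T_sum T_topspace[OF assms] assms) auto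
  moreover have "g p (\<Sum>i\<in>I. u i) v = (\<Sum>i\<in>I. g p (u i) v)" using insert by blast
  ultimately show ?case by (simp only: sum.insert[OF insert.hyps])
qed (simp_all add: g_zero_left[OF assms])

lemma g_lincomb_left:
  assumes "v \<in> T p" "\<And>i. i \<in> I \<Longrightarrow> u i \<in> T p"
  shows "g p (\<Sum>i\<in>I. tscale (c i) (u i)) v = (\<Sum>i\<in>I. c i * g p (u i) v)"
  using assms by (subst g_sum_left) (auto intro: T_scale simp: g_scale_left)

lemma g_lincomb_right:
  assumes "v \<in> T p" "\<And>i. i \<in> I \<Longrightarrow> u i \<in> T p"
  shows "g p v (\<Sum>i\<in>I. tscale (c i) (u i)) = (\<Sum>i\<in>I. c i * g p v (u i))"
proof -
  have "g p v (\<Sum>i\<in>I. tscale (c i) (u i)) = g p (\<Sum>i\<in>I. tscale (c i) (u i)) v"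
    using assms by (intro g_sym T_sum T_scale T_topspace[OF assms(1)]) auto
  then show ?thesis
    using assms by (simp add: g_lincomb_left g_sym[of v p])
qed

lemma g_snear:
  assumes U: "opn U" and X: "X \<in> vfields M U" and Y: "Y \<in> vfields M U" and p: "p \<in> U"
  shows "snear p (\<lambda>q. g q (X q) (Y q))"
  using riemannian[unfolded riemannian_metric_def, THEN conjunct2] U X Y smooth_fun_iff[OF U] p by blast

text \<open>The index type is free, because frames of the tangent bundle will be indexed by a sum
  type while \<open>orthonormal_frame\<close> uses natural numbers. Completeness is built in as the
  expansion clause.\<close>

definition onb :: "'i set \<Rightarrow> 'a \<Rightarrow> ('i \<Rightarrow> 'a tvec) \<Rightarrow> bool" where
  "onb I p e \<longleftrightarrow> finite I \<and> (\<forall>i\<in>I. e i \<in> T p) \<and>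
     (\<forall>i\<in>I. \<forall>j\<in>I. g p (e i) (e j) = (if i = j then 1 else 0)) \<and>
     (\<forall>v\<in>T p. v = (\<Sum>i\<in>I. tscale (g p v (e i)) (e i)))"

lemma onb_expand: "onb I p e \<Longrightarrow> v \<in> T p \<Longrightarrow> v = (\<Sum>i\<in>I. tscale (g p v (e i)) (e i))"
  unfolding onb_def by blast

lemma orthonormal_coeff:
  assumes "finite I" "\<And>i. i \<in> I \<Longrightarrow> e i \<in> T p"
    "\<And>i j. i \<in> I \<Longrightarrow> j \<in> I \<Longrightarrow> g p (e i) (e j) = (if i = j then 1 else 0)" "j \<in> I"
  shows "g p (\<Sum>i\<in>I. tscale (c i) (e i)) (e j) = c j"
proof -
  have "g p (\<Sum>i\<in>I. tscale (c i) (e i)) (e j) = (\<Sum>i\<in>I. c i * g p (e i) (e j))"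
    using assms by (intro g_lincomb_left) auto
  also have "\<dots> = (\<Sum>i\<in>I. if i = j then c i else 0)"
    using assms by (intro sum.cong) auto
  finally show ?thesis using assms by (simp add: sum.delta)
qed

lemma onb_parseval:
  assumes e: "onb I p e" and u: "u \<in> T p" and v: "v \<in> T p"
  shows "g p u v = (\<Sum>i\<in>I. g p u (e i) * g p v (e i))"
proof -
  have eT: "e i \<in> T p" if "i \<in> I" for i using e that by (simp add: onb_def)
  have "g p u v = g p u (\<Sum>i\<in>I. tscale (g p v (e i)) (e i))" using onb_expand[OF e v] by simp
  also have "\<dots> = (\<Sum>i\<in>I. g p v (e i) * g p u (e i))" using eT by (intro g_lincomb_right u)
  finally show ?thesis by (simp add: mult.commute)
qed

text \<open>Parseval for \<open>e\<close> shows that the matrix of inner products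
  \<open><e_i, e'_j>\<close> has orthonormal columns. As \<open>B\<close> is an arbitrary matrix,
  this serves both the trace of \<gamma> and the Ricci form.\<close>

lemma onb_trace:
  assumes e: "onb I p e" and e': "onb J p e'"
  shows "(\<Sum>i\<in>I. \<Sum>j\<in>J. \<Sum>k\<in>J. g p (e i) (e' j) * g p (e i) (e' k) * B j k) = (\<Sum>j\<in>J. B j j)"
proof -
  have fin: "finite J" using e' by (simp add: onb_def)
  have eT: "e i \<in> T p" if "i \<in> I" for i using e that by (simp add: onb_def)
  have eT': "e' i \<in> T p" if "i \<in> J" for i using e' that by (simp add: onb_def)
  have "(\<Sum>i\<in>I. \<Sum>j\<in>J. \<Sum>k\<in>J. g p (e i) (e' j) * g p (e i) (e' k) * B j k)
    = (\<Sum>j\<in>J. \<Sum>k\<in>J. \<Sum>i\<in>I. g p (e i) (e' j) * g p (e i) (e' k) * B j k)"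
    by (subst sum.swap) (intro sum.cong refl sum.swap)
  also have "\<dots> = (\<Sum>j\<in>J. \<Sum>k\<in>J. (\<Sum>i\<in>I. g p (e' j) (e i) * g p (e' k) (e i)) * B j k)"
    unfolding sum_distrib_right
    by (intro sum.cong refl arg_cong2[where f="(*)"] g_sym) (use eT eT' in auto)
  also have "\<dots> = (\<Sum>j\<in>J. \<Sum>k\<in>J. g p (e' j) (e' k) * B j k)"
    using eT' by (intro sum.cong refl) (simp add: onb_parseval[OF e])
  also have "\<dots> = (\<Sum>j\<in>J. \<Sum>k\<in>J. if j = k then B j k else 0)"
    using e' by (intro sum.cong refl) (simp add: onb_def)
  finally show ?thesis using fin by (simp add: sum.delta)
qed

text \<open>Completeness is a dimension count in the model space: \<open>L\<close> sends basis
  vectors to the components of the \<open>E i\<close>, pairing with \<open>E j\<close> recovers the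
  coordinates of the argument, so \<open>L\<close> is injective and hence surjective.\<close>

lemma frame_onb:
  assumes E: "orthonormal_frame M g U E" and p: "p \<in> U"
  shows "onb {..<DIM('e)} p (\<lambda>i. E i p)"
proof -
  let ?n = "DIM('e)"
  have U: "opn U" and Ev: "\<And>i. i < ?n \<Longrightarrow> E i \<in> vfields M U"
    and on: "\<And>i j. i < ?n \<Longrightarrow> j < ?n \<Longrightarrow> g p (E i p) (E j p) = (if i = j then 1 else 0)"
    using E p by (auto simp: orthonormal_frame_def)
  have ET: "E i p \<in> T p" if "i < ?n" for i using vfields_T[OF Ev[OF that] p] .
  obtain V \<phi> where c: "(V, \<phi>) \<in> atlas M" "p \<in> V" using chart_at opn_topspace[OF U p] by metis
  have "\<forall>i\<in>{..<?n}. \<exists>w. E i p = cvec V \<phi> w p"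
    using T_cvecE[OF ET c] by (metis lessThan_iff)
  then obtain w where w: "\<And>i. i < ?n \<Longrightarrow> E i p = cvec V \<phi> (w i) p"
    using bchoice[of "{..<?n}" "\<lambda>i w. E i p = cvec V \<phi> w p"] by auto
  obtain b :: "nat \<Rightarrow> 'e" where b: "bij_betw b {..<?n} Basis"
    using ex_bij_betw_nat_finite[of "Basis :: 'e set"] by (auto simp: lessThan_atLeast0)
  define L where "L x = (\<Sum>i<?n. (x \<bullet> b i) *\<^sub>R w i)" for x
  have lin: "linear L"
    unfolding L_def by (intro linear_compose_sum ballI linearI) (auto simp: inner_add_left scaleR_left_distrib)
  have cL: "cvec V \<phi> (L x) p = (\<Sum>i<?n. tscale (x \<bullet> b i) (E i p))" for x
    unfolding L_def cvec_sum[OF c] cvec_scale[OF c] using w by simp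
  have co: "g p (cvec V \<phi> (L x) p) (E j p) = x \<bullet> b j" if "j < ?n" for x j
    unfolding cL using ET on that by (intro orthonormal_coeff) auto
  have "inj L"
  proof (subst linear_injective_0[OF lin], intro allI impI)
    fix x assume "L x = 0"
    then have "x \<bullet> b j = 0" if "j < ?n" for j
      using co[OF that, of x] cvec_zero[OF c] g_zero_left[OF ET[OF that]] by simp
    then have x0: "\<forall>j\<in>{..<?n}. x \<bullet> b j = 0" by simp
    show "x = 0"
    proof (rule euclidean_eqI)
      fix d :: 'e assume "d \<in> Basis"
      then obtain j where "j \<in> {..<?n}" "d = b j" using bij_betw_imp_surj_on[OF b] by blast
      then show "x \<bullet> d = 0 \<bullet> d" using x0 by simp
    qed
  qed
  then have surj: "surj L" using linear_injective_imp_surjective[OF lin] by blast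
  have "v = (\<Sum>i<?n. tscale (g p v (E i p)) (E i p))" if v: "v \<in> T p" for v
  proof -
    obtain y where y: "v = cvec V \<phi> y p" by (rule T_cvecE[OF v c])
    obtain x where "y = L x" using surj by auto
    then have vx: "v = cvec V \<phi> (L x) p" using y by simp
    show ?thesis unfolding vx using co[of _ x] cL[of x] by simp
  qed
  then show ?thesis unfolding onb_def using ET on by auto
qed

text \<open>The third clause keeps the first \<open>k\<close> fields inside the span of the first
  \<open>k\<close> coordinate fields. It is what guarantees that the next vector to be normalised is
  nonzero at every point of the chart.\<close>

lemma gram_schmidt:
  assumes c: "(U, \<phi>) \<in> atlas M" and b: "bij_betw b {..<DIM('e)} (Basis :: 'e set)"
  shows "k \<le> DIM('e) \<Longrightarrow> \<exists>E. (\<forall>i<k. E i \<in> vfields M U) \<and>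
    (\<forall>i<k. \<forall>j<k. \<forall>p\<in>U. g p (E i p) (E j p) = (if i = j then 1 else 0)) \<and>
    (\<forall>i<k. \<forall>l. k \<le> l \<longrightarrow> l < DIM('e) \<longrightarrow> (\<forall>p\<in>U. E i p (\<lambda>q. \<phi> q \<bullet> b l) = 0))"
proof (induction k)
  case 0
  show ?case by simp
next
  case (Suc k)
  obtain E where E': "\<forall>i<k. E i \<in> vfields M U"
    "\<forall>i<k. \<forall>j<k. \<forall>p\<in>U. g p (E i p) (E j p) = (if i = j then 1 else 0)"
    "\<forall>i<k. \<forall>l. k \<le> l \<longrightarrow> l < DIM('e) \<longrightarrow> (\<forall>p\<in>U. E i p (\<lambda>q. \<phi> q \<bullet> b l) = 0)"
    using Suc.IH[OF Suc_leD[OF Suc.prems]] by (elim exE conjE) (rule that)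
  then have E: "\<And>i. i < k \<Longrightarrow> E i \<in> vfields M U"
    "\<And>i j p. i < k \<Longrightarrow> j < k \<Longrightarrow> p \<in> U \<Longrightarrow> g p (E i p) (E j p) = (if i = j then 1 else 0)"
    "\<And>i l p. i < k \<Longrightarrow> k \<le> l \<Longrightarrow> l < DIM('e) \<Longrightarrow> p \<in> U \<Longrightarrow> E i p (\<lambda>q. \<phi> q \<bullet> b l) = 0"
    by blast+
  have U: "opn U" using chart_opn[OF c] .
  define C where "C = cvec U \<phi> (b k)"
  have C: "C \<in> vfields M U" unfolding C_def by (rule vfields_cvec[OF c])
  define W where "W = C - (\<Sum>j<k. fscale (\<lambda>q. g q (C q) (E j q)) (E j))"
  have S: "(\<Sum>j<k. fscale (\<lambda>q. g q (C q) (E j q)) (E j)) \<in> vfields M U"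
    using E(1) by (intro vfields_sum[OF U] vfields_fscale[OF U] g_snear[OF U C]) auto
  have W: "W \<in> vfields M U" unfolding W_def by (rule vfields_diff[OF U C S])
  have Wp: "W p = C p - (\<Sum>j<k. tscale (g p (C p) (E j p)) (E j p))" for p
    by (simp add: W_def sum_fun_apply[where x=p])
  have bl: "b k \<bullet> b l = (if k = l then 1 else 0)" if "l < DIM('e)" for l
  proof -
    have "b k \<in> Basis" "b l \<in> Basis" "b k = b l \<longleftrightarrow> k = l"
      using b that Suc.prems by (auto simp: bij_betw_def inj_on_def)
    then show ?thesis by (simp add: inner_Basis)
  qed
  \<comment> \<open>Only the coordinate field \<open>C\<close> contributes to the components from
    \<open>k\<close> on, so component \<open>k\<close> of \<open>W\<close> is 1 and \<open>W\<close>
    vanishes nowhere.\<close>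
  have Wc: "W p (\<lambda>q. \<phi> q \<bullet> b l) = (if k = l then 1 else 0)" if "p \<in> U" "k \<le> l" "l < DIM('e)" for p l
    using that E(3)[OF _ that(2,3,1)] bl[OF that(3)]
    by (simp add: Wp sum_fun_apply C_def cvec_coord[OF c that(1)])
  have WT: "W p \<in> T p" if "p \<in> U" for p using vfields_T[OF W that] .
  have Wpos: "g p (W p) (W p) > 0" if "p \<in> U" for p
  proof -
    have "W p \<noteq> 0"
    proof
      assume "W p = 0"
      then show False using Wc[OF that, of k] Suc.prems by simp
    qed
    then show ?thesis using g_pos WT[OF that] by blast
  qed
  have WE: "g p (W p) (E j p) = 0" if p: "p \<in> U" and j: "j < k" for p j
  proof -
    have ET: "E i p \<in> T p" if "i < k" for i using vfields_T[OF E(1)[OF that] p] .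
    have "(\<Sum>j<k. tscale (g p (C p) (E j p)) (E j p)) \<in> T p"
      using ET by (intro T_sum T_scale opn_topspace[OF U p]) auto
    then have "g p (W p) (E j p) = g p (C p) (E j p) - g p (\<Sum>j<k. tscale (g p (C p) (E j p)) (E j p)) (E j p)"
      unfolding Wp using ET[OF j] vfields_T[OF C p] by (intro g_diff_left)
    also have "g p (\<Sum>j<k. tscale (g p (C p) (E j p)) (E j p)) (E j p) = g p (C p) (E j p)"
      using ET E(2) p j by (intro orthonormal_coeff) auto
    finally show ?thesis by simp
  qed
  define s where "s q = inverse (sqrt (g q (W q) (W q)))" for q
  have ss: "snear p s" if "p \<in> U" for p
    unfolding s_def
    by (rule snear_compose[OF g_snear[OF U W W that] _ smooth_on_inverse_sqrt U that]) (use Wpos in auto)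
  define E' where "E' = E(k := fscale s W)"
  have E'k: "E' k p = tscale (s p) (W p)" for p by (simp add: E'_def)
  have E'i: "E' i = E i" if "i \<noteq> k" for i using that by (simp add: E'_def)
  have E'v: "E' i \<in> vfields M U" if "i < Suc k" for i
    using that E(1) vfields_fscale[OF U W ss] by (cases "i = k") (auto simp: E'_def)
  have E'on: "g p (E' i p) (E' j p) = (if i = j then 1 else 0)" if "i < Suc k" "j < Suc k" and p: "p \<in> U" for i j p
  proof -
    have kk: "g p (E' k p) (E' k p) = 1"
    proof -
      have "g p (E' k p) (E' k p) = s p * (s p * g p (W p) (W p))"
        unfolding E'k using WT[OF p] T_scale by (simp add: g_scale_left g_scale_right)
      also have "\<dots> = (s p * sqrt (g p (W p) (W p))) * (s p * sqrt (g p (W p) (W p)))"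
        using Wpos[OF p] by (simp add: algebra_simps)
      also have "\<dots> = 1" using Wpos[OF p] by (simp add: s_def)
      finally show ?thesis .
    qed
    have kj: "g p (E' k p) (E' j p) = 0" "g p (E' j p) (E' k p) = 0" if "j < k" for j
    proof -
      show "g p (E' k p) (E' j p) = 0"
        using that WT[OF p] vfields_T[OF E(1)[OF that] p] WE[OF p that] by (simp add: E'_def g_scale_left)
      then show "g p (E' j p) (E' k p) = 0"
        using g_sym[OF vfields_T[OF E'v p] vfields_T[OF E'v p]] that by (metis less_SucI lessI)
    qed
    show ?thesis
      using that kk kj E(2)[OF _ _ p] E'i by (cases "i = k"; cases "j = k") auto
  qed
  have E'0: "E' i p (\<lambda>q. \<phi> q \<bullet> b l) = 0" if "i < Suc k" "Suc k \<le> l" "l < DIM('e)" "p \<in> U" for i l p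
    using that E(3)[of i l p] Wc[of p l] by (cases "i = k") (auto simp: E'_def)
  show ?case
    using E'v E'on E'0 by (intro exI[of _ E']) blast
qed

lemma ex_orthonormal_frame:
  assumes "p \<in> topspace (mtop M)"
  obtains U E where "orthonormal_frame M g U E" "p \<in> U"
proof -
  obtain U \<phi> where c: "(U, \<phi>) \<in> atlas M" "p \<in> U" using chart_at assms by metis
  obtain b :: "nat \<Rightarrow> 'e" where b: "bij_betw b {..<DIM('e)} Basis"
    using ex_bij_betw_nat_finite[of "Basis :: 'e set"] by (auto simp: lessThan_atLeast0)
  obtain E where "\<forall>i<DIM('e). E i \<in> vfields M U"
    "\<forall>i<DIM('e). \<forall>j<DIM('e). \<forall>p\<in>U. g p (E i p) (E j p) = (if i = j then 1 else 0)"
    using gram_schmidt[OF c(1) b, of "DIM('e)"] by blast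
  then show ?thesis
    using that[of U E] c chart_opn[OF c(1)] by (simp add: orthonormal_frame_def)
qed

lemma orthonormal_frame_restrict:
  "orthonormal_frame M g U E \<Longrightarrow> opn V \<Longrightarrow> V \<subseteq> U \<Longrightarrow> orthonormal_frame M g V E"
  unfolding orthonormal_frame_def using vfields_restrict by blast

end

lemma sum_skew_sym_eq_0:
  fixes a b :: "'i \<Rightarrow> 'i \<Rightarrow> real"
  assumes "\<And>i j. i \<in> I \<Longrightarrow> j \<in> I \<Longrightarrow> a i j = - a j i" "\<And>i j. i \<in> I \<Longrightarrow> j \<in> I \<Longrightarrow> b i j = b j i"
  shows "(\<Sum>i\<in>I. \<Sum>j\<in>I. a i j * b i j) = 0"
proof -
  have "(\<Sum>i\<in>I. \<Sum>j\<in>I. a i j * b i j) = (\<Sum>j\<in>I. \<Sum>i\<in>I. a i j * b i j)" by (rule sum.swap)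
  also have "\<dots> = (\<Sum>i\<in>I. \<Sum>j\<in>I. - (a i j * b i j))"
  proof (intro sum.cong refl)
    fix i j assume "i \<in> I" "j \<in> I"
    then show "a j i * b j i = - (a i j * b i j)" using assms(1)[of j i] assms(2)[of j i] by simp
  qed
  also have "\<dots> = - (\<Sum>i\<in>I. \<Sum>j\<in>I. a i j * b i j)" by (simp add: sum_negf)
  finally show ?thesis by simp
qed

section \<open>Affine-Riemann manifolds\<close>

text \<open>\<open>D\<close> enters as a second copy of \<open>conn_mfd\<close>, which makes every
  rule for connections available under the prefix \<open>lc\<close>.\<close>

locale affine_riem = riem_mfd M g + conn_mfd M nab + lc: conn_mfd M D
  for M :: "('a, 'e::euclidean_space) manifold" and g nab D +
  assumes tors: "torsion_free M nab" and flat: "flat M nab" and lc: "levi_civita M g D"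
begin

abbreviation gam :: "'a vfield \<Rightarrow> 'a vfield \<Rightarrow> 'a vfield" where "gam \<equiv> difference_tensor D nab"

lemma torsion:
  assumes "opn U" "X \<in> vfields M U" "Y \<in> vfields M U" "p \<in> U"
  shows "nab X Y p - nab Y X p = lie_bracket M X Y p" "D X Y p - D Y X p = lie_bracket M X Y p"
proof -
  show "nab X Y p - nab Y X p = lie_bracket M X Y p"
    using tors assms unfolding torsion_free_def by blast
  have "torsion_free M D" using lc unfolding levi_civita_def by (elim conjE)
  then show "D X Y p - D Y X p = lie_bracket M X Y p"
    using assms unfolding torsion_free_def by blast
qed

lemma D_metric:
  assumes "opn U" "X \<in> vfields M U" "Y \<in> vfields M U" "Z \<in> vfields M U" "p \<in> U"
  shows "X p (\<lambda>q. g q (Y q) (Z q)) = g p (D X Y p) (Z p) + g p (Y p) (D X Z p)"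
  using lc[unfolded levi_civita_def, THEN conjunct2, THEN conjunct2] assms by blast

lemma gam_apply: "gam X Y p = D X Y p - nab X Y p"
  by (simp add: difference_tensor_def)

lemma gam_vfields: "opn U \<Longrightarrow> X \<in> vfields M U \<Longrightarrow> Y \<in> vfields M U \<Longrightarrow> gam X Y \<in> vfields M U"
  unfolding difference_tensor_def by (intro vfields_diff nab_vfields lc.nab_vfields)

lemma gam_sym:
  assumes "opn U" "X \<in> vfields M U" "Y \<in> vfields M U" "p \<in> U"
  shows "gam X Y p = gam Y X p"
  using torsion[OF assms] unfolding gam_apply by (simp add: algebra_simps)

text \<open>Together with \<open>gam_sym\<close> this gives linearity over functions in both
  arguments, without meeting the Leibniz terms of \<open>D\<close> and \<open>nab\<close> in their
  second argument.\<close>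

lemma gam_lincomb_left:
  assumes U: "opn U" and E: "\<And>i. i \<in> I \<Longrightarrow> E i \<in> vfields M U"
    and f: "\<And>i q. i \<in> I \<Longrightarrow> q \<in> U \<Longrightarrow> snear q (f i)"
    and Y: "Y \<in> vfields M U" and X: "X \<in> vfields M U" and p: "p \<in> U"
    and eq: "\<And>q. q \<in> U \<Longrightarrow> X q = (\<Sum>i\<in>I. tscale (f i q) (E i q))"
  shows "gam X Y p = (\<Sum>i\<in>I. tscale (f i p) (gam (E i) Y p))"
proof -
  have 1: "nab X Y p = (\<Sum>i\<in>I. tscale (f i p) (nab (E i) Y p))"
    by (rule nab_lincomb_left[OF U E f Y X p eq])
  have 2: "D X Y p = (\<Sum>i\<in>I. tscale (f i p) (D (E i) Y p))"
    by (rule lc.nab_lincomb_left[OF U E f Y X p eq])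
  show ?thesis
    by (rule ext) (simp add: gam_apply 1 2 sum_fun_apply right_diff_distrib sum_subtractf)
qed

lemma frame_expand_field:
  assumes E: "orthonormal_frame M g U E" and X: "X \<in> vfields M U" and q: "q \<in> U"
  shows "X q = (\<Sum>i<DIM('e). tscale (g q (X q) (E i q)) (E i q))"
  by (rule onb_expand[OF frame_onb[OF E q] vfields_T[OF X q]])

text \<open>Two local frames differ by an orthogonal matrix of functions. Expanding
  \<open>E'\<close> in \<open>E\<close>, once in each slot with symmetry exchanging the slots,
  reduces the independence of the frame to \<open>onb_trace\<close>.\<close>

lemma trace_gam:
  assumes E: "orthonormal_frame M g U E" and p: "p \<in> U"
  shows "metric_trace M g gam p = (\<Sum>i<DIM('e). gam (E i) (E i) p)"
  unfolding metric_trace_def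
proof (rule the_equality)
  fix v assume "\<exists>U E. orthonormal_frame M g U E \<and> p \<in> U \<and> v = (\<Sum>i<DIM('e). gam (E i) (E i) p)"
  then obtain U' E' where E': "orthonormal_frame M g U' E'" and p': "p \<in> U'"
    and v: "v = (\<Sum>i<DIM('e). gam (E' i) (E' i) p)" by blast
  define W where "W = U \<inter> U'"
  have W: "opn W" unfolding W_def by (rule opn_Int) (use E E' in \<open>simp_all add: orthonormal_frame_def\<close>)
  have pW: "p \<in> W" using p p' by (simp add: W_def)
  have F: "orthonormal_frame M g W E" "orthonormal_frame M g W E'"
    using orthonormal_frame_restrict[OF E W] orthonormal_frame_restrict[OF E' W] by (auto simp: W_def)
  have vf: "E i \<in> vfields M W" "E' i \<in> vfields M W" if "i < DIM('e)" for i
    using F that by (simp_all add: orthonormal_frame_def)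
  let ?c = "\<lambda>i j q. g q (E' i q) (E j q)"
  have ex: "gam (E' i) Y p = (\<Sum>j<DIM('e). tscale (?c i j p) (gam (E j) Y p))"
    if i: "i < DIM('e)" and Y: "Y \<in> vfields M W" for i Y
  proof (rule gam_lincomb_left[OF W _ _ Y vf(2)[OF i] pW])
    show "E j \<in> vfields M W" if "j \<in> {..<DIM('e)}" for j using vf that by simp
    show "snear q (?c i j)" if "j \<in> {..<DIM('e)}" "q \<in> W" for j q
      by (rule g_snear[OF W vf(2)[OF i] _ that(2)]) (use vf that in simp)
    show "E' i q = (\<Sum>j<DIM('e). tscale (?c i j q) (E j q))" if "q \<in> W" for q
      by (rule frame_expand_field[OF F(1) vf(2)[OF i] that])
  qed
  have "v h = (\<Sum>i<DIM('e). gam (E i) (E i) p) h" for h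
  proof -
    have "v h = (\<Sum>i<DIM('e). gam (E' i) (E' i) p h)" by (simp add: v sum_fun_apply)
    also have "\<dots> = (\<Sum>i<DIM('e). \<Sum>j<DIM('e). \<Sum>k<DIM('e). ?c i j p * ?c i k p * gam (E j) (E k) p h)"
    proof (intro sum.cong refl)
      fix i assume i: "i \<in> {..<DIM('e)}"
      have "gam (E' i) (E' i) p h = (\<Sum>j<DIM('e). ?c i j p * gam (E j) (E' i) p h)"
        using ex[of i "E' i"] vf i by (simp add: sum_fun_apply)
      also have "\<dots> = (\<Sum>j<DIM('e). ?c i j p * gam (E' i) (E j) p h)"
        using gam_sym[OF W _ _ pW] vf i by (intro sum.cong refl) auto
      also have "\<dots> = (\<Sum>j<DIM('e). ?c i j p * (\<Sum>k<DIM('e). ?c i k p * gam (E k) (E j) p h))"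
        using ex vf i by (intro sum.cong refl) (simp add: sum_fun_apply)
      also have "\<dots> = (\<Sum>j<DIM('e). \<Sum>k<DIM('e). ?c i j p * ?c i k p * gam (E j) (E k) p h)"
        unfolding sum_distrib_left using gam_sym[OF W _ _ pW] vf
        by (intro sum.cong refl) auto
      finally show "gam (E' i) (E' i) p h = \<dots>" .
    qed
    also have "\<dots> = (\<Sum>j<DIM('e). gam (E j) (E j) p h)"
      by (rule onb_trace[OF frame_onb[OF F(2) pW] frame_onb[OF F(1) pW]])
    finally show ?thesis by (simp add: sum_fun_apply)
  qed
  then show "v = (\<Sum>i<DIM('e). gam (E i) (E i) p)" ..
qed (use E p in blast)

section \<open>Vanishing of the trace of the covariant derivative of \<gamma>\<close>

lemma frame_connection_skew:
  assumes E: "orthonormal_frame M g U E" and X: "X \<in> vfields M U" and p: "p \<in> U"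
    and i: "i < DIM('e)" and j: "j < DIM('e)"
  shows "g p (D X (E i) p) (E j p) = - g p (D X (E j) p) (E i p)"
proof -
  have U: "opn U" and Ev: "\<And>i. i < DIM('e) \<Longrightarrow> E i \<in> vfields M U" using E by (auto simp: orthonormal_frame_def)
  have "X p (\<lambda>q. g q (E i q) (E j q)) = X p (\<lambda>q. if i = j then 1 else 0)"
    by (rule T_cong[OF vfields_T[OF X p] U p]) (use E i j in \<open>simp add: orthonormal_frame_def\<close>)
  also have "\<dots> = 0" by (rule T_deriv_const[OF vfields_T[OF X p]])
  finally have "g p (D X (E i) p) (E j p) + g p (E i p) (D X (E j) p) = 0"
    using D_metric[OF U X Ev[OF i] Ev[OF j] p] by simp
  moreover have "g p (E i p) (D X (E j) p) = g p (D X (E j) p) (E i p)"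
    by (rule g_sym) (use vfields_T[OF Ev[OF i] p] lc.nab_T[OF U X Ev[OF j] p] in auto)
  ultimately show ?thesis by simp
qed

text \<open>Vanishing of the trace near \<open>p\<close>, not just at \<open>p\<close>, makes
  \<open>\<Sum> D_X(\<gamma>(E_i, E_i))\<close> zero. The two correction sums are equal by symmetry
  of \<gamma> and vanish by the pairing of a skew with a symmetric matrix.\<close>

lemma trace_deriv_gam:
  assumes tr: "\<forall>p\<in>topspace (mtop M). metric_trace M g gam p = 0"
    and X: "X \<in> vfields M (topspace (mtop M))" and p: "p \<in> topspace (mtop M)"
  shows "metric_trace M g (tensor_deriv D gam X) p = 0"
proof -
  have zero: "(\<Sum>i<DIM('e). tensor_deriv D gam X (E i) (E i) p) = 0"
    if E: "orthonormal_frame M g U E" and p: "p \<in> U" for U E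
  proof -
    have U: "opn U" and Ev: "\<And>i. i < DIM('e) \<Longrightarrow> E i \<in> vfields M U"
      using E by (auto simp: orthonormal_frame_def)
    have XU: "X \<in> vfields M U" using vfields_restrict[OF X] openin_subset[OF U] by blast
    have DE: "D X (E i) \<in> vfields M U" if "i < DIM('e)" for i using lc.nab_vfields[OF U XU Ev[OF that]] .
    have gv: "gam (E i) (E i) \<in> vfields M U" if "i < DIM('e)" for i using gam_vfields[OF U Ev Ev] that by blast
    have one: "\<And>q. q \<in> U \<Longrightarrow> snear q (\<lambda>q. 1)" using snear_const opn_topspace[OF U] by blast
    have t1: "tscale 1 v = v" for v :: "'a tvec" by (simp add: fun_eq_iff)
    have Z0: "0 = (\<Sum>i<DIM('e). tscale 1 (gam (E i) (E i) q))" if "q \<in> U" for q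
      using trace_gam[OF E that] tr opn_topspace[OF U that] by (simp only: t1)
    \<comment> \<open>The zero field is read as the combination of the fields
      \<open>\<gamma>(E_i, E_i)\<close> with all coefficients 1, so that their derivatives can be
      taken termwise.\<close>
    have "D X 0 p = (\<Sum>i<DIM('e). tscale (X p (\<lambda>q. 1)) (gam (E i) (E i) p) + tscale 1 (D X (gam (E i) (E i)) p))"
      by (rule lc.nab_lincomb_right[OF U _ _ vfields_zero[OF U] XU p]) (use gv one Z0 in auto)
    then have A: "(\<Sum>i<DIM('e). D X (gam (E i) (E i)) p h) = 0" for h
      using T_deriv_const[OF vfields_T[OF XU p]] lc.nab_zero_right[OF U XU p]
      by (simp add: fun_eq_iff sum_fun_apply)
    have B: "(\<Sum>i<DIM('e). gam (D X (E i)) (E i) p h) = 0" for h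
    proof -
      have "gam (D X (E i)) (E i) p = (\<Sum>j<DIM('e). tscale (g p (D X (E i) p) (E j p)) (gam (E j) (E i) p))"
        if i: "i < DIM('e)" for i
      proof (rule gam_lincomb_left[OF U _ _ Ev[OF i] DE[OF i] p])
        show "E j \<in> vfields M U" if "j \<in> {..<DIM('e)}" for j using Ev that by simp
        show "snear q (\<lambda>q. g q (D X (E i) q) (E j q))" if "j \<in> {..<DIM('e)}" "q \<in> U" for j q
          by (rule g_snear[OF U DE[OF i] _ that(2)]) (use Ev that in simp)
        show "D X (E i) q = (\<Sum>j<DIM('e). tscale (g q (D X (E i) q) (E j q)) (E j q))" if "q \<in> U" for q
          by (rule frame_expand_field[OF E DE[OF i] that])
      qed
      then have "(\<Sum>i<DIM('e). gam (D X (E i)) (E i) p h) =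
        (\<Sum>i<DIM('e). \<Sum>j<DIM('e). g p (D X (E i) p) (E j p) * gam (E j) (E i) p h)"
        by (simp add: sum_fun_apply)
      also have "\<dots> = 0"
      proof (rule sum_skew_sym_eq_0[where a="\<lambda>i j. g p (D X (E i) p) (E j p)" and b="\<lambda>i j. gam (E j) (E i) p h"])
        fix i j assume ij: "i \<in> {..<DIM('e)}" "j \<in> {..<DIM('e)}"
        then have i: "i < DIM('e)" and j: "j < DIM('e)" by auto
        show "g p (D X (E i) p) (E j p) = - g p (D X (E j) p) (E i p)"
          by (rule frame_connection_skew[OF E XU p i j])
        show "gam (E j) (E i) p h = gam (E i) (E j) p h"
          using gam_sym[OF U Ev[OF j] Ev[OF i] p] by (rule fun_cong)
      qed
      finally show ?thesis .
    qed
    have C: "gam (E i) (D X (E i)) p = gam (D X (E i)) (E i) p" if "i < DIM('e)" for i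
      using gam_sym[OF U Ev DE p] that by blast
    have "(\<Sum>i<DIM('e). tensor_deriv D gam X (E i) (E i) p) h = 0" for h
      using A[of h] B[of h] C by (simp add: sum_fun_apply tensor_deriv_def sum_subtractf flip: sum_distrib_left)
    then show ?thesis by (simp add: fun_eq_iff)
  qed
  \<comment> \<open>The description needs a frame that attains the value 0, besides the fact that
    every frame yields 0.\<close>
  obtain U E where E: "orthonormal_frame M g U E" "p \<in> U" using ex_orthonormal_frame[OF p] .
  show ?thesis
    unfolding metric_trace_def
  proof (rule the_equality)
    show "\<exists>U E. orthonormal_frame M g U E \<and> p \<in> U \<and>
        0 = (\<Sum>i<DIM('e). tensor_deriv D gam X (E i) (E i) p)"
      by (intro exI[of _ U] exI[of _ E] conjI E zero[OF E, symmetric])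
  next
    fix v assume "\<exists>U E. orthonormal_frame M g U E \<and> p \<in> U \<and>
        v = (\<Sum>i<DIM('e). tensor_deriv D gam X (E i) (E i) p)"
    then obtain U E where UE: "orthonormal_frame M g U E" "p \<in> U"
      and v: "v = (\<Sum>i<DIM('e). tensor_deriv D gam X (E i) (E i) p)" by (elim exE conjE)
    show "v = 0" unfolding v by (rule zero[OF UE])
  qed
qed

end

section \<open>The tangent bundle as a smooth manifold\<close>

lemma smooth_on_fst:
  fixes f :: "'e::euclidean_space \<Rightarrow> 'c::real_normed_vector"
  assumes "open S" "smooth_on S f"
  shows "smooth_on (S \<times> (UNIV :: 'f::euclidean_space set)) (\<lambda>z. f (fst z))"
  by (rule smooth_on_compose[OF _ assms(1) _ assms(2)])
    (auto intro!: open_Times assms smooth_on_linear bounded_linear_fst)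

text \<open>The fibre part of maps between bundle charts has this form. Linearity in the second
  variable turns it into a sum of coordinates times derivatives in fixed directions.\<close>

lemma smooth_on_tangent_map:
  fixes F :: "'e::euclidean_space \<Rightarrow> real"
  assumes S: "open S" and F: "smooth_on S F"
  shows "smooth_on (S \<times> UNIV) (\<lambda>z. frechet_derivative F (at (fst z)) (snd z))"
proof -
  have o: "open (S \<times> (UNIV :: 'e set))" using S by (intro open_Times) auto
  have "smooth_on (S \<times> UNIV) (\<lambda>z. \<Sum>d\<in>Basis. (snd z \<bullet> d) * frechet_derivative F (at (fst z)) d)"
  proof (intro smooth_on_sum[OF o] smooth_on_mult[OF o])
    fix d :: 'e
    show "smooth_on (S \<times> UNIV) (\<lambda>z. snd z \<bullet> d)"
      by (intro smooth_on_linear[OF _ o] bounded_linear_inner_left_comp bounded_linear_snd)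
    show "smooth_on (S \<times> UNIV) (\<lambda>z. frechet_derivative F (at (fst z)) d)"
      by (rule smooth_on_fst[OF S smooth_on_frechet[OF F]])
  qed
  then show ?thesis
  proof (rule smooth_on_cong[OF o])
    fix z :: "'e \<times> 'e" assume "z \<in> S \<times> UNIV"
    then have "(F has_derivative frechet_derivative F (at (fst z))) (at (fst z))"
      using smooth_on_has_derivative[OF F] by auto
    from linear_expand[OF has_derivative_linear[OF this], of "snd z"]
    show "(\<Sum>d\<in>Basis. (snd z \<bullet> d) * frechet_derivative F (at (fst z)) d) = frechet_derivative F (at (fst z)) (snd z)"
      by simp
  qed
qed

context smooth_mfd
begin

abbreviation TM :: "('a \<times> 'a tvec, 'e \<times> 'e) manifold" where "TM \<equiv> tangent_bundle M"
abbreviation bo :: "'a set \<Rightarrow> ('a \<times> 'a tvec) set" where "bo \<equiv> bundle_over M"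

definition vco :: "('a \<Rightarrow> 'e) \<Rightarrow> 'a tvec \<Rightarrow> 'e" where
  "vco \<phi> v = (\<Sum>b\<in>Basis. v (\<lambda>q. \<phi> q \<bullet> b) *\<^sub>R b)"

lemma bundle_chart_eq: "bundle_chart \<phi> z = (\<phi> (fst z), vco \<phi> (snd z))"
  by (simp add: bundle_chart_def vco_def split_beta)

lemma vco_inner: "b \<in> Basis \<Longrightarrow> vco \<phi> v \<bullet> b = v (\<lambda>q. \<phi> q \<bullet> b)"
  by (simp add: vco_def)

lemma vco_cvec: "(U, \<phi>) \<in> atlas M \<Longrightarrow> p \<in> U \<Longrightarrow> vco \<phi> (cvec U \<phi> w p) = w"
  by (simp add: vco_def cvec_coord euclidean_representation)

lemma cvec_vco: "(U, \<phi>) \<in> atlas M \<Longrightarrow> p \<in> U \<Longrightarrow> v \<in> T p \<Longrightarrow> cvec U \<phi> (vco \<phi> v) p = v"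
  using T_cvecE vco_cvec by metis

lemma mem_bo: "z \<in> bo U \<longleftrightarrow> fst z \<in> U \<and> snd z \<in> T (fst z)"
  by (auto simp: bundle_over_def)

lemma bo_Int: "bo U \<inter> bo V = bo (U \<inter> V)"
  by (auto simp: bundle_over_def)

lemma bo_mono: "U \<subseteq> V \<Longrightarrow> bo U \<subseteq> bo V"
  by (auto simp: bundle_over_def)

lemma bundle_chart_inj: 
  assumes c: "(U, \<phi>) \<in> atlas M" shows "inj_on (bundle_chart \<phi>) (bo U)"
proof (rule inj_onI)
  fix z z' assume z: "z \<in> bo U" "z' \<in> bo U" and eq: "bundle_chart \<phi> z = bundle_chart \<phi> z'"
  have e: "\<phi> (fst z) = \<phi> (fst z')" "vco \<phi> (snd z) = vco \<phi> (snd z')"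
    using eq by (simp_all add: bundle_chart_eq)
  have m: "fst z \<in> U" "fst z' \<in> U" "snd z \<in> T (fst z)" "snd z' \<in> T (fst z')"
    using z by (simp_all add: mem_bo)
  have 1: "fst z = fst z'" by (rule inj_onD[OF chart_inj[OF c] e(1) m(1,2)])
  have "snd z = cvec U \<phi> (vco \<phi> (snd z)) (fst z)" by (rule cvec_vco[OF c m(1,3), symmetric])
  also have "\<dots> = cvec U \<phi> (vco \<phi> (snd z')) (fst z')" by (simp only: 1 e(2))
  also have "\<dots> = snd z'" by (rule cvec_vco[OF c m(2,4)])
  finally show "z = z'" using 1 by (simp add: prod_eq_iff)
qed

lemma bundle_chart_image:
  assumes c: "(U, \<phi>) \<in> atlas M" and V: "V \<subseteq> U" shows "bundle_chart \<phi> ` bo V = \<phi> ` V \<times> UNIV"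
proof (intro equalityI subsetI)
  fix y :: "'e \<times> 'e" assume "y \<in> \<phi> ` V \<times> UNIV"
  then obtain p where p: "p \<in> V" "fst y = \<phi> p" by auto
  have "y = bundle_chart \<phi> (p, cvec U \<phi> (snd y) p)"
    using p V vco_cvec[OF c] by (auto simp: bundle_chart_eq prod_eq_iff)
  moreover have "(p, cvec U \<phi> (snd y) p) \<in> bo V"
    using p V cvec_in_T[OF c] by (auto simp: mem_bo)
  ultimately show "y \<in> bundle_chart \<phi> ` bo V" by (rule image_eqI)
qed (auto simp: bundle_chart_eq mem_bo)

lemma bundle_chart_inv:
  assumes c: "(U, \<phi>) \<in> atlas M" and x: "x \<in> \<phi> ` U"
  shows "inv_into (bo U) (bundle_chart \<phi>) (x, y) = (inv_into U \<phi> x, cvec U \<phi> y (inv_into U \<phi> x))"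
proof (rule inv_into_f_eq[OF bundle_chart_inj[OF c]])
  have q: "inv_into U \<phi> x \<in> U" "\<phi> (inv_into U \<phi> x) = x" using x by (auto simp: inv_into_into f_inv_into_f)
  then show "(inv_into U \<phi> x, cvec U \<phi> y (inv_into U \<phi> x)) \<in> bo U" using cvec_in_T[OF c] by (simp add: mem_bo)
  show "bundle_chart \<phi> (inv_into U \<phi> x, cvec U \<phi> y (inv_into U \<phi> x)) = (x, y)"
    using q vco_cvec[OF c] by (simp add: bundle_chart_eq)
qed

text \<open>The base component is the transition map of \<open>M\<close>, the fibre component its
  differential applied to the fibre coordinate.\<close>

lemma bundle_transition_smooth:
  assumes c: "(U, \<phi>) \<in> atlas M" and d: "(V, \<psi>) \<in> atlas M"
  shows "smooth_on (\<phi> ` (U \<inter> V) \<times> UNIV) (bundle_chart \<psi> \<circ> inv_into (bo U) (bundle_chart \<phi>))"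
proof -
  let ?S = "\<phi> ` (U \<inter> V)"
  have S: "open ?S" using chart_open_image[OF c chart_opn[OF d]] by (simp add: Int_commute)
  have o: "open (?S \<times> (UNIV :: 'e set))" using S by (intro open_Times) auto
  have comp: "smooth_on ?S ((\<lambda>q. \<psi> q \<bullet> b) \<circ> inv_into U \<phi>)" for b
    using smooth_on_bounded_linear[OF bounded_linear_inner_left S chart_transition[OF c d], of b]
    by (simp add: o_def)
  have eq: "(bundle_chart \<psi> \<circ> inv_into (bo U) (bundle_chart \<phi>)) z =
     (\<psi> (inv_into U \<phi> (fst z)), vco \<psi> (cvec U \<phi> (snd z) (inv_into U \<phi> (fst z))))" if "z \<in> ?S \<times> UNIV" for z
    using bundle_chart_inv[OF c, of "fst z" "snd z"] that by (auto simp: bundle_chart_eq)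
  have ss: "snear (inv_into U \<phi> (fst z)) (\<lambda>q. \<psi> q \<bullet> b)" if "z \<in> ?S \<times> (UNIV :: 'e set)" for z b
    using that snear_coord[OF d] inv_chart[OF c] by auto
  have cv: "cvec U \<phi> (snd z) (inv_into U \<phi> (fst z)) (\<lambda>q. \<psi> q \<bullet> b) =
     frechet_derivative ((\<lambda>q. \<psi> q \<bullet> b) \<circ> inv_into U \<phi>) (at (fst z)) (snd z)" if "z \<in> ?S \<times> UNIV" for z b
  proof -
    have "\<phi> (inv_into U \<phi> (fst z)) = fst z" using that by (auto simp: f_inv_into_f)
    then show ?thesis using ss[OF that] by (simp add: cvec_def)
  qed
  show ?thesis
  proof (rule smooth_on_components[OF o])
    fix \<beta> :: "'e \<times> 'e" assume "\<beta> \<in> Basis"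
    then consider b where "b \<in> Basis" "\<beta> = (b, 0)" | b where "b \<in> Basis" "\<beta> = (0, b)"
      by (auto simp: Basis_prod_def)
    then show "smooth_on (?S \<times> UNIV) (\<lambda>z. (bundle_chart \<psi> \<circ> inv_into (bo U) (bundle_chart \<phi>)) z \<bullet> \<beta>)"
    proof cases
      case 1
      from smooth_on_fst[OF S comp[of b]] show ?thesis
        by (rule smooth_on_cong[OF o]) (subst eq, simp_all add: 1)
    next
      case 2
      from smooth_on_tangent_map[OF S comp[of b]] show ?thesis
        by (rule smooth_on_cong[OF o]) (subst eq, simp_all add: vco_inner 2 cv)
    qed
  qed
qed

section \<open>Topology of the tangent bundle\<close>

lemma bundle_generator_open: "(U, \<phi>) \<in> atlas M \<Longrightarrow> open W \<Longrightarrow> openin (mtop TM) (bo U \<inter> bundle_chart \<phi> -` W)"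
  unfolding tangent_bundle_def by (auto intro!: topology_generated_by_Basis)

lemma bo_chart_open: "(U, \<phi>) \<in> atlas M \<Longrightarrow> openin (mtop TM) (bo U)"
  using bundle_generator_open[of U \<phi> UNIV] by simp

lemma atlas_TM: "atlas TM = {(bo U, bundle_chart \<phi>) | U \<phi>. (U, \<phi>) \<in> atlas M}"
  by (simp add: tangent_bundle_def)

lemma topspace_TM: "topspace (mtop TM) = bo (topspace (mtop M))"
proof -
  have "topspace (mtop TM) = \<Union>{bo U \<inter> bundle_chart \<phi> -` W | U \<phi> W. (U, \<phi>) \<in> atlas M \<and> open W}"
    by (simp add: tangent_bundle_def)
  also have "\<dots> = bo (topspace (mtop M))"
  proof (intro equalityI subsetI)
    fix z assume "z \<in> \<Union>{bo U \<inter> bundle_chart \<phi> -` W | U \<phi> W. (U, \<phi>) \<in> atlas M \<and> open W}"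
    then obtain U \<phi> where "(U, \<phi>) \<in> atlas M" "z \<in> bo U" by blast
    then show "z \<in> bo (topspace (mtop M))" using opn_topspace[OF chart_opn] by (auto simp: mem_bo)
  next
    fix z assume z: "z \<in> bo (topspace (mtop M))"
    then obtain U \<phi> where c: "(U, \<phi>) \<in> atlas M" "fst z \<in> U" using chart_at by (metis mem_bo)
    then have "z \<in> bo U \<inter> bundle_chart \<phi> -` UNIV" using z by (simp add: mem_bo)
    then show "z \<in> \<Union>{bo U \<inter> bundle_chart \<phi> -` W | U \<phi> W. (U, \<phi>) \<in> atlas M \<and> open W}"
      using c(1) open_UNIV by blast
  qed
  finally show ?thesis .
qed

text \<open>Induction over the generation of the topology. Intersections use injectivity of the
  bundle chart; for a generator from another chart the image is a preimage under the continuous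
  transition map.\<close>

lemma bundle_chart_open_image:
  assumes O: "openin (mtop TM) Q" and c: "(U, \<phi>) \<in> atlas M"
  shows "open (bundle_chart \<phi> ` (Q \<inter> bo U))"
proof -
  let ?G = "{bo U \<inter> bundle_chart \<phi> -` W | U \<phi> W. (U, \<phi>) \<in> atlas M \<and> open W}"
  have "generate_topology_on ?G Q"
    using O unfolding tangent_bundle_def by (simp add: openin_topology_generated_by_iff)
  then show ?thesis
  proof (induction rule: generate_topology_on.induct)
    case (Int A B)
    have "bundle_chart \<phi> ` (A \<inter> B \<inter> bo U) = bundle_chart \<phi> ` (A \<inter> bo U) \<inter> bundle_chart \<phi> ` (B \<inter> bo U)"
      using bundle_chart_inj[OF c] by (auto simp: inj_on_def)
    then show ?case using Int.IH by (simp only: open_Int)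
  next
    case (UN K)
    have "bundle_chart \<phi> ` (\<Union>K \<inter> bo U) = (\<Union>A\<in>K. bundle_chart \<phi> ` (A \<inter> bo U))" by blast
    then show ?case using UN.IH by auto
  next
    case (Basis s)
    then obtain V \<psi> W where d: "(V, \<psi>) \<in> atlas M" "open W" "s = bo V \<inter> bundle_chart \<psi> -` W" by blast
    let ?t = "bundle_chart \<psi> \<circ> inv_into (bo U) (bundle_chart \<phi>)" and ?S = "\<phi> ` (U \<inter> V) \<times> (UNIV :: 'e set)"
    have S: "open ?S" using chart_open_image[OF c chart_opn[OF d(1)]] by (intro open_Times) (auto simp: Int_commute)
    have inv: "inv_into (bo U) (bundle_chart \<phi>) (bundle_chart \<phi> z) = z" if "z \<in> bo U" for z
      using bundle_chart_inj[OF c] that by (rule inv_into_f_f)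
    have S': "?S = bundle_chart \<phi> ` (bo U \<inter> bo V)" unfolding bo_Int using bundle_chart_image[OF c, of "U \<inter> V"] by simp
    have "bundle_chart \<phi> ` (s \<inter> bo U) = ?S \<inter> ?t -` W"
      unfolding S' d(3) using inv by auto
    also have "open \<dots>"
      by (rule continuous_open_preimage[OF smooth_on_continuous[OF bundle_transition_smooth[OF c d(1)]] S d(2)])
    finally show ?case .
  qed simp
qed

text \<open>The converse of \<open>bundle_chart_open_image\<close>. Generators lie over chart
  domains only, so this is what shows \<open>bo V\<close> open for an arbitrary open
  \<open>V\<close>.\<close>

lemma bundle_openI:
  assumes Q: "Q \<subseteq> bo (topspace (mtop M))"
    and im: "\<And>U \<phi>. (U, \<phi>) \<in> atlas M \<Longrightarrow> open (bundle_chart \<phi> ` (Q \<inter> bo U))"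
  shows "openin (mtop TM) Q"
proof (subst openin_subopen, intro ballI)
  fix z assume z: "z \<in> Q"
  then obtain U \<phi> where c: "(U, \<phi>) \<in> atlas M" "fst z \<in> U" using Q chart_at by (metis mem_bo subsetD)
  let ?B = "bo U \<inter> bundle_chart \<phi> -` (bundle_chart \<phi> ` (Q \<inter> bo U))"
  have "openin (mtop TM) ?B" by (rule bundle_generator_open[OF c(1) im[OF c(1)]])
  moreover have "z \<in> ?B" using z c Q by (auto simp: mem_bo)
  moreover have "?B \<subseteq> Q"
  proof
    fix y assume y: "y \<in> ?B"
    then obtain y' where "y' \<in> Q" "y' \<in> bo U" "bundle_chart \<phi> y = bundle_chart \<phi> y'" by blast
    then show "y \<in> Q" using inj_onD[OF bundle_chart_inj[OF c(1)], of y y'] y by simp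
  qed
  ultimately show "\<exists>T. openin (mtop TM) T \<and> z \<in> T \<and> T \<subseteq> Q" by blast
qed

lemma bo_open: 
  assumes V: "opn V" shows "openin (mtop TM) (bo V)"
proof (rule bundle_openI)
  show "bo V \<subseteq> bo (topspace (mtop M))" using bo_mono[OF openin_subset[OF V]] .
  fix U \<phi> assume c: "(U, \<phi>) \<in> atlas M"
  show "open (bundle_chart \<phi> ` (bo V \<inter> bo U))"
    unfolding bo_Int bundle_chart_image[OF c Int_lower2]
    by (intro open_Times chart_open_image[OF c V] open_UNIV)
qed

lemma Hausdorff_TM: "Hausdorff_space (mtop TM)"
  unfolding Hausdorff_space_def
proof (intro allI impI)
  fix x y assume xy: "x \<in> topspace (mtop TM) \<and> y \<in> topspace (mtop TM) \<and> x \<noteq> y"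
  have H: "Hausdorff_space (mtop M)" using smooth_manifold unfolding smooth_manifold_def by (elim conjE)
  have x: "x \<in> bo (topspace (mtop M))" and y: "y \<in> bo (topspace (mtop M))" using xy topspace_TM by auto
  show "\<exists>U V. openin (mtop TM) U \<and> openin (mtop TM) V \<and> x \<in> U \<and> y \<in> V \<and> disjnt U V"
  proof (cases "fst x = fst y")
    case False
    moreover have "fst x \<in> topspace (mtop M)" "fst y \<in> topspace (mtop M)"
      using x y by (simp_all add: mem_bo)
    ultimately obtain P Q where "opn P" "opn Q" "fst x \<in> P" "fst y \<in> Q" "disjnt P Q"
      using H[unfolded Hausdorff_space_def] by blast
    then show ?thesis
      using bo_open[of P] bo_open[of Q] x y
      by (intro exI[of _ "bo P"] exI[of _ "bo Q"]) (auto simp: mem_bo disjnt_iff)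
  next
    case True
    obtain U \<phi> where c: "(U, \<phi>) \<in> atlas M" "fst x \<in> U" using chart_at x by (metis mem_bo)
    have xU: "x \<in> bo U" "y \<in> bo U" using x y c True by (auto simp: mem_bo)
    then have "bundle_chart \<phi> x \<noteq> bundle_chart \<phi> y" using bundle_chart_inj[OF c(1)] xy by (auto simp: inj_on_def)
    then obtain P Q where PQ: "open P" "open Q" "bundle_chart \<phi> x \<in> P" "bundle_chart \<phi> y \<in> Q" "P \<inter> Q = {}"
      by (meson hausdorff)
    show ?thesis
    proof (intro exI conjI)
      show "openin (mtop TM) (bo U \<inter> bundle_chart \<phi> -` P)" "openin (mtop TM) (bo U \<inter> bundle_chart \<phi> -` Q)"
        using bundle_generator_open[OF c(1)] PQ by auto
      show "disjnt (bo U \<inter> bundle_chart \<phi> -` P) (bo U \<inter> bundle_chart \<phi> -` Q)"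
        using PQ(5) by (auto simp: disjnt_iff)
    qed (use xU PQ in auto)
  qed
qed

text \<open>The atlas may be uncountable. A countable subatlas still covers \<open>M\<close>, and
  combining it with a countable base of the model space gives a countable base of the
  bundle.\<close>

lemma second_countable_TM: "second_countable (mtop TM)"
proof -
  have "second_countable (mtop M)" using smooth_manifold unfolding smooth_manifold_def by (elim conjE)
  then obtain \<B> where B': "countable \<B>" "\<forall>V\<in>\<B>. opn V"
    "\<forall>U x. opn U \<and> x \<in> U \<longrightarrow> (\<exists>V\<in>\<B>. x \<in> V \<and> V \<subseteq> U)"
    unfolding second_countable_def by (elim exE conjE)
  then have B: "countable \<B>" "\<And>V. V \<in> \<B> \<Longrightarrow> opn V"
    "\<And>U x. opn U \<Longrightarrow> x \<in> U \<Longrightarrow> \<exists>V\<in>\<B>. x \<in> V \<and> V \<subseteq> U"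
    by (blast+)
  \<comment> \<open>One chart is chosen for each member of the countable base that fits into some
    chart domain.\<close>
  define ch where "ch V = (SOME c. c \<in> atlas M \<and> V \<subseteq> fst c)" for V
  define A where "A = ch ` {V \<in> \<B>. \<exists>c. c \<in> atlas M \<and> V \<subseteq> fst c}"
  have A: "countable A" unfolding A_def using B(1) by (intro countable_image) (auto intro: countable_subset)
  have ch: "ch V \<in> atlas M" "V \<subseteq> fst (ch V)" if "\<exists>c. c \<in> atlas M \<and> V \<subseteq> fst c" for V
    using someI_ex[OF that] by (simp_all add: ch_def)
  have Acov: "\<exists>U \<phi>. (U, \<phi>) \<in> A \<and> (U, \<phi>) \<in> atlas M \<and> p \<in> U" if p: "p \<in> topspace (mtop M)" for p
  proof -
    obtain U \<phi> where c: "(U, \<phi>) \<in> atlas M" "p \<in> U" using chart_at[OF p] .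
    obtain V where V: "V \<in> \<B>" "p \<in> V" "V \<subseteq> U" using B(3)[OF chart_opn[OF c(1)] c(2)] by blast
    have "\<exists>c. c \<in> atlas M \<and> V \<subseteq> fst c" using c V by (intro exI[of _ "(U, \<phi>)"]) simp
    then have "ch V \<in> A" "ch V \<in> atlas M" "p \<in> fst (ch V)" using ch V by (auto simp: A_def)
    then show ?thesis by (metis prod.collapse)
  qed
  obtain \<C> :: "('e \<times> 'e) set set" where C: "countable \<C>" "\<And>W. W \<in> \<C> \<Longrightarrow> open W"
    "\<And>S. open S \<Longrightarrow> \<exists>\<C>'. \<C>' \<subseteq> \<C> \<and> S = \<Union>\<C>'"
    using univ_second_countable by blast
  define \<D> where "\<D> = (\<lambda>((U, \<phi>), W). bo U \<inter> bundle_chart \<phi> -` W) ` ((A \<inter> atlas M) \<times> \<C>)"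
  show ?thesis
    unfolding second_countable_def
  proof (intro exI[of _ \<D>] conjI ballI allI impI)
    show "countable \<D>" unfolding \<D>_def using A C(1) by (intro countable_image countable_SIGMA) (auto intro: countable_subset)
    show "openin (mtop TM) V" if "V \<in> \<D>" for V
      using that bundle_generator_open C(2) unfolding \<D>_def by auto
    fix Q z assume Qz: "openin (mtop TM) Q \<and> z \<in> Q"
    then have z: "z \<in> bo (topspace (mtop M))" using openin_subset topspace_TM by blast
    then obtain U \<phi> where c: "(U, \<phi>) \<in> A" "(U, \<phi>) \<in> atlas M" "fst z \<in> U" using Acov by (metis mem_bo)
    have zU: "z \<in> bo U" using c z by (simp add: mem_bo)
    have "open (bundle_chart \<phi> ` (Q \<inter> bo U))" using bundle_chart_open_image[OF _ c(2)] Qz by blast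
    then obtain \<C>' where C': "\<C>' \<subseteq> \<C>" "bundle_chart \<phi> ` (Q \<inter> bo U) = \<Union>\<C>'" using C(3) by blast
    moreover have "bundle_chart \<phi> z \<in> bundle_chart \<phi> ` (Q \<inter> bo U)" using Qz zU by blast
    ultimately obtain W where W: "W \<in> \<C>" "bundle_chart \<phi> z \<in> W" "W \<subseteq> bundle_chart \<phi> ` (Q \<inter> bo U)"
      by auto
    show "\<exists>V\<in>\<D>. z \<in> V \<and> V \<subseteq> Q"
    proof (rule bexI[of _ "bo U \<inter> bundle_chart \<phi> -` W"])
      show "z \<in> bo U \<inter> bundle_chart \<phi> -` W \<and> bo U \<inter> bundle_chart \<phi> -` W \<subseteq> Q"
      proof (intro conjI subsetI)
        show "z \<in> bo U \<inter> bundle_chart \<phi> -` W" using W(2) zU by simp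
        fix y assume y: "y \<in> bo U \<inter> bundle_chart \<phi> -` W"
        then obtain y' where "y' \<in> Q" "y' \<in> bo U" "bundle_chart \<phi> y = bundle_chart \<phi> y'" using W(3) by blast
        then show "y \<in> Q" using inj_onD[OF bundle_chart_inj[OF c(2)], of y y'] y by simp
      qed
      show "bo U \<inter> bundle_chart \<phi> -` W \<in> \<D>"
        unfolding \<D>_def using c W(1) by (intro image_eqI[of _ _ "((U, \<phi>), W)"]) auto
    qed
  qed
qed

lemma bundle_chart_homeo:
  assumes c: "(U, \<phi>) \<in> atlas M"
  shows "homeomorphic_map (subtopology (mtop TM) (bo U)) (top_of_set (bundle_chart \<phi> ` bo U)) (bundle_chart \<phi>)"
proof (rule bijective_open_imp_homeomorphic_map)
  have sub: "bo U \<subseteq> topspace (mtop TM)" using openin_subset[OF bo_chart_open[OF c]] .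
  then have ts: "topspace (subtopology (mtop TM) (bo U)) = bo U" by (simp add: Int_absorb1)
  show "bundle_chart \<phi> ` topspace (subtopology (mtop TM) (bo U)) = topspace (top_of_set (bundle_chart \<phi> ` bo U))"
    unfolding ts by simp
  show "inj_on (bundle_chart \<phi>) (topspace (subtopology (mtop TM) (bo U)))"
    unfolding ts by (rule bundle_chart_inj[OF c])
  show "continuous_map (subtopology (mtop TM) (bo U)) (top_of_set (bundle_chart \<phi> ` bo U)) (bundle_chart \<phi>)"
    unfolding continuous_map_def ts
  proof (intro conjI allI impI)
    show "bundle_chart \<phi> \<in> bo U \<rightarrow> topspace (top_of_set (bundle_chart \<phi> ` bo U))" by simp
    fix W assume "openin (top_of_set (bundle_chart \<phi> ` bo U)) W"
    then obtain P where P: "open P" "W = bundle_chart \<phi> ` bo U \<inter> P" by (auto simp: openin_open)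
    then have "{x \<in> bo U. bundle_chart \<phi> x \<in> W} = (bo U \<inter> bundle_chart \<phi> -` P) \<inter> bo U" by auto
    then show "openin (subtopology (mtop TM) (bo U)) {x \<in> bo U. bundle_chart \<phi> x \<in> W}"
      using bundle_generator_open[OF c P(1)] openin_subtopology by blast
  qed
  show "open_map (subtopology (mtop TM) (bo U)) (top_of_set (bundle_chart \<phi> ` bo U)) (bundle_chart \<phi>)"
    unfolding open_map_def
  proof (intro allI impI)
    fix Q assume "openin (subtopology (mtop TM) (bo U)) Q"
    then obtain P where P: "openin (mtop TM) P" "Q = P \<inter> bo U" by (auto simp: openin_subtopology)
    have "open (bundle_chart \<phi> ` Q)" unfolding P(2) by (rule bundle_chart_open_image[OF P(1) c])
    moreover have "bundle_chart \<phi> ` Q \<subseteq> bundle_chart \<phi> ` bo U" using P(2) by blast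
    ultimately show "openin (top_of_set (bundle_chart \<phi> ` bo U)) (bundle_chart \<phi> ` Q)"
      by (simp add: open_subset)
  qed
qed

lemma smooth_manifold_TM: "smooth_manifold TM"
  unfolding smooth_manifold_def
proof (intro conjI ballI)
  show "Hausdorff_space (mtop TM)" "second_countable (mtop TM)" by (rule Hausdorff_TM second_countable_TM)+
  show "(\<Union>(U, \<phi>)\<in>atlas TM. U) = topspace (mtop TM)"
  proof (intro equalityI subsetI)
    fix z assume "z \<in> (\<Union>(U, \<phi>)\<in>atlas TM. U)"
    then obtain U \<phi> where "(U, \<phi>) \<in> atlas M" "z \<in> bo U" unfolding atlas_TM by blast
    then show "z \<in> topspace (mtop TM)" using openin_subset[OF bo_chart_open] by blast
  next
    fix z assume "z \<in> topspace (mtop TM)"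
    then have z: "z \<in> bo (topspace (mtop M))" by (simp only: topspace_TM)
    then obtain U \<phi> where c: "(U, \<phi>) \<in> atlas M" "fst z \<in> U" using chart_at by (metis mem_bo)
    then have "z \<in> bo U" "(bo U, bundle_chart \<phi>) \<in> atlas TM" using z by (auto simp: mem_bo atlas_TM)
    then show "z \<in> (\<Union>(U, \<phi>)\<in>atlas TM. U)" by blast
  qed
next
  fix x assume "x \<in> atlas TM"
  then obtain U \<phi> where c: "(U, \<phi>) \<in> atlas M" and x: "x = (bo U, bundle_chart \<phi>)" unfolding atlas_TM by blast
  have "open (bundle_chart \<phi> ` bo U)"
    unfolding bundle_chart_image[OF c subset_refl] using chart_open[OF c] open_Times by blast
  then show "case x of (U, \<phi>) \<Rightarrow> openin (mtop TM) U \<and> open (\<phi> ` U) \<and>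
        homeomorphic_map (subtopology (mtop TM) U) (top_of_set (\<phi> ` U)) \<phi>"
    unfolding x using bo_chart_open[OF c] bundle_chart_homeo[OF c] by simp
  show "case x of (U, \<phi>) \<Rightarrow> \<forall>(V, \<psi>)\<in>atlas TM. smooth_on (\<phi> ` (U \<inter> V)) (\<psi> \<circ> inv_into U \<phi>)"
    unfolding x prod.case
  proof (intro ballI)
    fix y assume "y \<in> atlas TM"
    then obtain V \<psi> where d: "(V, \<psi>) \<in> atlas M" and y: "y = (bo V, bundle_chart \<psi>)" unfolding atlas_TM by blast
    show "case y of (V, \<psi>) \<Rightarrow> smooth_on (bundle_chart \<phi> ` (bo U \<inter> V)) (\<psi> \<circ> inv_into (bo U) (bundle_chart \<phi>))"
      unfolding y prod.case bo_Int bundle_chart_image[OF c Int_lower1]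
      by (rule bundle_transition_smooth[OF c d])
  qed
qed

end

section \<open>Vertical and horizontal lifts\<close>

context smooth_mfd
begin

interpretation tb: smooth_mfd TM
  by unfold_locales (rule smooth_manifold_TM)

lemma chart_TM: "(U, \<phi>) \<in> atlas M \<Longrightarrow> (bo U, bundle_chart \<phi>) \<in> atlas TM"
  unfolding atlas_TM by blast

lemma bundle_coord_fst:
  fixes \<phi> :: "'a \<Rightarrow> 'e"
  shows "(\<lambda>w. bundle_chart \<phi> w \<bullet> (b, 0)) = (\<lambda>w. \<phi> (fst w) \<bullet> b)"
  by (rule ext) (simp add: bundle_chart_eq)

lemma bundle_coord_snd:
  fixes \<phi> :: "'a \<Rightarrow> 'e"
  shows "b \<in> Basis \<Longrightarrow> (\<lambda>w. bundle_chart \<phi> w \<bullet> (0, b)) = (\<lambda>w. snd w (\<lambda>q. \<phi> q \<bullet> b))"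
  by (rule ext) (simp add: bundle_chart_eq vco_inner)

text \<open>In a bundle chart the two functions become \<open>F(x)\<close> and
  \<open>F'(x) y\<close>, where \<open>F\<close> is the local representative of
  \<open>f\<close>.\<close>

lemma snear_TM:
  assumes z: "z \<in> bo (topspace (mtop M))" and f: "snear (fst z) f"
  shows snear_TM_fst: "smooth_near TM z (\<lambda>w. f (fst w))"
    and snear_TM_snd: "smooth_near TM z (\<lambda>w. snd w f)"
proof -
  have p: "fst z \<in> topspace (mtop M)" using z by (simp add: mem_bo)
  obtain U \<phi> where c: "(U, \<phi>) \<in> atlas M" "fst z \<in> U" using chart_at[OF p] .
  obtain W where W: "opn W" "W \<subseteq> U" "fst z \<in> W" "open (\<phi> ` W)" "smooth_on (\<phi> ` W) (f \<circ> inv_into U \<phi>)"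
    using smooth_near_chartE[OF f c] .
  have zW: "z \<in> bo W" using z W(3) by (simp add: mem_bo)
  have im: "bundle_chart \<phi> ` bo W = \<phi> ` W \<times> UNIV" by (rule bundle_chart_image[OF c(1) W(2)])
  have o: "open (\<phi> ` W \<times> (UNIV :: 'e set))" by (intro open_Times W(4) open_UNIV)
  have inv: "inv_into (bo U) (bundle_chart \<phi>) y = (inv_into U \<phi> (fst y), cvec U \<phi> (snd y) (inv_into U \<phi> (fst y)))"
    if "y \<in> \<phi> ` W \<times> UNIV" for y
    using bundle_chart_inv[OF c(1), of "fst y" "snd y"] that W(2) by auto
  show "smooth_near TM z (\<lambda>w. f (fst w))"
  proof (rule tb.smooth_near_chartI[OF chart_TM[OF c(1)] bo_open[OF W(1)] bo_mono[OF W(2)] zW], unfold im)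
    show "smooth_on (\<phi> ` W \<times> UNIV) ((\<lambda>w. f (fst w)) \<circ> inv_into (bo U) (bundle_chart \<phi>))"
      by (rule smooth_on_cong[OF o smooth_on_fst[OF W(4,5)]]) (simp add: inv)
  qed
  show "smooth_near TM z (\<lambda>w. snd w f)"
  proof (rule tb.smooth_near_chartI[OF chart_TM[OF c(1)] bo_open[OF W(1)] bo_mono[OF W(2)] zW], unfold im)
    show "smooth_on (\<phi> ` W \<times> UNIV) ((\<lambda>w. snd w f) \<circ> inv_into (bo U) (bundle_chart \<phi>))"
    proof (rule smooth_on_cong[OF o smooth_on_tangent_map[OF W(4,5)]])
      fix y :: "'e \<times> 'e" assume y: "y \<in> \<phi> ` W \<times> UNIV"
      then obtain q where q: "q \<in> W" "fst y = \<phi> q" by auto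
      have "snear q f" by (rule smooth_near_chartI[OF c(1) W(1,2) q(1) W(5)])
      moreover have "inv_into U \<phi> (fst y) = q" using q W(2) inv_chart[OF c(1)] by auto
      ultimately show "frechet_derivative (f \<circ> inv_into U \<phi>) (at (fst y)) (snd y) =
          ((\<lambda>w. snd w f) \<circ> inv_into (bo U) (bundle_chart \<phi>)) y"
        using q by (simp add: inv[OF y] cvec_def)
    qed
  qed
qed

text \<open>Bundle coordinates are base coordinates and the fibre functions
  \<open>u \<mapsto> u(x_b)\<close>. Every identity between vectors on the bundle is checked on
  these two families.\<close>

lemma TM_eqI:
  assumes x: "\<xi> \<in> tangent_space TM z" and e: "\<eta> \<in> tangent_space TM z"
    and c: "(U, \<phi>) \<in> atlas M" "z \<in> bo U"
    and 1: "\<And>b. b \<in> Basis \<Longrightarrow> \<xi> (\<lambda>w. \<phi> (fst w) \<bullet> b) = \<eta> (\<lambda>w. \<phi> (fst w) \<bullet> b)"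
    and 2: "\<And>b. b \<in> Basis \<Longrightarrow> \<xi> (\<lambda>w. snd w (\<lambda>q. \<phi> q \<bullet> b)) = \<eta> (\<lambda>w. snd w (\<lambda>q. \<phi> q \<bullet> b))"
  shows "\<xi> = \<eta>"
proof (rule tb.T_eqI[OF x e chart_TM[OF c(1)] c(2)])
  fix \<beta> :: "'e \<times> 'e" assume "\<beta> \<in> Basis"
  then consider b where "b \<in> Basis" "\<beta> = (b, 0)" | b where "b \<in> Basis" "\<beta> = (0, b)"
    by (auto simp: Basis_prod_def)
  then show "\<xi> (\<lambda>w. bundle_chart \<phi> w \<bullet> \<beta>) = \<eta> (\<lambda>w. bundle_chart \<phi> w \<bullet> \<beta>)"
  proof cases
    case (1 b)
    show ?thesis unfolding 1(2) bundle_coord_fst by (rule assms(5)[OF 1(1)])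
  next
    case (2 b)
    show ?thesis unfolding 2(2) bundle_coord_snd[OF 2(1)] by (rule assms(6)[OF 2(1)])
  qed
qed

lemma TM_vfieldsI:
  assumes Q: "openin (mtop TM) Q" and XT: "\<And>z. z \<in> Q \<Longrightarrow> X z \<in> tangent_space TM z"
    and co: "\<And>z. z \<in> Q \<Longrightarrow> \<exists>U \<phi>. (U, \<phi>) \<in> atlas M \<and> fst z \<in> U \<and> (\<forall>b\<in>Basis.
      smooth_near TM z (\<lambda>w. X w (\<lambda>y. \<phi> (fst y) \<bullet> b)) \<and> smooth_near TM z (\<lambda>w. X w (\<lambda>y. snd y (\<lambda>q. \<phi> q \<bullet> b))))"
  shows "X \<in> vfields TM Q"
proof (rule tb.vfields_chartI[OF Q XT])
  fix z assume z: "z \<in> Q"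
  obtain U \<phi> where c: "(U, \<phi>) \<in> atlas M" "fst z \<in> U" and s: "\<And>b. b \<in> Basis \<Longrightarrow>
      smooth_near TM z (\<lambda>w. X w (\<lambda>y. \<phi> (fst y) \<bullet> b)) \<and> smooth_near TM z (\<lambda>w. X w (\<lambda>y. snd y (\<lambda>q. \<phi> q \<bullet> b)))"
    using co[OF z] by blast
  have zU: "z \<in> bo U" using c openin_subset[OF Q] z unfolding topspace_TM by (auto simp: mem_bo)
  show "\<exists>V \<psi>. (V, \<psi>) \<in> atlas TM \<and> z \<in> V \<and> (\<forall>b\<in>Basis. smooth_near TM z (\<lambda>q. X q (\<lambda>r. \<psi> r \<bullet> b)))"
  proof (intro exI conjI ballI)
    show "(bo U, bundle_chart \<phi>) \<in> atlas TM" by (rule chart_TM[OF c(1)])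
    show "z \<in> bo U" by (rule zU)
    fix \<beta> :: "'e \<times> 'e" assume "\<beta> \<in> Basis"
    then consider b where "b \<in> Basis" "\<beta> = (b, 0)" | b where "b \<in> Basis" "\<beta> = (0, b)"
      by (auto simp: Basis_prod_def)
    then show "smooth_near TM z (\<lambda>q. X q (\<lambda>r. bundle_chart \<phi> r \<bullet> \<beta>))"
    proof cases
      case (1 b)
      show ?thesis unfolding 1(2) bundle_coord_fst using s[OF 1(1)] by (elim conjE)
    next
      case (2 b)
      show ?thesis unfolding 2(2) bundle_coord_snd[OF 2(1)] using s[OF 2(1)] by (elim conjE)
    qed
  qed
qed

lemma vco_add: "(U, \<phi>) \<in> atlas M \<Longrightarrow> p \<in> U \<Longrightarrow> u \<in> T p \<Longrightarrow> x \<in> T p \<Longrightarrow>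
   cvec U \<phi> (vco \<phi> u + t *\<^sub>R vco \<phi> x) p = u + tscale t x"
  by (simp only: cvec_add cvec_scale cvec_vco)

text \<open>The curve \<open>t \<mapsto> (p, u + t x)\<close> is a straight line in the bundle
  chart, so its velocity is the coordinate vector with components
  \<open>(0, vco \<phi> x)\<close>.\<close>

lemma vlift_T:
  assumes z: "z \<in> bo (topspace (mtop M))" and x: "x \<in> T (fst z)"
  shows "vlift_at M z x \<in> tangent_space TM z"
proof -
  let ?p = "fst z" and ?u = "snd z"
  have p: "?p \<in> topspace (mtop M)" and u: "?u \<in> T ?p" using z by (simp_all add: mem_bo)
  obtain U \<phi> where c: "(U, \<phi>) \<in> atlas M" "?p \<in> U" using chart_at[OF p] .
  have zU: "z \<in> bo U" using c u by (simp add: mem_bo)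
  have "vlift_at M z x = tb.cvec (bo U) (bundle_chart \<phi>) (0, vco \<phi> x) z"
  proof
    fix F
    show "vlift_at M z x F = tb.cvec (bo U) (bundle_chart \<phi>) (0, vco \<phi> x) z F"
    proof (cases "smooth_near TM z F")
      case True
      let ?G = "F \<circ> inv_into (bo U) (bundle_chart \<phi>)"
      have a: "bundle_chart \<phi> z + 0 *\<^sub>R (0, vco \<phi> x) = bundle_chart \<phi> z" by (simp add: bundle_chart_eq)
      have "((\<lambda>t. ?G (bundle_chart \<phi> z + t *\<^sub>R (0, vco \<phi> x))) has_real_derivative
        frechet_derivative ?G (at (bundle_chart \<phi> z)) (0, vco \<phi> x)) (at 0)"
        by (rule has_real_derivative_along_line, unfold a, rule tb.snear_has_derivative[OF True chart_TM[OF c(1)] zU])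
      moreover have "?G (bundle_chart \<phi> z + t *\<^sub>R (0, vco \<phi> x)) = F (?p, ?u + tscale t x)" for t
      proof -
        have "bundle_chart \<phi> z + t *\<^sub>R (0, vco \<phi> x) = (\<phi> ?p, vco \<phi> ?u + t *\<^sub>R vco \<phi> x)"
          by (simp add: bundle_chart_eq)
        then show ?thesis
          using bundle_chart_inv[OF c(1), of "\<phi> ?p"] c(2) inv_chart[OF c] vco_add[OF c u x] by simp
      qed
      ultimately have "deriv (\<lambda>t. F (?p, ?u + tscale t x)) 0 =
          frechet_derivative ?G (at (bundle_chart \<phi> z)) (0, vco \<phi> x)"
        using DERIV_imp_deriv by simp
      then show ?thesis using True by (simp add: vlift_at_def tb.cvec_def)
    next
      case False
      then show ?thesis by (simp add: vlift_at_def tb.cvec_def)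
    qed
  qed
  then show ?thesis using tb.cvec_in_T[OF chart_TM[OF c(1)] zU] by simp
qed

lemma vlift_fst:
  assumes z: "z \<in> bo (topspace (mtop M))" and f: "snear (fst z) f"
  shows "vlift_at M z x (\<lambda>w. f (fst w)) = 0"
  using snear_TM_fst[OF z f] by (simp add: vlift_at_def)

lemma vlift_snd:
  assumes z: "z \<in> bo (topspace (mtop M))" and f: "snear (fst z) f"
  shows "vlift_at M z x (\<lambda>w. snd w f) = x f"
proof -
  have "((\<lambda>t. snd z f + t * x f) has_real_derivative x f) (at 0)"
    by (auto intro!: derivative_eq_intros)
  then show ?thesis using snear_TM_snd[OF z f] by (simp add: vlift_at_def DERIV_imp_deriv)
qed

text \<open>In charts the section is the smooth map \<open>s\<close>, a point together with the
  components of \<open>Y\<close>. Composition with \<open>s\<close> gives the first claim; by the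
  chain rule the differential is the coordinate vector with components \<open>s'(w)\<close>.\<close>

lemma section_smooth_T:
  assumes U: "opn U" and Y: "Y \<in> vfields M U" and p: "p \<in> U"
  shows section_smooth: "smooth_near TM (p, Y p) F \<Longrightarrow> snear p (\<lambda>q. F (q, Y q))"
    and section_T: "x \<in> T p \<Longrightarrow> differential M TM (\<lambda>q. (q, Y q)) p x \<in> tangent_space TM (p, Y p)"
proof -
  obtain V \<phi> where c: "(V, \<phi>) \<in> atlas M" "p \<in> V" using chart_at[OF opn_topspace[OF U p]] .
  have zV: "(p, Y p) \<in> bo V" using c vfields_T[OF Y p] by (simp add: mem_bo)
  let ?S = "\<phi> ` (U \<inter> V)"
  have S: "open ?S" by (rule chart_open_image[OF c(1) U])
  have UV: "opn (U \<inter> V)" by (rule opn_Int[OF U chart_opn[OF c(1)]])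
  define s where "s x = (x, vco \<phi> (Y (inv_into V \<phi> x)))" for x
  have s: "smooth_on ?S s"
  proof (rule smooth_on_components[OF S])
    fix \<beta> :: "'e \<times> 'e" assume "\<beta> \<in> Basis"
    then consider b where "b \<in> Basis" "\<beta> = (b, 0)" | b where "b \<in> Basis" "\<beta> = (0, b)"
      by (auto simp: Basis_prod_def)
    then show "smooth_on ?S (\<lambda>x. s x \<bullet> \<beta>)"
    proof cases
      case (1 b)
      then show ?thesis using smooth_on_linear[OF bounded_linear_inner_left S, of b] by (simp add: s_def)
    next
      case (2 b)
      have "\<forall>q\<in>U \<inter> V. snear q (\<lambda>q. Y q (\<lambda>r. \<phi> r \<bullet> b))"
        using vfields_snear[OF U Y _ snear_coord[OF c(1)]] by blast
      then have "smooth_fun M (U \<inter> V) (\<lambda>q. Y q (\<lambda>r. \<phi> r \<bullet> b))" using smooth_fun_iff[OF UV] by blast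
      then have "smooth_on (\<phi> ` (U \<inter> V \<inter> V)) ((\<lambda>q. Y q (\<lambda>r. \<phi> r \<bullet> b)) \<circ> inv_into V \<phi>)"
        using c(1) unfolding smooth_fun_def by blast
      then show ?thesis using 2 by (simp add: s_def vco_inner o_def Int_assoc)
    qed
  qed
  have inv: "inv_into (bo V) (bundle_chart \<phi>) (s (\<phi> q)) = (q, Y q)" if "q \<in> U \<inter> V" for q
    using bundle_chart_inv[OF c(1), of "\<phi> q"] that inv_chart[OF c(1)] cvec_vco[OF c(1), of q "Y q"] vfields_T[OF Y]
    by (simp add: s_def)
  have sp: "s (\<phi> q) = bundle_chart \<phi> (q, Y q)" if "q \<in> U \<inter> V" for q
    using inv_chart[OF c(1)] that by (simp add: s_def bundle_chart_eq)
  let ?G = "\<lambda>F. F \<circ> inv_into (bo V) (bundle_chart \<phi>)"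
  have GF: "((\<lambda>q. F (q, Y q)) \<circ> inv_into V \<phi>) y = ?G F (s y)" if y: "y \<in> ?S" for y F
  proof -
    obtain q where q: "q \<in> U \<inter> V" "y = \<phi> q" using y by blast
    then show ?thesis using inv[OF q(1)] inv_chart[OF c(1), of q] by simp
  qed
  show sm: "snear p (\<lambda>q. F (q, Y q))" if F: "smooth_near TM (p, Y p) F" for F
  proof -
    obtain Q where Q: "openin (mtop TM) Q" "Q \<subseteq> bo V" "(p, Y p) \<in> Q" "open (bundle_chart \<phi> ` Q)"
      "smooth_on (bundle_chart \<phi> ` Q) (?G F)"
      using tb.smooth_near_chartE[OF F chart_TM[OF c(1)] zV] .
    define S' where "S' = ?S \<inter> s -` (bundle_chart \<phi> ` Q)"
    have S': "open S'" unfolding S'_def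
      by (rule continuous_open_preimage[OF smooth_on_continuous[OF s] S Q(4)])
    define W where "W = U \<inter> {q \<in> V. \<phi> q \<in> S'}"
    have W: "opn W" unfolding W_def by (rule opn_Int[OF U chart_open_vimage[OF c(1) S']])
    have WV: "W \<subseteq> V" by (auto simp: W_def)
    have WS: "\<phi> ` W = S'" using inv_chart[OF c(1)] by (auto simp: W_def S'_def)
    have pS: "\<phi> p \<in> S'" using p c Q(3) sp[of p] by (auto simp: S'_def)
    have pW: "p \<in> W" using p c pS by (simp add: W_def)
    show ?thesis
    proof (rule smooth_near_chartI[OF c(1) W WV pW], unfold WS)
      have "smooth_on S' (\<lambda>y. ?G F (s y))"
        by (rule smooth_on_compose[OF S' Q(4) _ Q(5) smooth_on_subset[OF s]]) (auto simp: S'_def)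
      then show "smooth_on S' ((\<lambda>q. F (q, Y q)) \<circ> inv_into V \<phi>)"
        by (rule smooth_on_cong[OF S']) (rule GF[symmetric], simp add: S'_def)
    qed
  qed
  show "differential M TM (\<lambda>q. (q, Y q)) p x \<in> tangent_space TM (p, Y p)" if x: "x \<in> T p" for x
  proof -
    obtain w where w: "x = cvec V \<phi> w p" by (rule T_cvecE[OF x c])
    have "differential M TM (\<lambda>q. (q, Y q)) p x =
      tb.cvec (bo V) (bundle_chart \<phi>) (frechet_derivative s (at (\<phi> p)) w) (p, Y p)"
    proof
      fix F
      show "differential M TM (\<lambda>q. (q, Y q)) p x F =
        tb.cvec (bo V) (bundle_chart \<phi>) (frechet_derivative s (at (\<phi> p)) w) (p, Y p) F"
      proof (cases "smooth_near TM (p, Y p) F")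
        case True
        have s': "(s has_derivative frechet_derivative s (at (\<phi> p))) (at (\<phi> p))"
          using smooth_on_has_derivative[OF s] p c by blast
        have "(?G F has_derivative frechet_derivative (?G F) (at (bundle_chart \<phi> (p, Y p)))) (at (s (\<phi> p)))"
          using tb.snear_has_derivative[OF True chart_TM[OF c(1)] zV] sp[of p] p c by simp
        from diff_chain_at[OF s' this]
        have "frechet_derivative (?G F \<circ> s) (at (\<phi> p)) =
          frechet_derivative (?G F) (at (bundle_chart \<phi> (p, Y p))) \<circ> frechet_derivative s (at (\<phi> p))"
          using frechet_derivative_at by metis
        moreover have "frechet_derivative ((\<lambda>q. F (q, Y q)) \<circ> inv_into V \<phi>) (at (\<phi> p)) = frechet_derivative (?G F \<circ> s) (at (\<phi> p))"
          by (rule frechet_derivative_cong_open[OF S]) (use p c GF in auto)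
        ultimately show ?thesis
          using True sm[OF True] by (simp add: differential_def w cvec_def tb.cvec_def o_def)
      next
        case False
        then show ?thesis by (simp add: differential_def tb.cvec_def)
      qed
    qed
    then show ?thesis using tb.cvec_in_T[OF chart_TM[OF c(1)] zV] by simp
  qed
qed

end

section \<open>Sections parallel at a point\<close>

context conn_mfd
begin

text \<open>This is the side condition that \<open>horizontal_space\<close> puts on a section, with
  the prescribed value at \<open>p\<close> left out.\<close>

definition parallel_at :: "'a set \<Rightarrow> 'a vfield \<Rightarrow> 'a \<Rightarrow> bool" where
  "parallel_at U Y p \<longleftrightarrow> opn U \<and> p \<in> U \<and> Y \<in> vfields M U \<and> (\<forall>Z\<in>vfields M U. nab Z Y p = 0)"

lemma parallel_atD:
  assumes "parallel_at U Y p"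
  shows "opn U" "p \<in> U" "Y \<in> vfields M U" "\<And>Z. Z \<in> vfields M U \<Longrightarrow> nab Z Y p = 0"
  using assms unfolding parallel_at_def by blast+

text \<open>A field \<open>Z0\<close> with constant components is corrected by a field that vanishes
  at \<open>p\<close> and has there the same covariant derivative as \<open>Z0\<close>. The value at
  \<open>p\<close> is kept and the derivative is removed.\<close>

lemma ex_parallel_at:
  assumes u: "u \<in> T p"
  obtains U Y where "parallel_at U Y p" "Y p = u"
proof -
  obtain U \<phi> where c: "(U, \<phi>) \<in> atlas M" "p \<in> U" using chart_at[OF T_topspace[OF u]] .
  have U: "opn U" by (rule chart_opn[OF c(1)])
  define Z0 where "Z0 = cvec U \<phi> (vco \<phi> u)"
  have Z0: "Z0 \<in> vfields M U" unfolding Z0_def by (rule vfields_cvec[OF c(1)])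
  \<comment> \<open>Coordinates centred at \<open>p\<close>: they vanish there, so in the Leibniz
    rule for \<open>S\<close> only the terms with derivatives of \<open>k\<close> survive.\<close>
  define k where "k b q = \<phi> q \<bullet> b + (- (\<phi> p \<bullet> b))" for b q
  have k: "snear q (k b)" if "q \<in> U" for q b
    unfolding k_def by (intro snear_add snear_coord[OF c(1) that] snear_const opn_topspace[OF U that])
  define E where "E b = nab (cvec U \<phi> b) Z0" for b
  have E: "E b \<in> vfields M U" for b unfolding E_def by (rule nab_vfields[OF U vfields_cvec[OF c(1)] Z0])
  define S where "S = (\<Sum>b\<in>Basis. fscale (k b) (E b))"
  have S: "S \<in> vfields M U" unfolding S_def by (intro vfields_sum[OF U] vfields_fscale[OF U] E k)
  have Sq: "S q = (\<Sum>b\<in>Basis. tscale (k b q) (E b q))" for q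
    unfolding S_def by (simp add: sum_fun_apply[where x=q])
  have t0: "tscale 0 v = 0" for v :: "'a tvec" by (simp add: fun_eq_iff)
  have kp: "k b p = 0" for b by (simp add: k_def)
  have Sp: "S p = 0" unfolding Sq kp t0 by simp
  have "nab Z (Z0 - S) p = 0" if Z: "Z \<in> vfields M U" for Z
  proof -
    have ZT: "Z p \<in> T p" by (rule vfields_T[OF Z c(2)])
    have "Z p (k b) = Z p (\<lambda>q. \<phi> q \<bullet> b)" for b
      unfolding k_def T_deriv_add[OF ZT snear_coord[OF c] snear_const[OF T_topspace[OF u]]] T_deriv_const[OF ZT]
      by simp
    moreover have "nab Z S p = (\<Sum>b\<in>Basis. tscale (Z p (k b)) (E b p) + tscale (k b p) (nab Z (E b) p))"
      by (rule nab_lincomb_right[OF U E k S Z c(2) Sq])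
    moreover have "nab Z Z0 p = (\<Sum>b\<in>Basis. tscale (Z p (\<lambda>q. \<phi> q \<bullet> b)) (nab (cvec U \<phi> b) Z0 p))"
    proof (rule nab_lincomb_left[OF U vfields_cvec[OF c(1)] _ Z0 Z c(2)])
      show "snear q (\<lambda>q. Z q (\<lambda>r. \<phi> r \<bullet> b))" if "q \<in> U" for q b
        by (rule vfields_snear[OF U Z that snear_coord[OF c(1) that]])
      show "Z q = (\<Sum>b\<in>Basis. tscale (Z q (\<lambda>r. \<phi> r \<bullet> b)) (cvec U \<phi> b q))" if "q \<in> U" for q
        by (rule T_expand[OF vfields_T[OF Z that] c(1) that])
    qed
    ultimately have "nab Z S p = nab Z Z0 p" by (simp only: kp t0 add_0_right E_def)
    then show ?thesis using nab_diff_right[OF U Z Z0 S c(2)] by simp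
  qed
  moreover have "(Z0 - S) p = u" using Sp cvec_vco[OF c u] by (simp add: Z0_def)
  ultimately show ?thesis
    using that[of U "Z0 - S"] U c(2) vfields_diff[OF U Z0 S] unfolding parallel_at_def by blast
qed

text \<open>\<open>parallel_at U Y p\<close> tests only fields on all of \<open>U\<close>, while
  \<open>X\<close> lives on another open set. The bump function provides a global field proportional
  to \<open>X\<close> at \<open>p\<close>, and \<open>nab\<close> sees only this value.\<close>

lemma parallel_nab:
  assumes Y: "parallel_at U Y p" and W: "opn W" "p \<in> W" and X: "X \<in> vfields M W"
  shows "nab X Y p = 0"
proof -
  note Y' = parallel_atD[OF Y]
  obtain X' k where X': "X' \<in> vfields M (topspace (mtop M))" "k > 0" "X' p = tscale k (X p)"
    using vfields_bump[OF W X] .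
  have X'U: "X' \<in> vfields M U" by (rule vfields_restrict[OF X'(1) openin_subset[OF Y'(1)]])
  have o: "opn (U \<inter> W)" by (rule opn_Int[OF Y'(1) W(1)])
  have XO: "X \<in> vfields M (U \<inter> W)" and X'O: "X' \<in> vfields M (U \<inter> W)" and YO: "Y \<in> vfields M (U \<inter> W)"
    using vfields_restrict[OF X] vfields_restrict[OF X'U] vfields_restrict[OF Y'(3)] by auto
  have kO: "\<And>q. q \<in> U \<inter> W \<Longrightarrow> snear q (\<lambda>_. k)" using snear_const opn_topspace[OF o] by blast
  have pO: "p \<in> U \<inter> W" using Y'(2) W(2) by simp
  have kX: "fscale (\<lambda>_. k) X \<in> vfields M (U \<inter> W)" by (rule vfields_fscale[OF o XO kO])
  have kXp: "X' p = fscale (\<lambda>_. k) X p" unfolding X'(3) fscale_def ..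
  have "nab X' Y p = nab (fscale (\<lambda>_. k) X) Y p"
    by (rule nab_tensor_left[OF o X'O kX YO pO kXp])
  also have "\<dots> = tscale k (nab X Y p)" by (rule nab_fscale_left[OF o XO YO kO pO])
  finally have "tscale k (nab X Y p) = 0" using Y'(4)[OF X'U] by simp
  then show ?thesis using X'(2) by (simp add: fun_eq_iff)
qed

end

section \<open>Horizontal and vertical lifts for a flat torsion-free connection\<close>

locale flat_conn = conn_mfd M nab for M :: "('a, 'e::euclidean_space) manifold" and nab +
  assumes torsion_free: "torsion_free M nab" and flat_nab: "flat M nab"
begin

interpretation tb: smooth_mfd TM
  by unfold_locales (rule smooth_manifold_TM)

lemma nab_torsion:
  assumes "opn U" "X \<in> vfields M U" "Y \<in> vfields M U" "p \<in> U"
  shows "nab X Y p - nab Y X p = lie_bracket M X Y p"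
  using torsion_free assms unfolding torsion_free_def by blast

text \<open>Since \<open>\<nabla>_X Y\<close> vanishes at \<open>p\<close>, vanishing torsion gives
  \<open>X(Y f) - Y(X f) = - (\<nabla>_Y X) f\<close>. All terms but \<open>X(Y f)\<close> depend on
  \<open>Y\<close> only through \<open>Y p\<close>, so \<open>Y\<close> may be replaced there by any
  extension \<open>Z\<close>.\<close>

lemma parallel_formula:
  assumes Y: "parallel_at U Y p" and W: "opn W" "p \<in> W" and X: "X \<in> vfields M W"
    and Z: "Z \<in> vfields M W" "Z p = Y p" and f: "snear p f"
  shows "X p (\<lambda>q. Y q f) = Z p (\<lambda>q. X q f) - nab Z X p f"
proof -
  note Y' = parallel_atD[OF Y]
  have o: "opn (U \<inter> W)" by (rule opn_Int[OF Y'(1) W(1)])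
  have XO: "X \<in> vfields M (U \<inter> W)" and ZO: "Z \<in> vfields M (U \<inter> W)" and YO: "Y \<in> vfields M (U \<inter> W)"
    using vfields_restrict[OF X] vfields_restrict[OF Z(1)] vfields_restrict[OF Y'(3)] by auto
  have pO: "p \<in> U \<inter> W" using Y'(2) W(2) by simp
  have "X p (\<lambda>q. Y q f) - Y p (\<lambda>q. X q f) = (nab X Y p - nab Y X p) f"
    unfolding nab_torsion[OF o XO YO pO] lie_bracket_apply[OF f] ..
  moreover have "nab X Y p = 0" by (rule parallel_nab[OF Y W X])
  moreover have "nab Y X p = nab Z X p" by (rule nab_tensor_left[OF o YO ZO XO pO]) (use Z(2) in simp)
  ultimately show ?thesis by (simp add: Z(2))
qed

abbreviation hlift :: "'a \<times> 'a tvec \<Rightarrow> 'a tvec \<Rightarrow> ('a \<times> 'a tvec) tvec" where "hlift \<equiv> hlift_at M nab"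
abbreviation vlift :: "'a \<times> 'a tvec \<Rightarrow> 'a tvec \<Rightarrow> ('a \<times> 'a tvec) tvec" where "vlift \<equiv> vlift_at M"
abbreviation B :: "('a \<times> 'a tvec) set" where "B \<equiv> bo (topspace (mtop M))"

text \<open>Projecting a horizontal vector recovers \<open>x\<close>. Two sections parallel at
  \<open>p\<close> with the same value there induce the same vector, because by
  \<open>parallel_formula\<close> their fibre derivatives agree.\<close>

lemma hlift_eq:
  assumes Y: "parallel_at U Y p" and x: "x \<in> T p"
  shows "hlift (p, Y p) x = differential M TM (\<lambda>q. (q, Y q)) p x"
  unfolding hlift_at_def
proof (rule the_equality)
  have YT: "Y p \<in> T p" using parallel_atD[OF Y] vfields_T by blast
  have zB: "(p, Y p) \<in> B" using YT T_topspace[OF YT] by (simp add: mem_bo)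
  have proj: "differential TM M fst (p, v) (differential M TM (\<lambda>q. (q, Y q)) p x) = x"
    if "parallel_at U Y p" "Y p = v" "x \<in> T p" for U Y v x
  proof
    fix f
    have zB: "(p, v) \<in> B" using parallel_atD[OF that(1)] vfields_T[of Y U p] T_topspace that(2) by (auto simp: mem_bo)
    show "differential TM M fst (p, v) (differential M TM (\<lambda>q. (q, Y q)) p x) f = x f"
    proof (cases "snear p f")
      case True
      then have "smooth_near TM (p, v) (f \<circ> fst)" using snear_TM_fst[OF zB] by (simp add: o_def)
      then show ?thesis using True that(2) by (simp add: differential_def o_def)
    next
      case False
      then show ?thesis using T_not_smooth[OF that(3)] by (simp add: differential_def)
    qed
  qed
  have "differential M TM (\<lambda>q. (q, Y q)) p x \<in> horizontal_space M nab (p, Y p)"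
    unfolding horizontal_space_def using x parallel_atD[OF Y] by (auto intro!: exI[of _ x] exI[of _ Y] exI[of _ U])
  with proj[OF Y refl x]
  show "differential M TM (\<lambda>q. (q, Y q)) p x \<in> horizontal_space M nab (p, Y p) \<and>
    differential TM M fst (p, Y p) (differential M TM (\<lambda>q. (q, Y q)) p x) = x" by simp
  fix \<xi> assume "\<xi> \<in> horizontal_space M nab (p, Y p) \<and> differential TM M fst (p, Y p) \<xi> = x"
  then obtain x' Y' U' where \<xi>: "\<xi> = differential M TM (\<lambda>q. (q, Y' q)) p x'" and x': "x' \<in> T p"
    and U': "opn U'" "p \<in> U'" "Y' \<in> vfields M U'" "Y' p = Y p" "\<forall>Z\<in>vfields M U'. nab Z Y' p = 0"
    and px: "differential TM M fst (p, Y p) \<xi> = x"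
    unfolding horizontal_space_def by auto
  have Y': "parallel_at U' Y' p" using U' by (simp add: parallel_at_def)
  have "x' = x" using proj[OF Y' U'(4) x'] px \<xi> by simp
  obtain V \<phi> where c: "(V, \<phi>) \<in> atlas M" "p \<in> V" using chart_at[OF T_topspace[OF x]] .
  have V: "opn V" by (rule chart_opn[OF c(1)])
  show "\<xi> = differential M TM (\<lambda>q. (q, Y q)) p x"
  proof (rule TM_eqI[OF _ _ c(1)])
    show "\<xi> \<in> tangent_space TM (p, Y p)"
      unfolding \<xi> U'(4)[symmetric] by (rule section_T[OF U'(1,3,2) x'])
    show "differential M TM (\<lambda>q. (q, Y q)) p x \<in> tangent_space TM (p, Y p)"
      by (rule section_T[OF parallel_atD(1,3,2)[OF Y] x])
    show "(p, Y p) \<in> bo V" using c YT by (simp add: mem_bo)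
    fix b :: 'e assume "b \<in> Basis"
    have s: "snear p (\<lambda>q. \<phi> q \<bullet> b)" by (rule snear_coord[OF c])
    show "\<xi> (\<lambda>w. \<phi> (fst w) \<bullet> b) = differential M TM (\<lambda>q. (q, Y q)) p x (\<lambda>w. \<phi> (fst w) \<bullet> b)"
      unfolding \<xi> \<open>x' = x\<close> differential_def using U'(4) by (simp add: o_def)
    \<comment> \<open>The right-hand side mentions the section only through \<open>Y p\<close>;
      fields with constant components serve as extensions of \<open>x\<close> and
      \<open>Y p\<close>.\<close>
    have f: "x (\<lambda>q. Y q (\<lambda>q. \<phi> q \<bullet> b)) = cvec V \<phi> (vco \<phi> (Y p)) p (\<lambda>q. cvec V \<phi> (vco \<phi> x) q (\<lambda>q. \<phi> q \<bullet> b))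
      - nab (cvec V \<phi> (vco \<phi> (Y p))) (cvec V \<phi> (vco \<phi> x)) p (\<lambda>q. \<phi> q \<bullet> b)" if Y: "parallel_at U Y p" for U Y
    proof -
      have YT: "Y p \<in> T p" using parallel_atD[OF Y] vfields_T by blast
      show ?thesis
        using parallel_formula[OF Y V c(2) vfields_cvec[OF c(1), of "vco \<phi> x"] vfields_cvec[OF c(1)] cvec_vco[OF c YT] s]
        by (simp only: cvec_vco[OF c x])
    qed
    have "x (\<lambda>q. Y' q (\<lambda>q. \<phi> q \<bullet> b)) = x (\<lambda>q. Y q (\<lambda>q. \<phi> q \<bullet> b))"
      unfolding f[OF Y] f[OF Y'] U'(4) ..
    then show "\<xi> (\<lambda>w. snd w (\<lambda>q. \<phi> q \<bullet> b)) = differential M TM (\<lambda>q. (q, Y q)) p x (\<lambda>w. snd w (\<lambda>q. \<phi> q \<bullet> b))"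
      unfolding \<xi> \<open>x' = x\<close> differential_def using U'(4) by (simp add: o_def)
  qed
qed

lemma hlift_apply:
  assumes Y: "parallel_at U Y p" "Y p = u" and x: "x \<in> T p" and F: "smooth_near TM (p, u) F"
  shows "hlift (p, u) x F = x (\<lambda>q. F (q, Y q))"
  using hlift_eq[OF Y(1) x] F Y(2) by (simp add: differential_def o_def)

lemma parallel_at_bundle:
  assumes "z \<in> B" obtains U Y where "parallel_at U Y (fst z)" "Y (fst z) = snd z"
  using ex_parallel_at[of "snd z" "fst z"] assms by (auto simp: mem_bo)

lemma hlift_T:
  assumes z: "z \<in> B" and x: "x \<in> T (fst z)" shows "hlift z x \<in> tangent_space TM z"
proof -
  obtain U Y where Y: "parallel_at U Y (fst z)" "Y (fst z) = snd z" using parallel_at_bundle[OF z] .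
  show ?thesis
    using hlift_eq[OF Y(1) x] section_T[OF parallel_atD(1,3,2)[OF Y(1)] x] unfolding Y(2) by simp
qed

lemma hlift_fst:
  assumes z: "z \<in> B" and x: "x \<in> T (fst z)" and f: "snear (fst z) f"
  shows "hlift z x (\<lambda>w. f (fst w)) = x f"
proof -
  obtain U Y where Y: "parallel_at U Y (fst z)" "Y (fst z) = snd z" using parallel_at_bundle[OF z] .
  show ?thesis using hlift_apply[OF Y x, of "\<lambda>w. f (fst w)"] snear_TM_fst[OF z f] by simp
qed

lemma hlift_snd:
  assumes z: "z \<in> B" and W: "opn W" "fst z \<in> W" and X: "X \<in> vfields M W"
    and Z: "Z \<in> vfields M W" "Z (fst z) = snd z" and f: "snear (fst z) f"
  shows "hlift z (X (fst z)) (\<lambda>w. snd w f) = Z (fst z) (\<lambda>q. X q f) - nab Z X (fst z) f"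
proof -
  obtain U Y where Y: "parallel_at U Y (fst z)" "Y (fst z) = snd z" using parallel_at_bundle[OF z] .
  have "hlift z (X (fst z)) (\<lambda>w. snd w f) = X (fst z) (\<lambda>q. Y q f)"
    using hlift_apply[OF Y vfields_T[OF X W(2)], of "\<lambda>w. snd w f"] snear_TM_snd[OF z f] by simp
  also have "\<dots> = Z (fst z) (\<lambda>q. X q f) - nab Z X (fst z) f"
    by (rule parallel_formula[OF Y(1) W X Z(1) _ f]) (simp add: Y(2) Z(2))
  finally show ?thesis .
qed

text \<open>One section parallel at the base point represents the lifts of all vectors there at
  once, and its differential is linear.\<close>

lemma hlift_linear:
  assumes z: "z \<in> B" and x: "x \<in> T (fst z)" and y: "y \<in> T (fst z)"
  shows hlift_add: "hlift z (x + y) = hlift z x + hlift z y"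
    and hlift_scale: "hlift z (tscale k x) = tscale k (hlift z x)"
proof -
  obtain U Y where Y: "parallel_at U Y (fst z)" "Y (fst z) = snd z" using parallel_at_bundle[OF z] .
  have e: "hlift z x = differential M TM (\<lambda>q. (q, Y q)) (fst z) x" if "x \<in> T (fst z)" for x
    using hlift_eq[OF Y(1) that] unfolding Y(2) by simp
  show "hlift z (x + y) = hlift z x + hlift z y"
    unfolding e[OF x] e[OF y] e[OF T_add[OF x y]] by (simp add: differential_def fun_eq_iff)
  show "hlift z (tscale k x) = tscale k (hlift z x)"
    unfolding e[OF x] e[OF T_scale[OF x]] by (simp add: differential_def fun_eq_iff)
qed

lemma vlift_linear:
  assumes z: "z \<in> B" and x: "x \<in> T (fst z)" and y: "y \<in> T (fst z)"
  shows vlift_add: "vlift z (x + y) = vlift z x + vlift z y"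
    and vlift_scale: "vlift z (tscale k x) = tscale k (vlift z x)"
proof -
  have p: "fst z \<in> topspace (mtop M)" using z by (simp add: mem_bo)
  obtain V \<phi> where c: "(V, \<phi>) \<in> atlas M" "fst z \<in> V" using chart_at[OF p] .
  have zV: "z \<in> bo V" using c z by (simp add: mem_bo)
  have s: "snear (fst z) (\<lambda>q. \<phi> q \<bullet> b)" for b by (rule snear_coord[OF c])
  show "vlift z (x + y) = vlift z x + vlift z y"
    by (rule TM_eqI[OF vlift_T[OF z T_add[OF x y]] tb.T_add[OF vlift_T[OF z x] vlift_T[OF z y]] c(1) zV])
      (simp_all add: vlift_fst[OF z s] vlift_snd[OF z s])
  show "vlift z (tscale k x) = tscale k (vlift z x)"
    by (rule TM_eqI[OF vlift_T[OF z T_scale[OF x]] tb.T_scale[OF vlift_T[OF z x]] c(1) zV])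
      (simp_all add: vlift_fst[OF z s] vlift_snd[OF z s])
qed

lemma lift_decomp:
  assumes z: "z \<in> B" and \<xi>: "\<xi> \<in> tangent_space TM z"
  obtains x y where "x \<in> T (fst z)" "y \<in> T (fst z)" "\<xi> = hlift z x + vlift z y"
proof -
  have p: "fst z \<in> topspace (mtop M)" using z by (simp add: mem_bo)
  obtain V \<phi> where c: "(V, \<phi>) \<in> atlas M" "fst z \<in> V" using chart_at[OF p] .
  have zV: "z \<in> bo V" using c z by (simp add: mem_bo)
  have s: "snear (fst z) (\<lambda>q. \<phi> q \<bullet> b)" for b by (rule snear_coord[OF c])
  define x where "x = cvec V \<phi> (\<Sum>b\<in>Basis. \<xi> (\<lambda>w. \<phi> (fst w) \<bullet> b) *\<^sub>R b) (fst z)"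
  have x: "x \<in> T (fst z)" unfolding x_def by (rule cvec_in_T[OF c])
  \<comment> \<open>The fibre components of \<open>\<xi>\<close> that remain after subtracting those
    of the horizontal lift of its projection.\<close>
  define y where "y = cvec V \<phi> (\<Sum>b\<in>Basis. (\<xi> (\<lambda>w. snd w (\<lambda>q. \<phi> q \<bullet> b)) - hlift z x (\<lambda>w. snd w (\<lambda>q. \<phi> q \<bullet> b))) *\<^sub>R b) (fst z)"
  have y: "y \<in> T (fst z)" unfolding y_def by (rule cvec_in_T[OF c])
  have "\<xi> = hlift z x + vlift z y"
  proof (rule TM_eqI[OF \<xi> tb.T_add[OF hlift_T[OF z x] vlift_T[OF z y]] c(1) zV])
    fix b :: 'e assume b: "b \<in> Basis"
    show "\<xi> (\<lambda>w. \<phi> (fst w) \<bullet> b) = (hlift z x + vlift z y) (\<lambda>w. \<phi> (fst w) \<bullet> b)"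
      using b by (simp add: vlift_fst[OF z s] hlift_fst[OF z x s]) (simp add: x_def cvec_coord[OF c])
    show "\<xi> (\<lambda>w. snd w (\<lambda>q. \<phi> q \<bullet> b)) = (hlift z x + vlift z y) (\<lambda>w. snd w (\<lambda>q. \<phi> q \<bullet> b))"
      using b by (simp add: vlift_snd[OF z s]) (simp add: y_def cvec_coord[OF c])
  qed
  with x y that show ?thesis by blast
qed

text \<open>Base functions kill vertical lifts and so determine \<open>x\<close>; once the
  horizontal parts agree, fibre functions determine \<open>y\<close>.\<close>

lemma lift_unique:
  assumes z: "z \<in> B" and T: "x \<in> T (fst z)" "y \<in> T (fst z)" "x' \<in> T (fst z)" "y' \<in> T (fst z)"
    and eq: "hlift z x + vlift z y = hlift z x' + vlift z y'"
  shows "x = x'" "y = y'"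
proof -
  have p: "fst z \<in> topspace (mtop M)" using z by (simp add: mem_bo)
  obtain V \<phi> where c: "(V, \<phi>) \<in> atlas M" "fst z \<in> V" using chart_at[OF p] .
  have s: "snear (fst z) (\<lambda>q. \<phi> q \<bullet> b)" for b by (rule snear_coord[OF c])
  show "x = x'"
  proof (rule T_eqI[OF T(1,3) c])
    fix b :: 'e
    show "x (\<lambda>q. \<phi> q \<bullet> b) = x' (\<lambda>q. \<phi> q \<bullet> b)"
      using fun_cong[OF eq, of "\<lambda>w. \<phi> (fst w) \<bullet> b"]
      by (simp add: vlift_fst[OF z s] hlift_fst[OF z T(1) s] hlift_fst[OF z T(3) s])
  qed
  then have eq': "vlift z y = vlift z y'" using eq by simp
  show "y = y'"
  proof (rule T_eqI[OF T(2,4) c])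
    fix b :: 'e
    show "y (\<lambda>q. \<phi> q \<bullet> b) = y' (\<lambda>q. \<phi> q \<bullet> b)"
      using fun_cong[OF eq', of "\<lambda>w. snd w (\<lambda>q. \<phi> q \<bullet> b)"] by (simp add: vlift_snd[OF z s])
  qed
qed

end

section \<open>Brackets of lifted fields\<close>

context flat_conn
begin

interpretation tb: smooth_mfd TM
  by unfold_locales (rule smooth_manifold_TM)

definition hl :: "'a vfield \<Rightarrow> ('a \<times> 'a tvec) vfield" where "hl X z = hlift z (X (fst z))"
definition vl :: "'a vfield \<Rightarrow> ('a \<times> 'a tvec) vfield" where "vl X z = vlift z (X (fst z))"

lemma bo_B: "opn U \<Longrightarrow> z \<in> bo U \<Longrightarrow> z \<in> B"
  using opn_topspace by (simp add: mem_bo)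

lemma lift_zero:
  assumes z: "z \<in> B" shows hlift_zero: "hlift z 0 = 0" and vlift_zero: "vlift z 0 = 0"
proof -
  have 0: "0 \<in> T (fst z)" using z T_zero by (simp add: mem_bo)
  show "hlift z 0 = 0" using hlift_add[OF z 0 0] by simp
  show "vlift z 0 = 0" using vlift_add[OF z 0 0] by simp
qed

lemma lift_uminus:
  assumes z: "z \<in> B" and x: "x \<in> T (fst z)"
  shows hlift_uminus: "hlift z (- x) = - hlift z x" and vlift_uminus: "vlift z (- x) = - vlift z x"
proof -
  show "hlift z (- x) = - hlift z x"
    using hlift_add[OF z T_uminus[OF x] x] hlift_zero[OF z] by (simp add: eq_neg_iff_add_eq_0)
  show "vlift z (- x) = - vlift z x"
    using vlift_add[OF z T_uminus[OF x] x] vlift_zero[OF z] by (simp add: eq_neg_iff_add_eq_0)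
qed

lemma lift_diff:
  assumes z: "z \<in> B" and x: "x \<in> T (fst z)" and y: "y \<in> T (fst z)"
  shows hlift_diff: "hlift z (x - y) = hlift z x - hlift z y" and vlift_diff: "vlift z (x - y) = vlift z x - vlift z y"
  using hlift_add[OF z x T_uminus[OF y]] vlift_add[OF z x T_uminus[OF y]] hlift_uminus[OF z y] vlift_uminus[OF z y]
  by simp_all

lemma lift_lincomb:
  assumes z: "z \<in> B"
  shows hlift_lincomb: "(\<And>i. i \<in> I \<Longrightarrow> u i \<in> T (fst z)) \<Longrightarrow>
      hlift z (\<Sum>i\<in>I. tscale (k i) (u i)) = (\<Sum>i\<in>I. tscale (k i) (hlift z (u i)))"
    and vlift_lincomb: "(\<And>i. i \<in> I \<Longrightarrow> u i \<in> T (fst z)) \<Longrightarrow>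
      vlift z (\<Sum>i\<in>I. tscale (k i) (u i)) = (\<Sum>i\<in>I. tscale (k i) (vlift z (u i)))"
proof -
  have p: "fst z \<in> topspace (mtop M)" using z by (simp add: mem_bo)
  show "(\<And>i. i \<in> I \<Longrightarrow> u i \<in> T (fst z)) \<Longrightarrow>
      hlift z (\<Sum>i\<in>I. tscale (k i) (u i)) = (\<Sum>i\<in>I. tscale (k i) (hlift z (u i)))"
  proof (induction I rule: infinite_finite_induct)
    case (insert i I)
    have ui: "u i \<in> T (fst z)" and uI: "\<And>i. i \<in> I \<Longrightarrow> u i \<in> T (fst z)" using insert.prems by auto
    have sT: "(\<Sum>i\<in>I. tscale (k i) (u i)) \<in> T (fst z)" by (intro T_sum p T_scale uI)
    have "hlift z (tscale (k i) (u i) + (\<Sum>i\<in>I. tscale (k i) (u i))) =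
        tscale (k i) (hlift z (u i)) + hlift z (\<Sum>i\<in>I. tscale (k i) (u i))"
      unfolding hlift_add[OF z T_scale[OF ui] sT] hlift_scale[OF z ui ui] ..
    then show ?case by (simp only: sum.insert[OF insert.hyps] insert.IH[OF uI])
  qed (use hlift_zero[OF z] in simp_all)
  show "(\<And>i. i \<in> I \<Longrightarrow> u i \<in> T (fst z)) \<Longrightarrow>
      vlift z (\<Sum>i\<in>I. tscale (k i) (u i)) = (\<Sum>i\<in>I. tscale (k i) (vlift z (u i)))"
  proof (induction I rule: infinite_finite_induct)
    case (insert i I)
    have ui: "u i \<in> T (fst z)" and uI: "\<And>i. i \<in> I \<Longrightarrow> u i \<in> T (fst z)" using insert.prems by auto
    have sT: "(\<Sum>i\<in>I. tscale (k i) (u i)) \<in> T (fst z)" by (intro T_sum p T_scale uI)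
    have "vlift z (tscale (k i) (u i) + (\<Sum>i\<in>I. tscale (k i) (u i))) =
        tscale (k i) (vlift z (u i)) + vlift z (\<Sum>i\<in>I. tscale (k i) (u i))"
      unfolding vlift_add[OF z T_scale[OF ui] sT] vlift_scale[OF z ui ui] ..
    then show ?case by (simp only: sum.insert[OF insert.hyps] insert.IH[OF uI])
  qed (use vlift_zero[OF z] in simp_all)
qed

context
  fixes U assumes U: "opn U"
begin

lemma hl_T: "X \<in> vfields M U \<Longrightarrow> z \<in> bo U \<Longrightarrow> hl X z \<in> tangent_space TM z"
  unfolding hl_def by (rule hlift_T[OF bo_B[OF U] vfields_T]) (auto simp: mem_bo)

lemma vl_T: "X \<in> vfields M U \<Longrightarrow> z \<in> bo U \<Longrightarrow> vl X z \<in> tangent_space TM z"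
  unfolding vl_def by (rule vlift_T[OF bo_B[OF U] vfields_T]) (auto simp: mem_bo)

lemma hl_fst: "X \<in> vfields M U \<Longrightarrow> z \<in> bo U \<Longrightarrow> snear (fst z) f \<Longrightarrow> hl X z (\<lambda>w. f (fst w)) = X (fst z) f"
  unfolding hl_def by (rule hlift_fst[OF bo_B[OF U] vfields_T]) (auto simp: mem_bo)

lemma vl_fst: "z \<in> bo U \<Longrightarrow> snear (fst z) f \<Longrightarrow> vl X z (\<lambda>w. f (fst w)) = 0"
  unfolding vl_def by (rule vlift_fst[OF bo_B[OF U]])

lemma vl_snd: "z \<in> bo U \<Longrightarrow> snear (fst z) f \<Longrightarrow> vl X z (\<lambda>w. snd w f) = X (fst z) f"
  unfolding vl_def by (rule vlift_snd[OF bo_B[OF U]])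

text \<open>Extending the fibre point by constant components shows that the fibre derivative of a
  horizontal field is linear in the fibre coordinates, with coefficients from the base. This yields
  smoothness of \<open>hl X\<close> and its vertical derivatives.\<close>

lemma hl_snd_chart:
  assumes X: "X \<in> vfields M U" and c: "(V, \<phi>) \<in> atlas M" and z: "z \<in> bo (U \<inter> V)" and f: "snear (fst z) f"
  shows "hl X z (\<lambda>w. snd w f) = (\<Sum>d\<in>Basis. snd z (\<lambda>q. \<phi> q \<bullet> d) *
     (cvec V \<phi> d (fst z) (\<lambda>q. X q f) - nab (cvec V \<phi> d) X (fst z) f))"
proof -
  let ?O = "U \<inter> V" and ?Z = "cvec V \<phi> (vco \<phi> (snd z))"
  have o: "opn ?O" by (rule opn_Int[OF U chart_opn[OF c]])
  have p: "fst z \<in> ?O" "fst z \<in> V" and u: "snd z \<in> T (fst z)" using z by (auto simp: mem_bo)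
  have XO: "X \<in> vfields M ?O" by (rule vfields_restrict[OF X]) auto
  have cO: "cvec V \<phi> w \<in> vfields M ?O" for w by (rule vfields_restrict[OF vfields_cvec[OF c]]) auto
  have "hl X z (\<lambda>w. snd w f) = ?Z (fst z) (\<lambda>q. X q f) - nab ?Z X (fst z) f"
    unfolding hl_def by (rule hlift_snd[OF bo_B[OF o z] o p(1) XO cO cvec_vco[OF c p(2) u] f])
  moreover have "nab ?Z X (fst z) = (\<Sum>d\<in>Basis. tscale (vco \<phi> (snd z) \<bullet> d) (nab (cvec V \<phi> d) X (fst z)))"
  proof (rule nab_lincomb_left[OF o cO _ XO cO p(1)])
    show "snear q (\<lambda>_. vco \<phi> (snd z) \<bullet> d)" if "q \<in> ?O" for q d by (rule snear_const[OF opn_topspace[OF o that]])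
    show "?Z q = (\<Sum>d\<in>Basis. tscale (vco \<phi> (snd z) \<bullet> d) (cvec V \<phi> d q))" if "q \<in> ?O" for q
      by (rule cvec_expand[OF c]) (use that in simp)
  qed
  moreover have "?Z (fst z) = (\<Sum>d\<in>Basis. tscale (vco \<phi> (snd z) \<bullet> d) (cvec V \<phi> d (fst z)))"
    by (rule cvec_expand[OF c p(2)])
  ultimately show ?thesis
    by (simp add: sum_fun_apply vco_inner right_diff_distrib sum_subtractf)
qed

lemma hl_vfields:
  assumes X: "X \<in> vfields M U" shows "hl X \<in> vfields TM (bo U)"
proof (rule TM_vfieldsI[OF bo_open[OF U] hl_T[OF X]])
  fix z assume z: "z \<in> bo U"
  have p: "fst z \<in> U" and zB: "z \<in> B" using z bo_B[OF U] by (auto simp: mem_bo)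
  obtain V \<phi> where c: "(V, \<phi>) \<in> atlas M" "fst z \<in> V" using chart_at[OF opn_topspace[OF U p]] .
  let ?O = "U \<inter> V"
  have o: "opn ?O" by (rule opn_Int[OF U chart_opn[OF c(1)]])
  have zO: "z \<in> bo ?O" using z c by (simp add: mem_bo)
  have XO: "X \<in> vfields M ?O" by (rule vfields_restrict[OF X]) auto
  have cO: "cvec V \<phi> w \<in> vfields M ?O" for w by (rule vfields_restrict[OF vfields_cvec[OF c(1)]]) auto
  have pO: "fst z \<in> ?O" using p c by simp
  have sb: "snear (fst w) (\<lambda>q. \<phi> q \<bullet> b)" if "w \<in> bo ?O" for w b
    using snear_coord[OF c(1)] that by (simp add: mem_bo)
  have Xs: "snear (fst z) (\<lambda>q. X q (\<lambda>r. \<phi> r \<bullet> b))" for b by (rule vfields_snear[OF U X p sb[OF zO]])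
  show "\<exists>V \<phi>. (V, \<phi>) \<in> atlas M \<and> fst z \<in> V \<and> (\<forall>b\<in>Basis.
      smooth_near TM z (\<lambda>w. hl X w (\<lambda>y. \<phi> (fst y) \<bullet> b)) \<and>
      smooth_near TM z (\<lambda>w. hl X w (\<lambda>y. snd y (\<lambda>q. \<phi> q \<bullet> b))))"
  proof (intro exI conjI ballI)
    show "(V, \<phi>) \<in> atlas M" "fst z \<in> V" by (rule c)+
    fix b :: 'e assume b: "b \<in> Basis"
    show "smooth_near TM z (\<lambda>w. hl X w (\<lambda>y. \<phi> (fst y) \<bullet> b))"
    proof (rule tb.snear_cong[OF snear_TM_fst[OF zB Xs] bo_open[OF o] zO])
      fix w assume w: "w \<in> bo ?O"
      then have "w \<in> bo U" by (simp add: mem_bo)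
      from hl_fst[OF X this sb[OF w]] show "X (fst w) (\<lambda>r. \<phi> r \<bullet> b) = hl X w (\<lambda>y. \<phi> (fst y) \<bullet> b)" by simp
    qed
    have "smooth_near TM z (\<lambda>w. \<Sum>d\<in>Basis. snd w (\<lambda>q. \<phi> q \<bullet> d) *
     (cvec V \<phi> d (fst w) (\<lambda>q. X q (\<lambda>q. \<phi> q \<bullet> b)) - nab (cvec V \<phi> d) X (fst w) (\<lambda>q. \<phi> q \<bullet> b)))"
    proof (rule tb.snear_sum)
      show "z \<in> topspace (mtop TM)" using zB by (simp only: topspace_TM)
      fix d :: 'e
      show "smooth_near TM z (\<lambda>w. snd w (\<lambda>q. \<phi> q \<bullet> d) *
         (cvec V \<phi> d (fst w) (\<lambda>q. X q (\<lambda>q. \<phi> q \<bullet> b)) - nab (cvec V \<phi> d) X (fst w) (\<lambda>q. \<phi> q \<bullet> b)))"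
        by (rule tb.snear_mult[OF snear_TM_snd[OF zB sb[OF zO]] tb.snear_diff[OF
              snear_TM_fst[OF zB cvec_smooth[OF Xs c]]
              snear_TM_fst[OF zB vfields_snear[OF o nab_vfields[OF o cO XO] pO sb[OF zO]]]]])
    qed
    then show "smooth_near TM z (\<lambda>w. hl X w (\<lambda>y. snd y (\<lambda>q. \<phi> q \<bullet> b)))"
      by (rule tb.snear_cong[OF _ bo_open[OF o] zO]) (rule hl_snd_chart[OF X c(1) _ sb, symmetric])
  qed
qed

lemma vl_vfields:
  assumes X: "X \<in> vfields M U" shows "vl X \<in> vfields TM (bo U)"
proof (rule TM_vfieldsI[OF bo_open[OF U] vl_T[OF X]])
  fix z assume z: "z \<in> bo U"
  have p: "fst z \<in> U" and zB: "z \<in> B" using z bo_B[OF U] by (auto simp: mem_bo)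
  obtain V \<phi> where c: "(V, \<phi>) \<in> atlas M" "fst z \<in> V" using chart_at[OF opn_topspace[OF U p]] .
  let ?O = "U \<inter> V"
  have o: "opn ?O" by (rule opn_Int[OF U chart_opn[OF c(1)]])
  have zO: "z \<in> bo ?O" using z c by (simp add: mem_bo)
  have sb: "snear (fst w) (\<lambda>q. \<phi> q \<bullet> b)" if "w \<in> bo ?O" for w b
    using snear_coord[OF c(1)] that by (simp add: mem_bo)
  have wU: "w \<in> bo U" if "w \<in> bo ?O" for w using that by (simp add: mem_bo)
  have Xs: "snear (fst z) (\<lambda>q. X q (\<lambda>r. \<phi> r \<bullet> b))" for b by (rule vfields_snear[OF U X p sb[OF zO]])
  have zT: "z \<in> topspace (mtop TM)" using zB by (simp only: topspace_TM)
  show "\<exists>V \<phi>. (V, \<phi>) \<in> atlas M \<and> fst z \<in> V \<and> (\<forall>b\<in>Basis.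
      smooth_near TM z (\<lambda>w. vl X w (\<lambda>y. \<phi> (fst y) \<bullet> b)) \<and>
      smooth_near TM z (\<lambda>w. vl X w (\<lambda>y. snd y (\<lambda>q. \<phi> q \<bullet> b))))"
  proof (intro exI conjI ballI)
    show "(V, \<phi>) \<in> atlas M" "fst z \<in> V" by (rule c)+
    fix b :: 'e
    show "smooth_near TM z (\<lambda>w. vl X w (\<lambda>y. \<phi> (fst y) \<bullet> b))"
      by (rule tb.snear_cong[OF tb.snear_const[OF zT, of 0] bo_open[OF o] zO])
        (rule vl_fst[OF wU sb, symmetric])
    show "smooth_near TM z (\<lambda>w. vl X w (\<lambda>y. snd y (\<lambda>q. \<phi> q \<bullet> b)))"
      by (rule tb.snear_cong[OF snear_TM_fst[OF zB Xs] bo_open[OF o] zO])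
        (rule vl_snd[OF wU sb, symmetric])
  qed
qed

section \<open>Bracket relations of horizontal and vertical lifts\<close>

context
  fixes X Y z assumes X: "X \<in> vfields M U" and Y: "Y \<in> vfields M U" and z: "z \<in> bo U"
begin

text \<open>A vertical lift sends every bundle coordinate to a function pulled back from the base,
  and the second vertical lift annihilates that.\<close>

lemma bracket_vl_vl: "lie_bracket TM (vl X) (vl Y) z = 0"
proof -
  have p: "fst z \<in> U" and zB: "z \<in> B" using z bo_B[OF U] by (auto simp: mem_bo)
  obtain V \<phi> where c: "(V, \<phi>) \<in> atlas M" "fst z \<in> V" using chart_at[OF opn_topspace[OF U p]] .
  let ?O = "U \<inter> V"
  have o: "opn ?O" by (rule opn_Int[OF U chart_opn[OF c(1)]])
  have zO: "z \<in> bo ?O" and zV: "z \<in> bo V" using z c by (simp_all add: mem_bo)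
  have sb: "snear (fst w) (\<lambda>q. \<phi> q \<bullet> b)" if "w \<in> bo ?O" for w b
    using snear_coord[OF c(1)] that by (simp add: mem_bo)
  have wU: "w \<in> bo U" if "w \<in> bo ?O" for w using that by (simp add: mem_bo)
  have zT: "z \<in> topspace (mtop TM)" using zB by (simp only: topspace_TM)
  have 1: "vl X z (\<lambda>w. vl Y w (\<lambda>y. \<phi> (fst y) \<bullet> b)) = 0" if X: "X \<in> vfields M U" for X Y b
  proof -
    have "vl X z (\<lambda>w. vl Y w (\<lambda>y. \<phi> (fst y) \<bullet> b)) = vl X z (\<lambda>w. 0)"
      by (rule tb.T_cong[OF vl_T[OF X z] bo_open[OF o] zO]) (rule vl_fst[OF wU sb])
    then show ?thesis using tb.T_deriv_const[OF vl_T[OF X z]] by simp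
  qed
  have 2: "vl X z (\<lambda>w. vl Y w (\<lambda>y. snd y (\<lambda>q. \<phi> q \<bullet> b))) = 0"
    if X: "X \<in> vfields M U" and Y: "Y \<in> vfields M U" for X Y b
  proof -
    have "vl X z (\<lambda>w. vl Y w (\<lambda>y. snd y (\<lambda>q. \<phi> q \<bullet> b))) = vl X z (\<lambda>w. Y (fst w) (\<lambda>q. \<phi> q \<bullet> b))"
      by (rule tb.T_cong[OF vl_T[OF X z] bo_open[OF o] zO]) (rule vl_snd[OF wU sb])
    also have "\<dots> = 0" by (rule vl_fst[OF z vfields_snear[OF U Y p sb[OF zO]]])
    finally show ?thesis .
  qed
  show ?thesis
  proof (rule TM_eqI[OF tb.lie_bracket_T[OF bo_open[OF U] vl_vfields[OF X] vl_vfields[OF Y] z] tb.T_zero[OF zT] c(1) zV])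
    fix b :: 'e
    show "lie_bracket TM (vl X) (vl Y) z (\<lambda>w. \<phi> (fst w) \<bullet> b) = 0 (\<lambda>w. \<phi> (fst w) \<bullet> b)"
      unfolding tb.lie_bracket_apply[OF snear_TM_fst[OF zB sb[OF zO]]] 1[OF X] 1[OF Y] by simp
    show "lie_bracket TM (vl X) (vl Y) z (\<lambda>w. snd w (\<lambda>q. \<phi> q \<bullet> b)) = 0 (\<lambda>w. snd w (\<lambda>q. \<phi> q \<bullet> b))"
      unfolding tb.lie_bracket_apply[OF snear_TM_snd[OF zB sb[OF zO]]] 2[OF X Y] 2[OF Y X] by simp
  qed
qed

text \<open>On fibre functions the first term is \<open>X(Y f)\<close>. In the second, the vertical
  derivative replaces the fibre coordinates in \<open>hl_snd_chart\<close> by the components of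
  \<open>Y\<close>, giving \<open>Y(X f) - (\<nabla>_Y X) f\<close>. Vanishing torsion turns the
  difference into \<open>(\<nabla>_X Y) f\<close>.\<close>

lemma bracket_hl_vl: "lie_bracket TM (hl X) (vl Y) z = vl (nab X Y) z"
proof -
  have p: "fst z \<in> U" and zB: "z \<in> B" using z bo_B[OF U] by (auto simp: mem_bo)
  obtain V \<phi> where c: "(V, \<phi>) \<in> atlas M" "fst z \<in> V" using chart_at[OF opn_topspace[OF U p]] .
  let ?O = "U \<inter> V"
  have o: "opn ?O" by (rule opn_Int[OF U chart_opn[OF c(1)]])
  have zO: "z \<in> bo ?O" and zV: "z \<in> bo V" and pO: "fst z \<in> ?O" using z c by (simp_all add: mem_bo)
  have XO: "X \<in> vfields M ?O" and YO: "Y \<in> vfields M ?O" using X Y vfields_restrict[of _ U ?O] by auto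
  have cO: "cvec V \<phi> w \<in> vfields M ?O" for w by (rule vfields_restrict[OF vfields_cvec[OF c(1)]]) auto
  have sb: "snear (fst w) (\<lambda>q. \<phi> q \<bullet> b)" if "w \<in> bo ?O" for w b
    using snear_coord[OF c(1)] that by (simp add: mem_bo)
  have wU: "w \<in> bo U" if "w \<in> bo ?O" for w using that by (simp add: mem_bo)
  have Xs: "snear (fst z) (\<lambda>q. X q (\<lambda>r. \<phi> r \<bullet> b))" for b by (rule vfields_snear[OF U X p sb[OF zO]])
  have Ys: "snear (fst z) (\<lambda>q. Y q (\<lambda>r. \<phi> r \<bullet> b))" for b by (rule vfields_snear[OF U Y p sb[OF zO]])
  note hT = hl_T[OF X z] and vT = vl_T[OF Y z]
  note nT = vl_T[OF nab_vfields[OF U X Y] z]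
  show ?thesis
  proof (rule TM_eqI[OF tb.lie_bracket_T[OF bo_open[OF U] hl_vfields[OF X] vl_vfields[OF Y] z] nT c(1) zV])
    fix b :: 'e
    let ?f = "\<lambda>q. \<phi> q \<bullet> b"
    have "hl X z (\<lambda>w. vl Y w (\<lambda>y. ?f (fst y))) = hl X z (\<lambda>w. 0)"
      by (rule tb.T_cong[OF hT bo_open[OF o] zO]) (rule vl_fst[OF wU sb])
    moreover have "vl Y z (\<lambda>w. hl X w (\<lambda>y. ?f (fst y))) = vl Y z (\<lambda>w. X (fst w) ?f)"
      by (rule tb.T_cong[OF vT bo_open[OF o] zO]) (rule hl_fst[OF X wU sb])
    moreover have "vl Y z (\<lambda>w. X (fst w) ?f) = 0" by (rule vl_fst[OF z Xs])
    moreover have "vl (nab X Y) z (\<lambda>w. ?f (fst w)) = 0" by (rule vl_fst[OF z sb[OF zO]])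
    ultimately show "lie_bracket TM (hl X) (vl Y) z (\<lambda>w. ?f (fst w)) = vl (nab X Y) z (\<lambda>w. ?f (fst w))"
      unfolding tb.lie_bracket_apply[OF snear_TM_fst[OF zB sb[OF zO]]] using tb.T_deriv_const[OF hT] by simp
    define G where "G d q = cvec V \<phi> d q (\<lambda>q. X q ?f) - nab (cvec V \<phi> d) X q ?f" for d q
    have Gs: "snear (fst z) (G d)" for d
      unfolding G_def by (rule snear_diff[OF cvec_smooth[OF Xs c] vfields_snear[OF o nab_vfields[OF o cO XO] pO sb[OF zO]]])
    have "hl X z (\<lambda>w. vl Y w (\<lambda>y. snd y ?f)) = hl X z (\<lambda>w. Y (fst w) ?f)"
      by (rule tb.T_cong[OF hT bo_open[OF o] zO]) (rule vl_snd[OF wU sb])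
    also have "\<dots> = X (fst z) (\<lambda>q. Y q ?f)" by (rule hl_fst[OF X z Ys])
    finally have 1: "hl X z (\<lambda>w. vl Y w (\<lambda>y. snd y ?f)) = X (fst z) (\<lambda>q. Y q ?f)" .
    have "vl Y z (\<lambda>w. hl X w (\<lambda>y. snd y ?f)) = vl Y z (\<lambda>w. \<Sum>d\<in>Basis. snd w (\<lambda>q. \<phi> q \<bullet> d) * G d (fst w))"
      unfolding G_def by (rule tb.T_cong[OF vT bo_open[OF o] zO]) (rule hl_snd_chart[OF X c(1) _ sb])
    also have "\<dots> = (\<Sum>d\<in>Basis. vl Y z (\<lambda>w. snd w (\<lambda>q. \<phi> q \<bullet> d) * G d (fst w)))"
      by (rule tb.T_deriv_sum[OF vT]) (rule tb.snear_mult[OF snear_TM_snd[OF zB sb[OF zO]] snear_TM_fst[OF zB Gs]])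
    also have "\<dots> = (\<Sum>d\<in>Basis. Y (fst z) (\<lambda>q. \<phi> q \<bullet> d) * G d (fst z))"
      unfolding tb.T_deriv_mult[OF vT snear_TM_snd[OF zB sb[OF zO]] snear_TM_fst[OF zB Gs]]
        vl_fst[OF z Gs] vl_snd[OF z sb[OF zO]] by simp
    also have "\<dots> = (\<Sum>d\<in>Basis. Y (fst z) (\<lambda>q. \<phi> q \<bullet> d) * cvec V \<phi> d (fst z) (\<lambda>q. X q ?f))
       - (\<Sum>d\<in>Basis. Y (fst z) (\<lambda>q. \<phi> q \<bullet> d) * nab (cvec V \<phi> d) X (fst z) ?f)"
      unfolding G_def by (simp add: right_diff_distrib sum_subtractf)
    also have "(\<Sum>d\<in>Basis. Y (fst z) (\<lambda>q. \<phi> q \<bullet> d) * cvec V \<phi> d (fst z) (\<lambda>q. X q ?f)) = Y (fst z) (\<lambda>q. X q ?f)"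
      using fun_cong[OF T_expand[OF vfields_T[OF Y p] c], of "\<lambda>q. X q ?f"] by (simp add: sum_fun_apply)
    also have "(\<Sum>d\<in>Basis. Y (fst z) (\<lambda>q. \<phi> q \<bullet> d) * nab (cvec V \<phi> d) X (fst z) ?f) = nab Y X (fst z) ?f"
    proof -
      have "nab Y X (fst z) = (\<Sum>d\<in>Basis. tscale (Y (fst z) (\<lambda>q. \<phi> q \<bullet> d)) (nab (cvec V \<phi> d) X (fst z)))"
      proof (rule nab_lincomb_left[OF o cO _ XO YO pO])
        show "snear q (\<lambda>q. Y q (\<lambda>r. \<phi> r \<bullet> d))" if "q \<in> ?O" for q d
          by (rule vfields_snear[OF o YO that snear_coord[OF c(1)]]) (use that in simp)
        show "Y q = (\<Sum>d\<in>Basis. tscale (Y q (\<lambda>r. \<phi> r \<bullet> d)) (cvec V \<phi> d q))" if "q \<in> ?O" for q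
          by (rule T_expand[OF vfields_T[OF YO that] c(1)]) (use that in simp)
      qed
      then show ?thesis by (simp add: sum_fun_apply)
    qed
    finally have 2: "vl Y z (\<lambda>w. hl X w (\<lambda>y. snd y ?f)) = Y (fst z) (\<lambda>q. X q ?f) - nab Y X (fst z) ?f" .
    have 3: "X (fst z) (\<lambda>q. Y q ?f) - Y (fst z) (\<lambda>q. X q ?f) = (nab X Y (fst z) - nab Y X (fst z)) ?f"
      unfolding nab_torsion[OF U X Y p] lie_bracket_apply[OF sb[OF zO]] ..
    have "vl (nab X Y) z (\<lambda>w. snd w ?f) = nab X Y (fst z) ?f" by (rule vl_snd[OF z sb[OF zO]])
    then show "lie_bracket TM (hl X) (vl Y) z (\<lambda>w. snd w ?f) = vl (nab X Y) z (\<lambda>w. snd w ?f)"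
      unfolding tb.lie_bracket_apply[OF snear_TM_snd[OF zB sb[OF zO]]] 1 2 using 3 by simp
  qed
qed

text \<open>Here a horizontal derivative at \<open>(p, u)\<close> is computed along a section \<open>Z\<close> with \<open>Z p = u\<close> that is
  parallel at \<open>p\<close>; this turns the bracket of horizontal lifts into a curvature term.\<close>

lemma bracket_hl_hl: "lie_bracket TM (hl X) (hl Y) z = hl (lie_bracket M X Y) z"
proof -
  have p: "fst z \<in> U" and zB: "z \<in> B" using z bo_B[OF U] by (auto simp: mem_bo)
  obtain V \<phi> where c: "(V, \<phi>) \<in> atlas M" "fst z \<in> V" using chart_at[OF opn_topspace[OF U p]] .
  obtain P Z where Z: "parallel_at P Z (fst z)" "Z (fst z) = snd z" using parallel_at_bundle[OF zB] .
  let ?O = "P \<inter> U \<inter> V"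
  have o1: "opn (U \<inter> V)" by (rule opn_Int[OF U chart_opn[OF c(1)]])
  have o: "opn ?O" by (rule opn_Int[OF opn_Int[OF parallel_atD(1)[OF Z(1)] U] chart_opn[OF c(1)]])
  have zO: "z \<in> bo (U \<inter> V)" and zV: "z \<in> bo V" using z c by (simp_all add: mem_bo)
  have pO: "fst z \<in> ?O" using p c parallel_atD(2)[OF Z(1)] by simp
  have XO: "X \<in> vfields M ?O" by (rule vfields_restrict[OF X]) auto
  have YO: "Y \<in> vfields M ?O" by (rule vfields_restrict[OF Y]) auto
  have ZO: "Z \<in> vfields M ?O" by (rule vfields_restrict[OF parallel_atD(3)[OF Z(1)]]) auto
  have sb: "snear (fst w) (\<lambda>q. \<phi> q \<bullet> b)" if "w \<in> bo (U \<inter> V)" for w b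
    using snear_coord[OF c(1)] that by (simp add: mem_bo)
  have sbq: "snear q (\<lambda>q. \<phi> q \<bullet> b)" if "q \<in> ?O" for q b
    using snear_coord[OF c(1)] that by simp
  have wU: "w \<in> bo U" if "w \<in> bo (U \<inter> V)" for w using that by (simp add: mem_bo)
  note hTX = hl_T[OF X z] and hTY = hl_T[OF Y z]
  have 1: "hl X z (\<lambda>w. hl Y w (\<lambda>y. \<phi> (fst y) \<bullet> b)) = X (fst z) (\<lambda>q. Y q (\<lambda>q. \<phi> q \<bullet> b))"
    if X: "X \<in> vfields M U" and Y: "Y \<in> vfields M U" for X Y b
  proof -
    have "hl X z (\<lambda>w. hl Y w (\<lambda>y. \<phi> (fst y) \<bullet> b)) = hl X z (\<lambda>w. Y (fst w) (\<lambda>q. \<phi> q \<bullet> b))"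
      by (rule tb.T_cong[OF hl_T[OF X z] bo_open[OF o1] zO]) (rule hl_fst[OF Y wU sb])
    also have "\<dots> = X (fst z) (\<lambda>q. Y q (\<lambda>q. \<phi> q \<bullet> b))"
      by (rule hl_fst[OF X z vfields_snear[OF U Y p sb[OF zO]]])
    finally show ?thesis .
  qed
  have 2: "hl X z (\<lambda>w. hl Y w (\<lambda>y. snd y (\<lambda>q. \<phi> q \<bullet> b)))
      = X (fst z) (\<lambda>q. Y q (\<lambda>q. Z q (\<lambda>q. \<phi> q \<bullet> b))) - nab X (nab Y Z) (fst z) (\<lambda>q. \<phi> q \<bullet> b)"
    if X: "X \<in> vfields M U" and Y: "Y \<in> vfields M U" and XO: "X \<in> vfields M ?O" and YO: "Y \<in> vfields M ?O" for X Y b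
  proof -
    let ?f = "\<lambda>q. \<phi> q \<bullet> b" and ?p = "fst z"
    let ?W = "nab Y Z"
    have zz: "(?p, snd z) = z" by simp
    have XT: "X ?p \<in> T ?p" by (rule vfields_T[OF X p])
    have W: "?W \<in> vfields M ?O" by (rule nab_vfields[OF o YO ZO])
    have Wp: "?W ?p = 0" by (rule parallel_nab[OF Z(1) U p Y])
    have sF: "smooth_near TM (?p, snd z) (\<lambda>w. hl Y w (\<lambda>y. snd y ?f))"
      unfolding zz by (rule tb.vfields_snear[OF bo_open[OF U] hl_vfields[OF Y] z snear_TM_snd[OF zB sb[OF zO]]])
    have "hl X z (\<lambda>w. hl Y w (\<lambda>y. snd y ?f)) = X ?p (\<lambda>q. hl Y (q, Z q) (\<lambda>y. snd y ?f))"
      using hlift_apply[OF Z XT sF] unfolding hl_def zz .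
    \<comment> \<open>Away from the base point \<open>Z\<close> need not be parallel, so there the
      horizontal lift through \<open>Z q\<close> is evaluated by \<open>hlift_snd\<close>; the
      failure to be parallel is recorded in \<open>?W\<close>.\<close>
    also have "\<dots> = X ?p (\<lambda>q. Y q (\<lambda>q. Z q ?f) - ?W q ?f)"
    proof (rule T_cong[OF XT o pO])
      fix q assume q: "q \<in> ?O"
      have qB: "(q, Z q) \<in> B" using vfields_T[OF ZO q] opn_topspace[OF o q] by (simp add: mem_bo)
      have "hl Y (q, Z q) (\<lambda>y. snd y ?f) = Z q (\<lambda>q. Y q ?f) - nab Z Y q ?f"
        using hlift_snd[OF qB o _ YO ZO, of ?f] q sbq[OF q] by (simp add: hl_def)
      moreover have "(nab Y Z q - nab Z Y q) ?f = Y q (\<lambda>q. Z q ?f) - Z q (\<lambda>q. Y q ?f)"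
        unfolding nab_torsion[OF o YO ZO q] lie_bracket_apply[OF sbq[OF q]] ..
      ultimately show "hl Y (q, Z q) (\<lambda>y. snd y ?f) = Y q (\<lambda>q. Z q ?f) - ?W q ?f" by simp
    qed
    also have "\<dots> = X ?p (\<lambda>q. Y q (\<lambda>q. Z q ?f)) - X ?p (\<lambda>q. ?W q ?f)"
      by (rule T_deriv_diff[OF XT vfields_snear[OF o YO pO vfields_snear[OF o ZO pO sbq[OF pO]]]
            vfields_snear[OF o W pO sbq[OF pO]]])
    \<comment> \<open>As \<open>?W\<close> vanishes at the base point, the other two terms of the
      torsion identity drop out and ordinary and covariant derivative of \<open>?W\<close> agree
      there.\<close>
    also have "X ?p (\<lambda>q. ?W q ?f) = nab X ?W ?p ?f"
    proof -
      have "(nab X ?W ?p - nab ?W X ?p) ?f = X ?p (\<lambda>q. ?W q ?f) - ?W ?p (\<lambda>q. X q ?f)"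
        unfolding nab_torsion[OF o XO W pO] lie_bracket_apply[OF sbq[OF pO]] ..
      moreover have "nab ?W X ?p = nab 0 X ?p"
        by (rule nab_tensor_left[OF o W vfields_zero[OF o] XO pO]) (simp only: Wp zero_fun_apply)
      moreover have "nab 0 X ?p = 0" by (rule nab_zero_left[OF o XO pO])
      ultimately show ?thesis by (simp add: Wp)
    qed
    finally show ?thesis .
  qed
  have br: "lie_bracket M X Y \<in> vfields M U" by (rule vfields_lie_bracket[OF U X Y])
  show ?thesis
  proof (rule TM_eqI[OF tb.lie_bracket_T[OF bo_open[OF U] hl_vfields[OF X] hl_vfields[OF Y] z] hl_T[OF br z] c(1) zV])
    fix b :: 'e
    let ?f = "\<lambda>q. \<phi> q \<bullet> b"
    show "lie_bracket TM (hl X) (hl Y) z (\<lambda>w. ?f (fst w)) = hl (lie_bracket M X Y) z (\<lambda>w. ?f (fst w))"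
      unfolding tb.lie_bracket_apply[OF snear_TM_fst[OF zB sb[OF zO]]] 1[OF X Y] 1[OF Y X]
        hl_fst[OF br z sb[OF zO]] lie_bracket_apply[OF sb[OF zO]] ..
    have zz: "(fst z, snd z) = z" by simp
    have sF: "smooth_near TM (fst z, snd z) (\<lambda>w. snd w ?f)" unfolding zz by (rule snear_TM_snd[OF zB sb[OF zO]])
    have h: "hl (lie_bracket M X Y) z (\<lambda>w. snd w ?f) = lie_bracket M X Y (fst z) (\<lambda>q. Z q ?f)"
      using hlift_apply[OF Z vfields_T[OF br p] sF] unfolding hl_def zz by simp
    \<comment> \<open>Flatness enters here. \<open>Z\<close> being parallel at the base point
      removes the bracket term of the curvature, so the two second covariant derivatives of
      \<open>Z\<close> cancel in the commutator.\<close>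
    have "curvature M nab X Y Z (fst z) = 0"
      using flat_nab o XO YO ZO pO unfolding flat_def by blast
    moreover have "nab (lie_bracket M X Y) Z (fst z) = 0" by (rule parallel_nab[OF Z(1) U p br])
    ultimately have "nab X (nab Y Z) (fst z) = nab Y (nab X Z) (fst z)"
      by (simp add: curvature_def)
    then show "lie_bracket TM (hl X) (hl Y) z (\<lambda>w. snd w ?f) = hl (lie_bracket M X Y) z (\<lambda>w. snd w ?f)"
      unfolding tb.lie_bracket_apply[OF snear_TM_snd[OF zB sb[OF zO]]] 2[OF X Y XO YO] 2[OF Y X YO XO] h
        lie_bracket_apply[OF vfields_snear[OF o ZO pO sbq[OF pO]]] by simp
  qed
qed

end

end

section \<open>The canonical Hermitian structure\<close>

abbreviation J :: "'a \<times> 'a tvec \<Rightarrow> ('a \<times> 'a tvec) tvec \<Rightarrow> ('a \<times> 'a tvec) tvec" where "J \<equiv> J1 M nab"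

text \<open>Uniqueness of the horizontal-vertical decomposition leaves the definite description in
  \<open>J1\<close> a single candidate.\<close>

lemma J_lift:
  assumes z: "z \<in> B" and x: "x \<in> T (fst z)" and y: "y \<in> T (fst z)"
  shows "J z (hlift z x + vlift z y) = vlift z x - hlift z y"
  unfolding J1_def
proof (rule the_equality)
  show "\<exists>x'\<in>T (fst z). \<exists>y'\<in>T (fst z). hlift z x + vlift z y = hlift z x' + vlift z y' \<and>
     vlift z x - hlift z y = vlift z x' - hlift z y'"
    by (intro bexI[of _ x] bexI[of _ y] conjI refl x y)
  fix \<eta> assume "\<exists>x'\<in>T (fst z). \<exists>y'\<in>T (fst z). hlift z x + vlift z y = hlift z x' + vlift z y' \<and>
     \<eta> = vlift z x' - hlift z y'"
  then obtain x' y' where x': "x' \<in> T (fst z)" and y': "y' \<in> T (fst z)"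
    and eq: "hlift z x + vlift z y = hlift z x' + vlift z y'" and \<eta>: "\<eta> = vlift z x' - hlift z y'"
    by (elim bexE conjE)
  show "\<eta> = vlift z x - hlift z y"
    unfolding \<eta> lift_unique[OF z x y x' y' eq] ..
qed

lemma J_hlift:
  assumes z: "z \<in> B" and x: "x \<in> T (fst z)" shows "J z (hlift z x) = vlift z x"
proof -
  have 0: "0 \<in> T (fst z)" by (rule T_zero[OF T_topspace[OF x]])
  show ?thesis using J_lift[OF z x 0] hlift_zero[OF z] vlift_zero[OF z] by simp
qed

lemma J_vlift:
  assumes z: "z \<in> B" and x: "x \<in> T (fst z)" shows "J z (vlift z x) = - hlift z x"
proof -
  have 0: "0 \<in> T (fst z)" by (rule T_zero[OF T_topspace[OF x]])
  show ?thesis using J_lift[OF z 0 x] hlift_zero[OF z] vlift_zero[OF z] by simp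
qed

lemma J_props:
  assumes z: "z \<in> B" and \<xi>: "\<xi> \<in> tangent_space TM z" and \<eta>: "\<eta> \<in> tangent_space TM z"
  shows J_T: "J z \<xi> \<in> tangent_space TM z" and J_add: "J z (\<xi> + \<eta>) = J z \<xi> + J z \<eta>"
    and J_scale: "J z (tscale k \<xi>) = tscale k (J z \<xi>)" and J_J: "J z (J z \<xi>) = - \<xi>"
proof -
  obtain x y where x: "x \<in> T (fst z)" and y: "y \<in> T (fst z)" and e: "\<xi> = hlift z x + vlift z y"
    using lift_decomp[OF z \<xi>] .
  obtain x' y' where x': "x' \<in> T (fst z)" and y': "y' \<in> T (fst z)" and e': "\<eta> = hlift z x' + vlift z y'"
    using lift_decomp[OF z \<eta>] .
  show "J z \<xi> \<in> tangent_space TM z"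
    unfolding e J_lift[OF z x y] by (rule tb.T_diff[OF vlift_T[OF z x] hlift_T[OF z y]])
  have "\<xi> + \<eta> = hlift z (x + x') + vlift z (y + y')"
    unfolding e e' hlift_add[OF z x x'] vlift_add[OF z y y'] by (simp add: algebra_simps)
  then have "J z (\<xi> + \<eta>) = vlift z (x + x') - hlift z (y + y')"
    using J_lift[OF z T_add[OF x x'] T_add[OF y y']] by (simp only:)
  then show "J z (\<xi> + \<eta>) = J z \<xi> + J z \<eta>"
    unfolding hlift_add[OF z y y'] vlift_add[OF z x x'] e e' J_lift[OF z x y] J_lift[OF z x' y']
    by (simp add: algebra_simps)
  have "tscale k \<xi> = hlift z (tscale k x) + vlift z (tscale k y)"
    unfolding e hlift_scale[OF z x x] vlift_scale[OF z y y] by (simp add: fun_eq_iff algebra_simps)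
  then have "J z (tscale k \<xi>) = vlift z (tscale k x) - hlift z (tscale k y)"
    using J_lift[OF z T_scale[OF x] T_scale[OF y]] by (simp only:)
  then show "J z (tscale k \<xi>) = tscale k (J z \<xi>)"
    unfolding hlift_scale[OF z y y] vlift_scale[OF z x x] e J_lift[OF z x y] by (simp add: fun_eq_iff algebra_simps)
  have "J z \<xi> = hlift z (- y) + vlift z x"
    unfolding e J_lift[OF z x y] hlift_uminus[OF z y] by simp
  then have "J z (J z \<xi>) = vlift z (- y) - hlift z x"
    using J_lift[OF z T_uminus[OF y] x] by (simp only:)
  then show "J z (J z \<xi>) = - \<xi>" unfolding vlift_uminus[OF z y] e by simp
qed

lemma J_uminus:
  assumes z: "z \<in> B" and \<xi>: "\<xi> \<in> tangent_space TM z"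
  shows "J z (- \<xi>) = - J z \<xi>"
proof -
  have m: "- v = tscale (- 1) v" for v :: "('a \<times> 'a tvec) tvec" by (simp add: fun_eq_iff)
  show ?thesis unfolding m by (rule J_scale[OF z \<xi> \<xi>])
qed

text \<open>Lifts of coordinate fields form a local smooth frame of the bundle. This carries
  pointwise facts about lifts over to arbitrary smooth fields: smoothness of \<open>J\<close> and of
  the metric, and the Nijenhuis identity.\<close>

lemma TM_coeffs:
  assumes Q: "openin (mtop TM) Q" and X: "X \<in> vfields TM Q" and c: "(V, \<phi>) \<in> atlas M" and QV: "Q \<subseteq> bo V"
  obtains a k where "\<forall>b. \<forall>w\<in>Q. smooth_near TM w (a b)" "\<forall>b. \<forall>w\<in>Q. smooth_near TM w (k b)"
    "\<forall>w\<in>Q. X w = hlift w (\<Sum>b\<in>Basis. tscale (a b w) (cvec V \<phi> b (fst w)))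
        + vlift w (\<Sum>b\<in>Basis. tscale (k b w) (cvec V \<phi> b (fst w)))"
proof -
  have V: "opn V" by (rule chart_opn[OF c])
  define a where "a b w = X w (\<lambda>y. \<phi> (fst y) \<bullet> b)" for b w
  \<comment> \<open>Horizontal lifts have fibre components of their own, which are subtracted before
    the vertical coefficients are read off.\<close>
  define k where "k b w = X w (\<lambda>y. snd y (\<lambda>q. \<phi> q \<bullet> b)) -
    (\<Sum>d\<in>Basis. a d w * hl (cvec V \<phi> d) w (\<lambda>y. snd y (\<lambda>q. \<phi> q \<bullet> b)))" for b w
  have wV: "w \<in> bo V" "w \<in> B" "fst w \<in> V" if "w \<in> Q" for w
    using that QV bo_B[OF V, of w] by (auto simp: mem_bo)
  have sb: "snear (fst w) (\<lambda>q. \<phi> q \<bullet> b)" if "w \<in> Q" for w b by (rule snear_coord[OF c wV(3)[OF that]])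
  have as: "smooth_near TM w (a b)" if "w \<in> Q" for w b
    unfolding a_def by (rule tb.vfields_snear[OF Q X that snear_TM_fst[OF wV(2)[OF that] sb[OF that]]])
  have ks: "smooth_near TM w (k b)" if "w \<in> Q" for w b
    unfolding k_def
  proof (rule tb.snear_diff)
    have s: "smooth_near TM w (\<lambda>y. snd y (\<lambda>q. \<phi> q \<bullet> b))" by (rule snear_TM_snd[OF wV(2)[OF that] sb[OF that]])
    show "smooth_near TM w (\<lambda>w. X w (\<lambda>y. snd y (\<lambda>q. \<phi> q \<bullet> b)))" by (rule tb.vfields_snear[OF Q X that s])
    show "smooth_near TM w (\<lambda>w. \<Sum>d\<in>Basis. a d w * hl (cvec V \<phi> d) w (\<lambda>y. snd y (\<lambda>q. \<phi> q \<bullet> b)))"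
      by (rule tb.snear_sum[OF tb.opn_topspace[OF Q that]])
        (rule tb.snear_mult[OF as[OF that] tb.vfields_snear[OF bo_open[OF V] hl_vfields[OF V vfields_cvec[OF c]] wV(1)[OF that] s]])
  qed
  have X': "X w = hlift w (\<Sum>b\<in>Basis. tscale (a b w) (cvec V \<phi> b (fst w)))
        + vlift w (\<Sum>b\<in>Basis. tscale (k b w) (cvec V \<phi> b (fst w)))" if w: "w \<in> Q" for w
  proof -
    note w' = wV[OF w]
    have cT: "cvec V \<phi> b (fst w) \<in> T (fst w)" for b by (rule cvec_in_T[OF c w'(3)])
    have sT: "(\<Sum>b\<in>Basis. tscale (e b) (cvec V \<phi> b (fst w))) \<in> T (fst w)" for e
      by (intro T_sum T_scale cT T_topspace[OF cT])
    show ?thesis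
    proof (rule TM_eqI[OF tb.vfields_T[OF X w] tb.T_add[OF hlift_T[OF w'(2) sT] vlift_T[OF w'(2) sT]] c w'(1)])
      fix b :: 'e assume b: "b \<in> Basis"
      have d: "(\<Sum>d\<in>Basis. e d * (d \<bullet> b)) = e b" for e :: "'e \<Rightarrow> real"
        using b by (simp add: inner_Basis if_distrib sum.delta cong: if_cong)
      have v: "(\<Sum>d\<in>Basis. tscale (e d) (cvec V \<phi> d (fst w))) (\<lambda>q. \<phi> q \<bullet> b) = e b" for e
        by (simp add: sum_fun_apply cvec_coord[OF c w'(3)] d)
      show "X w (\<lambda>y. \<phi> (fst y) \<bullet> b) = (hlift w (\<Sum>b\<in>Basis. tscale (a b w) (cvec V \<phi> b (fst w)))
        + vlift w (\<Sum>b\<in>Basis. tscale (k b w) (cvec V \<phi> b (fst w)))) (\<lambda>y. \<phi> (fst y) \<bullet> b)"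
        unfolding plus_fun_apply hlift_fst[OF w'(2) sT sb[OF w]] vlift_fst[OF w'(2) sb[OF w]] v by (simp add: a_def)
      have "hlift w (\<Sum>b\<in>Basis. tscale (a b w) (cvec V \<phi> b (fst w))) (\<lambda>y. snd y (\<lambda>q. \<phi> q \<bullet> b))
        = (\<Sum>d\<in>Basis. a d w * hl (cvec V \<phi> d) w (\<lambda>y. snd y (\<lambda>q. \<phi> q \<bullet> b)))"
        unfolding hlift_lincomb[OF w'(2) cT] sum_fun_apply tscale_apply hl_def ..
      then show "X w (\<lambda>y. snd y (\<lambda>q. \<phi> q \<bullet> b)) = (hlift w (\<Sum>b\<in>Basis. tscale (a b w) (cvec V \<phi> b (fst w)))
        + vlift w (\<Sum>b\<in>Basis. tscale (k b w) (cvec V \<phi> b (fst w)))) (\<lambda>y. snd y (\<lambda>q. \<phi> q \<bullet> b))"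
        unfolding plus_fun_apply vlift_snd[OF w'(2) sb[OF w]] v by (simp add: k_def)
    qed
  qed
  show ?thesis using that[of a k] as ks X' by blast
qed

lemma TM_chart_nhd:
  assumes Q: "openin (mtop TM) Q" and z: "z \<in> Q"
  obtains V \<phi> where "(V, \<phi>) \<in> atlas M" "openin (mtop TM) (Q \<inter> bo V)" "z \<in> Q \<inter> bo V"
proof -
  have zB: "z \<in> B" using tb.opn_topspace[OF Q z] by (simp only: topspace_TM)
  then have p: "fst z \<in> topspace (mtop M)" by (simp add: mem_bo)
  obtain V \<phi> where c: "(V, \<phi>) \<in> atlas M" "fst z \<in> V" using chart_at[OF p] .
  show ?thesis
    by (rule that[OF c(1) tb.opn_Int[OF Q bo_chart_open[OF c(1)]]]) (use z zB c in \<open>simp add: mem_bo\<close>)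
qed

lemma J_vfields:
  assumes Q: "openin (mtop TM) Q" and X: "X \<in> vfields TM Q"
  shows "field_map J X \<in> vfields TM Q"
proof (rule tb.vfields_local[OF Q])
  fix z assume z: "z \<in> Q"
  obtain V \<phi> where c: "(V, \<phi>) \<in> atlas M" "openin (mtop TM) (Q \<inter> bo V)" "z \<in> Q \<inter> bo V"
    using TM_chart_nhd[OF Q z] .
  have V: "opn V" by (rule chart_opn[OF c(1)])
  let ?Q = "Q \<inter> bo V"
  have XQ: "X \<in> vfields TM ?Q" by (rule tb.vfields_restrict[OF X]) auto
  obtain a k where ak: "\<forall>b. \<forall>w\<in>?Q. smooth_near TM w (a b)" "\<forall>b. \<forall>w\<in>?Q. smooth_near TM w (k b)"
    "\<forall>w\<in>?Q. X w = hlift w (\<Sum>b\<in>Basis. tscale (a b w) (cvec V \<phi> b (fst w)))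
        + vlift w (\<Sum>b\<in>Basis. tscale (k b w) (cvec V \<phi> b (fst w)))"
    using TM_coeffs[OF c(2) XQ c(1) Int_lower2] .
  have a: "\<And>b w. w \<in> ?Q \<Longrightarrow> smooth_near TM w (a b)" and k: "\<And>b w. w \<in> ?Q \<Longrightarrow> smooth_near TM w (k b)"
    using ak(1,2) by simp_all
  note eq = bspec[OF ak(3)]
  have hQ: "hl (cvec V \<phi> b) \<in> vfields TM ?Q" "vl (cvec V \<phi> b) \<in> vfields TM ?Q" for b
    using tb.vfields_restrict[OF hl_vfields[OF V vfields_cvec[OF c(1)]]]
      tb.vfields_restrict[OF vl_vfields[OF V vfields_cvec[OF c(1)]]] by auto
  have "(\<Sum>b\<in>Basis. fscale (a b) (vl (cvec V \<phi> b))) - (\<Sum>b\<in>Basis. fscale (k b) (hl (cvec V \<phi> b))) \<in> vfields TM ?Q"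
    by (intro tb.vfields_diff[OF c(2)] tb.vfields_sum[OF c(2)] tb.vfields_fscale[OF c(2)] hQ a k)
  then have "field_map J X \<in> vfields TM ?Q"
  proof (rule tb.vfields_cong[OF c(2)])
    fix w assume w: "w \<in> ?Q"
    have wB: "w \<in> B" and wV: "fst w \<in> V" using w bo_B[OF V, of w] by (auto simp: mem_bo)
    have cT: "cvec V \<phi> b (fst w) \<in> T (fst w)" for b by (rule cvec_in_T[OF c(1) wV])
    have sT: "(\<Sum>b\<in>Basis. tscale (e b) (cvec V \<phi> b (fst w))) \<in> T (fst w)" for e
      by (intro T_sum T_scale cT T_topspace[OF cT])
    have "field_map J X w = vlift w (\<Sum>b\<in>Basis. tscale (a b w) (cvec V \<phi> b (fst w)))
        - hlift w (\<Sum>b\<in>Basis. tscale (k b w) (cvec V \<phi> b (fst w)))"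
      unfolding field_map_def eq[OF w] J_lift[OF wB sT sT] ..
    also have "\<dots> = (\<Sum>b\<in>Basis. tscale (a b w) (vl (cvec V \<phi> b) w)) - (\<Sum>b\<in>Basis. tscale (k b w) (hl (cvec V \<phi> b) w))"
      unfolding hlift_lincomb[OF wB cT] vlift_lincomb[OF wB cT] hl_def vl_def ..
    finally show "((\<Sum>b\<in>Basis. fscale (a b) (vl (cvec V \<phi> b))) - (\<Sum>b\<in>Basis. fscale (k b) (hl (cvec V \<phi> b)))) w = field_map J X w"
      by (simp only: minus_apply sum_fun_apply[where x=w] fscale_apply)
  qed
  then show "\<exists>W. openin (mtop TM) W \<and> z \<in> W \<and> field_map J X \<in> vfields TM W" using c by blast
qed

end

section \<open>Koszul formula and curvature in orthonormal frames\<close>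

lemma (in smooth_mfd) linear_on_T_lincomb:
  assumes p: "p \<in> topspace (mtop M)"
    and add: "\<And>u v. u \<in> T p \<Longrightarrow> v \<in> T p \<Longrightarrow> K (u + v) = K u + K v"
    and scale: "\<And>u c. u \<in> T p \<Longrightarrow> K (tscale c u) = tscale c (K u)"
  shows "(\<And>i. i \<in> I \<Longrightarrow> u i \<in> T p) \<Longrightarrow> K (\<Sum>i\<in>I. tscale (c i) (u i)) = (\<Sum>i\<in>I. tscale (c i) (K (u i)))"
proof (induction I rule: infinite_finite_induct)
  case (insert i I)
  have ui: "u i \<in> T p" and uI: "\<And>i. i \<in> I \<Longrightarrow> u i \<in> T p" using insert.prems by auto
  have sT: "(\<Sum>i\<in>I. tscale (c i) (u i)) \<in> T p" by (intro T_sum p T_scale uI)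
  have "K (tscale (c i) (u i) + (\<Sum>i\<in>I. tscale (c i) (u i))) =
      tscale (c i) (K (u i)) + K (\<Sum>i\<in>I. tscale (c i) (u i))"
    unfolding add[OF T_scale[OF ui] sT] scale[OF ui] ..
  then show ?case by (simp only: sum.insert[OF insert.hyps] insert.IH[OF uI])
qed (use add[OF T_zero[OF p] T_zero[OF p]] in simp_all)

context riem_mfd
begin

text \<open>With constant inner products metric compatibility says that each \<open>L X\<close> is
  skew on the three fields, so the Koszul formula keeps only its bracket terms. It follows linearly
  from three skewness and three torsion identities.\<close>

lemma koszul_const:
  assumes lc: "levi_civita M g L" and U: "opn U"
    and A: "A \<in> vfields M U" and B: "B \<in> vfields M U" and C: "C \<in> vfields M U" and p: "p \<in> U"
    and ab: "\<And>q. q \<in> U \<Longrightarrow> g q (A q) (B q) = kab" and ac: "\<And>q. q \<in> U \<Longrightarrow> g q (A q) (C q) = kac"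
    and bc: "\<And>q. q \<in> U \<Longrightarrow> g q (B q) (C q) = kbc"
  shows "2 * g p (L A B p) (C p) = g p (lie_bracket M A B p) (C p) - g p (lie_bracket M A C p) (B p)
     - g p (lie_bracket M B C p) (A p)"
proof -
  have conn: "connection M L" and tf: "torsion_free M L" using lc unfolding levi_civita_def by blast+
  interpret L: conn_mfd M L by unfold_locales (rule conn)
  have LT: "L X Y p \<in> T p" if "X \<in> vfields M U" "Y \<in> vfields M U" for X Y by (rule L.nab_T[OF U that p])
  have skew: "g p (L X Y p) (Z p) = - g p (L X Z p) (Y p)"
    if X: "X \<in> vfields M U" and Y: "Y \<in> vfields M U" and Z: "Z \<in> vfields M U"
      and k: "\<And>q. q \<in> U \<Longrightarrow> g q (Y q) (Z q) = k" for X Y Z k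
  proof -
    have "X p (\<lambda>q. g q (Y q) (Z q)) = X p (\<lambda>q. k)" by (rule T_cong[OF vfields_T[OF X p] U p k])
    then have "g p (L X Y p) (Z p) + g p (Y p) (L X Z p) = 0"
      using lc[unfolded levi_civita_def, THEN conjunct2, THEN conjunct2, rule_format, OF U X Y Z p]
        T_deriv_const[OF vfields_T[OF X p]] by simp
    then show ?thesis using g_sym[OF vfields_T[OF Y p] LT[OF X Z]] by simp
  qed
  have tors: "g p (lie_bracket M X Y p) (Z p) = g p (L X Y p) (Z p) - g p (L Y X p) (Z p)"
    if X: "X \<in> vfields M U" and Y: "Y \<in> vfields M U" and Z: "Z \<in> vfields M U" for X Y Z
  proof -
    have "lie_bracket M X Y p = L X Y p - L Y X p" using tf U X Y p unfolding torsion_free_def by simp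
    then show ?thesis using g_diff_left[OF LT[OF X Y] LT[OF Y X] vfields_T[OF Z p]] by (simp only:)
  qed
  show ?thesis
    using tors[OF A B C] tors[OF A C B] tors[OF B C A] skew[OF A B C bc] skew[OF B A C ac] skew[OF C A B ab]
    by linarith
qed

end

section \<open>Connection form of an orthonormal frame\<close>

locale riem_conn = riem_mfd M g + conn_mfd M nab
  for M :: "('a, 'e::euclidean_space) manifold" and g nab
begin

definition conn_coeff :: "('i \<Rightarrow> 'a vfield) \<Rightarrow> 'a vfield \<Rightarrow> 'i \<Rightarrow> 'i \<Rightarrow> 'a \<Rightarrow> real" where
  "conn_coeff F X a b w = g w (nab X (F a) w) (F b w)"

context
  fixes Q :: "'a set" and I :: "'i set" and F :: "'i \<Rightarrow> 'a vfield"
  assumes Q: "opn Q" and F: "\<And>i. i \<in> I \<Longrightarrow> F i \<in> vfields M Q"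
    and on: "\<And>w. w \<in> Q \<Longrightarrow> onb I w (\<lambda>i. F i w)"
begin

lemma conn_coeff_expand:
  assumes X: "X \<in> vfields M Q" and a: "a \<in> I" and w: "w \<in> Q"
  shows "nab X (F a) w = (\<Sum>b\<in>I. tscale (conn_coeff F X a b w) (F b w))"
  unfolding conn_coeff_def by (rule onb_expand[OF on[OF w] nab_T[OF Q X F[OF a] w]])

lemma conn_coeff_smooth:
  assumes X: "X \<in> vfields M Q" and a: "a \<in> I" and b: "b \<in> I" and w: "w \<in> Q"
  shows "snear w (conn_coeff F X a b)"
  unfolding conn_coeff_def by (rule g_snear[OF Q nab_vfields[OF Q X F[OF a]] F[OF b] w])

text \<open>Relations between the entries of the connection form that are linear with constant
  coefficients need only be checked for \<open>X\<close> in the frame.\<close>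

lemma conn_coeff_tensor:
  assumes X: "X \<in> vfields M Q" and a: "a \<in> I" and b: "b \<in> I" and w: "w \<in> Q"
  shows "conn_coeff F X a b w = (\<Sum>d\<in>I. g w (X w) (F d w) * conn_coeff F (F d) a b w)"
proof -
  have "nab X (F a) w = (\<Sum>d\<in>I. tscale (g w (X w) (F d w)) (nab (F d) (F a) w))"
  proof (rule nab_lincomb_left[OF Q F _ F[OF a] X w])
    show "snear q (\<lambda>q. g q (X q) (F d q))" if "d \<in> I" "q \<in> Q" for d q
      by (rule g_snear[OF Q X F[OF that(1)] that(2)])
    show "X q = (\<Sum>d\<in>I. tscale (g q (X q) (F d q)) (F d q))" if "q \<in> Q" for q
      by (rule onb_expand[OF on[OF that] vfields_T[OF X that]])
  qed
  then have "conn_coeff F X a b w = g w (\<Sum>d\<in>I. tscale (g w (X w) (F d w)) (nab (F d) (F a) w)) (F b w)"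
    unfolding conn_coeff_def by (simp only:)
  also have "\<dots> = (\<Sum>d\<in>I. g w (X w) (F d w) * g w (nab (F d) (F a) w) (F b w))"
    by (rule g_lincomb_left[OF vfields_T[OF F[OF b] w]]) (rule nab_T[OF Q F F[OF a] w])
  finally show ?thesis by (simp add: conn_coeff_def)
qed

text \<open>Differentiating the frame expansion of \<open>\<nabla>_Y F_a\<close> gives the
  derivative of the connection form plus a product of two of its values as matrices.\<close>

lemma g_nab_nab:
  assumes X: "X \<in> vfields M Q" and Y: "Y \<in> vfields M Q" and a: "a \<in> I" and c: "c \<in> I" and w: "w \<in> Q"
  shows "g w (nab X (nab Y (F a)) w) (F c w) =
    X w (conn_coeff F Y a c) + (\<Sum>b\<in>I. conn_coeff F Y a b w * conn_coeff F X b c w)"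
proof -
  let ?k = "conn_coeff F"
  have fin: "finite I" using on[OF w] by (simp add: onb_def)
  have FT: "F b w \<in> T w" if "b \<in> I" for b by (rule vfields_T[OF F[OF that] w])
  have nT: "nab X (F b) w \<in> T w" if "b \<in> I" for b by (rule nab_T[OF Q X F[OF that] w])
  have "nab X (nab Y (F a)) w = (\<Sum>b\<in>I. tscale (X w (?k Y a b)) (F b w) + tscale (?k Y a b w) (nab X (F b) w))"
    by (rule nab_lincomb_right[OF Q F conn_coeff_smooth[OF Y a] nab_vfields[OF Q Y F[OF a]] X w conn_coeff_expand[OF Y a]])
  also have "\<dots> = (\<Sum>b\<in>I. tscale (X w (?k Y a b)) (F b w)) + (\<Sum>b\<in>I. tscale (?k Y a b w) (nab X (F b) w))"
    by (rule sum.distrib)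
  finally have "g w (nab X (nab Y (F a)) w) (F c w) =
      g w ((\<Sum>b\<in>I. tscale (X w (?k Y a b)) (F b w)) + (\<Sum>b\<in>I. tscale (?k Y a b w) (nab X (F b) w))) (F c w)"
    by (simp only:)
  also have "\<dots> = g w (\<Sum>b\<in>I. tscale (X w (?k Y a b)) (F b w)) (F c w) + g w (\<Sum>b\<in>I. tscale (?k Y a b w) (nab X (F b) w)) (F c w)"
    by (rule g_add_left) (intro T_sum T_scale FT nT c opn_topspace[OF Q w]; assumption)+
  also have "g w (\<Sum>b\<in>I. tscale (X w (?k Y a b)) (F b w)) (F c w) = X w (?k Y a c)"
    by (rule orthonormal_coeff[OF fin FT _ c]) (use on[OF w] in \<open>simp_all add: onb_def\<close>)
  also have "g w (\<Sum>b\<in>I. tscale (?k Y a b w) (nab X (F b) w)) (F c w) = (\<Sum>b\<in>I. ?k Y a b w * ?k X b c w)"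
    unfolding conn_coeff_def by (rule g_lincomb_left[OF FT[OF c] nT])
  finally show ?thesis .
qed

text \<open>If \<open>j\<close> is the constant skew matrix of a complex structure commuting with the connection form,
  then the \<open>j\<close>-trace of the curvature is minus the differential of the \<open>j\<close>-trace of the connection form: the
  quadratic terms are the trace of a commutator.\<close>

lemma curvature_trace_eq_0:
  assumes skew: "\<And>a c. a \<in> I \<Longrightarrow> c \<in> I \<Longrightarrow> j a c = - j c a"
    and comm: "\<And>X w a c. X \<in> vfields M Q \<Longrightarrow> w \<in> Q \<Longrightarrow> a \<in> I \<Longrightarrow> c \<in> I \<Longrightarrow>
       (\<Sum>b\<in>I. j a b * conn_coeff F X b c w) = (\<Sum>b\<in>I. conn_coeff F X a b w * j b c)"
    and tr: "\<And>X w. X \<in> vfields M Q \<Longrightarrow> w \<in> Q \<Longrightarrow> (\<Sum>a\<in>I. \<Sum>c\<in>I. j a c * conn_coeff F X a c w) = 0"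
    and X: "X \<in> vfields M Q" and Y: "Y \<in> vfields M Q" and w: "w \<in> Q"
  shows "(\<Sum>a\<in>I. \<Sum>c\<in>I. j a c * g w (curvature M nab X Y (F a) w) (F c w)) = 0"
proof -
  let ?k = "conn_coeff F"
  have br: "lie_bracket M X Y \<in> vfields M Q" by (rule vfields_lie_bracket[OF Q X Y])
  define q where "q X Y a c = (\<Sum>b\<in>I. ?k Y a b w * ?k X b c w)" for X Y a c
  have cv: "g w (curvature M nab X Y (F a) w) (F c w) =
      ?k (lie_bracket M X Y) a c w - X w (?k Y a c) - q X Y a c + Y w (?k X a c) + q Y X a c"
    if a: "a \<in> I" and c: "c \<in> I" for a c
  proof -
    have T1: "nab (lie_bracket M X Y) (F a) w \<in> T w" by (rule nab_T[OF Q br F[OF a] w])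
    have T2: "nab X (nab Y (F a)) w \<in> T w" by (rule nab_T[OF Q X nab_vfields[OF Q Y F[OF a]] w])
    have T3: "nab Y (nab X (F a)) w \<in> T w" by (rule nab_T[OF Q Y nab_vfields[OF Q X F[OF a]] w])
    have FT: "F c w \<in> T w" by (rule vfields_T[OF F[OF c] w])
    have "g w (curvature M nab X Y (F a) w) (F c w) = g w (nab (lie_bracket M X Y) (F a) w) (F c w)
      - g w (nab X (nab Y (F a)) w) (F c w) + g w (nab Y (nab X (F a)) w) (F c w)"
      unfolding curvature_def plus_fun_apply minus_apply
        g_add_left[OF T_diff[OF T1 T2] T3 FT] g_diff_left[OF T1 T2 FT] ..
    then show ?thesis
      unfolding g_nab_nab[OF X Y a c w] g_nab_nab[OF Y X a c w] q_def conn_coeff_def by simp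
  qed
  \<comment> \<open>The \<open>j\<close>-trace vanishes on all of \<open>Q\<close> and
    \<open>j\<close> is constant, so the trace of the differentiated entries vanishes too.\<close>
  have dtr: "(\<Sum>a\<in>I. \<Sum>c\<in>I. j a c * X w (?k Y a c)) = 0" if X: "X \<in> vfields M Q" and Y: "Y \<in> vfields M Q" for X Y
  proof -
    have XT: "X w \<in> T w" by (rule vfields_T[OF X w])
    have wt: "w \<in> topspace (mtop M)" by (rule opn_topspace[OF Q w])
    have s: "snear w (\<lambda>q. j a c * ?k Y a c q)" if "a \<in> I" "c \<in> I" for a c
      by (rule snear_mult[OF snear_const[OF wt] conn_coeff_smooth[OF Y that w]])
    have "X w (\<lambda>q. \<Sum>a\<in>I. \<Sum>c\<in>I. j a c * ?k Y a c q) = X w (\<lambda>q. 0)"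
      by (rule T_cong[OF XT Q w]) (rule tr[OF Y])
    also have "\<dots> = 0" by (rule T_deriv_const[OF XT])
    also have "X w (\<lambda>q. \<Sum>a\<in>I. \<Sum>c\<in>I. j a c * ?k Y a c q) = (\<Sum>a\<in>I. X w (\<lambda>q. \<Sum>c\<in>I. j a c * ?k Y a c q))"
      by (rule T_deriv_sum[OF XT]) (intro snear_sum[OF wt] s; assumption)
    also have "\<dots> = (\<Sum>a\<in>I. \<Sum>c\<in>I. X w (\<lambda>q. j a c * ?k Y a c q))"
      by (intro sum.cong refl T_deriv_sum[OF XT] s; assumption)
    also have "\<dots> = (\<Sum>a\<in>I. \<Sum>c\<in>I. j a c * X w (?k Y a c))"
      by (intro sum.cong refl T_deriv_cmult[OF XT] conn_coeff_smooth[OF Y _ _ w]; assumption)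
    finally show ?thesis .
  qed
  \<comment> \<open>Skewness of \<open>j\<close> and reordering bring both quadratic terms to the
    form of a trace with the matrix of \<open>Y\<close> in front: here it multiplies the product of
    the matrix of \<open>X\<close> with \<open>j\<close>, in \<open>q2\<close> that of
    \<open>j\<close> with the matrix of \<open>X\<close>.\<close>
  have q1: "(\<Sum>a\<in>I. \<Sum>c\<in>I. j a c * q X Y a c) = - (\<Sum>a\<in>I. \<Sum>b\<in>I. ?k Y a b w * (\<Sum>c\<in>I. ?k X b c w * j c a))" for X Y
  proof -
    have "(\<Sum>a\<in>I. \<Sum>c\<in>I. j a c * q X Y a c) = (\<Sum>a\<in>I. \<Sum>c\<in>I. \<Sum>b\<in>I. - (?k Y a b w * (?k X b c w * j c a)))"
      unfolding q_def sum_distrib_left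
    proof (intro sum.cong refl)
      fix a c b assume "a \<in> I" "c \<in> I"
      then show "j a c * (?k Y a b w * ?k X b c w) = - (?k Y a b w * (?k X b c w * j c a))"
        using skew[of a c] by simp
    qed
    also have "\<dots> = (\<Sum>a\<in>I. \<Sum>b\<in>I. \<Sum>c\<in>I. - (?k Y a b w * (?k X b c w * j c a)))"
      by (intro sum.cong refl sum.swap)
    finally show ?thesis by (simp add: sum_negf sum_distrib_left)
  qed
  have q2: "(\<Sum>a\<in>I. \<Sum>c\<in>I. j a c * q Y X a c) = - (\<Sum>a\<in>I. \<Sum>b\<in>I. ?k Y a b w * (\<Sum>c\<in>I. j b c * ?k X c a w))"
  proof -
    have "(\<Sum>a\<in>I. \<Sum>c\<in>I. j a c * q Y X a c) = (\<Sum>a\<in>I. \<Sum>c\<in>I. \<Sum>b\<in>I. - (?k Y b c w * (j c a * ?k X a b w)))"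
      unfolding q_def sum_distrib_left
    proof (intro sum.cong refl)
      fix a c b assume "a \<in> I" "c \<in> I"
      then show "j a c * (?k X a b w * ?k Y b c w) = - (?k Y b c w * (j c a * ?k X a b w))"
        using skew[of a c] by simp
    qed
    also have "\<dots> = (\<Sum>a\<in>I. \<Sum>b\<in>I. \<Sum>c\<in>I. - (?k Y b c w * (j c a * ?k X a b w)))"
      by (intro sum.cong refl sum.swap)
    also have "\<dots> = (\<Sum>b\<in>I. \<Sum>a\<in>I. \<Sum>c\<in>I. - (?k Y b c w * (j c a * ?k X a b w)))"
      by (rule sum.swap)
    also have "\<dots> = (\<Sum>b\<in>I. \<Sum>c\<in>I. \<Sum>a\<in>I. - (?k Y b c w * (j c a * ?k X a b w)))"
      by (intro sum.cong refl sum.swap)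
    finally show ?thesis by (simp add: sum_negf sum_distrib_left)
  qed
  have qq: "(\<Sum>a\<in>I. \<Sum>c\<in>I. j a c * q X Y a c) = (\<Sum>a\<in>I. \<Sum>c\<in>I. j a c * q Y X a c)"
    using q1[of X Y] q2 comm[OF X w] by simp
  have "(\<Sum>a\<in>I. \<Sum>c\<in>I. j a c * g w (curvature M nab X Y (F a) w) (F c w)) =
    (\<Sum>a\<in>I. \<Sum>c\<in>I. j a c * ?k (lie_bracket M X Y) a c w) - (\<Sum>a\<in>I. \<Sum>c\<in>I. j a c * X w (?k Y a c))
    - (\<Sum>a\<in>I. \<Sum>c\<in>I. j a c * q X Y a c) + (\<Sum>a\<in>I. \<Sum>c\<in>I. j a c * Y w (?k X a c))
    + (\<Sum>a\<in>I. \<Sum>c\<in>I. j a c * q Y X a c)"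
    unfolding sum.distrib[symmetric] sum_subtractf[symmetric]
    by (intro sum.cong refl) (simp add: cv algebra_simps)
  then show ?thesis using tr[OF br w] dtr[OF X Y] dtr[OF Y X] qq by simp
qed

text \<open>The Ricci form is a definite description over all \<open>nat\<close>-indexed frames.
  Each of them is expanded in \<open>F\<close>, where the rows of \<open>j\<close> are the
  components of \<open>J\<close>, so that the sum becomes the \<open>j\<close>-trace of the
  curvature.\<close>

lemma ricci_form_eq_0:
  fixes J :: "'a \<Rightarrow> 'a tvec \<Rightarrow> 'a tvec"
  assumes skew: "\<And>a c. a \<in> I \<Longrightarrow> c \<in> I \<Longrightarrow> j a c = - j c a"
    and comm: "\<And>X w a c. X \<in> vfields M Q \<Longrightarrow> w \<in> Q \<Longrightarrow> a \<in> I \<Longrightarrow> c \<in> I \<Longrightarrow>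
       (\<Sum>b\<in>I. j a b * conn_coeff F X b c w) = (\<Sum>b\<in>I. conn_coeff F X a b w * j b c)"
    and tr: "\<And>X w. X \<in> vfields M Q \<Longrightarrow> w \<in> Q \<Longrightarrow> (\<Sum>a\<in>I. \<Sum>c\<in>I. j a c * conn_coeff F X a c w) = 0"
    and X: "X \<in> vfields M Q" and Y: "Y \<in> vfields M Q" and w: "w \<in> Q"
    and JT: "\<And>u. u \<in> T w \<Longrightarrow> J w u \<in> T w"
    and Jadd: "\<And>u v. u \<in> T w \<Longrightarrow> v \<in> T w \<Longrightarrow> J w (u + v) = J w u + J w v"
    and Jscale: "\<And>u c. u \<in> T w \<Longrightarrow> J w (tscale c u) = tscale c (J w u)"
    and JF: "\<And>a. a \<in> I \<Longrightarrow> J w (F a w) = (\<Sum>c\<in>I. tscale (j a c) (F c w))"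
  shows "ricci_form M J g nab X Y w = 0"
proof -
  have wt: "w \<in> topspace (mtop M)" by (rule opn_topspace[OF Q w])
  have FT: "F b w \<in> T w" if "b \<in> I" for b by (rule vfields_T[OF F[OF that] w])
  have zero: "(\<Sum>i<DIM('e). g w (curvature M nab X Y (E i) w) (J w (E i w))) = 0"
    if E: "orthonormal_frame M g U E" and wU: "w \<in> U" for U E
  proof -
    define W where "W = U \<inter> Q"
    have U: "opn U" and Ev: "\<And>i. i < DIM('e) \<Longrightarrow> E i \<in> vfields M U" using E by (auto simp: orthonormal_frame_def)
    have W: "opn W" unfolding W_def by (rule opn_Int[OF U Q])
    have wO: "w \<in> W" using wU w by (simp add: W_def)
    have EO: "E i \<in> vfields M W" if "i < DIM('e)" for i by (rule vfields_restrict[OF Ev[OF that]]) (auto simp: W_def)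
    have FO: "F a \<in> vfields M W" if "a \<in> I" for a by (rule vfields_restrict[OF F[OF that]]) (auto simp: W_def)
    have XO: "X \<in> vfields M W" by (rule vfields_restrict[OF X]) (auto simp: W_def)
    have YO: "Y \<in> vfields M W" by (rule vfields_restrict[OF Y]) (auto simp: W_def)
    have cT: "curvature M nab X Y (F a) w \<in> T w" if "a \<in> I" for a
    proof -
      have "curvature M nab X Y (F a) w = nab (lie_bracket M X Y) (F a) w - nab X (nab Y (F a)) w + nab Y (nab X (F a)) w"
        by (rule ext) (simp add: curvature_def)
      also have "\<dots> \<in> T w"
        by (intro T_add T_diff nab_T[OF W _ _ wO] nab_vfields[OF W] vfields_lie_bracket[OF W] XO YO FO that)
      finally show ?thesis .
    qed
    \<comment> \<open>The matrix of the form whose trace is the Ricci sum; curvature and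
      \<open>J\<close> are both linear at \<open>w\<close>, which allows passing from
      \<open>E\<close> to \<open>F\<close> by \<open>onb_trace\<close>.\<close>
    define r where "r a c = g w (curvature M nab X Y (F a) w) (J w (F c w))" for a c
    let ?c = "\<lambda>i a. g w (E i w) (F a w)"
    have Ex: "g w (curvature M nab X Y (E i) w) (J w (E i w)) = (\<Sum>a\<in>I. \<Sum>c\<in>I. ?c i a * ?c i c * r a c)"
      if i: "i < DIM('e)" for i
    proof -
      have ET: "E i w \<in> T w" by (rule vfields_T[OF EO[OF i] wO])
      have 1: "curvature M nab X Y (E i) w = (\<Sum>a\<in>I. tscale (?c i a) (curvature M nab X Y (F a) w))"
      proof (rule curvature_lincomb[OF W XO YO wO FO _ EO[OF i]])
        show "snear q (\<lambda>q. g q (E i q) (F a q))" if "a \<in> I" "q \<in> W" for a q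
          by (rule g_snear[OF W EO[OF i] FO[OF that(1)] that(2)])
        show "E i q = (\<Sum>a\<in>I. tscale (g q (E i q) (F a q)) (F a q))" if "q \<in> W" for q
          by (rule onb_expand[OF on vfields_T[OF EO[OF i] that]]) (use that in \<open>simp add: W_def\<close>)
      qed
      have "J w (E i w) = J w (\<Sum>a\<in>I. tscale (?c i a) (F a w))"
        using onb_expand[OF on[OF w] ET] by (rule arg_cong)
      also have "\<dots> = (\<Sum>a\<in>I. tscale (?c i a) (J w (F a w)))"
        by (rule linear_on_T_lincomb[OF wt Jadd Jscale FT])
      finally have 2: "J w (E i w) = (\<Sum>a\<in>I. tscale (?c i a) (J w (F a w)))" .
      have "g w (curvature M nab X Y (E i) w) (J w (E i w)) = (\<Sum>a\<in>I. ?c i a * g w (curvature M nab X Y (F a) w) (J w (E i w)))"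
        unfolding 1 by (rule g_lincomb_left[OF JT[OF ET] cT])
      also have "\<dots> = (\<Sum>a\<in>I. ?c i a * (\<Sum>c\<in>I. ?c i c * r a c))"
        unfolding 2 r_def by (intro sum.cong refl arg_cong2[where f="(*)"] g_lincomb_right cT JT FT; assumption)
      finally show ?thesis by (simp add: sum_distrib_left mult.assoc)
    qed
    have "(\<Sum>i<DIM('e). g w (curvature M nab X Y (E i) w) (J w (E i w))) =
      (\<Sum>i<DIM('e). \<Sum>a\<in>I. \<Sum>c\<in>I. ?c i a * ?c i c * r a c)" by (intro sum.cong refl Ex) simp
    also have "\<dots> = (\<Sum>a\<in>I. r a a)" by (rule onb_trace[OF frame_onb[OF E wU] on[OF w]])
    also have "\<dots> = (\<Sum>a\<in>I. \<Sum>c\<in>I. j a c * g w (curvature M nab X Y (F a) w) (F c w))"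
    proof (intro sum.cong refl)
      fix a assume a: "a \<in> I"
      show "r a a = (\<Sum>c\<in>I. j a c * g w (curvature M nab X Y (F a) w) (F c w))"
        unfolding r_def JF[OF a] by (rule g_lincomb_right[OF cT[OF a] FT])
    qed
    also have "\<dots> = 0" by (rule curvature_trace_eq_0[OF skew comm tr X Y w])
    finally show ?thesis .
  qed
  obtain U E where E: "orthonormal_frame M g U E" "w \<in> U" using ex_orthonormal_frame[OF wt] .
  show ?thesis
    unfolding ricci_form_def
  proof (rule the_equality)
    show "\<exists>U E. orthonormal_frame M g U E \<and> w \<in> U \<and>
        0 = 1/2 * (\<Sum>i<DIM('e). g w (curvature M nab X Y (E i) w) (J w (E i w)))"
      by (intro exI[of _ U] exI[of _ E] conjI E) (simp add: zero[OF E])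
  next
    fix r assume "\<exists>U E. orthonormal_frame M g U E \<and> w \<in> U \<and>
        r = 1/2 * (\<Sum>i<DIM('e). g w (curvature M nab X Y (E i) w) (J w (E i w)))"
    then obtain U E where UE: "orthonormal_frame M g U E" "w \<in> U"
      and r: "r = 1/2 * (\<Sum>i<DIM('e). g w (curvature M nab X Y (E i) w) (J w (E i w)))" by (elim exE conjE)
    show "r = 0" unfolding r zero[OF UE] by simp
  qed
qed

end

end

section \<open>Integrability of the complex structure\<close>

context flat_conn
begin

interpretation tb: smooth_mfd TM
  by unfold_locales (rule smooth_manifold_TM)

definition nij :: "('a \<times> 'a tvec) vfield \<Rightarrow> ('a \<times> 'a tvec) vfield \<Rightarrow> ('a \<times> 'a tvec) vfield" where
  "nij X Y z = lie_bracket TM (field_map J X) (field_map J Y) z - J z (lie_bracket TM (field_map J X) Y z)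
     - J z (lie_bracket TM X (field_map J Y) z) - lie_bracket TM X Y z"

lemma J_diff:
  assumes z: "z \<in> B" and \<xi>: "\<xi> \<in> tangent_space TM z" and \<eta>: "\<eta> \<in> tangent_space TM z"
  shows "J z (\<xi> - \<eta>) = J z \<xi> - J z \<eta>"
  using J_add[OF z \<xi> tb.T_uminus[OF \<eta>]] J_uminus[OF z \<eta>] by simp

lemma J_zero: "z \<in> B \<Longrightarrow> J z 0 = 0"
  using J_diff[of z 0 0] tb.T_zero[of z] by (simp add: topspace_TM)

context
  fixes Q assumes Q: "openin (mtop TM) Q"
begin

lemma Q_B: "z \<in> Q \<Longrightarrow> z \<in> B"
  using tb.opn_topspace[OF Q] by (simp only: topspace_TM)

lemma nij_cong:
  assumes X: "X \<in> vfields TM Q" and Y: "Y \<in> vfields TM Q" and z: "z \<in> Q"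
    and eq: "\<And>w. w \<in> Q \<Longrightarrow> X w = X' w" "\<And>w. w \<in> Q \<Longrightarrow> Y w = Y' w"
  shows "nij X Y z = nij X' Y' z"
proof -
  note JX = tb.vfields_T[OF J_vfields[OF Q X] z] and JY = tb.vfields_T[OF J_vfields[OF Q Y] z]
  note TX = tb.vfields_T[OF X z] and TY = tb.vfields_T[OF Y z]
  have Jeq: "field_map J X w = field_map J X' w" "field_map J Y w = field_map J Y' w" if "w \<in> Q" for w
    using eq[OF that] by (simp_all add: field_map_def)
  have 1: "lie_bracket TM (field_map J X) (field_map J Y) z = lie_bracket TM (field_map J X') (field_map J Y') z"
    by (rule tb.lie_bracket_cong[OF Q z]) (assumption | rule Jeq JX JY)+
  have 2: "lie_bracket TM (field_map J X) Y z = lie_bracket TM (field_map J X') Y' z"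
    by (rule tb.lie_bracket_cong[OF Q z]) (assumption | rule Jeq eq JX TY)+
  have 3: "lie_bracket TM X (field_map J Y) z = lie_bracket TM X' (field_map J Y') z"
    by (rule tb.lie_bracket_cong[OF Q z]) (assumption | rule Jeq eq TX JY)+
  have 4: "lie_bracket TM X Y z = lie_bracket TM X' Y' z"
    by (rule tb.lie_bracket_cong[OF Q z]) (assumption | rule eq TX TY)+
  show ?thesis unfolding nij_def 1 2 3 4 ..
qed

section \<open>Tensoriality of the Nijenhuis expression\<close>

context
  fixes z assumes z: "z \<in> Q"
begin

lemma nij_swap:
  assumes X: "X \<in> vfields TM Q" and Y: "Y \<in> vfields TM Q"
  shows "nij X Y z = - nij Y X z"
proof -
  have J: "J z (lie_bracket TM A C z) = - J z (lie_bracket TM C A z)" if "A \<in> vfields TM Q" "C \<in> vfields TM Q" for A C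
    using J_uminus[OF Q_B[OF z] tb.lie_bracket_T[OF Q that(2,1) z]] tb.lie_bracket_swap[of A C z] by simp
  show ?thesis
    unfolding nij_def J[OF J_vfields[OF Q X] Y] J[OF X J_vfields[OF Q Y]]
      tb.lie_bracket_swap[of X Y z] tb.lie_bracket_swap[of "field_map J X" "field_map J Y" z]
    by (simp add: algebra_simps)
qed

lemma nij_add:
  assumes X: "X \<in> vfields TM Q" and X': "X' \<in> vfields TM Q" and Y: "Y \<in> vfields TM Q"
  shows "nij (X + X') Y z = nij X Y z + nij X' Y z"
proof -
  note JX = J_vfields[OF Q X] and JX' = J_vfields[OF Q X'] and JY = J_vfields[OF Q Y]
  note XX = tb.vfields_add[OF Q X X']
  have Jeq: "field_map J (X + X') w = (field_map J X + field_map J X') w" if "w \<in> Q" for w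
    unfolding field_map_def plus_fun_def[of X] plus_fun_def[of "\<lambda>p. J p (X p)"]
    by (rule J_add[OF Q_B[OF that] tb.vfields_T[OF X that] tb.vfields_T[OF X' that]])
  have br: "lie_bracket TM (field_map J (X + X')) A z = lie_bracket TM (field_map J X) A z + lie_bracket TM (field_map J X') A z"
    if A: "A \<in> vfields TM Q" for A
  proof -
    have "lie_bracket TM (field_map J (X + X')) A z = lie_bracket TM (field_map J X + field_map J X') A z"
      by (rule tb.lie_bracket_cong[OF Q z])
        (assumption | rule Jeq refl tb.vfields_T[OF J_vfields[OF Q XX] z] tb.vfields_T[OF A z])+
    also have "\<dots> = lie_bracket TM (field_map J X) A z + lie_bracket TM (field_map J X') A z"
      by (rule tb.lie_bracket_add_left[OF Q JX JX' A z])
    finally show ?thesis .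
  qed
  have T: "lie_bracket TM A C z \<in> tangent_space TM z" if "A \<in> vfields TM Q" "C \<in> vfields TM Q" for A C
    by (rule tb.lie_bracket_T[OF Q that z])
  show ?thesis
    unfolding nij_def br[OF Y] br[OF JY] tb.lie_bracket_add_left[OF Q X X' Y z] tb.lie_bracket_add_left[OF Q X X' JY z]
      J_add[OF Q_B[OF z] T[OF JX Y] T[OF JX' Y]] J_add[OF Q_B[OF z] T[OF X JY] T[OF X' JY]]
    by (simp add: algebra_simps)
qed

text \<open>The derivatives of \<open>f\<close> cancel in pairs: those along \<open>J Y\<close>
  between the first and third summand, those along \<open>Y\<close> between the second and fourth,
  where \<open>J (J X) = - X\<close> supplies the sign.\<close>

lemma nij_fscale:
  assumes X: "X \<in> vfields TM Q" and Y: "Y \<in> vfields TM Q" and f: "\<And>w. w \<in> Q \<Longrightarrow> smooth_near TM w f"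
  shows "nij (fscale f X) Y z = tscale (f z) (nij X Y z)"
proof -
  note JX = J_vfields[OF Q X] and JY = J_vfields[OF Q Y]
  have fX: "fscale f X \<in> vfields TM Q" by (rule tb.vfields_fscale[OF Q X f])
  have Jeq: "field_map J (fscale f X) w = fscale f (field_map J X) w" if "w \<in> Q" for w
    unfolding field_map_def fscale_def
    by (rule J_scale[OF Q_B[OF that] tb.vfields_T[OF X that] tb.vfields_T[OF X that]])
  have br: "lie_bracket TM (field_map J (fscale f X)) A z =
      tscale (f z) (lie_bracket TM (field_map J X) A z) - tscale (A z f) (J z (X z))"
    if A: "A \<in> vfields TM Q" for A
  proof -
    have "lie_bracket TM (field_map J (fscale f X)) A z = lie_bracket TM (fscale f (field_map J X)) A z"
      by (rule tb.lie_bracket_cong[OF Q z])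
        (assumption | rule Jeq refl tb.vfields_T[OF J_vfields[OF Q fX] z] tb.vfields_T[OF A z])+
    also have "\<dots> = tscale (f z) (lie_bracket TM (field_map J X) A z) - tscale (A z f) (field_map J X z)"
      by (rule tb.lie_bracket_fscale_left[OF Q JX A z f[OF z]])
    finally show ?thesis by (simp only: field_map_def)
  qed
  have T: "lie_bracket TM A C z \<in> tangent_space TM z" if "A \<in> vfields TM Q" "C \<in> vfields TM Q" for A C
    by (rule tb.lie_bracket_T[OF Q that z])
  note zB = Q_B[OF z] and XT = tb.vfields_T[OF X z]
  note JXT = J_T[OF zB XT XT]
  have 1: "J z (lie_bracket TM (field_map J (fscale f X)) Y z) =
      tscale (f z) (J z (lie_bracket TM (field_map J X) Y z)) - tscale (Y z f) (- X z)"
    unfolding br[OF Y] J_diff[OF zB tb.T_scale[OF T[OF JX Y]] tb.T_scale[OF JXT]]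
      J_scale[OF zB T[OF JX Y] T[OF JX Y]] J_scale[OF zB JXT JXT] J_J[OF zB XT XT] ..
  have 2: "J z (lie_bracket TM (fscale f X) (field_map J Y) z) =
      tscale (f z) (J z (lie_bracket TM X (field_map J Y) z)) - tscale (field_map J Y z f) (J z (X z))"
    unfolding tb.lie_bracket_fscale_left[OF Q X JY z f[OF z]] J_diff[OF zB tb.T_scale[OF T[OF X JY]] tb.T_scale[OF XT]]
      J_scale[OF zB T[OF X JY] T[OF X JY]] J_scale[OF zB XT XT] ..
  show ?thesis
    by (rule ext) (simp add: nij_def 1 2 br[OF JY] tb.lie_bracket_fscale_left[OF Q X Y z f[OF z]] algebra_simps)
qed

lemma nij_lincomb:
  assumes Y: "Y \<in> vfields TM Q"
  shows "(\<And>i. i \<in> I \<Longrightarrow> E i \<in> vfields TM Q) \<Longrightarrow> (\<And>i w. i \<in> I \<Longrightarrow> w \<in> Q \<Longrightarrow> smooth_near TM w (f i)) \<Longrightarrow>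
    (\<And>i. i \<in> I \<Longrightarrow> nij (E i) Y z = 0) \<Longrightarrow> nij (\<Sum>i\<in>I. fscale (f i) (E i)) Y z = 0"
proof (induction I rule: infinite_finite_induct)
  case (insert i I)
  have Ei: "E i \<in> vfields TM Q" and fi: "\<And>w. w \<in> Q \<Longrightarrow> smooth_near TM w (f i)" and ni: "nij (E i) Y z = 0"
    using insert.prems by auto
  have fE: "fscale (f i) (E i) \<in> vfields TM Q" by (rule tb.vfields_fscale[OF Q Ei fi])
  have S: "(\<Sum>i\<in>I. fscale (f i) (E i)) \<in> vfields TM Q"
    using insert.prems(1,2) by (intro tb.vfields_sum[OF Q] tb.vfields_fscale[OF Q]) auto
  have "nij (\<Sum>i\<in>I. fscale (f i) (E i)) Y z = 0" using insert by blast
  moreover have "nij (fscale (f i) (E i)) Y z = tscale (f i z) (nij (E i) Y z)"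
    by (rule nij_fscale[OF Ei Y fi])
  ultimately show ?case
    unfolding sum.insert[OF insert.hyps] nij_add[OF fE S Y] ni by (simp add: fun_eq_iff)
qed (use nij_add[OF tb.vfields_zero[OF Q] tb.vfields_zero[OF Q] Y] in simp_all)

text \<open>By tensoriality in the first argument it suffices to know the expression on lifts of
  coordinate fields.\<close>

lemma nij_expand:
  assumes X: "X \<in> vfields TM Q" and Y: "Y \<in> vfields TM Q" and c: "(V, \<phi>) \<in> atlas M" and QV: "Q \<subseteq> bo V"
    and h: "\<And>b. nij (hl (cvec V \<phi> b)) Y z = 0" and v: "\<And>b. nij (vl (cvec V \<phi> b)) Y z = 0"
  shows "nij X Y z = 0"
proof -
  have V: "opn V" by (rule chart_opn[OF c])
  obtain a k where ak: "\<forall>b. \<forall>w\<in>Q. smooth_near TM w (a b)" "\<forall>b. \<forall>w\<in>Q. smooth_near TM w (k b)"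
    "\<forall>w\<in>Q. X w = hlift w (\<Sum>b\<in>Basis. tscale (a b w) (cvec V \<phi> b (fst w)))
        + vlift w (\<Sum>b\<in>Basis. tscale (k b w) (cvec V \<phi> b (fst w)))"
    using TM_coeffs[OF Q X c QV] .
  have hQ: "hl (cvec V \<phi> b) \<in> vfields TM Q" "vl (cvec V \<phi> b) \<in> vfields TM Q" for b
    using tb.vfields_restrict[OF hl_vfields[OF V vfields_cvec[OF c]] QV]
      tb.vfields_restrict[OF vl_vfields[OF V vfields_cvec[OF c]] QV] by auto
  let ?H = "\<Sum>b\<in>Basis. fscale (a b) (hl (cvec V \<phi> b))" and ?K = "\<Sum>b\<in>Basis. fscale (k b) (vl (cvec V \<phi> b))"
  have H: "?H \<in> vfields TM Q" "?K \<in> vfields TM Q"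
    using ak(1,2) by (auto intro!: tb.vfields_sum[OF Q] tb.vfields_fscale[OF Q] hQ)
  have "nij X Y z = nij (?H + ?K) Y z"
  proof (rule nij_cong[OF X Y z])
    fix w assume w: "w \<in> Q"
    have wB: "w \<in> B" and wV: "fst w \<in> V" using w Q_B QV by (auto simp: mem_bo)
    have cT: "cvec V \<phi> b (fst w) \<in> T (fst w)" for b by (rule cvec_in_T[OF c wV])
    have "X w = hlift w (\<Sum>b\<in>Basis. tscale (a b w) (cvec V \<phi> b (fst w)))
        + vlift w (\<Sum>b\<in>Basis. tscale (k b w) (cvec V \<phi> b (fst w)))" using ak(3) w by blast
    also have "\<dots> = (\<Sum>b\<in>Basis. tscale (a b w) (hl (cvec V \<phi> b) w)) + (\<Sum>b\<in>Basis. tscale (k b w) (vl (cvec V \<phi> b) w))"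
      unfolding hlift_lincomb[OF wB cT] vlift_lincomb[OF wB cT] hl_def vl_def ..
    finally show "X w = (?H + ?K) w"
      by (simp only: plus_fun_apply[where x=w] sum_fun_apply[where x=w] fscale_apply)
  qed simp
  also have "\<dots> = 0"
    unfolding nij_add[OF H Y] using nij_lincomb[OF Y hQ(1) _ h, of Basis a] nij_lincomb[OF Y hQ(2) _ v, of Basis k] ak(1,2)
    by simp
  finally show ?thesis .
qed

end

end

section \<open>The Nijenhuis expression on lifts\<close>

context
  fixes U X Y z assumes U: "opn U" and X: "X \<in> vfields M U" and Y: "Y \<in> vfields M U" and z: "z \<in> bo U"
begin

lemma J_hl: "W \<in> vfields M U \<Longrightarrow> w \<in> bo U \<Longrightarrow> field_map J (hl W) w = vl W w"
  unfolding field_map_def hl_def vl_def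
  by (rule J_hlift[OF bo_B[OF U] vfields_T]) (auto simp: mem_bo)

lemma J_vl:
  assumes W: "W \<in> vfields M U" and w: "w \<in> bo U"
  shows "field_map J (vl W) w = (- hl W) w"
proof -
  have p: "fst w \<in> U" using w by (simp add: mem_bo)
  have "field_map J (vl W) w = - hl W w"
    unfolding field_map_def hl_def vl_def by (rule J_vlift[OF bo_B[OF U w] vfields_T[OF W p]])
  also have "\<dots> = (- hl W) w" by (rule ext) simp
  finally show ?thesis .
qed

lemma bracket_J:
  assumes A: "A \<in> vfields TM (bo U)" and W: "W \<in> vfields M U"
  shows "lie_bracket TM (field_map J (hl W)) A z = lie_bracket TM (vl W) A z" (is ?a)
    and "lie_bracket TM (field_map J (vl W)) A z = - lie_bracket TM (hl W) A z" (is ?b)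
    and "lie_bracket TM A (field_map J (hl W)) z = lie_bracket TM A (vl W) z"
    and "lie_bracket TM A (field_map J (vl W)) z = - lie_bracket TM A (hl W) z"
proof -
  note o = bo_open[OF U]
  note AT = tb.vfields_T[OF A z]
  note hT = tb.vfields_T[OF J_vfields[OF o hl_vfields[OF U W]] z]
  note vT = tb.vfields_T[OF J_vfields[OF o vl_vfields[OF U W]] z]
  show a: ?a
    by (rule tb.lie_bracket_cong[OF o z]) (assumption | rule J_hl[OF W] refl hT AT)+
  have "lie_bracket TM (field_map J (vl W)) A z = lie_bracket TM (- hl W) A z"
    by (rule tb.lie_bracket_cong[OF o z]) (assumption | rule J_vl[OF W] refl vT AT)+
  also have "\<dots> = - lie_bracket TM (hl W) A z" by (rule tb.lie_bracket_uminus_left[OF o hl_vfields[OF U W] A z])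
  finally show b: ?b .
  show "lie_bracket TM A (field_map J (hl W)) z = lie_bracket TM A (vl W) z"
    unfolding tb.lie_bracket_swap[of A] a ..
  show "lie_bracket TM A (field_map J (vl W)) z = - lie_bracket TM A (hl W) z"
    unfolding tb.lie_bracket_swap[of A] b ..
qed

lemma bracket_vl_hl: "lie_bracket TM (vl X) (hl Y) z = - vl (nab Y X) z"
  using tb.lie_bracket_swap[of "vl X" "hl Y" z] bracket_hl_vl[OF U Y X z] by simp

lemma bracket_J_J:
  shows bracket_J_hl_hl: "lie_bracket TM (field_map J (hl X)) (field_map J (hl Y)) z = 0"
    and bracket_J_hl_vl: "lie_bracket TM (field_map J (hl X)) (field_map J (vl Y)) z = vl (nab Y X) z"
    and bracket_J_vl_hl: "lie_bracket TM (field_map J (vl X)) (field_map J (hl Y)) z = - vl (nab X Y) z"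
    and bracket_J_vl_vl: "lie_bracket TM (field_map J (vl X)) (field_map J (vl Y)) z = hl (lie_bracket M X Y) z"
proof -
  note o = bo_open[OF U]
  note JhY = J_vfields[OF o hl_vfields[OF U Y]] and JvY = J_vfields[OF o vl_vfields[OF U Y]]
  note hX = hl_vfields[OF U X] and vX = vl_vfields[OF U X]
  show "lie_bracket TM (field_map J (hl X)) (field_map J (hl Y)) z = 0"
    unfolding bracket_J(1)[OF JhY X] bracket_J(3)[OF vX Y] by (rule bracket_vl_vl[OF U X Y z])
  show "lie_bracket TM (field_map J (hl X)) (field_map J (vl Y)) z = vl (nab Y X) z"
    unfolding bracket_J(1)[OF JvY X] bracket_J(4)[OF vX Y] bracket_vl_hl by simp
  show "lie_bracket TM (field_map J (vl X)) (field_map J (hl Y)) z = - vl (nab X Y) z"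
    unfolding bracket_J(2)[OF JhY X] bracket_J(3)[OF hX Y] bracket_hl_vl[OF U X Y z] ..
  show "lie_bracket TM (field_map J (vl X)) (field_map J (vl Y)) z = hl (lie_bracket M X Y) z"
    unfolding bracket_J(2)[OF JvY X] bracket_J(4)[OF hX Y] bracket_hl_hl[OF U X Y z] by simp
qed

text \<open>After inserting the brackets, each of the three expressions is up to sign a lift of
  \<open>\<nabla>_X Y - \<nabla>_Y X - [X, Y]\<close>, which is the torsion.\<close>

lemma nij_lifts:
  shows nij_hl_hl: "nij (hl X) (hl Y) z = 0" and nij_hl_vl: "nij (hl X) (vl Y) z = 0"
    and nij_vl_vl: "nij (vl X) (vl Y) z = 0"
proof -
  note zB = bo_B[OF U z]
  have p: "fst z \<in> U" using z by (simp add: mem_bo)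
  note o = bo_open[OF U]
  note hX = hl_vfields[OF U X] and vX = vl_vfields[OF U X]
  note hY = hl_vfields[OF U Y] and vY = vl_vfields[OF U Y]
  have XY: "nab X Y (fst z) \<in> T (fst z)" and YX: "nab Y X (fst z) \<in> T (fst z)"
    by (rule nab_T[OF U X Y p] nab_T[OF U Y X p])+
  have br: "lie_bracket M X Y (fst z) = nab X Y (fst z) - nab Y X (fst z)" by (rule nab_torsion[OF U X Y p, symmetric])
  have hb: "hl (lie_bracket M X Y) z = hlift z (nab X Y (fst z)) - hlift z (nab Y X (fst z))"
    unfolding hl_def br by (rule hlift_diff[OF zB XY YX])
  have Jh: "J z (hlift z x) = vlift z x" if "x \<in> T (fst z)" for x by (rule J_hlift[OF zB that])
  have Jv: "J z (vlift z x) = - hlift z x" if "x \<in> T (fst z)" for x by (rule J_vlift[OF zB that])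
  have Jmv: "J z (- vlift z x) = hlift z x" if "x \<in> T (fst z)" for x
    using J_uminus[OF zB vlift_T[OF zB that]] Jv[OF that] by simp
  have Jmh: "J z (- (hlift z x - hlift z y)) = vlift z y - vlift z x" if "x \<in> T (fst z)" "y \<in> T (fst z)" for x y
    unfolding J_uminus[OF zB tb.T_diff[OF hlift_T[OF zB that(1)] hlift_T[OF zB that(2)]]]
      J_diff[OF zB hlift_T[OF zB that(1)] hlift_T[OF zB that(2)]] Jh[OF that(1)] Jh[OF that(2)] by simp
  show "nij (hl X) (hl Y) z = 0"
    unfolding nij_def bracket_J_hl_hl bracket_J(1)[OF hY X] bracket_J(3)[OF hX Y] bracket_vl_hl
      bracket_hl_vl[OF U X Y z] bracket_hl_hl[OF U X Y z] hb vl_def Jv[OF XY] Jmv[OF YX] by simp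
  show "nij (hl X) (vl Y) z = 0"
    unfolding nij_def bracket_J_hl_vl bracket_J(1)[OF vY X] bracket_J(4)[OF hX Y] bracket_vl_vl[OF U X Y z]
      bracket_hl_vl[OF U X Y z] bracket_hl_hl[OF U X Y z] hb vl_def J_zero[OF zB] Jmh[OF XY YX] by simp
  show "nij (vl X) (vl Y) z = 0"
    unfolding nij_def bracket_J_vl_vl bracket_J(2)[OF vY X] bracket_J(4)[OF vX Y] bracket_vl_vl[OF U X Y z]
      bracket_hl_vl[OF U X Y z] bracket_vl_hl hb vl_def Jmv[OF XY] minus_minus Jv[OF YX] by simp
qed

end

text \<open>\<open>nij_expand\<close> treats the first argument only; skew symmetry moves the second
  argument into first place.\<close>

lemma nij_eq_0:
  assumes Q: "openin (mtop TM) Q" and X: "X \<in> vfields TM Q" and Y: "Y \<in> vfields TM Q" and z: "z \<in> Q"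
  shows "nij X Y z = 0"
proof -
  obtain V \<phi> where c: "(V, \<phi>) \<in> atlas M" "openin (mtop TM) (Q \<inter> bo V)" "z \<in> Q \<inter> bo V"
    using TM_chart_nhd[OF Q z] .
  have V: "opn V" by (rule chart_opn[OF c(1)])
  have zV: "z \<in> bo V" using c(3) by simp
  let ?Q = "Q \<inter> bo V"
  have XQ: "X \<in> vfields TM ?Q" by (rule tb.vfields_restrict[OF X]) auto
  have YQ: "Y \<in> vfields TM ?Q" by (rule tb.vfields_restrict[OF Y]) auto
  note cv = vfields_cvec[OF c(1)]
  have hQ: "hl (cvec V \<phi> b) \<in> vfields TM ?Q" for b by (rule tb.vfields_restrict[OF hl_vfields[OF V cv]]) auto
  have vQ: "vl (cvec V \<phi> b) \<in> vfields TM ?Q" for b by (rule tb.vfields_restrict[OF vl_vfields[OF V cv]]) auto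
  have vh: "nij (vl (cvec V \<phi> b)) (hl (cvec V \<phi> d)) z = 0" for b d
    unfolding nij_swap[OF c(2,3) vQ hQ] nij_hl_vl[OF V cv cv zV] by simp
  have 1: "nij (hl (cvec V \<phi> b)) Y z = 0" for b
    unfolding nij_swap[OF c(2,3) hQ YQ]
      nij_expand[OF c(2,3) YQ hQ c(1) Int_lower2 nij_hl_hl[OF V cv cv zV] vh] by simp
  have 2: "nij (vl (cvec V \<phi> b)) Y z = 0" for b
    unfolding nij_swap[OF c(2,3) vQ YQ]
      nij_expand[OF c(2,3) YQ vQ c(1) Int_lower2 nij_hl_vl[OF V cv cv zV] nij_vl_vl[OF V cv cv zV]] by simp
  show ?thesis by (rule nij_expand[OF c(2,3) XQ YQ c(1) Int_lower2 1 2])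
qed

end

sublocale affine_riem \<subseteq> flat_conn M nab
  by unfold_locales (rule tors flat)+

section \<open>The Hermitian metric on the tangent bundle\<close>

context affine_riem
begin

interpretation tb: smooth_mfd TM
  by unfold_locales (rule smooth_manifold_TM)

abbreviation G :: "('a \<times> 'a tvec) metric_field" where "G \<equiv> g1 M nab g"

lemma G_lift:
  assumes z: "z \<in> B" and x: "x \<in> T (fst z)" and y: "y \<in> T (fst z)" and x': "x' \<in> T (fst z)" and y': "y' \<in> T (fst z)"
  shows "G z (hlift z x + vlift z y) (hlift z x' + vlift z y') = g (fst z) x x' + g (fst z) y y'"
  unfolding g1_def
proof (rule the_equality)
  show "\<exists>xa\<in>T (fst z). \<exists>ya\<in>T (fst z). \<exists>x'a\<in>T (fst z). \<exists>y'a\<in>T (fst z).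
       hlift z x + vlift z y = hlift z xa + vlift z ya \<and> hlift z x' + vlift z y' = hlift z x'a + vlift z y'a \<and>
       g (fst z) x x' + g (fst z) y y' = g (fst z) xa x'a + g (fst z) ya y'a"
    by (intro bexI[of _ x] bexI[of _ y] bexI[of _ x'] bexI[of _ y'] conjI refl x y x' y')
  fix r assume "\<exists>xa\<in>T (fst z). \<exists>ya\<in>T (fst z). \<exists>x'a\<in>T (fst z). \<exists>y'a\<in>T (fst z).
       hlift z x + vlift z y = hlift z xa + vlift z ya \<and> hlift z x' + vlift z y' = hlift z x'a + vlift z y'a \<and>
       r = g (fst z) xa x'a + g (fst z) ya y'a"
  then obtain xa ya xb yb where m: "xa \<in> T (fst z)" "ya \<in> T (fst z)" "xb \<in> T (fst z)" "yb \<in> T (fst z)"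
    and e1: "hlift z x + vlift z y = hlift z xa + vlift z ya" and e2: "hlift z x' + vlift z y' = hlift z xb + vlift z yb"
    and r: "r = g (fst z) xa xb + g (fst z) ya yb" by (elim bexE conjE)
  show "r = g (fst z) x x' + g (fst z) y y'"
    unfolding r lift_unique[OF z x y m(1,2) e1] lift_unique[OF z x' y' m(3,4) e2] ..
qed

lemma G_lifts:
  assumes z: "z \<in> B" and x: "x \<in> T (fst z)" and y: "y \<in> T (fst z)"
  shows G_hh: "G z (hlift z x) (hlift z y) = g (fst z) x y" and G_vv: "G z (vlift z x) (vlift z y) = g (fst z) x y"
    and G_hv: "G z (hlift z x) (vlift z y) = 0" and G_vh: "G z (vlift z x) (hlift z y) = 0"
proof -
  have 0: "0 \<in> T (fst z)" by (rule T_zero[OF T_topspace[OF x]])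
  note zz = hlift_zero[OF z] vlift_zero[OF z] add_0_right add_0_left
  note gz = g_zero_left[OF 0] g_zero_left[OF x] g_zero_left[OF y] g_zero_right[OF x] g_zero_right[OF y]
  show "G z (hlift z x) (hlift z y) = g (fst z) x y" using G_lift[OF z x 0 y 0] unfolding zz gz .
  show "G z (vlift z x) (vlift z y) = g (fst z) x y" using G_lift[OF z 0 x 0 y] unfolding zz gz .
  show "G z (hlift z x) (vlift z y) = 0" using G_lift[OF z x 0 0 y] unfolding zz gz .
  show "G z (vlift z x) (hlift z y) = 0" using G_lift[OF z 0 x y 0] unfolding zz gz .
qed

lemma riemannian_G: "riemannian_metric TM G"
  unfolding riemannian_metric_def
proof (intro conjI ballI allI impI)
  fix z assume "z \<in> topspace (mtop TM)"
  then have z: "z \<in> B" by (simp only: topspace_TM)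
  fix u v w c assume u: "u \<in> tangent_space TM z" and v: "v \<in> tangent_space TM z" and w: "w \<in> tangent_space TM z"
  obtain x1 y1 where 1: "x1 \<in> T (fst z)" "y1 \<in> T (fst z)" and e1: "u = hlift z x1 + vlift z y1" using lift_decomp[OF z u] .
  obtain x2 y2 where 2: "x2 \<in> T (fst z)" "y2 \<in> T (fst z)" and e2: "v = hlift z x2 + vlift z y2" using lift_decomp[OF z v] .
  obtain x3 y3 where 3: "x3 \<in> T (fst z)" "y3 \<in> T (fst z)" and e3: "w = hlift z x3 + vlift z y3" using lift_decomp[OF z w] .
  show "G z u v = G z v u"
    unfolding e1 e2 G_lift[OF z 1 2] G_lift[OF z 2 1] by (simp add: g_sym[OF 1(1) 2(1)] g_sym[OF 1(2) 2(2)])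
  have s: "u + v = hlift z (x1 + x2) + vlift z (y1 + y2)"
    unfolding e1 e2 hlift_add[OF z 1(1) 2(1)] vlift_add[OF z 1(2) 2(2)] by (simp add: algebra_simps)
  show "G z (u + v) w = G z u w + G z v w"
    unfolding s unfolding e1 e2 e3 G_lift[OF z T_add[OF 1(1) 2(1)] T_add[OF 1(2) 2(2)] 3] G_lift[OF z 1 3] G_lift[OF z 2 3]
      g_add_left[OF 1(1) 2(1) 3(1)] g_add_left[OF 1(2) 2(2) 3(2)] by simp
  have k: "tscale c u = hlift z (tscale c x1) + vlift z (tscale c y1)"
    unfolding e1 hlift_scale[OF z 1(1) 1(1)] vlift_scale[OF z 1(2) 1(2)] by (simp add: fun_eq_iff algebra_simps)
  show "G z (tscale c u) v = c * G z u v"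
    unfolding k unfolding e1 e2 G_lift[OF z T_scale[OF 1(1)] T_scale[OF 1(2)] 2] G_lift[OF z 1 2]
      g_scale_left[OF 1(1) 2(1)] g_scale_left[OF 1(2) 2(2)] by (simp add: algebra_simps)
  assume "u \<noteq> 0"
  then have "x1 \<noteq> 0 \<or> y1 \<noteq> 0" unfolding e1 using hlift_zero[OF z] vlift_zero[OF z] by auto
  moreover have "g (fst z) x x \<ge> 0" if "x \<in> T (fst z)" for x
    using g_pos[OF that] g_zero_left[OF that] by (cases "x = 0") (auto intro: less_imp_le)
  ultimately show "G z u u > 0"
    unfolding e1 G_lift[OF z 1 1] using g_pos[OF 1(1)] g_pos[OF 1(2)] 1
    by (metis add_nonneg_pos add_pos_nonneg)
next
  fix Q X Y assume Q: "openin (mtop TM) Q" and X: "X \<in> vfields TM Q" and Y: "Y \<in> vfields TM Q"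
  show "smooth_fun TM Q (\<lambda>p. G p (X p) (Y p))"
    unfolding tb.smooth_fun_iff[OF Q]
  proof
    fix z assume z: "z \<in> Q"
    obtain V \<phi> where c: "(V, \<phi>) \<in> atlas M" "openin (mtop TM) (Q \<inter> bo V)" "z \<in> Q \<inter> bo V"
      using TM_chart_nhd[OF Q z] .
    have V: "opn V" by (rule chart_opn[OF c(1)])
    let ?Q = "Q \<inter> bo V"
    have XQ: "X \<in> vfields TM ?Q" by (rule tb.vfields_restrict[OF X]) auto
    have YQ: "Y \<in> vfields TM ?Q" by (rule tb.vfields_restrict[OF Y]) auto
    let ?s = "\<lambda>a w. \<Sum>b\<in>Basis. tscale (a b w) (cvec V \<phi> b (fst w))"
    obtain a k where a: "\<forall>b. \<forall>w\<in>?Q. smooth_near TM w (a b)" and k: "\<forall>b. \<forall>w\<in>?Q. smooth_near TM w (k b)"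
      and ak: "\<forall>w\<in>?Q. X w = hlift w (?s a w) + vlift w (?s k w)"
      using TM_coeffs[OF c(2) XQ c(1) Int_lower2] .
    obtain a' k' where a': "\<forall>b. \<forall>w\<in>?Q. smooth_near TM w (a' b)" and k': "\<forall>b. \<forall>w\<in>?Q. smooth_near TM w (k' b)"
      and ak': "\<forall>w\<in>?Q. Y w = hlift w (?s a' w) + vlift w (?s k' w)"
      using TM_coeffs[OF c(2) YQ c(1) Int_lower2] .
    \<comment> \<open>The Gram matrix of the coordinate fields on the base. In the frame of their
      lifts the bundle metric consists of two copies of it, pulled back to the bundle, and mixed
      terms vanish.\<close>
    define m where "m b d q = g q (cvec V \<phi> b q) (cvec V \<phi> d q)" for b d q
    have zB: "z \<in> B" "fst z \<in> V" using c(3) bo_B[OF V, of z] by (auto simp: mem_bo)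
    have zt: "z \<in> topspace (mtop TM)" by (rule tb.opn_topspace[OF Q z])
    have ms: "smooth_near TM z (\<lambda>w. m b d (fst w))" for b d
      unfolding m_def by (rule snear_TM_fst[OF zB(1) g_snear[OF V vfields_cvec[OF c(1)] vfields_cvec[OF c(1)] zB(2)]])
    have az: "smooth_near TM z (a b)" "smooth_near TM z (k b)" "smooth_near TM z (a' b)" "smooth_near TM z (k' b)" for b
      using a k a' k' c(3) by simp_all
    have "smooth_near TM z (\<lambda>w. \<Sum>b\<in>Basis. \<Sum>d\<in>Basis. (a b w * a' d w + k b w * k' d w) * m b d (fst w))"
      by (intro tb.snear_sum[OF zt] tb.snear_mult tb.snear_add az ms)
    then show "smooth_near TM z (\<lambda>p. G p (X p) (Y p))"
    proof (rule tb.snear_cong[OF _ c(2,3)])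
      fix w assume w: "w \<in> ?Q"
      have wB: "w \<in> B" "fst w \<in> V" using w bo_B[OF V, of w] by (auto simp: mem_bo)
      have cT: "cvec V \<phi> b (fst w) \<in> T (fst w)" for b by (rule cvec_in_T[OF c(1) wB(2)])
      have sT: "?s e w \<in> T (fst w)" for e by (intro T_sum T_scale cT T_topspace[OF cT])
      have gs: "g (fst w) (?s e w) (?s e' w) = (\<Sum>b\<in>Basis. \<Sum>d\<in>Basis. e b w * e' d w * m b d (fst w))" for e e'
      proof -
        have "g (fst w) (?s e w) (?s e' w) = (\<Sum>b\<in>Basis. e b w * g (fst w) (cvec V \<phi> b (fst w)) (?s e' w))"
          by (rule g_lincomb_left[OF sT cT])
        also have "\<dots> = (\<Sum>b\<in>Basis. e b w * (\<Sum>d\<in>Basis. e' d w * g (fst w) (cvec V \<phi> b (fst w)) (cvec V \<phi> d (fst w))))"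
          by (intro sum.cong refl arg_cong2[where f="(*)"] g_lincomb_right cT)
        finally show ?thesis by (simp add: m_def sum_distrib_left mult.assoc)
      qed
      have "G w (X w) (Y w) = g (fst w) (?s a w) (?s a' w) + g (fst w) (?s k w) (?s k' w)"
        unfolding bspec[OF ak w] bspec[OF ak' w] by (rule G_lift[OF wB(1) sT sT sT sT])
      then show "(\<Sum>b\<in>Basis. \<Sum>d\<in>Basis. (a b w * a' d w + k b w * k' d w) * m b d (fst w)) = G w (X w) (Y w)"
        by (simp add: gs sum.distrib distrib_right)
    qed
  qed
qed

lemma G_J_J:
  assumes z: "z \<in> B" and u: "u \<in> tangent_space TM z" and v: "v \<in> tangent_space TM z"
  shows "G z (J z u) (J z v) = G z u v"
proof -
  obtain x1 y1 where 1: "x1 \<in> T (fst z)" "y1 \<in> T (fst z)" and e1: "u = hlift z x1 + vlift z y1" using lift_decomp[OF z u] .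
  obtain x2 y2 where 2: "x2 \<in> T (fst z)" "y2 \<in> T (fst z)" and e2: "v = hlift z x2 + vlift z y2" using lift_decomp[OF z v] .
  have J: "J z (hlift z x + vlift z y) = hlift z (- y) + vlift z x" if "x \<in> T (fst z)" "y \<in> T (fst z)" for x y
    unfolding J_lift[OF z that] hlift_uminus[OF z that(2)] by simp
  show ?thesis
    unfolding e1 e2 J[OF 1] J[OF 2] G_lift[OF z T_uminus[OF 1(2)] 1(1) T_uminus[OF 2(2)] 2(1)] G_lift[OF z 1 2]
      g_uminus_left[OF 1(2) T_uminus[OF 2(2)]] g_uminus_right[OF 1(2) 2(2)] by simp
qed

lemma hermitian_TM: "hermitian_manifold TM J G"
  unfolding hermitian_manifold_def
proof (intro conjI ballI allI impI)
  show "smooth_manifold TM" by (rule smooth_manifold_TM)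
  show "riemannian_metric TM G" by (rule riemannian_G)
next
  fix z assume "z \<in> topspace (mtop TM)"
  then have z: "z \<in> B" by (simp only: topspace_TM)
  fix u v c assume u: "u \<in> tangent_space TM z" and v: "v \<in> tangent_space TM z"
  show "J z u \<in> tangent_space TM z" "J z (u + v) = J z u + J z v" "J z (tscale c u) = tscale c (J z u)"
    "J z (J z u) = - u" "G z (J z u) (J z v) = G z u v"
    by (rule J_T[OF z u v] J_add[OF z u v] J_scale[OF z u v] J_J[OF z u v] G_J_J[OF z u v])+
next
  fix Q X assume Q: "openin (mtop TM) Q" and X: "X \<in> vfields TM Q"
  show "field_map J X \<in> vfields TM Q" by (rule J_vfields[OF Q X])
next
  fix Q X Y z assume Q: "openin (mtop TM) Q" and X: "X \<in> vfields TM Q" and Y: "Y \<in> vfields TM Q" and z: "z \<in> Q"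
  show "lie_bracket TM (field_map J X) (field_map J Y) z - J z (lie_bracket TM (field_map J X) Y z)
     - J z (lie_bracket TM X (field_map J Y) z) - lie_bracket TM X Y z = 0"
    using nij_eq_0[OF Q X Y z] unfolding nij_def .
qed

end

section \<open>The Bismut connection in an adapted frame\<close>

context affine_riem
begin

interpretation tb: smooth_mfd TM
  by unfold_locales (rule smooth_manifold_TM)

interpretation tr: riem_mfd TM G
  by unfold_locales (rule riemannian_G)

definition adapted :: "(nat \<Rightarrow> 'a vfield) \<Rightarrow> nat + nat \<Rightarrow> ('a \<times> 'a tvec) vfield" where
  "adapted E a = (case a of Inl i \<Rightarrow> hl (E i) | Inr i \<Rightarrow> vl (E i))"

text \<open>The matrix of \<open>J\<close> in the adapted frame, row \<open>a\<close> holding the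
  components of the image of field \<open>a\<close>: \<open>h_i\<close> goes to \<open>v_i\<close>
  and \<open>v_i\<close> to \<open>- h_i\<close>.\<close>

definition jmat :: "nat + nat \<Rightarrow> nat + nat \<Rightarrow> real" where
  "jmat a c = (case a of Inl i \<Rightarrow> (case c of Inl k \<Rightarrow> 0 | Inr k \<Rightarrow> if i = k then 1 else 0)
     | Inr i \<Rightarrow> (case c of Inl k \<Rightarrow> if i = k then - 1 else 0 | Inr k \<Rightarrow> 0))"

abbreviation ix :: "nat \<Rightarrow> (nat + nat) set" where "ix n \<equiv> {..<n} <+> {..<n}"

lemma sum_idx: "(\<Sum>a\<in>(ix DIM('e)). f a) = (\<Sum>i<DIM('e). f (Inl i)) + (\<Sum>i<DIM('e). f (Inr i))"
  by (simp add: sum.Plus)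

section \<open>Structure functions of the adapted frame\<close>

context
  fixes U E assumes E: "orthonormal_frame M g U E"
begin

lemma frame_opn: "opn U" and E_vf: "i < DIM('e) \<Longrightarrow> E i \<in> vfields M U"
  and E_on: "i < DIM('e) \<Longrightarrow> k < DIM('e) \<Longrightarrow> p \<in> U \<Longrightarrow> g p (E i p) (E k p) = (if i = k then 1 else 0)"
  using E by (auto simp: orthonormal_frame_def)

text \<open>Coefficients of the flat connection, not of \<open>D\<close>, in the orthonormal frame;
  in general they are not skew in \<open>k\<close> and \<open>l\<close>.\<close>

definition chr :: "nat \<Rightarrow> nat \<Rightarrow> nat \<Rightarrow> 'a \<Rightarrow> real" where
  "chr i k l p = g p (nab (E i) (E k) p) (E l p)"

lemma chr_bracket:
  assumes "i < DIM('e)" "k < DIM('e)" "l < DIM('e)" "p \<in> U"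
  shows "g p (lie_bracket M (E i) (E k) p) (E l p) = chr i k l p - chr k i l p"
  unfolding nab_torsion[OF frame_opn E_vf[OF assms(1)] E_vf[OF assms(2)] assms(4), symmetric] chr_def
  by (rule g_diff_left[OF nab_T[OF frame_opn E_vf[OF assms(1)] E_vf[OF assms(2)] assms(4)]
        nab_T[OF frame_opn E_vf[OF assms(2)] E_vf[OF assms(1)] assms(4)] vfields_T[OF E_vf[OF assms(3)] assms(4)]])

text \<open>The Koszul formula on \<open>M\<close> gives
  \<open><D_{E_i} E_i, E_l> = chr l i i - chr i l i\<close>. Subtracting \<open>chr i i l\<close>
  leaves the \<open>E_l\<close>-component of \<open>\<gamma>(E_i, E_i)\<close>, so the sum is that
  of the trace.\<close>

lemma chr_trace:
  assumes tr0: "\<forall>p\<in>topspace (mtop M). metric_trace M g gam p = 0" and l: "l < DIM('e)" and p: "p \<in> U"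
  shows "(\<Sum>i<DIM('e). chr l i i p - chr i l i p - chr i i l p) = 0"
proof -
  have lT: "E l p \<in> T p" by (rule vfields_T[OF E_vf[OF l] p])
  have gT: "gam (E i) (E i) p \<in> T p" if "i < DIM('e)" for i
    by (rule vfields_T[OF gam_vfields[OF frame_opn E_vf[OF that] E_vf[OF that]] p])
  have gi: "g p (gam (E i) (E i) p) (E l p) = chr l i i p - chr i l i p - chr i i l p" if i: "i < DIM('e)" for i
  proof -
    note Ei = E_vf[OF i] and El = E_vf[OF l]
    have "2 * g p (D (E i) (E i) p) (E l p) = g p (lie_bracket M (E i) (E i) p) (E l p)
        - g p (lie_bracket M (E i) (E l) p) (E i p) - g p (lie_bracket M (E i) (E l) p) (E i p)"
      by (rule koszul_const[OF lc frame_opn Ei Ei El p E_on[OF i i] E_on[OF i l] E_on[OF i l]])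
    then have "g p (D (E i) (E i) p) (E l p) = chr l i i p - chr i l i p"
      unfolding chr_bracket[OF i i l p] chr_bracket[OF i l i p] by simp
    moreover have "g p (gam (E i) (E i) p) (E l p) = g p (D (E i) (E i) p) (E l p) - chr i i l p"
      unfolding gam_apply chr_def by (rule g_diff_left[OF lc.nab_T[OF frame_opn Ei Ei p] nab_T[OF frame_opn Ei Ei p] lT])
    ultimately show ?thesis by simp
  qed
  have "(\<Sum>i<DIM('e). chr l i i p - chr i l i p - chr i i l p) = (\<Sum>i<DIM('e). g p (gam (E i) (E i) p) (E l p))"
    by (intro sum.cong refl gi[symmetric]) simp
  also have "\<dots> = g p (\<Sum>i<DIM('e). gam (E i) (E i) p) (E l p)"
    by (rule g_sum_left[OF lT, symmetric]) (simp add: gT)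
  also have "(\<Sum>i<DIM('e). gam (E i) (E i) p) = 0"
    using trace_gam[OF E p] tr0 opn_topspace[OF frame_opn p] by simp
  also have "g p 0 (E l p) = 0" by (rule g_zero_left[OF lT])
  finally show ?thesis .
qed

lemma adapted_onb:
  assumes w: "w \<in> bo U" shows "tr.onb (ix DIM('e)) w (\<lambda>a. adapted E a w)"
proof -
  have wB: "w \<in> B" by (rule bo_B[OF frame_opn w])
  have p: "fst w \<in> U" using w by (simp add: mem_bo)
  have ET: "E i (fst w) \<in> T (fst w)" if "i < DIM('e)" for i by (rule vfields_T[OF E_vf[OF that] p])
  note defs = adapted_def hl_def vl_def
  have "v = (\<Sum>a\<in>(ix DIM('e)). tscale (G w v (adapted E a w)) (adapted E a w))" if v: "v \<in> tangent_space TM w" for v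
  proof -
    obtain x y where x: "x \<in> T (fst w)" and y: "y \<in> T (fst w)" and e: "v = hlift w x + vlift w y"
      using lift_decomp[OF wB v] .
    have 0: "0 \<in> T (fst w)" by (rule T_zero[OF T_topspace[OF x]])
    have 1: "G w v (hlift w (E i (fst w))) = g (fst w) x (E i (fst w))" if "i < DIM('e)" for i
      using G_lift[OF wB x y ET[OF that] 0] g_zero_right[OF y] vlift_zero[OF wB] by (simp add: e)
    have 2: "G w v (vlift w (E i (fst w))) = g (fst w) y (E i (fst w))" if "i < DIM('e)" for i
      using G_lift[OF wB x y 0 ET[OF that]] g_zero_right[OF x] hlift_zero[OF wB] by (simp add: e)
    have ex: "u = (\<Sum>i<DIM('e). tscale (g (fst w) u (E i (fst w))) (E i (fst w)))" if "u \<in> T (fst w)" for u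
      by (rule onb_expand[OF frame_onb[OF E p] that])
    have "hlift w x = hlift w (\<Sum>i<DIM('e). tscale (g (fst w) x (E i (fst w))) (E i (fst w)))"
      using ex[OF x] by (rule arg_cong)
    also have "\<dots> = (\<Sum>i<DIM('e). tscale (G w v (hlift w (E i (fst w)))) (hlift w (E i (fst w))))"
      by (subst hlift_lincomb[OF wB]) (simp_all add: ET 1)
    finally have h: "hlift w x = \<dots>" .
    have "vlift w y = vlift w (\<Sum>i<DIM('e). tscale (g (fst w) y (E i (fst w))) (E i (fst w)))"
      using ex[OF y] by (rule arg_cong)
    also have "\<dots> = (\<Sum>i<DIM('e). tscale (G w v (vlift w (E i (fst w)))) (vlift w (E i (fst w))))"
      by (subst vlift_lincomb[OF wB]) (simp_all add: ET 2)
    finally have k: "vlift w y = \<dots>" .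
    have "v = (\<Sum>i<DIM('e). tscale (G w v (hlift w (E i (fst w)))) (hlift w (E i (fst w))))
      + (\<Sum>i<DIM('e). tscale (G w v (vlift w (E i (fst w)))) (vlift w (E i (fst w))))"
      by (rule trans[OF e arg_cong2[OF h k, of "(+)"]])
    then show ?thesis unfolding sum_idx defs sum.case .
  qed
  moreover have "adapted E a w \<in> tangent_space TM w" if "a \<in> (ix DIM('e))" for a
    using that hlift_T[OF wB ET] vlift_T[OF wB ET] by (auto simp only: defs sum.case lessThan_iff elim!: PlusE)
  moreover have "G w (adapted E a w) (adapted E c w) = (if a = c then 1 else 0)" if "a \<in> (ix DIM('e))" "c \<in> (ix DIM('e))" for a c
    using that G_lifts[OF wB ET ET] E_on[OF _ _ p]
    by (auto simp: defs elim!: PlusE split: if_splits)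
  ultimately show ?thesis unfolding tr.onb_def by simp
qed

lemma adapted_vf: "a \<in> (ix DIM('e)) \<Longrightarrow> adapted E a \<in> vfields TM (bo U)"
  using hl_vfields[OF frame_opn E_vf] vl_vfields[OF frame_opn E_vf] by (auto simp: adapted_def elim!: PlusE)

lemma J_adapted:
  assumes w: "w \<in> bo U" and a: "a \<in> (ix DIM('e))"
  shows "J w (adapted E a w) = (\<Sum>c\<in>(ix DIM('e)). tscale (jmat a c) (adapted E c w))"
proof -
  have wB: "w \<in> B" by (rule bo_B[OF frame_opn w])
  have p: "fst w \<in> U" using w by (simp add: mem_bo)
  have ET: "E i (fst w) \<in> T (fst w)" if "i < DIM('e)" for i by (rule vfields_T[OF E_vf[OF that] p])
  show ?thesis
    using a
  proof (rule PlusE)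
    fix i assume i: "a = Inl i" "i \<in> {..<DIM('e)}"
    then have "J w (adapted E a w) = vlift w (E i (fst w))"
      using J_hlift[OF wB ET, of i] by (simp add: adapted_def hl_def)
    moreover have "(\<Sum>c\<in>(ix DIM('e)). tscale (jmat a c) (adapted E c w)) f = vlift w (E i (fst w)) f" for f
      using i by (simp add: sum_idx sum_fun_apply i jmat_def adapted_def vl_def if_distrib[of "\<lambda>x. x * _"] sum.delta cong: if_cong)
    ultimately show ?thesis by (intro ext) simp
  next
    fix i assume i: "a = Inr i" "i \<in> {..<DIM('e)}"
    then have "J w (adapted E a w) = - hlift w (E i (fst w))"
      using J_vlift[OF wB ET, of i] by (simp add: adapted_def vl_def)
    moreover have "(\<Sum>c\<in>(ix DIM('e)). tscale (jmat a c) (adapted E c w)) f = - hlift w (E i (fst w)) f" for f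
      using i by (simp add: sum_idx sum_fun_apply i jmat_def adapted_def hl_def if_distrib[of "\<lambda>x. x * _"] sum.delta cong: if_cong)
    ultimately show ?thesis by (intro ext) simp
  qed
qed

text \<open>\<open>bra\<close> feeds the Koszul formula, \<open>braJ\<close> the exterior derivative
  on \<open>J\<close>-rotated arguments. In \<open>braJ\<close> the third field is not rotated
  because \<open>\<omega>([JA, JB], JC) = g_1([JA, JB], C)\<close>.\<close>

definition bra :: "nat + nat \<Rightarrow> nat + nat \<Rightarrow> nat + nat \<Rightarrow> 'a \<times> 'a tvec \<Rightarrow> real" where
  "bra a b c w = G w (lie_bracket TM (adapted E a) (adapted E b) w) (adapted E c w)"

definition braJ :: "nat + nat \<Rightarrow> nat + nat \<Rightarrow> nat + nat \<Rightarrow> 'a \<times> 'a tvec \<Rightarrow> real" where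
  "braJ a b c w = G w (lie_bracket TM (field_map J (adapted E a)) (field_map J (adapted E b)) w) (adapted E c w)"

text \<open>The bracket relations of lifts make all entries functions of the base point. An entry
  can be nonzero only if the number of vertical indices is even, a parity that the Bismut
  coefficients inherit.\<close>

lemma bra_table:
  assumes w: "w \<in> bo U" and i: "i < DIM('e)" and k: "k < DIM('e)" and l: "l < DIM('e)"
  shows "bra (Inl i) (Inl k) (Inl l) w = chr i k l (fst w) - chr k i l (fst w)" "bra (Inl i) (Inl k) (Inr l) w = 0"
    "bra (Inl i) (Inr k) (Inl l) w = 0" "bra (Inl i) (Inr k) (Inr l) w = chr i k l (fst w)"
    "bra (Inr i) (Inl k) (Inl l) w = 0" "bra (Inr i) (Inl k) (Inr l) w = - chr k i l (fst w)"
    "bra (Inr i) (Inr k) (Inl l) w = 0" "bra (Inr i) (Inr k) (Inr l) w = 0"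
    "braJ (Inl i) (Inl k) (Inl l) w = 0" "braJ (Inl i) (Inl k) (Inr l) w = 0"
    "braJ (Inl i) (Inr k) (Inl l) w = 0" "braJ (Inl i) (Inr k) (Inr l) w = chr k i l (fst w)"
    "braJ (Inr i) (Inl k) (Inl l) w = 0" "braJ (Inr i) (Inl k) (Inr l) w = - chr i k l (fst w)"
    "braJ (Inr i) (Inr k) (Inl l) w = chr i k l (fst w) - chr k i l (fst w)" "braJ (Inr i) (Inr k) (Inr l) w = 0"
proof -
  have wB: "w \<in> B" by (rule bo_B[OF frame_opn w])
  have p: "fst w \<in> U" using w by (simp add: mem_bo)
  note Ei = E_vf[OF i] and Ek = E_vf[OF k]
  have lT: "E l (fst w) \<in> T (fst w)" by (rule vfields_T[OF E_vf[OF l] p])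
  have 0: "0 \<in> T (fst w)" by (rule T_zero[OF T_topspace[OF lT]])
  have nT: "nab (E i) (E k) (fst w) \<in> T (fst w)" "nab (E k) (E i) (fst w) \<in> T (fst w)"
    by (rule nab_T[OF frame_opn Ei Ek p] nab_T[OF frame_opn Ek Ei p])+
  have bT: "lie_bracket M (E i) (E k) (fst w) \<in> T (fst w)" by (rule lie_bracket_T[OF frame_opn Ei Ek p])
  note vT = vlift_T[OF wB nT(1)] vlift_T[OF wB nT(2)]
  note lTh = hlift_T[OF wB lT] vlift_T[OF wB lT]
  have z: "G w 0 (hlift w (E l (fst w))) = 0" "G w 0 (vlift w (E l (fst w))) = 0"
    by (rule tr.g_zero_left[OF lTh(1)] tr.g_zero_left[OF lTh(2)])+
  note m = tr.g_uminus_left[OF vT(1) lTh(1)] tr.g_uminus_left[OF vT(1) lTh(2)]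
    tr.g_uminus_left[OF vT(2) lTh(1)] tr.g_uminus_left[OF vT(2) lTh(2)]
  note Gs = G_lifts[OF wB nT(1) lT] G_lifts[OF wB nT(2) lT] G_lifts[OF wB bT lT]
  note br = bracket_hl_hl[OF frame_opn Ei Ek w] bracket_hl_vl[OF frame_opn Ei Ek w] bracket_vl_hl[OF frame_opn Ei Ek w] bracket_vl_vl[OF frame_opn Ei Ek w]
    bracket_J_J[OF frame_opn Ei Ek w]
  have c: "chr i k l (fst w) = g (fst w) (nab (E i) (E k) (fst w)) (E l (fst w))"
    "chr k i l (fst w) = g (fst w) (nab (E k) (E i) (fst w)) (E l (fst w))" by (simp_all only: chr_def)
  have cb: "g (fst w) (lie_bracket M (E i) (E k) (fst w)) (E l (fst w)) = chr i k l (fst w) - chr k i l (fst w)"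
    by (rule chr_bracket[OF i k l p])
  note all = bra_def braJ_def adapted_def sum.case br
  show "bra (Inl i) (Inl k) (Inl l) w = chr i k l (fst w) - chr k i l (fst w)"
    unfolding all hl_def Gs(9) cb ..
  show "bra (Inl i) (Inl k) (Inr l) w = 0" unfolding all hl_def vl_def Gs(11) ..
  show "bra (Inl i) (Inr k) (Inl l) w = 0" unfolding all hl_def vl_def Gs(4) ..
  show "bra (Inl i) (Inr k) (Inr l) w = chr i k l (fst w)" unfolding all vl_def Gs(2) c ..
  show "bra (Inr i) (Inl k) (Inl l) w = 0" unfolding all hl_def vl_def m Gs(8) by simp
  show "bra (Inr i) (Inl k) (Inr l) w = - chr k i l (fst w)" unfolding all vl_def m Gs(6) c ..
  show "bra (Inr i) (Inr k) (Inl l) w = 0" unfolding all hl_def z ..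
  show "bra (Inr i) (Inr k) (Inr l) w = 0" unfolding all vl_def z ..
  show "braJ (Inl i) (Inl k) (Inl l) w = 0" unfolding all hl_def z ..
  show "braJ (Inl i) (Inl k) (Inr l) w = 0" unfolding all vl_def z ..
  show "braJ (Inl i) (Inr k) (Inl l) w = 0" unfolding all hl_def vl_def Gs(8) ..
  show "braJ (Inl i) (Inr k) (Inr l) w = chr k i l (fst w)" unfolding all vl_def Gs(6) c ..
  show "braJ (Inr i) (Inl k) (Inl l) w = 0" unfolding all hl_def vl_def m Gs(4) by simp
  show "braJ (Inr i) (Inl k) (Inr l) w = - chr i k l (fst w)" unfolding all vl_def m Gs(2) c ..
  show "braJ (Inr i) (Inr k) (Inl l) w = chr i k l (fst w) - chr k i l (fst w)"
    unfolding all hl_def Gs(9) cb ..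
  show "braJ (Inr i) (Inr k) (Inr l) w = 0" unfolding all hl_def vl_def Gs(11) ..
qed

section \<open>Connection form of the Bismut connection\<close>

context
  fixes Bc :: "('a \<times> 'a tvec) vfield \<Rightarrow> ('a \<times> 'a tvec) vfield \<Rightarrow> ('a \<times> 'a tvec) vfield"
  assumes bismut: "bismut_connection TM J G Bc"
begin

interpretation rc: riem_conn TM G Bc
  by unfold_locales (use bismut in \<open>simp add: bismut_connection_def\<close>)

text \<open>The Koszul formula contributes the three \<open>bra\<close> terms and the exterior
  derivative the three \<open>braJ\<close> terms. The factor 2 clears the 2 of the former and the
  1/2 in front of the latter.\<close>

lemma bismut_coeff:
  assumes w: "w \<in> bo U" and d: "d \<in> (ix DIM('e))" and a: "a \<in> (ix DIM('e))" and b: "b \<in> (ix DIM('e))"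
  shows "2 * G w (Bc (adapted E d) (adapted E a) w) (adapted E b w) =
    bra d a b w - bra d b a w - bra a b d w - braJ d a b w + braJ d b a w - braJ a b d w"
proof -
  let ?F = "adapted E" and ?Q = "bo U"
  let ?JF = "\<lambda>a. field_map J (?F a)"
  note Q = bo_open[OF frame_opn]
  obtain L where L: "levi_civita TM G L" and Bf: "\<forall>U. openin (mtop TM) U \<longrightarrow>
           (\<forall>X\<in>vfields TM U. \<forall>Y\<in>vfields TM U. \<forall>Z\<in>vfields TM U. \<forall>p\<in>U.
              G p (Bc X Y p) (Z p) = G p (L X Y p) (Z p)
                + 1/2 * ext_deriv2 TM (fundamental_form J G) (field_map J X) (field_map J Y) (field_map J Z) p)"
    using bismut unfolding bismut_connection_def by (elim conjE exE)
  note Fv = adapted_vf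
  have JFv: "?JF a \<in> vfields TM ?Q" if "a \<in> (ix DIM('e))" for a by (rule J_vfields[OF Q Fv[OF that]])
  have FT: "?F a q \<in> tangent_space TM q" if "a \<in> (ix DIM('e))" "q \<in> ?Q" for a q by (rule tb.vfields_T[OF Fv[OF that(1)] that(2)])
  have on: "G q (?F a q) (?F c q) = (if a = c then 1 else 0)" if "a \<in> (ix DIM('e))" "c \<in> (ix DIM('e))" "q \<in> ?Q" for a c q
    using adapted_onb[OF that(3)] that(1,2) unfolding tr.onb_def by blast
  have "2 * G w (L (?F d) (?F a) w) (?F b w) = bra d a b w - bra d b a w - bra a b d w"
    unfolding bra_def
    by (rule tr.koszul_const[OF L Q Fv[OF d] Fv[OF a] Fv[OF b] w on[OF d a] on[OF d b] on[OF a b]])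
  moreover have "ext_deriv2 TM (fundamental_form J G) (?JF d) (?JF a) (?JF b) w = - braJ d a b w + braJ d b a w - braJ a b d w"
  proof -
    \<comment> \<open>By invariance under \<open>J\<close> the fundamental form of two rotated frame
      fields is an entry of \<open>jmat\<close>, a constant, so the three derivative terms of the
      exterior derivative vanish.\<close>
    have const: "?JF x w (fundamental_form J G (?JF y) (?JF z)) = 0" if x: "x \<in> (ix DIM('e))" and y: "y \<in> (ix DIM('e))" and z: "z \<in> (ix DIM('e))" for x y z
    proof -
      have JT: "?JF x w \<in> tangent_space TM w" by (rule tb.vfields_T[OF JFv[OF x] w])
      have "?JF x w (fundamental_form J G (?JF y) (?JF z)) = ?JF x w (\<lambda>q. jmat y z)"
      proof (rule tb.T_cong[OF JT Q w])
        fix q assume q: "q \<in> ?Q"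
        have qB: "q \<in> B" by (rule bo_B[OF frame_opn q])
        have fin: "finite (ix DIM('e))" by simp
        have "fundamental_form J G (?JF y) (?JF z) q = G q (J q (?F y q)) (?F z q)"
          unfolding fundamental_form_def field_map_def
          by (rule G_J_J[OF qB J_T[OF qB FT[OF y q] FT[OF y q]] FT[OF z q]])
        also have "\<dots> = jmat y z"
          unfolding J_adapted[OF q y] by (rule tr.orthonormal_coeff[OF fin FT[OF _ q] on[OF _ _ q] z])
        finally show "fundamental_form J G (?JF y) (?JF z) q = jmat y z" .
      qed
      also have "\<dots> = 0" by (rule tb.T_deriv_const[OF JT])
      finally show ?thesis .
    qed
    have wB: "w \<in> B" by (rule bo_B[OF frame_opn w])
    have ob: "fundamental_form J G (lie_bracket TM (?JF x) (?JF y)) (?JF z) w = braJ x y z w"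
      if x: "x \<in> (ix DIM('e))" and y: "y \<in> (ix DIM('e))" and z: "z \<in> (ix DIM('e))" for x y z
      unfolding fundamental_form_def braJ_def
      using G_J_J[OF wB tb.lie_bracket_T[OF Q JFv[OF x] JFv[OF y] w] FT[OF z w]] unfolding field_map_def .
    show ?thesis
      unfolding ext_deriv2_def const[OF d a b] const[OF a d b] const[OF b d a] ob[OF d a b] ob[OF d b a] ob[OF a b d] by simp
  qed
  ultimately show ?thesis
    using Bf[rule_format, OF Q Fv[OF d] Fv[OF a] Fv[OF b] w] by simp
qed

text \<open>These block identities say that the connection form commutes with \<open>jmat\<close>,
  that is, the connection preserves \<open>J\<close>. Comparing table entries settles
  \<open>X\<close> in the frame; both sides are linear in \<open>X\<close> over functions.\<close>

lemma conn_coeff_relations: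
  assumes Q: "openin (mtop TM) Q" "Q \<subseteq> bo U" and X: "X \<in> vfields TM Q" and w: "w \<in> Q"
    and i: "i < DIM('e)" and k: "k < DIM('e)"
  shows "rc.conn_coeff (adapted E) X (Inr i) (Inr k) w = rc.conn_coeff (adapted E) X (Inl i) (Inl k) w"
    and "rc.conn_coeff (adapted E) X (Inr i) (Inl k) w = - rc.conn_coeff (adapted E) X (Inl i) (Inr k) w"
proof -
  have wU: "w \<in> bo U" using w Q(2) by blast
  have F: "adapted E a \<in> vfields TM Q" if "a \<in> (ix DIM('e))" for a by (rule tb.vfields_restrict[OF adapted_vf[OF that] Q(2)])
  have on: "tr.onb (ix DIM('e)) q (\<lambda>a. adapted E a q)" if "q \<in> Q" for q by (rule adapted_onb) (use that Q(2) in blast)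
  have tens: "rc.conn_coeff (adapted E) X a b w = (\<Sum>d\<in>(ix DIM('e)). G w (X w) (adapted E d w)
      * rc.conn_coeff (adapted E) (adapted E d) a b w)" if "a \<in> (ix DIM('e))" "b \<in> (ix DIM('e))" for a b
    by (rule rc.conn_coeff_tensor[OF Q(1) F on X that w])
  have m: "Inl i \<in> (ix DIM('e))" "Inl k \<in> (ix DIM('e))" "Inr i \<in> (ix DIM('e))" "Inr k \<in> (ix DIM('e))" using i k by auto
  have 1: "rc.conn_coeff (adapted E) (adapted E d) (Inr i) (Inr k) w = rc.conn_coeff (adapted E) (adapted E d) (Inl i) (Inl k) w"
    and 2: "rc.conn_coeff (adapted E) (adapted E d) (Inr i) (Inl k) w = - rc.conn_coeff (adapted E) (adapted E d) (Inl i) (Inr k) w"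
    if d: "d \<in> (ix DIM('e))" for d
  proof -
    consider l where "d = Inl l" "l < DIM('e)" | l where "d = Inr l" "l < DIM('e)" using d by auto
    then show "rc.conn_coeff (adapted E) (adapted E d) (Inr i) (Inr k) w = rc.conn_coeff (adapted E) (adapted E d) (Inl i) (Inl k) w"
    proof cases
      case (1 l)
      show ?thesis
        using bismut_coeff[OF wU d m(3,4)] bismut_coeff[OF wU d m(1,2)] 1 i k
        by (simp add: rc.conn_coeff_def bra_table[OF wU])
    next
      case (2 l)
      show ?thesis
        using bismut_coeff[OF wU d m(3,4)] bismut_coeff[OF wU d m(1,2)] 2 i k
        by (simp add: rc.conn_coeff_def bra_table[OF wU])
    qed
    from \<open>d \<in> (ix DIM('e))\<close> consider l where "d = Inl l" "l < DIM('e)" | l where "d = Inr l" "l < DIM('e)" by auto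
    then show "rc.conn_coeff (adapted E) (adapted E d) (Inr i) (Inl k) w = - rc.conn_coeff (adapted E) (adapted E d) (Inl i) (Inr k) w"
    proof cases
      case (1 l)
      show ?thesis
        using bismut_coeff[OF wU d m(3,2)] bismut_coeff[OF wU d m(1,4)] 1 i k
        by (simp add: rc.conn_coeff_def bra_table[OF wU])
    next
      case (2 l)
      show ?thesis
        using bismut_coeff[OF wU d m(3,2)] bismut_coeff[OF wU d m(1,4)] 2 i k
        by (simp add: rc.conn_coeff_def bra_table[OF wU])
    qed
  qed
  show "rc.conn_coeff (adapted E) X (Inr i) (Inr k) w = rc.conn_coeff (adapted E) X (Inl i) (Inl k) w"
    unfolding tens[OF m(3,4)] tens[OF m(1,2)] by (intro sum.cong refl arg_cong2[where f="(*)"] 1)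
  have "(\<Sum>d\<in>(ix DIM('e)). G w (X w) (adapted E d w) * rc.conn_coeff (adapted E) (adapted E d) (Inr i) (Inl k) w) =
     (\<Sum>d\<in>(ix DIM('e)). - (G w (X w) (adapted E d w) * rc.conn_coeff (adapted E) (adapted E d) (Inl i) (Inr k) w))"
    by (intro sum.cong refl) (simp only: 2 mult_minus_right)
  then show "rc.conn_coeff (adapted E) X (Inr i) (Inl k) w = - rc.conn_coeff (adapted E) X (Inl i) (Inr k) w"
    unfolding tens[OF m(3,2)] tens[OF m(1,4)] by (simp only: sum_negf)
qed

text \<open>Along a horizontal frame field every mixed coefficient involves an odd number of
  vertical indices and vanishes. Along \<open>v_l\<close> the six bracket terms add up to twice the
  summand of \<open>chr_trace\<close>.\<close>

lemma conn_coeff_trace: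
  assumes tr0: "\<forall>p\<in>topspace (mtop M). metric_trace M g gam p = 0"
    and Q: "openin (mtop TM) Q" "Q \<subseteq> bo U" and X: "X \<in> vfields TM Q" and w: "w \<in> Q"
  shows "(\<Sum>i<DIM('e). rc.conn_coeff (adapted E) X (Inl i) (Inr i) w) = 0"
proof -
  let ?k = "rc.conn_coeff (adapted E)"
  have wU: "w \<in> bo U" using w Q(2) by blast
  have p: "fst w \<in> U" using wU by (simp add: mem_bo)
  have F: "adapted E a \<in> vfields TM Q" if "a \<in> (ix DIM('e))" for a by (rule tb.vfields_restrict[OF adapted_vf[OF that] Q(2)])
  have on: "tr.onb (ix DIM('e)) q (\<lambda>a. adapted E a q)" if "q \<in> Q" for q by (rule adapted_onb) (use that Q(2) in blast)
  have m: "Inl i \<in> (ix DIM('e))" "Inr i \<in> (ix DIM('e))" if "i < DIM('e)" for i using that by auto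
  have Fd: "(\<Sum>i<DIM('e). ?k (adapted E d) (Inl i) (Inr i) w) = 0" if d: "d \<in> (ix DIM('e))" for d
  proof -
    consider l where "d = Inl l" "l < DIM('e)" | l where "d = Inr l" "l < DIM('e)" using d by auto
    then show ?thesis
    proof cases
      case (1 l)
      have "?k (adapted E d) (Inl i) (Inr i) w = 0" if i: "i < DIM('e)" for i
        using bismut_coeff[OF wU d m[OF i]] 1 i by (simp add: rc.conn_coeff_def bra_table[OF wU])
      then show ?thesis by simp
    next
      case (2 l)
      have "?k (adapted E d) (Inl i) (Inr i) w = chr l i i (fst w) - chr i l i (fst w) - chr i i l (fst w)"
        if i: "i < DIM('e)" for i
        using bismut_coeff[OF wU d m[OF i]] 2 i by (simp add: rc.conn_coeff_def bra_table[OF wU])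
      then show ?thesis using chr_trace[OF tr0 2(2) p] by simp
    qed
  qed
  have "(\<Sum>i<DIM('e). ?k X (Inl i) (Inr i) w) =
     (\<Sum>i<DIM('e). \<Sum>d\<in>(ix DIM('e)). G w (X w) (adapted E d w) * ?k (adapted E d) (Inl i) (Inr i) w)"
    by (intro sum.cong refl rc.conn_coeff_tensor[OF Q(1) F on X _ _ w]) auto
  also have "\<dots> = (\<Sum>d\<in>(ix DIM('e)). \<Sum>i<DIM('e). G w (X w) (adapted E d w) * ?k (adapted E d) (Inl i) (Inr i) w)"
    by (rule sum.swap)
  also have "\<dots> = (\<Sum>d\<in>(ix DIM('e)). G w (X w) (adapted E d w) * (\<Sum>i<DIM('e). ?k (adapted E d) (Inl i) (Inr i) w))"
    by (simp only: sum_distrib_left)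
  also have "\<dots> = 0" by (intro sum.neutral ballI) (simp only: Fd mult_zero_right)
  finally show ?thesis .
qed

lemma ricci_form_bismut:
  assumes tr0: "\<forall>p\<in>topspace (mtop M). metric_trace M g gam p = 0"
    and P: "openin (mtop TM) P" and X: "X \<in> vfields TM P" and Y: "Y \<in> vfields TM P" and w: "w \<in> P" "w \<in> bo U"
  shows "ricci_form TM J G Bc X Y w = 0"
proof -
  define Q where "Q = P \<inter> bo U"
  have Q: "openin (mtop TM) Q" unfolding Q_def by (rule tb.opn_Int[OF P bo_open[OF frame_opn]])
  have QU: "Q \<subseteq> bo U" by (simp add: Q_def)
  have wQ: "w \<in> Q" using w by (simp add: Q_def)
  have wB: "w \<in> B" by (rule bo_B[OF frame_opn w(2)])
  have F: "adapted E a \<in> vfields TM Q" if "a \<in> (ix DIM('e))" for a by (rule tb.vfields_restrict[OF adapted_vf[OF that] QU])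
  have on: "tr.onb (ix DIM('e)) q (\<lambda>a. adapted E a q)" if "q \<in> Q" for q by (rule adapted_onb) (use that QU in blast)
  have XQ: "X \<in> vfields TM Q" by (rule tb.vfields_restrict[OF X]) (simp add: Q_def)
  have YQ: "Y \<in> vfields TM Q" by (rule tb.vfields_restrict[OF Y]) (simp add: Q_def)
  let ?k = "rc.conn_coeff (adapted E)"
  \<comment> \<open>Each row and each column of \<open>jmat\<close> has a single nonzero entry, so
    multiplication from either side is a signed swap of the horizontal and vertical indices.\<close>
  have jl: "(\<Sum>b\<in>(ix DIM('e)). jmat a b * f b) = (case a of Inl i \<Rightarrow> f (Inr i) | Inr i \<Rightarrow> - f (Inl i))" if "a \<in> (ix DIM('e))" for a f
    using that by (auto simp: sum_idx jmat_def if_distrib[of "\<lambda>x. x * _"] sum.delta cong: if_cong)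
  have jr: "(\<Sum>b\<in>(ix DIM('e)). f b * jmat b c) = (case c of Inl k \<Rightarrow> - f (Inr k) | Inr k \<Rightarrow> f (Inl k))" if "c \<in> (ix DIM('e))" for c f
    using that by (auto simp: sum_idx jmat_def if_distrib[of "\<lambda>x. _ * x"] sum.delta' cong: if_cong)
  show ?thesis
  proof (rule rc.ricci_form_eq_0[OF Q F on, where j = jmat])
    show "jmat a c = - jmat c a" for a c by (auto simp: jmat_def split: sum.split)
    show "(\<Sum>b\<in>(ix DIM('e)). jmat a b * ?k X b c w) = (\<Sum>b\<in>(ix DIM('e)). ?k X a b w * jmat b c)"
      if "X \<in> vfields TM Q" "w \<in> Q" "a \<in> (ix DIM('e))" "c \<in> (ix DIM('e))" for X w a c
      unfolding jl[OF that(3)] jr[OF that(4)]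
      using that(3,4) conn_coeff_relations[OF Q QU that(1,2)] by (auto split: sum.split)
    show "(\<Sum>a\<in>(ix DIM('e)). \<Sum>c\<in>(ix DIM('e)). jmat a c * ?k X a c w) = 0" if "X \<in> vfields TM Q" "w \<in> Q" for X w
    proof -
      have 1: "(\<Sum>c\<in>(ix DIM('e)). jmat a c * ?k X a c w) =
        (case a of Inl i \<Rightarrow> ?k X a (Inr i) w | Inr i \<Rightarrow> - ?k X a (Inl i) w)" if "a \<in> (ix DIM('e))" for a
        by (rule jl[OF that])
      \<comment> \<open>The two mixed blocks contribute equally, so the \<open>jmat\<close>-trace is
        twice the sum in \<open>conn_coeff_trace\<close>.\<close>
      have 2: "(\<Sum>i<DIM('e). - ?k X (Inr i) (Inl i) w) = (\<Sum>i<DIM('e). ?k X (Inl i) (Inr i) w)"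
        by (intro sum.cong refl) (simp add: conn_coeff_relations(2)[OF Q QU that])
      have "(\<Sum>a\<in>(ix DIM('e)). \<Sum>c\<in>(ix DIM('e)). jmat a c * ?k X a c w) =
        (\<Sum>a\<in>(ix DIM('e)). case a of Inl i \<Rightarrow> ?k X a (Inr i) w | Inr i \<Rightarrow> - ?k X a (Inl i) w)"
        by (rule sum.cong[OF refl 1])
      then show ?thesis
        using sum_idx[of "\<lambda>a. case a of Inl i \<Rightarrow> ?k X a (Inr i) w | Inr i \<Rightarrow> - ?k X a (Inl i) w"]
          conn_coeff_trace[OF tr0 Q QU that] 2 by simp
    qed
    show "J w u \<in> tangent_space TM w" if "u \<in> tangent_space TM w" for u by (rule J_T[OF wB that that])
    show "J w (u + v) = J w u + J w v" if "u \<in> tangent_space TM w" "v \<in> tangent_space TM w" for u v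
      by (rule J_add[OF wB that])
    show "J w (tscale c u) = tscale c (J w u)" if "u \<in> tangent_space TM w" for u c
      by (rule J_scale[OF wB that that])
    show "J w (adapted E a w) = (\<Sum>c\<in>(ix DIM('e)). tscale (jmat a c) (adapted E c w))" if "a \<in> (ix DIM('e))" for a
      by (rule J_adapted[OF w(2) that])
  qed (use XQ YQ wQ in auto)
qed

end

end

lemma calabi_yau_TM:
  assumes tr0: "\<forall>p\<in>topspace (mtop M). metric_trace M g gam p = 0"
  shows "calabi_yau_with_torsion TM J G"
  unfolding calabi_yau_with_torsion_def
proof (intro conjI hermitian_TM allI impI ballI)
  fix Bc P X Y w
  assume Bc: "bismut_connection TM J G Bc" and P: "openin (mtop TM) P"
    and X: "X \<in> vfields TM P" and Y: "Y \<in> vfields TM P" and w: "w \<in> P"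
  have wB: "w \<in> B" using tb.opn_topspace[OF P w] by (simp only: topspace_TM)
  then have p: "fst w \<in> topspace (mtop M)" by (simp add: mem_bo)
  obtain U E where E: "orthonormal_frame M g U E" "fst w \<in> U" using ex_orthonormal_frame[OF p] .
  have wU: "w \<in> bo U" using wB E(2) by (simp add: mem_bo)
  show "ricci_form TM J G Bc X Y w = 0" by (rule ricci_form_bismut[OF E(1) Bc tr0 P X Y w wU])
qed

end

theorem proposition5p3:
  fixes M :: "('a, 'e::euclidean_space) manifold"
    and nab D :: "'a vfield \<Rightarrow> 'a vfield \<Rightarrow> 'a vfield"
    and g :: "'a metric_field"
  assumes "affine_riemann M nab g"
    and "levi_civita M g D"
    and "\<forall>p\<in>topspace (mtop M). metric_trace M g (difference_tensor D nab) p = 0"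
  shows "(\<forall>X\<in>vfields M (topspace (mtop M)). \<forall>p\<in>topspace (mtop M).
            metric_trace M g (tensor_deriv D (difference_tensor D nab) X) p = 0) \<and>
         calabi_yau_with_torsion (tangent_bundle M) (J1 M nab) (g1 M nab g)"
proof -
  have "connection M D" using assms(2) by (simp add: levi_civita_def)
  with assms(1,2) interpret affine_riem M g nab D
    by unfold_locales (auto simp: affine_riemann_def)
  show ?thesis
    using trace_deriv_gam[OF assms(3)] calabi_yau_TM[OF assms(3)] by blast
qed

end
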